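(* Under the hypotheses of Theorem 1 (i.e. $u_0:\mathbb R^d\to[0,1]$ measurable and $\{\mu^n\}$ associated to $u_0$), for every $T>0$ the empirical process $\{\pi^n_t;t\in[0,T]\}$, $\pi^n_t(dx)=n^{-d}\sum_{z\in\mathbb Z^d}\eta^n_t(z)\delta_{z/n}(dx)$, converges in distribution in the Skorohod space $\mathcal D([0,T],\mathcal M_+(\mathbb R^d))$ to the deterministic trajectory $u(t,x)dx$, where $u$ is the unique weak solution of $\partial_tu=\mathcal Lu$, $u(0,\cdot)=u_0$.
   Context: Fix $d\ge1$, $\alpha\in(0,2)$ and a continuous function $h:\mathbb R^d\setminus\{0\}\to(0,\infty)$, even and homogeneous of degree $-(d+\alpha)$; $p(z)=h(z)$ for $z\ne0$, $p(0)=0$. The exclusion process has generator $Lf(\eta)=\sum_{x,y}p(y-x)\eta(x)(1-\eta(y))[f(\eta^{xy})-f(\eta)]$ on $\{0,1\}^{\mathbb Z^d}$ ($\eta^{xy}$: values at $x,y$ exchanged), and $\eta^n_t=\eta_{tn^\alpha}$ starts from $\mu^n$. Measures $\mu^n$ are associated to $u_0$ if for every $F\in C_c(\mathbb R^d)$ and $\epsilon>0$, $\mu^n\{|n^{-d}\sum_z\eta(z)F(z/n)-\int u_0F\,dx|>\epsilon\}\to0$. $\mathcal M_+(\mathbb R^d)$ is the space of nonnegative Radon measures with the weak topology. $\mathcal LF(x)=\frac12\int h(y)(F(x+y)+F(x-y)-2F(x))dy$. A weak solution on $[0,T]$ is a bounded measurable $u$ with $\int u(t,x)G(t,x)dx-\int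 u_0G(0,x)dx-\int_0^t\int u(\partial_s+\mathcal L)G\,dx\,ds=0$ for every $t\in[0,T]$ and every smooth compactly supported $G$. *)

theory Defs
  imports "HOL-Probability.Probability"
begin

type_synonym 'd config = "int^'d \<Rightarrow> bool"

definition lat :: "int^'d \<Rightarrow> real^'d" where
  "lat z = (\<chi> i. real_of_int (z $ i))"

definition jump_rate :: "(real^'d \<Rightarrow> real) \<Rightarrow> int^'d \<Rightarrow> real" where
  "jump_rate h z = (if z = 0 then 0 else h (lat z))"

definition swap_conf :: "'d config \<Rightarrow> int^'d \<Rightarrow> int^'d \<Rightarrow> 'd config" where
  "swap_conf \<xi> x y = \<xi>(x := \<xi> y, y := \<xi> x)"

definition local_fun :: "('d config \<Rightarrow> real) \<Rightarrow> bool" where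
  "local_fun f \<longleftrightarrow> (\<exists>\<Lambda>. finite \<Lambda> \<and> (\<forall>\<xi> \<xi>'. (\<forall>z\<in>\<Lambda>. \<xi> z = \<xi>' z) \<longrightarrow> f \<xi> = f \<xi>'))"

definition excl_gen :: "(real^'d \<Rightarrow> real) \<Rightarrow> ('d config \<Rightarrow> real) \<Rightarrow> 'd config \<Rightarrow> real" where
  "excl_gen h f \<xi> = infsum (\<lambda>(x, y). jump_rate h (y - x) * of_bool (\<xi> x) * (1 - of_bool (\<xi> y))
                                        * (f (swap_conf \<xi> x y) - f \<xi>)) UNIV"

definition Cc :: "(real^'d \<Rightarrow> real) set" where
  "Cc = {F. continuous_on UNIV F \<and> (\<exists>K. compact K \<and> (\<forall>x. x \<notin> K \<longrightarrow> F x = 0))}"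

definition emp :: "nat \<Rightarrow> 'd config \<Rightarrow> (real^'d \<Rightarrow> real) \<Rightarrow> real" where
  "emp n \<xi> F = infsum (\<lambda>z. of_bool (\<xi> z) * F ((1 / real n) *\<^sub>R lat z)) UNIV / real n ^ CARD('d)"

definition associated :: "(nat \<Rightarrow> 'w measure) \<Rightarrow> (nat \<Rightarrow> 'w \<Rightarrow> 'd config) \<Rightarrow> (real^'d \<Rightarrow> real) \<Rightarrow> bool" where
  "associated M \<xi> u0 \<longleftrightarrow>
     (\<forall>F\<in>Cc. \<forall>\<epsilon>>0. (\<lambda>n. measure (M n)
        {\<omega> \<in> space (M n). \<bar>emp n (\<xi> n \<omega>) F - (\<integral>x. u0 x * F x \<partial>lborel)\<bar> > \<epsilon>}) \<longlonglongrightarrow> 0)"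

text \<open>Cadlag paths in {0,1}^{Z^d} with the product (of discrete) topology.\<close>
definition cadlag_coords :: "(real \<Rightarrow> 'd config) \<Rightarrow> bool" where
  "cadlag_coords \<eta> \<longleftrightarrow>
     (\<forall>z. \<forall>t\<ge>0. \<exists>\<delta>>0. \<forall>s. t \<le> s \<and> s < t + \<delta> \<longrightarrow> \<eta> s z = \<eta> t z) \<and>
     (\<forall>z. \<forall>t>0. \<exists>\<delta>>0. \<forall>s s'. s \<in> {t - \<delta><..<t} \<and> s' \<in> {t - \<delta><..<t} \<longrightarrow> \<eta> s z = \<eta> s' z)"

definition nat_filt :: "'w measure \<Rightarrow> ('w \<Rightarrow> real \<Rightarrow> 'd config) \<Rightarrow> real \<Rightarrow> 'w measure" where
  "nat_filt M \<eta> s = sigma (space M) {{\<omega> \<in> space M. \<eta> \<omega> r z} | r z. r \<in> {0..s}}"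

definition dynkin_mart :: "(real^'d \<Rightarrow> real) \<Rightarrow> ('w \<Rightarrow> real \<Rightarrow> 'd config) \<Rightarrow> ('d config \<Rightarrow> real)
    \<Rightarrow> real \<Rightarrow> 'w \<Rightarrow> real" where
  "dynkin_mart h \<eta> f t \<omega> = f (\<eta> \<omega> t) - f (\<eta> \<omega> 0)
      - set_lebesgue_integral lborel {0..t} (\<lambda>r. excl_gen h f (\<eta> \<omega> r))"

definition martingale_problem :: "'w measure \<Rightarrow> (real^'d \<Rightarrow> real) \<Rightarrow> ('w \<Rightarrow> real \<Rightarrow> 'd config) \<Rightarrow> bool" where
  "martingale_problem M h \<eta> \<longleftrightarrow>
     (\<forall>f. local_fun f \<longrightarrow> (\<forall>s t. 0 \<le> s \<and> s \<le> t \<longrightarrow>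
        (\<forall>Y. Y \<in> borel_measurable (nat_filt M \<eta> s) \<and> bounded (Y ` space M) \<longrightarrow>
          (\<integral>\<omega>. (dynkin_mart h \<eta> f t \<omega> - dynkin_mart h \<eta> f s \<omega>) * Y \<omega> \<partial>M) = 0)))"

fun iter_deriv :: "'a::real_normed_vector list \<Rightarrow> ('a \<Rightarrow> real) \<Rightarrow> 'a \<Rightarrow> real" where
  "iter_deriv [] f = f"
| "iter_deriv (v # vs) f = (\<lambda>x. frechet_derivative (iter_deriv vs f) (at x) v)"

definition smooth_fun :: "('a::real_normed_vector \<Rightarrow> real) \<Rightarrow> bool" where
  "smooth_fun f \<longleftrightarrow> (\<forall>vs x. iter_deriv vs f differentiable (at x))"

definition test_fun :: "(real \<times> (real^'d) \<Rightarrow> real) \<Rightarrow> bool" where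
  "test_fun G \<longleftrightarrow> smooth_fun G \<and> (\<exists>K. compact K \<and> (\<forall>z. z \<notin> K \<longrightarrow> G z = 0))"

definition frac_gen :: "(real^'d \<Rightarrow> real) \<Rightarrow> (real^'d \<Rightarrow> real) \<Rightarrow> real^'d \<Rightarrow> real" where
  "frac_gen h F x = (1/2) * (\<integral>y. h y * (F (x + y) + F (x - y) - 2 * F x) \<partial>lborel)"

definition weak_sol :: "real \<Rightarrow> (real^'d \<Rightarrow> real) \<Rightarrow> (real^'d \<Rightarrow> real) \<Rightarrow> (real \<Rightarrow> real^'d \<Rightarrow> real) \<Rightarrow> bool" where
  "weak_sol T h u0 u \<longleftrightarrow>
     (\<lambda>(t, x). u t x) \<in> borel_measurable (lborel \<Otimes>\<^sub>M lborel) \<and>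
     (\<exists>B. \<forall>t\<in>{0..T}. \<forall>x. \<bar>u t x\<bar> \<le> B) \<and>
     (\<forall>t\<in>{0..T}. \<forall>G. test_fun G \<longrightarrow>
        (\<integral>x. u t x * G (t, x) \<partial>lborel) - (\<integral>x. u0 x * G (0, x) \<partial>lborel)
        - set_lebesgue_integral lborel {0..t}
            (\<lambda>s. \<integral>x. u s x * (deriv (\<lambda>r. G (r, x)) s + frac_gen h (\<lambda>y. G (s, y)) x) \<partial>lborel) = 0)"

text \<open>Skorohod (J1) space D([0,T], M_+(R^d)); measure-valued paths are represented
  by their pairings t, F |-> <pi_t, F> with F in C_c (vague topology).\<close>
definition time_change :: "real \<Rightarrow> (real \<Rightarrow> real) \<Rightarrow> bool" where
  "time_change T \<tau> \<longleftrightarrow> continuous_on {0..T} \<tau> \<and> strict_mono_on {0..T} \<tau> \<and> \<tau> 0 = 0 \<and> \<tau> T = T"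

definition sk_nbhd :: "real \<Rightarrow> (real^'d \<Rightarrow> real) set \<Rightarrow> real \<Rightarrow> (real \<Rightarrow> (real^'d \<Rightarrow> real) \<Rightarrow> real)
    \<Rightarrow> (real \<Rightarrow> (real^'d \<Rightarrow> real) \<Rightarrow> real) set" where
  "sk_nbhd T Fs \<epsilon> x = {y. \<exists>\<tau>. time_change T \<tau> \<and> (\<forall>t\<in>{0..T}. \<bar>\<tau> t - t\<bar> < \<epsilon>) \<and>
       (\<forall>F\<in>Fs. \<forall>t\<in>{0..T}. \<bar>y (\<tau> t) F - x t F\<bar> < \<epsilon>)}"

text \<open>Convergence in distribution in D([0,T], M_+(R^d)) to a deterministic path x:
  every basic Skorohod neighbourhood of x has (inner) probability tending to 1.\<close>
definition conv_dist_D :: "real \<Rightarrow> (nat \<Rightarrow> 'w measure)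
    \<Rightarrow> (nat \<Rightarrow> 'w \<Rightarrow> real \<Rightarrow> (real^'d \<Rightarrow> real) \<Rightarrow> real) \<Rightarrow> (real \<Rightarrow> (real^'d \<Rightarrow> real) \<Rightarrow> real) \<Rightarrow> bool" where
  "conv_dist_D T M X x \<longleftrightarrow>
     (\<forall>Fs \<epsilon>. finite Fs \<and> Fs \<subseteq> Cc \<and> \<epsilon> > 0 \<longrightarrow>
        (\<exists>A. (\<forall>n. A n \<in> sets (M n) \<and> A n \<subseteq> {\<omega> \<in> space (M n). X n \<omega> \<in> sk_nbhd T Fs \<epsilon> x})
             \<and> (\<lambda>n. measure (M n) (A n)) \<longlonglongrightarrow> 1))"

end

theory Submission
  imports Defs
begin

text \<open>
  Let \<open>R t x\<close> be the random walk semigroup applied to the initial configuration. Symmetry of \<open>p\<close> makes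
  \<open>E \<eta>\<^sub>t(x) - R t x\<close> solve a closed linear equation, and a maximum principle for the two-point function
  gives negative correlations; hence \<open>\<Sum> g(x) (\<eta>\<^sub>t(x) - R t x)\<close> has variance at most \<open>2 \<Sum> g\<^sup>2\<close>. Doob's
  inequality for the Dynkin martingale makes this bound uniform in time, so the empirical measure follows
  the walk semigroup started from the empirical initial measure. The rescaled walks have generators
  converging to the fractional operator, uniformly on smooth compactly supported functions, and their
  semigroups have uniformly small tails; this produces the weak solution as a limit and identifies
  it with the limit of the empirical process. Uniqueness of weak solutions is again a maximum
  principle, applied to the solution mollified by a test function.
\<close>

text \<open>The kernel \<open>h\<close> is not integrable at 0, so the limiting generator is
  unbounded, and its semigroup is never built. For each n, however, the accelerated walk has a
  finite total rate: its semigroup is a power series acting on bounded functions of R^d, not only of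
  the grid, and \<open>u\<close> is a limit of these semigroups applied to \<open>u0\<close>. The
  rates diverge with n, so every estimate that has to survive the limit comes from positivity or
  from second differences, never from the rate. A second obstacle shapes the end. Association
  concerns one fixed continuous compactly supported function at a time, whereas the walk semigroup
  applied to a test function varies with n and t and need not have compact support. A cutoff,
  together with a finite grid of times at one frozen index, reduces it to finitely many admissible
  functions. Lattice sums are integrals over counting measure, so that Fubini, dominated convergence
  and duality serve sums and integrals alike.\<close>

abbreviation lsum :: "('a \<Rightarrow> real) \<Rightarrow> real" (binder "LSUM " 10) where
  "lsum f \<equiv> integral\<^sup>L (count_space UNIV) f"

abbreviation lsummable :: "('a \<Rightarrow> real) \<Rightarrow> bool" where
  "lsummable f \<equiv> integrable (count_space UNIV) f"

lemmas integrable_boundL = Bochner_Integration.integrable_bound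
  and integrable_diffL = Bochner_Integration.integrable_diff
  and integral_diffL = Bochner_Integration.integral_diff
  and integral_congL = Bochner_Integration.integral_cong
  and integral_nonnegL = Bochner_Integration.integral_nonneg

section \<open>Fubini with a product bound\<close>

lemma integrable_prod_mult:
  fixes u :: "'a \<Rightarrow> real" and v :: "'b \<Rightarrow> real"
  assumes "sigma_finite_measure M1" "sigma_finite_measure M2"
    and u: "integrable M1 u" and v: "integrable M2 v"
  shows "integrable (M1 \<Otimes>\<^sub>M M2) (\<lambda>(x, y). u x * v y)"
proof -
  interpret pair_sigma_finite M1 M2
    using assms by (simp add: pair_sigma_finite_def)
  have [measurable]: "u \<in> borel_measurable M1" "v \<in> borel_measurable M2" using u v by auto
  show ?thesis
  proof (rule Fubini_integrable)
    show "integrable M1 (\<lambda>x. \<integral>y. norm (case (x, y) of (x, y) \<Rightarrow> u x * v y) \<partial>M2)"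
      using u v by (simp add: abs_mult)
  qed (use v in auto)
qed

text \<open>A product bound is what most exchanges below have at hand: one factor carries summable
  jump rates or an interval of time, the other an integrable function or a constant on a probability
  space.\<close>

lemma fubini_dom:
  fixes f :: "'a \<Rightarrow> 'b \<Rightarrow> real"
  assumes "sigma_finite_measure M1" "sigma_finite_measure M2"
    and f: "case_prod f \<in> borel_measurable (M1 \<Otimes>\<^sub>M M2)"
    and u: "integrable M1 u" and v: "integrable M2 v"
    and bound: "\<And>x y. x \<in> space M1 \<Longrightarrow> y \<in> space M2 \<Longrightarrow> \<bar>f x y\<bar> \<le> u x * v y"
  shows "(\<integral>x. \<integral>y. f x y \<partial>M2 \<partial>M1) = (\<integral>y. \<integral>x. f x y \<partial>M1 \<partial>M2)" (is ?g1)
    and "integrable M1 (\<lambda>x. \<integral>y. f x y \<partial>M2)" (is ?g2)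
    and "integrable M2 (\<lambda>y. \<integral>x. f x y \<partial>M1)" (is ?g3)
proof -
  interpret pair_sigma_finite M1 M2
    using assms by (simp add: pair_sigma_finite_def)
  have I: "integrable (M1 \<Otimes>\<^sub>M M2) (case_prod f)"
    by (rule integrable_boundL[OF integrable_prod_mult[OF assms(1,2) u v] f])
      (auto simp: space_pair_measure intro!: AE_I2 order_trans[OF bound])
  show ?g1
    using Fubini_integral[OF I] by simp
  show ?g2
    using integrable_fst[OF I] by simp
  show ?g3
    using integrable_snd[OF I] by simp
qed

section \<open>A maximum principle for linear evolution equations\<close>

lemma set_integrable_Icc_subset:
  fixes f :: "real \<Rightarrow> real"
  assumes "set_integrable lborel {0..T} f" "t \<le> T"
  shows "set_integrable lborel {0..t} f"
  by (rule set_integrable_subset[OF assms(1)]) (use assms in auto)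

lemma integrating_factor:
  fixes f a :: "real \<Rightarrow> real"
  assumes t: "0 \<le> t" and K: "0 \<le> K" and a: "set_integrable lborel {0..t} a"
    and eq: "\<And>r. r \<in> {0..t} \<Longrightarrow> f r = f0 + (LBINT s:{0..r}. a s)"
  shows "set_integrable lborel {0..t} (\<lambda>s. exp (K * s) * (a s + K * f s))" (is ?g1)
    and "exp (K * t) * f t = f0 + (LBINT s:{0..t}. exp (K * s) * (a s + K * f s))" (is ?g2)
proof -
  define a' where "a' s = indicator {0..t} s * a s" for s
  have a': "integrable lborel a'" using a by (simp add: a'_def[abs_def] set_integrable_def)
  have [measurable]: "a' \<in> borel_measurable borel" using borel_measurable_integrable[OF a'] by simp
  define g where "g r s = (if 0 \<le> s \<and> s \<le> r \<and> r \<le> t then K * exp (K * r) * a' s else 0)" for r s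
  have gm: "case_prod g \<in> borel_measurable (lborel \<Otimes>\<^sub>M lborel)"
    unfolding g_def by measurable
  have gb: "\<bar>g r s\<bar> \<le> (K * exp (K * t) * indicator {0..t} r) * \<bar>a' s\<bar>" for r s
    using K by (auto simp: g_def abs_mult intro!: mult_right_mono mult_left_mono)
  have u: "integrable lborel (\<lambda>r. K * exp (K * t) * indicator {0..t} r)"
    by (intro integrable_mult_right integrable_real_indicator) (auto simp: emeasure_lborel_Icc_eq)
  note F = fubini_dom[OF _ _ gm u integrable_abs[OF a'] gb, OF sigma_finite_lborel sigma_finite_lborel]
  have inner1: "(LBINT s. g r s) = indicator {0..t} r * (K * exp (K * r) * (f r - f0))" for r
  proof (cases "r \<in> {0..t}")
    case True
    have "(LBINT s. g r s) = (LBINT s. K * exp (K * r) * (indicator {0..r} s * a s))"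
      by (rule integral_congL) (use True in \<open>auto simp: g_def a'_def split: split_indicator\<close>)
    also have "\<dots> = K * exp (K * r) * (f r - f0)"
      using eq[OF True] by (simp add: set_lebesgue_integral_def)
    finally show ?thesis using True by simp
  next
    case False
    then have "g r = (\<lambda>s. 0)" by (auto simp: g_def)
    then show ?thesis using False by simp
  qed
  have inner2: "(LBINT r. g r s) = (exp (K * t) - exp (K * s)) * a' s" for s
  proof (cases "s \<in> {0..t}")
    case True
    have "(LBINT r. g r s) = (LBINT r. a' s * (K * exp (K * r) * indicator {s..t} r))"
      by (rule integral_congL) (use True in \<open>auto simp: g_def split: split_indicator\<close>)
    also have "\<dots> = a' s * (exp (K * t) - exp (K * s))"
      using True by (subst integral_mult_right_zero, subst integral_FTC_Icc_real[where F="\<lambda>r. exp (K * r)"])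
        (auto intro!: derivative_eq_intros continuous_intros)
    finally show ?thesis by simp
  next
    case False
    then have "(\<lambda>r. g r s) = (\<lambda>r. 0)" by (auto simp: g_def fun_eq_iff)
    then show ?thesis using False by (simp add: a'_def)
  qed
  have c1: "integrable lborel (\<lambda>r. indicator {0..t} r * (K * exp (K * r) * f0))"
  proof -
    have "continuous_on {0..t} (\<lambda>r. K * exp (K * r) * f0)" by (intro continuous_intros)
    from borel_integrable_atLeastAtMost'[OF this] show ?thesis by (simp add: set_integrable_def)
  qed
  have ea: "integrable lborel (\<lambda>s. exp (K * s) * a' s)"
  proof (rule integrable_boundL[OF integrable_mult_right[OF a', of "exp (K * t)"]])
    show "AE s in lborel. norm (exp (K * s) * a' s) \<le> norm (exp (K * t) * a' s)"
      using K by (auto simp: a'_def abs_mult mult_left_mono split: split_indicator intro!: AE_I2 mult_right_mono)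
  qed measurable
  have I1: "integrable lborel (\<lambda>r. indicator {0..t} r * (K * exp (K * r) * f r))"
    using Bochner_Integration.integrable_add[OF F(2) c1] by (simp add: inner1 algebra_simps)
  have split: "indicator {0..t} s *\<^sub>R (exp (K * s) * (a s + K * f s)) =
     exp (K * s) * a' s + indicator {0..t} s * (K * exp (K * s) * f s)" for s
    by (simp add: a'_def algebra_simps)
  show ?g1
    unfolding set_integrable_def split using ea I1 by simp
  have "(LBINT s:{0..t}. exp (K * s) * (a s + K * f s)) =
     (LBINT s. exp (K * s) * a' s) + (LBINT r. indicator {0..t} r * (K * exp (K * r) * f r))"
    unfolding set_lebesgue_integral_def split using ea I1 by simp
  also have "(LBINT r. indicator {0..t} r * (K * exp (K * r) * f r))
     = (LBINT r. (LBINT s. g r s)) + (LBINT r. indicator {0..t} r * (K * exp (K * r) * f0))"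
    by (subst Bochner_Integration.integral_add[symmetric, OF F(2) c1]) (simp add: inner1 algebra_simps)
  also have "(LBINT r. (LBINT s. g r s)) = (LBINT s. exp (K * t) * a' s - exp (K * s) * a' s)"
    by (simp add: F(1) inner2 algebra_simps)
  also have "\<dots> = exp (K * t) * (LBINT s. a' s) - (LBINT s. exp (K * s) * a' s)"
    using a' ea by simp
  also have "(LBINT r. indicator {0..t} r * (K * exp (K * r) * f0)) =
       (LBINT r. f0 * ((K * exp (K * r)) * indicator {0..t} r))"
    by (rule integral_congL) auto
  also have "\<dots> = f0 * (exp (K * t) - 1)"
    using t by (subst integral_mult_right_zero, subst integral_FTC_Icc_real[where F="\<lambda>r. exp (K * r)"])
      (auto intro!: derivative_eq_intros continuous_intros)
  also have "(LBINT s. a' s) = f t - f0"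
    using eq[of t] t by (simp add: set_lebesgue_integral_def a'_def[abs_def])
  finally show ?g2
    by (simp add: algebra_simps)
qed

text \<open>\<open>a\<close> stands for a generator applied to f, and \<open>gen\<close> says that
  adding K f makes it positivity preserving up to a source c. No minimum in x need be attained, so
  the argument at a minimum point is replaced by a self-improving bound: the weighted supremum S of
  the violation satisfies S \<le> S K/(K+1), hence vanishes. The index set \<open>X\<close> is free
  so that two-point functions can be treated off the diagonal.\<close>

lemma max_principle:
  fixes f a :: "real \<Rightarrow> 'x \<Rightarrow> real"
  assumes K: "0 \<le> K" and c: "0 \<le> c" and m0: "0 \<le> m0"
    and bdd: "\<And>t x. t \<in> {0..T} \<Longrightarrow> x \<in> X \<Longrightarrow> - Bd \<le> f t x"
    and int: "\<And>x. x \<in> X \<Longrightarrow> set_integrable lborel {0..T} (\<lambda>r. a r x)"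
    and eq: "\<And>t x. t \<in> {0..T} \<Longrightarrow> x \<in> X \<Longrightarrow> f t x = f 0 x + (LBINT r:{0..t}. a r x)"
    and init: "\<And>x. x \<in> X \<Longrightarrow> - m0 \<le> f 0 x"
    and gen: "\<And>r x m. r \<in> {0..T} \<Longrightarrow> x \<in> X \<Longrightarrow> 0 \<le> m \<Longrightarrow> (\<And>y. y \<in> X \<Longrightarrow> - m \<le> f r y) \<Longrightarrow>
       - (K * m + c) \<le> a r x + K * f r x"
    and t: "t \<in> {0..T}" and x: "x \<in> X"
  shows "- (m0 + c * t) \<le> f t x"
proof -
  \<comment> \<open>The weight exp(-t) produces the contraction: an error S exp(r) fed back at rate
    K against exp(K r) integrates to the fraction K/(K+1) of S exp((K+1) t).\<close>
  define \<phi> where "\<phi> = (\<lambda>(t, x). max 0 ((- f t x - m0 - c * t) * exp (- t)))"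
  define S where "S = Sup (\<phi> ` ({0..T} \<times> X))"
  have ne: "({0..T} \<times> X) \<noteq> {}" using t x by auto
  have "\<phi> (t, x) \<le> \<bar>Bd\<bar>" if "t \<in> {0..T}" "x \<in> X" for t x
  proof -
    have "c * t \<ge> 0" using c that by simp
    then have *: "- f t x - m0 - c * t \<le> \<bar>Bd\<bar>" using bdd[OF that] m0 by linarith
    have "(- f t x - m0 - c * t) * exp (- t) \<le> \<bar>Bd\<bar> * exp (- t)"
      by (rule mult_right_mono[OF *]) simp
    also have "\<dots> \<le> \<bar>Bd\<bar> * 1"
      using that by (intro mult_left_mono) auto
    finally show ?thesis by (simp add: \<phi>_def)
  qed
  then have bddS: "bdd_above (\<phi> ` ({0..T} \<times> X))"
    by (intro bdd_aboveI[where M="\<bar>Bd\<bar>"]) auto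
  have leS: "\<phi> (t, x) \<le> S" if "t \<in> {0..T}" "x \<in> X" for t x
    unfolding S_def by (rule cSup_upper[OF _ bddS]) (use that in auto)
  have S0: "0 \<le> S" using order_trans[OF _ leS[OF t x], of 0] by (simp add: \<phi>_def)
  have fS: "- (m0 + c * t + S * exp t) \<le> f t x" if "t \<in> {0..T}" "x \<in> X" for t x
  proof -
    have "(- f t x - m0 - c * t) * exp (- t) \<le> S" using leS[OF that] by (simp add: \<phi>_def)
    then have "(- f t x - m0 - c * t) * exp (- t) * exp t \<le> S * exp t" by (rule mult_right_mono) simp
    then show ?thesis by (simp add: mult.assoc flip: exp_add)
  qed
  have key: "\<phi> (t, x) \<le> S * (K / (K + 1))" if "t \<in> {0..T}" "x \<in> X" for t x
  proof -
    have t0: "0 \<le> t" and tT: "t \<le> T" using that by auto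
    note IF = integrating_factor[OF t0 K set_integrable_Icc_subset[OF int[OF that(2)] tT], of "\<lambda>r. f r x" "f 0 x"]
    have eq': "\<And>r. r \<in> {0..t} \<Longrightarrow> f r x = f 0 x + (LBINT s:{0..r}. a s x)"
      by (rule eq) (use tT that in auto)
    \<comment> \<open>k is minus the lower bound that \<open>gen\<close> yields with m = m0 + c r +
      S exp r, times the integrating factor; kF is its antiderivative.\<close>
    define k where "k r = exp (K * r) * (K * (m0 + c * r) + c) + K * S * exp ((K + 1) * r)" for r
    define kF where "kF r = exp (K * r) * (m0 + c * r) + K / (K + 1) * S * exp ((K + 1) * r)" for r
    have K1: "K + 1 > 0" using K by simp
    have kd: "(kF has_real_derivative k r) (at r)" for r
    proof -
      have KK: "K / (K + 1) * (K + 1) = K" using K1 by simp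
      have "(kF has_real_derivative (K * exp (K * r) * (m0 + c * r) + exp (K * r) * c
          + K / (K + 1) * S * ((K + 1) * exp ((K + 1) * r)))) (at r)"
        unfolding kF_def by (auto intro!: derivative_eq_intros)
      also have "K * exp (K * r) * (m0 + c * r) + exp (K * r) * c
          + K / (K + 1) * S * ((K + 1) * exp ((K + 1) * r)) = 
          exp (K * r) * (K * (m0 + c * r) + c) + (K / (K + 1) * (K + 1)) * S * exp ((K + 1) * r)"
        by (simp only: distrib_left mult.assoc mult.commute mult.left_commute add.assoc)
      finally show ?thesis unfolding k_def KK .
    qed
    have kc: "isCont k r" for r unfolding k_def by (intro continuous_intros)
    have kint: "(LBINT r. k r * indicator {0..t} r) = kF t - kF 0"
      by (rule integral_FTC_Icc_real) (use t0 kd kc in auto)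
    have kI: "set_integrable lborel {0..t} k"
      by (rule borel_integrable_atLeastAtMost') (use kc in \<open>auto intro: continuous_at_imp_continuous_on\<close>)
    have "- (kF t - kF 0) = (LBINT r:{0..t}. - k r)"
      using kint by (simp add: set_lebesgue_integral_def mult.commute)
    also have "\<dots> \<le> (LBINT s:{0..t}. exp (K * s) * (a s x + K * f s x))"
    proof (rule set_integral_mono)
      show "set_integrable lborel {0..t} (\<lambda>r. - k r)" using kI by (simp add: set_integrable_def)
      show "set_integrable lborel {0..t} (\<lambda>s. exp (K * s) * (a s x + K * f s x))"
        by (rule IF(1)[OF eq'])
      fix r assume r: "r \<in> {0..t}"
      then have rT: "r \<in> {0..T}" using tT by auto
      have "c * r \<ge> 0" using c r by simp
      then have "- (K * (m0 + c * r + S * exp r) + c) \<le> a r x + K * f r x"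
        by (intro gen[OF rT that(2)] fS[OF rT]) (use S0 m0 in auto)
      then have "exp (K * r) * - (K * (m0 + c * r + S * exp r) + c) \<le> exp (K * r) * (a r x + K * f r x)"
        by (intro mult_left_mono) auto
      then show "- k r \<le> exp (K * r) * (a r x + K * f r x)"
        by (simp add: k_def algebra_simps exp_add)
    qed
    also have "\<dots> = exp (K * t) * f t x - f 0 x" using IF(2)[OF eq'] by simp
    finally have "exp (K * t) * f t x \<ge> f 0 x - kF t + kF 0" by simp
    moreover have "kF 0 + f 0 x \<ge> 0"
    proof -
      have "0 \<le> K * S / (K + 1)" using S0 K by simp
      then show ?thesis using init[OF that(2)] by (simp add: kF_def)
    qed
    ultimately have "exp (K * t) * f t x \<ge> - kF t" by simp
    then have "exp (- (K * t)) * (exp (K * t) * f t x) \<ge> exp (- (K * t)) * (- kF t)"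
      by (intro mult_left_mono) auto
    then have "f t x \<ge> - (exp (- (K * t)) * kF t)" by (simp flip: mult.assoc exp_add)
    also have "exp (- (K * t)) * kF t = m0 + c * t + K / (K + 1) * S * exp t"
      unfolding kF_def by (simp add: distrib_left distrib_right exp_add mult.assoc exp_minus field_simps)
    finally have "- f t x - m0 - c * t \<le> K / (K + 1) * S * exp t" by simp
    then have "(- f t x - m0 - c * t) * exp (- t) \<le> K / (K + 1) * S * exp t * exp (- t)"
      by (rule mult_right_mono) simp
    also have "\<dots> = S * (K / (K + 1))" by (simp add: mult.assoc flip: exp_add)
    finally show ?thesis using S0 K by (simp add: \<phi>_def)
  qed
  have "S \<le> S * (K / (K + 1))"
    unfolding S_def by (rule cSup_least) (use ne key in \<open>auto simp: S_def\<close>)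
  then have "S * (1 / (K + 1)) \<le> 0" using K by (simp add: field_simps)
  then have "S \<le> 0" using K by (simp add: divide_le_0_iff)
  then show ?thesis using fS[OF t x] S0 by simp
qed

text \<open>\<open>b\<close> is the monotone part of the generator (the incoming jumps) and a + K f
  - b is the source. This form serves the comparison of semigroups, the one-point function and
  uniqueness, where bounds hold from both sides.\<close>

lemma max_principle_abs:
  fixes f a :: "real \<Rightarrow> 'x \<Rightarrow> real"
  assumes K: "0 \<le> K" and c: "0 \<le> c" and m0: "0 \<le> m0"
    and bdd: "\<And>t x. t \<in> {0..T} \<Longrightarrow> x \<in> X \<Longrightarrow> \<bar>f t x\<bar> \<le> Bd"
    and int: "\<And>x. x \<in> X \<Longrightarrow> set_integrable lborel {0..T} (\<lambda>r. a r x)"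
    and eq: "\<And>t x. t \<in> {0..T} \<Longrightarrow> x \<in> X \<Longrightarrow> f t x = f 0 x + (LBINT r:{0..t}. a r x)"
    and init: "\<And>x. x \<in> X \<Longrightarrow> \<bar>f 0 x\<bar> \<le> m0"
    and gen: "\<And>r x. r \<in> {0..T} \<Longrightarrow> x \<in> X \<Longrightarrow> \<bar>a r x + K * f r x - b r x\<bar> \<le> c"
    and pos: "\<And>r x m. r \<in> {0..T} \<Longrightarrow> x \<in> X \<Longrightarrow> 0 \<le> m \<Longrightarrow> (\<And>y. y \<in> X \<Longrightarrow> - m \<le> f r y) \<Longrightarrow> - (K * m) \<le> b r x"
    and neg: "\<And>r x m. r \<in> {0..T} \<Longrightarrow> x \<in> X \<Longrightarrow> 0 \<le> m \<Longrightarrow> (\<And>y. y \<in> X \<Longrightarrow> f r y \<le> m) \<Longrightarrow> b r x \<le> K * m"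
    and t: "t \<in> {0..T}" and x: "x \<in> X"
  shows "\<bar>f t x\<bar> \<le> m0 + c * t"
proof -
  have "- (m0 + c * t) \<le> f t x"
  proof (rule max_principle[where f=f and a=a and Bd=Bd, OF K c m0 _ int eq _ _ t x])
    fix r x m assume *: "r \<in> {0..T}" "x \<in> X" "0 \<le> m" and "\<And>y. y \<in> X \<Longrightarrow> - m \<le> f r y"
    then show "- (K * m + c) \<le> a r x + K * f r x" using pos[OF *] gen[OF *(1,2)] by fastforce
  qed (use bdd init in \<open>force simp: abs_le_iff\<close>)+
  moreover have "- (m0 + c * t) \<le> - f t x"
  proof (rule max_principle[where f="\<lambda>t x. - f t x" and a="\<lambda>t x. - a t x" and Bd=Bd, OF K c m0 _ _ _ _ _ t x])
    fix r x m assume *: "r \<in> {0..T}" "x \<in> X" "0 \<le> m" and "\<And>y. y \<in> X \<Longrightarrow> - m \<le> - f r y"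
    then show "- (K * m + c) \<le> - a r x + K * - f r x" using neg[OF *] gen[OF *(1,2)] by fastforce
  next
    fix x assume "x \<in> X"
    then show "set_integrable lborel {0..T} (\<lambda>r. - a r x)" using int by (simp add: set_integrable_def)
  next
    fix t x assume "t \<in> {0..T}" "x \<in> X"
    then show "- f t x = - f 0 x + (LBINT r:{0..t}. - a r x)" using eq[of t x] by (simp add: set_lebesgue_integral_def)
  qed (use bdd init in \<open>force simp: abs_le_iff\<close>)+
  ultimately show ?thesis by linarith
qed

section \<open>Random walk semigroups\<close>

lemma integrable_cmult:
  fixes f :: "'a \<Rightarrow> real" shows "integrable M f \<Longrightarrow> integrable M (\<lambda>x. c * f x)" by simp

lemma integrable_multc:
  fixes f :: "'a \<Rightarrow> real" shows "integrable M f \<Longrightarrow> integrable M (\<lambda>x. f x * c)" by simp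

lemma measurable_pair_countable2:
  fixes f :: "'a \<times> 'b::countable \<Rightarrow> 'c"
  assumes "\<And>y. (\<lambda>x. f (x, y)) \<in> measurable N L"
  shows "f \<in> measurable (N \<Otimes>\<^sub>M count_space UNIV) L"
proof -
  have "(\<lambda>(y, x). f (x, y)) \<in> measurable (count_space UNIV \<Otimes>\<^sub>M N) L"
    by (rule measurable_pair_measure_countable1) (use assms in auto)
  from measurable_compose[OF measurable_pair_swap' this] show ?thesis by (simp add: case_prod_beta)
qed

definition bnd :: "real \<Rightarrow> ('a \<Rightarrow> real) \<Rightarrow> bool" where
  "bnd C F \<longleftrightarrow> (\<forall>x. \<bar>F x\<bar> \<le> C)"

lemma bndD: "bnd C F \<Longrightarrow> \<bar>F x\<bar> \<le> C" by (simp add: bnd_def)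

lemma bnd_nonneg: "bnd C F \<Longrightarrow> 0 \<le> C"
  using bndD[of C F undefined] by linarith

definition odd_shift :: "('b::group_add \<Rightarrow> 'a::group_add) \<Rightarrow> bool" where
  "odd_shift s \<longleftrightarrow> (\<forall>y. s (- y) = - s y)"

text \<open>\<open>s\<close> embeds the lattice steps into the group on which the functions live:
  the identity for the walk on Z^d, y/n for the rescaled walk acting on functions of R^d. One theory
  serves both.\<close>

definition conv :: "(int^'d \<Rightarrow> real) \<Rightarrow> (int^'d \<Rightarrow> 'a::ab_group_add) \<Rightarrow> ('a \<Rightarrow> real) \<Rightarrow> 'a \<Rightarrow> real" where
  "conv p s F x = (LSUM y. p y * F (x + s y))"

definition rate :: "(int^'d \<Rightarrow> real) \<Rightarrow> real" where
  "rate p = (LSUM y. p y)"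

definition gen :: "(int^'d \<Rightarrow> real) \<Rightarrow> (int^'d \<Rightarrow> 'a::ab_group_add) \<Rightarrow> ('a \<Rightarrow> real) \<Rightarrow> 'a \<Rightarrow> real" where
  "gen p s F x = conv p s F x - rate p * F x"

text \<open>Expansion over the number of jumps of a Poisson clock; \<open>conv\<close> is not
  normalised, so its k-th iterate already contains the factor rate^k. Being a power series in t, it
  can be differentiated and integrated term by term.\<close>

definition semi :: "(int^'d \<Rightarrow> real) \<Rightarrow> (int^'d \<Rightarrow> 'a::ab_group_add) \<Rightarrow> real \<Rightarrow> ('a \<Rightarrow> real) \<Rightarrow> 'a \<Rightarrow> real" where
  "semi p s t F x = exp (- (rate p * t)) * (\<Sum>k. ((conv p s ^^ k) F x / fact k) * t ^ k)"

lemma sf_count: "sigma_finite_measure (count_space (UNIV :: (int^'d) set))"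
  by (rule sigma_finite_measure_count_space_countable) auto

lemma conv_integrable:
  assumes "lsummable p" "bnd C F"
  shows "lsummable (\<lambda>y. p y * F (x + s y))"
proof (rule integrable_boundL[OF integrable_cmult[OF assms(1), of C]])
  have "0 \<le> C" using assms(2) by (rule bnd_nonneg)
  then show "AE y in count_space UNIV. norm (p y * F (x + s y)) \<le> norm (C * p y)"
    using bndD[OF assms(2)] by (auto simp: abs_mult mult.commute[of C] intro!: AE_I2 mult_left_mono)
qed simp

lemma conv_lin:
  assumes "lsummable p" "bnd C F" "bnd C' G"
  shows "conv p s (\<lambda>x. a * F x + b * G x) x = a * conv p s F x + b * conv p s G x"
proof -
  have "conv p s (\<lambda>x. a * F x + b * G x) x = (LSUM y. a * (p y * F (x + s y)) + b * (p y * G (x + s y)))"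
    unfolding conv_def by (simp add: algebra_simps)
  also have "\<dots> = a * conv p s F x + b * conv p s G x"
    using conv_integrable[OF assms(1,2)] conv_integrable[OF assms(1,3)] by (simp add: conv_def)
  finally show ?thesis .
qed

text \<open>Translations of an abelian group commute. This is what later makes the generator of one
  walk commute with the semigroup of another.\<close>

lemma conv_commute:
  fixes s s' :: "int^'d \<Rightarrow> 'a::ab_group_add"
  assumes p: "lsummable p" and p': "lsummable p'"
    and F: "bnd C F"
  shows "conv p s (conv p' s' F) x = conv p' s' (conv p s F) x"
proof -
  have "(LSUM y. (LSUM z. p y * (p' z * F (x + s y + s' z)))) =
     (LSUM z. (LSUM y. p y * (p' z * F (x + s y + s' z))))"
  proof (rule fubini_dom(1)[OF sf_count sf_count, where u="\<lambda>y. \<bar>p y\<bar>" and v="\<lambda>z. C * \<bar>p' z\<bar>"])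
    show "\<bar>p x' * (p' y * F (x + s x' + s' y))\<bar> \<le> \<bar>p x'\<bar> * (C * \<bar>p' y\<bar>)" for x' y
      using bndD[OF F] by (auto simp: abs_mult mult.commute[of C] intro!: mult_left_mono)
  qed (use p p' in \<open>auto simp: pair_measure_countable\<close>)
  then show ?thesis
    unfolding conv_def by (simp add: algebra_simps flip: integral_mult_right_zero)
qed

lemma conv_factor:
  assumes "\<And>z y. \<phi> (z + s1 y) = \<phi> z + s2 y"
  shows "conv p s1 (\<lambda>z. F (\<phi> z)) z = conv p s2 F (\<phi> z)"
  by (simp add: conv_def assms)

text \<open>A map that intertwines two step embeddings carries one walk to the other. It links the
  lattice walk with the walk on R^d, and for a translation it expresses translation invariance of
  the semigroup.\<close>

lemma semi_factor:
  assumes "\<And>z y. \<phi> (z + s1 y) = \<phi> z + s2 y"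
  shows "semi p s1 t (\<lambda>z. F (\<phi> z)) z = semi p s2 t F (\<phi> z)"
proof -
  have "(conv p s1 ^^ k) (\<lambda>z. F (\<phi> z)) = (\<lambda>z. (conv p s2 ^^ k) F (\<phi> z))" for k
  proof (induction k)
    case (Suc k)
    show ?case unfolding funpow.simps o_apply Suc by (rule ext) (rule conv_factor[of \<phi> s1 s2, OF assms])
  qed simp
  then show ?thesis by (simp add: semi_def)
qed

text \<open>Multiplying all rates by c means running time c times faster; through this the
  acceleration by n^\<alpha> enters.\<close>

lemma semi_scale: "semi (\<lambda>y. c * p y) s t F x = semi p s (c * t) F x"
proof -
  have 1: "conv (\<lambda>y. c * p y) s G = (\<lambda>x. c * conv p s G x)" for G
    by (simp add: conv_def fun_eq_iff mult.assoc)
  have 2: "conv p s (\<lambda>x. a * G x) = (\<lambda>x. a * conv p s G x)" for a G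
    by (simp add: conv_def fun_eq_iff mult.left_commute[of _ a])
  have "(conv (\<lambda>y. c * p y) s ^^ k) F = (\<lambda>x. c ^ k * (conv p s ^^ k) F x)" for k
    by (induction k) (simp_all add: 1 2 mult.assoc)
  then show ?thesis by (simp add: semi_def rate_def power_mult_distrib mult_ac)
qed

lemma gen_scale: "gen (\<lambda>y. c * p y) s F x = c * gen p s F x"
  by (simp add: gen_def conv_def rate_def mult.assoc right_diff_distrib)

locale walk =
  fixes p :: "int^'d \<Rightarrow> real"
  assumes p_nonneg: "0 \<le> p y" and p_even: "p (- y) = p y"
    and p_int: "lsummable p"
begin

lemma rate_nonneg: "0 \<le> rate p"
  unfolding rate_def using p_nonneg by (intro integral_nonnegL) auto

lemma conv_le:
  assumes "bnd C F" "\<forall>x. F x \<le> m"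
  shows "conv p s F x \<le> rate p * m"
proof -
  have "conv p s F x \<le> (LSUM y. p y * m)"
    unfolding conv_def
    by (intro integral_mono conv_integrable[OF p_int assms(1)] integrable_mult_left p_int mult_left_mono)
      (use assms p_nonneg in auto)
  then show ?thesis by (simp add: rate_def)
qed

lemma conv_ge:
  assumes "bnd C F" "\<forall>x. m \<le> F x"
  shows "rate p * m \<le> conv p s F x"
proof -
  have "(LSUM y. p y * m) \<le> conv p s F x"
    unfolding conv_def
    by (intro integral_mono conv_integrable[OF p_int assms(1)] integrable_mult_left p_int mult_left_mono)
      (use assms p_nonneg in auto)
  then show ?thesis by (simp add: rate_def)
qed

lemma conv_bnd:
  assumes "bnd C F"
  shows "bnd (rate p * C) (conv p s F)"
proof -
  have "\<forall>x. F x \<le> C" "\<forall>x. - C \<le> F x" using bndD[OF assms] by (auto simp: abs_le_iff minus_le_iff)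
  then show ?thesis
    using conv_le[OF assms, of C s] conv_ge[OF assms, of "- C" s] by (auto simp: abs_le_iff bnd_def minus_le_iff)
qed

lemma gen_bnd:
  assumes "bnd C F"
  shows "bnd (2 * rate p * C) (gen p s F)"
  unfolding bnd_def
proof
  fix x
  have "\<bar>rate p * F x\<bar> \<le> rate p * C" using bndD[OF assms] rate_nonneg by (simp add: abs_mult mult_left_mono)
  then show "\<bar>gen p s F x\<bar> \<le> 2 * rate p * C" using bndD[OF conv_bnd[OF assms], of s x] unfolding gen_def by linarith
qed

lemma iter_bnd:
  assumes "bnd C F"
  shows "bnd (rate p ^ k * C) ((conv p s ^^ k) F)"
proof (induction k)
  case (Suc k)
  then show ?case using conv_bnd[OF Suc, of s] by (simp add: mult.assoc)
qed (use assms in simp)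

lemma iter_nonneg:
  assumes "\<forall>x. 0 \<le> F x"
  shows "0 \<le> (conv p s ^^ k) F x"
proof (induction k arbitrary: x)
  case (Suc k)
  then show ?case using p_nonneg by (auto simp: conv_def intro!: integral_nonnegL)
qed (use assms in simp)

text \<open>The exponential series with ratio rate |t| dominates. Negative t is included because
  termwise differentiation needs convergence in a full neighbourhood of each time, also of
  0.\<close>

lemma semi_terms:
  assumes "bnd C F"
  shows "summable (\<lambda>k. C * ((rate p * \<bar>t\<bar>) ^ k / fact k))" (is ?g1)
    and "(\<Sum>k. C * ((rate p * \<bar>t\<bar>) ^ k / fact k)) = C * exp (rate p * \<bar>t\<bar>)"
    and "\<bar>(conv p s ^^ k) F x / fact k * t ^ k\<bar> \<le> C * ((rate p * \<bar>t\<bar>) ^ k / fact k)" (is ?g2)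
    and "summable (\<lambda>k. (conv p s ^^ k) F x / fact k * t ^ k)" (is ?g3)
    and "summable (\<lambda>k. \<bar>(conv p s ^^ k) F x / fact k * t ^ k\<bar>)" (is ?g4)
proof -
  have e: "(\<lambda>k. (rate p * \<bar>t\<bar>) ^ k / fact k) sums exp (rate p * \<bar>t\<bar>)"
    using exp_converges[of "rate p * \<bar>t\<bar>"] by (simp add: divide_inverse mult.commute)
  then have e': "(\<lambda>k. C * ((rate p * \<bar>t\<bar>) ^ k / fact k)) sums (C * exp (rate p * \<bar>t\<bar>))" by (rule sums_mult)
  then show S: ?g1
    "(\<Sum>k. C * ((rate p * \<bar>t\<bar>) ^ k / fact k)) = C * exp (rate p * \<bar>t\<bar>)"
    by (auto simp: sums_iff)
  have b: "\<bar>(conv p s ^^ k) F x / fact k * t ^ k\<bar> \<le> C * ((rate p * \<bar>t\<bar>) ^ k / fact k)" for k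
  proof -
    have "\<bar>(conv p s ^^ k) F x / fact k * t ^ k\<bar> = \<bar>(conv p s ^^ k) F x\<bar> * (\<bar>t\<bar> ^ k / fact k)"
      by (simp add: abs_mult power_abs)
    also have "\<dots> \<le> rate p ^ k * C * (\<bar>t\<bar> ^ k / fact k)"
      by (intro mult_right_mono bndD[OF iter_bnd[OF assms]]) auto
    finally show ?thesis by (simp add: power_mult_distrib mult_ac)
  qed
  show ?g2 by (rule b)
  show ?g4
    by (rule summable_comparison_test'[OF S(1), of 0]) (use b in auto)
  then show ?g3 by (rule summable_rabs_cancel)
qed

lemma semi_bnd:
  assumes "bnd C F" "0 \<le> t"
  shows "bnd C (semi p s t F)"
  unfolding bnd_def
proof
  fix x
  note T = semi_terms[OF assms(1), where t=t]
  have "\<bar>\<Sum>k. (conv p s ^^ k) F x / fact k * t ^ k\<bar> \<le> (\<Sum>k. \<bar>(conv p s ^^ k) F x / fact k * t ^ k\<bar>)"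
    by (rule summable_rabs[OF T(5)])
  also have "\<dots> \<le> (\<Sum>k. C * ((rate p * \<bar>t\<bar>) ^ k / fact k))"
    by (rule suminf_le[OF T(3) T(5) T(1)])
  finally have "\<bar>\<Sum>k. (conv p s ^^ k) F x / fact k * t ^ k\<bar> \<le> C * exp (rate p * t)"
    using T(2) assms(2) by simp
  then have "exp (- (rate p * t)) * \<bar>\<Sum>k. (conv p s ^^ k) F x / fact k * t ^ k\<bar> \<le> exp (- (rate p * t)) * (C * exp (rate p * t))"
    by (intro mult_left_mono) auto
  also have "\<dots> = C" by (simp add: mult.left_commute flip: exp_add)
  finally show "\<bar>semi p s t F x\<bar> \<le> C" by (simp add: semi_def abs_mult)
qed

lemma semi_nonneg:
  assumes "\<forall>x. 0 \<le> F x" "bnd C F" "0 \<le> t"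
  shows "0 \<le> semi p s t F x"
  unfolding semi_def using assms iter_nonneg[OF assms(1)]
  by (intro mult_nonneg_nonneg suminf_nonneg semi_terms(4)[OF assms(2)]) auto

lemma semi_0: "semi p s 0 F x = F x"
proof -
  have "(\<lambda>k. (conv p s ^^ k) F x / fact k * 0 ^ k) = (\<lambda>k. if k = 0 then F x else 0)" by (auto simp: fun_eq_iff)
  moreover have "(\<lambda>k. if k = 0 then F x else 0) sums F x" using sums_single[of 0 "\<lambda>_. F x"] by simp
  ultimately show ?thesis by (simp add: semi_def sums_iff)
qed

lemma iter_lin:
  assumes "bnd C F" "bnd C' G"
  shows "(conv p s ^^ k) (\<lambda>x. a * F x + b * G x) x = a * (conv p s ^^ k) F x + b * (conv p s ^^ k) G x"
proof (induction k arbitrary: x)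
  case (Suc k)
  then have "(conv p s ^^ k) (\<lambda>x. a * F x + b * G x) = (\<lambda>x. a * (conv p s ^^ k) F x + b * (conv p s ^^ k) G x)" by auto
  then show ?case by (simp add: conv_lin[OF p_int iter_bnd[OF assms(1)] iter_bnd[OF assms(2)]])
qed simp

lemma semi_lin:
  assumes "bnd C F" "bnd C' G"
  shows "semi p s t (\<lambda>x. a * F x + b * G x) x = a * semi p s t F x + b * semi p s t G x"
proof -
  have "(\<lambda>k. (conv p s ^^ k) (\<lambda>x. a * F x + b * G x) x / fact k * t ^ k) =
     (\<lambda>k. a * ((conv p s ^^ k) F x / fact k * t ^ k) + b * ((conv p s ^^ k) G x / fact k * t ^ k))"
    by (auto simp: fun_eq_iff iter_lin[OF assms] field_simps)
  then have "(\<Sum>k. (conv p s ^^ k) (\<lambda>x. a * F x + b * G x) x / fact k * t ^ k) =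
     a * (\<Sum>k. (conv p s ^^ k) F x / fact k * t ^ k) + b * (\<Sum>k. (conv p s ^^ k) G x / fact k * t ^ k)"
    using semi_terms(4)[OF assms(1)] semi_terms(4)[OF assms(2)]
    by (simp only: suminf_add[symmetric] suminf_mult summable_mult)
  then show ?thesis unfolding semi_def by (simp only: distrib_left mult.left_commute)
qed

lemma semi_diff:
  assumes "bnd C F" "bnd C' G"
  shows "semi p s t (\<lambda>x. F x - G x) x = semi p s t F x - semi p s t G x"
  using semi_lin[OF assms, where a=1 and b="-1"] by simp

lemma semi_mono:
  assumes "bnd C F" "bnd C' G" "\<forall>x. F x \<le> G x" "0 \<le> t"
  shows "semi p s t F x \<le> semi p s t G x"
proof -
  have "bnd (C' + C) (\<lambda>x. G x - F x)"
    unfolding bnd_def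
  proof
    fix x
    show "\<bar>G x - F x\<bar> \<le> C' + C" using bndD[OF assms(1), of x] bndD[OF assms(2), of x] by linarith
  qed
  then show ?thesis
    using semi_nonneg[where F="\<lambda>x. G x - F x" and C="C' + C", of t s x] assms(3,4) semi_diff[OF assms(2,1)] by simp
qed

text \<open>Differentiation shifts the coefficients by one, and since the (k+1)-st iterate on F is
  the k-th iterate on \<open>conv p s F\<close>, the shift is absorbed into F. The generator thus
  appears inside the semigroup, acting on F.\<close>

lemma semi_DERIV':
  assumes "bnd C F"
  shows "((\<lambda>t. semi p s t F x) has_real_derivative (semi p s t (conv p s F) x - rate p * semi p s t F x)) (at t)"
proof -
  have d: "diffs (\<lambda>k. (conv p s ^^ k) F x / fact k) = (\<lambda>k. (conv p s ^^ k) (conv p s F) x / fact k)"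
    by (auto simp: diffs_def fun_eq_iff funpow_Suc_right simp del: funpow.simps)
  have "((\<lambda>t. \<Sum>k. (conv p s ^^ k) F x / fact k * t ^ k) has_real_derivative
     (\<Sum>k. (conv p s ^^ k) (conv p s F) x / fact k * t ^ k)) (at t)"
    using termdiffs_strong_converges_everywhere[of "\<lambda>k. (conv p s ^^ k) F x / fact k" t, OF semi_terms(4)[OF assms]]
    unfolding d .
  moreover have "((\<lambda>t. exp (- (rate p * t))) has_real_derivative (- rate p * exp (- (rate p * t)))) (at t)"
    by (auto intro!: derivative_eq_intros)
  ultimately show ?thesis
    using DERIV_mult unfolding semi_def by (fastforce simp: algebra_simps)
qed

lemma semi_DERIV:
  assumes "bnd C F"
  shows "((\<lambda>t. semi p s t F x) has_real_derivative semi p s t (gen p s F) x) (at t)"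
proof -
  have "gen p s F = (\<lambda>x. 1 * conv p s F x + (- rate p) * F x)" by (auto simp: gen_def)
  then show ?thesis
    using semi_DERIV'[OF assms, of s x t] semi_lin[OF conv_bnd[OF assms] assms, of s t 1 s "- rate p" x] by simp
qed

lemma semi_cont: 
  assumes "bnd C F"
  shows "isCont (\<lambda>t. semi p s t F x) t"
  by (rule DERIV_isCont[OF semi_DERIV[OF assms]])

lemma semi_integrable:
  assumes "bnd C F"
  shows "set_integrable lborel {a..b} (\<lambda>r. semi p s r F x)"
  by (rule borel_integrable_atLeastAtMost') (use semi_cont[OF assms] in \<open>auto intro: continuous_at_imp_continuous_on\<close>)

lemma semi_eq:
  assumes "bnd C F" "r \<le> t"
  shows "semi p s t F x = semi p s r F x + (LBINT r:{r..t}. semi p s r (gen p s F) x)"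
  using integral_FTC_Icc_real[OF assms(2), of "\<lambda>t. semi p s t F x" "\<lambda>r. semi p s r (gen p s F) x"]
    semi_DERIV[OF assms(1)] semi_cont[OF gen_bnd[OF assms(1)]]
  by (simp add: set_lebesgue_integral_def mult.commute)

text \<open>Integration against g passes into the jump expansion. With counting measure and g
  another jump rate this gives commutation of two walks; with an invariant measure it is one half of
  self-adjointness.\<close>

lemma semi_interchange:
  assumes g: "integrable N g" and F: "bnd C F"
    and m: "\<And>k. (\<lambda>z. (conv p s ^^ k) F (\<phi> z)) \<in> borel_measurable N"
  shows "integrable N (\<lambda>z. g z * semi p s t F (\<phi> z))" (is ?i)
    and "(\<integral>z. g z * semi p s t F (\<phi> z) \<partial>N) =
      exp (- (rate p * t)) * (\<Sum>k. ((\<integral>z. g z * (conv p s ^^ k) F (\<phi> z) \<partial>N) / fact k) * t ^ k)" (is ?e)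
proof -
  have gm[measurable]: "g \<in> borel_measurable N" using g by auto
  note mm[measurable] = m
  have I1: "integrable N (\<lambda>z. g z * (conv p s ^^ k) F (\<phi> z))" for k
  proof (rule integrable_boundL[OF integrable_cmult[OF g, of "rate p ^ k * C"]])
    have "0 \<le> C" using F by (rule bnd_nonneg)
    then show "AE z in N. norm (g z * (conv p s ^^ k) F (\<phi> z)) \<le> norm (rate p ^ k * C * g z)"
      using bndD[OF iter_bnd[OF F]] rate_nonneg
      by (auto simp: abs_mult mult.commute[of "rate p ^ k * C"] mult.commute[of _ "\<bar>g _\<bar>"] intro!: AE_I2 mult_left_mono simp del: mult_minus_left)
  qed simp
  define f where "f k z = g z * (conv p s ^^ k) F (\<phi> z) / fact k * t ^ k" for k z
  have I: "integrable N (f k)" for k unfolding f_def using I1[of k] by auto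
  have b: "\<bar>f k z\<bar> \<le> \<bar>g z\<bar> * (C * ((rate p * \<bar>t\<bar>) ^ k / fact k))" for k z
  proof -
    have "\<bar>f k z\<bar> = \<bar>g z\<bar> * \<bar>(conv p s ^^ k) F (\<phi> z) / fact k * t ^ k\<bar>" by (simp add: f_def abs_mult)
    then show ?thesis using mult_left_mono[OF semi_terms(3)[OF F, where t=t], of "\<bar>g z\<bar>"] by simp
  qed
  have s1: "AE z in N. summable (\<lambda>k. norm (f k z))"
  proof (rule AE_I2)
    fix z
    show "summable (\<lambda>k. norm (f k z))"
      by (rule summable_comparison_test'[OF summable_mult[OF semi_terms(1)[OF F, where t=t]], of 0 _ "\<bar>g z\<bar>"]) (use b in auto)
  qed
  have s2: "summable (\<lambda>k. \<integral>z. norm (f k z) \<partial>N)"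
  proof (rule summable_comparison_test'[OF summable_mult[OF semi_terms(1)[OF F, where t=t]], of 0 _ "\<integral>z. \<bar>g z\<bar> \<partial>N"])
    fix k
    have "(\<integral>z. norm (f k z) \<partial>N) \<le> (\<integral>z. \<bar>g z\<bar> * (C * ((rate p * \<bar>t\<bar>) ^ k / fact k)) \<partial>N)"
      by (intro integral_mono integrable_norm I integrable_mult_left integrable_abs g) (use b in auto)
    then show "norm (\<integral>z. norm (f k z) \<partial>N) \<le> (\<integral>z. \<bar>g z\<bar> \<partial>N) * (C * ((rate p * \<bar>t\<bar>) ^ k / fact k))"
      by simp
  qed
  have eq: "g z * semi p s t F (\<phi> z) = exp (- (rate p * t)) * (\<Sum>k. f k z)" for z
    using suminf_mult[OF semi_terms(4)[OF F, where t=t], of "g z"]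
    by (simp add: semi_def f_def mult_ac)
  show ?i unfolding eq by (rule integrable_cmult[OF integrable_suminf[OF I s1 s2]])
  have "(\<integral>z. f k z \<partial>N) = (\<integral>z. g z * (conv p s ^^ k) F (\<phi> z) \<partial>N) / fact k * t ^ k" for k
    by (simp add: f_def)
  then show ?e unfolding eq integral_mult_right_zero integral_suminf[OF I s1 s2] by simp
qed

lemma semi_conv_commute:
  fixes p' :: "int^'d \<Rightarrow> real"
  assumes p': "lsummable p'" and F: "bnd C F"
  shows "conv p' s' (semi p s t F) x = semi p s t (conv p' s' F) x"
proof -
  have c: "(conv p s ^^ k) (conv p' s' F) x = conv p' s' ((conv p s ^^ k) F) x" for k x
  proof (induction k arbitrary: x)
    case (Suc k)
    then have "(conv p s ^^ k) (conv p' s' F) = conv p' s' ((conv p s ^^ k) F)" by auto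
    then show ?case by (simp add: conv_commute[OF p_int p' iter_bnd[OF F, of k s]])
  qed simp
  have "conv p' s' (semi p s t F) x = (LSUM y. p' y * semi p s t F (x + s' y))"
    by (simp add: conv_def)
  also have "\<dots> = exp (- (rate p * t)) * (\<Sum>k. ((LSUM z. p' z * (conv p s ^^ k) F (x + s' z)) / fact k) * t ^ k)"
    by (rule semi_interchange(2)[OF p' F]) simp
  also have "\<dots> = semi p s t (conv p' s' F) x"
    by (simp add: semi_def c conv_def)
  finally show ?thesis .
qed

lemma semi_gen_commute:
  fixes p' :: "int^'d \<Rightarrow> real"
  assumes p': "walk p'" and F: "bnd C F"
  shows "gen p' s' (semi p s t F) x = semi p s t (gen p' s' F) x"
proof -
  interpret q: walk p' by fact
  have "gen p' s' F = (\<lambda>x. 1 * conv p' s' F x + (- rate p') * F x)" by (auto simp: gen_def)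
  then show ?thesis
    using semi_lin[OF q.conv_bnd[OF F] F, of s t 1 s' "- rate p'" x] semi_conv_commute[OF q.p_int F]
    by (simp add: gen_def)
qed

lemma semi_eq_gen:
  assumes "bnd C F" "0 \<le> t"
  shows "semi p s t F x = F x + (LBINT r:{0..t}. gen p s (semi p s r F) x)"
  using semi_eq[OF assms, of s x] by (simp add: semi_0 semi_gen_commute[OF walk_axioms assms(1)])

text \<open>The Lipschitz constant is the bound on \<open>gen p s F\<close>, not the total rate; for
  smooth F it stays bounded while the rates of the rescaled walks diverge.\<close>

lemma semi_time_lipschitz:
  assumes "bnd C F" "bnd c (gen p s F)" "0 \<le> r" "r \<le> t"
  shows "\<bar>semi p s t F x - semi p s r F x\<bar> \<le> c * (t - r)"
proof -
  have "\<bar>LBINT r:{r..t}. semi p s r (gen p s F) x\<bar> \<le> (LBINT r:{r..t}. \<bar>semi p s r (gen p s F) x\<bar>)"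
    using set_integral_norm_bound[OF semi_integrable[OF assms(2)]] by simp
  also have "\<dots> \<le> (LBINT r:{r..t}. c)"
  proof (rule set_integral_mono)
    show "set_integrable lborel {r..t} (\<lambda>ra. \<bar>semi p s ra (gen p s F) x\<bar>)"
      using semi_integrable[OF assms(2)] by (rule set_integrable_abs)
    show "set_integrable lborel {r..t} (\<lambda>r. c)"
      by (rule borel_integrable_atLeastAtMost') auto
  qed (use bndD[OF semi_bnd[OF assms(2)]] assms(3) in auto)
  also have "\<dots> = c * (t - r)" using assms(4) by (simp add: set_lebesgue_integral_def)
  finally show ?thesis using semi_eq[OF assms(1,4), of s x] by simp
qed

end

text \<open>Duhamel's formula read through the maximum principle. The difference solves the equation
  of the first walk with source (A1 - A2) S2(t) F; as all operators commute, the source equals S2(t)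
  (A1 - A2) F and is bounded by c. No rate enters the result.\<close>

lemma semi_compare:
  fixes p1 p2 :: "int^'d \<Rightarrow> real"
  assumes p1: "walk p1" and p2: "walk p2" and F: "bnd C F"
    and c: "bnd c (\<lambda>x. gen p1 s1 F x - gen p2 s2 F x)" and t: "0 \<le> t"
  shows "\<bar>semi p1 s1 t F x - semi p2 s2 t F x\<bar> \<le> c * t"
proof -
  interpret p1: walk p1 by fact
  interpret p2: walk p2 by fact
  define f where "f t x = semi p1 s1 t F x - semi p2 s2 t F x" for t x
  define a where "a t x = gen p1 s1 (semi p1 s1 t F) x - gen p2 s2 (semi p2 s2 t F) x" for t x
  have c0: "0 \<le> c" using c by (rule bnd_nonneg)
  have ab: "bnd (C + C) (f t)" if "t \<ge> 0" for t
    unfolding bnd_def f_def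
  proof
    fix x
    show "\<bar>semi p1 s1 t F x - semi p2 s2 t F x\<bar> \<le> C + C"
      using bndD[OF p1.semi_bnd[OF F that, of s1], of x] bndD[OF p2.semi_bnd[OF F that, of s2], of x] by linarith
  qed
  have f0: "f 0 x = 0" for x by (simp add: f_def p1.semi_0 p2.semi_0)
  have 1: "(\<lambda>r. gen p1 s1 (semi p1 s1 r F) x) = (\<lambda>r. semi p1 s1 r (gen p1 s1 F) x)" for x
    by (rule ext) (rule p1.semi_gen_commute[OF p1 F])
  have 2: "(\<lambda>r. gen p2 s2 (semi p2 s2 r F) x) = (\<lambda>r. semi p2 s2 r (gen p2 s2 F) x)" for x
    by (rule ext) (rule p2.semi_gen_commute[OF p2 F])
  have int1: "set_integrable lborel {0..t} (\<lambda>r. gen p1 s1 (semi p1 s1 r F) x)" for t x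
    unfolding 1 by (rule p1.semi_integrable[OF p1.gen_bnd[OF F]])
  have int2: "set_integrable lborel {0..t} (\<lambda>r. gen p2 s2 (semi p2 s2 r F) x)" for t x
    unfolding 2 by (rule p2.semi_integrable[OF p2.gen_bnd[OF F]])
  have "\<bar>f t x\<bar> \<le> 0 + c * t"
  proof (rule max_principle_abs[where T=t and X=UNIV and a=a and K="rate p1" and Bd="C + C" and b="\<lambda>r. conv p1 s1 (f r)"])
    show "set_integrable lborel {0..t} (\<lambda>r. a r x)" for x
      unfolding a_def by (rule set_integral_diff(1)[OF int1 int2])
    show "f r x = f 0 x + (LBINT r:{0..r}. a r x)" if "r \<in> {0..t}" for r x
      unfolding a_def set_integral_diff(2)[OF int1 int2] f0
      using p1.semi_eq_gen[OF F, of r s1 x] p2.semi_eq_gen[OF F, of r s2 x] that by (simp add: f_def)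
    fix r x assume r: "r \<in> {0..t}"
    have r0: "0 \<le> r" using r by simp
    have "conv p1 s1 (f r) x = conv p1 s1 (semi p1 s1 r F) x - conv p1 s1 (semi p2 s2 r F) x"
      using conv_lin[OF p1.p_int p1.semi_bnd[OF F r0] p2.semi_bnd[OF F r0], of s1 1 s1 "-1" s2 x]
      by (simp add: f_def[abs_def])
    then have "a r x + rate p1 * f r x - conv p1 s1 (f r) x = gen p1 s1 (semi p2 s2 r F) x - gen p2 s2 (semi p2 s2 r F) x"
      by (simp add: a_def gen_def f_def algebra_simps)
    also have "\<dots> = semi p2 s2 r (gen p1 s1 F) x - semi p2 s2 r (gen p2 s2 F) x"
      by (simp add: p2.semi_gen_commute[OF p1 F] p2.semi_gen_commute[OF p2 F])
    also have "\<dots> = semi p2 s2 r (\<lambda>x. gen p1 s1 F x - gen p2 s2 F x) x"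
      by (simp add: p2.semi_diff[OF p1.gen_bnd[OF F] p2.gen_bnd[OF F]])
    finally show "\<bar>a r x + rate p1 * f r x - conv p1 s1 (f r) x\<bar> \<le> c"
      using bndD[OF p2.semi_bnd[OF c r0]] by simp
    { fix m assume "\<And>y. y \<in> UNIV \<Longrightarrow> - m \<le> f r y"
      then show "- (rate p1 * m) \<le> conv p1 s1 (f r) x"
        using p1.conv_ge[OF ab[OF r0], of "- m" s1 x] by simp }
    { fix m assume "\<And>y. y \<in> UNIV \<Longrightarrow> f r y \<le> m"
      then show "conv p1 s1 (f r) x \<le> rate p1 * m"
        using p1.conv_le[OF ab[OF r0], of m s1 x] by simp }
  qed (use t bndD[OF ab] f0 c0 p1.rate_nonneg in auto)
  then show ?thesis by (simp add: f_def)
qed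

section \<open>Symmetry with respect to translation-invariant measures\<close>

text \<open>The two instances are Lebesgue measure on R^d and counting measure on Z^d.\<close>

locale transl_inv = sigma_finite_measure N for N :: "'a::ab_group_add measure" +
  assumes shift_meas: "(\<lambda>x. x + a) \<in> measurable N N"
    and shift_distr: "distr N N (\<lambda>x. x + a) = N"
    and space_N: "space N = UNIV"
begin

lemma conv_meas:
  fixes F :: "'a \<Rightarrow> real"
  assumes [measurable]: "F \<in> borel_measurable N"
  shows "conv p s F \<in> borel_measurable N"
proof -
  interpret c: sigma_finite_measure "count_space (UNIV :: (int^'b) set)" by (rule sf_count)
  have "(\<lambda>(x, y). p y * F (x + s y)) \<in> borel_measurable (N \<Otimes>\<^sub>M count_space UNIV)"
  proof (rule measurable_pair_countable2)
    fix y :: "int^'b"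
    have [measurable]: "(\<lambda>x. x + s y) \<in> measurable N N" by (rule shift_meas)
    show "(\<lambda>x. case (x, y) of (x, y) \<Rightarrow> p y * F (x + s y)) \<in> borel_measurable N" by simp
  qed
  then have "(\<lambda>x. LSUM y. p y * F (x + s y)) \<in> borel_measurable N"
    by (rule c.borel_measurable_lebesgue_integral)
  then show ?thesis by (simp add: conv_def[abs_def])
qed

lemma iter_meas:
  fixes F :: "'a \<Rightarrow> real"
  assumes "F \<in> borel_measurable N"
  shows "(conv p s ^^ k) F \<in> borel_measurable N"
  by (induction k) (use assms conv_meas in auto)

lemma semi_meas:
  fixes F :: "'a \<Rightarrow> real"
  assumes [measurable]: "F \<in> borel_measurable N"
  shows "semi p s t F \<in> borel_measurable N" (is ?g1)
    and "(\<lambda>(t, x). semi p s t F x) \<in> borel_measurable (borel \<Otimes>\<^sub>M N)" (is ?g2)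
proof -
  have [measurable]: "(conv p s ^^ k) F \<in> borel_measurable N" for k by (rule iter_meas) fact
  show ?g1 unfolding semi_def[abs_def] by measurable
  show ?g2
    unfolding semi_def[abs_def] by measurable
qed

lemma shift_integral:
  fixes F :: "'a \<Rightarrow> real"
  assumes "F \<in> borel_measurable N"
  shows "(\<integral>x. F (x + a) \<partial>N) = (\<integral>x. F x \<partial>N)"
  using integral_distr[OF shift_meas assms, of a] by (simp add: shift_distr)

lemma shift_integrable:
  fixes F :: "'a \<Rightarrow> real"
  assumes "integrable N F"
  shows "integrable N (\<lambda>x. F (x + a))"
  using integrable_distr_eq[OF shift_meas borel_measurable_integrable[OF assms], of a] assms by (simp add: shift_distr)

text \<open>Shift the variable by s(y) and replace y by -y: p is even and s is odd, so convolution
  is self-adjoint for every invariant measure.\<close>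

lemma conv_dual:
  fixes F g :: "'a \<Rightarrow> real"
  assumes "walk p" and s: "odd_shift s" and g: "integrable N g" and gb: "bnd C' g"
    and F[measurable]: "F \<in> borel_measurable N" and Fb: "bnd C F"
  shows "(\<integral>x. g x * conv p s F x \<partial>N) = (\<integral>x. conv p s g x * F x \<partial>N)" (is ?g1) "integrable N (conv p s g)"
proof -
  interpret walk p by fact
  have gm[measurable]: "g \<in> borel_measurable N" using g by auto
  have [measurable]: "(\<lambda>x. x + a) \<in> measurable N N" for a by (rule shift_meas)
  have [measurable]: "(\<lambda>x. x - a) \<in> measurable N N" for a using shift_meas[of "- a"] by simp
  have C0: "0 \<le> C" using Fb by (rule bnd_nonneg)
  have fub1: "(\<integral>x. (LSUM y. g x * (p y * F (x + s y))) \<partial>N) = (LSUM y. \<integral>x. g x * (p y * F (x + s y)) \<partial>N)"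
    by (rule fubini_dom(1)[OF _ sf_count, where u="\<lambda>x. \<bar>g x\<bar>" and v="\<lambda>y. C * p y"])
      (use g p_int p_nonneg bndD[OF Fb] C0 sigma_finite_measure_axioms in \<open>auto intro!: measurable_pair_countable2 mult_mono simp: abs_mult mult.commute[of C]\<close>)
  \<comment> \<open>The shift of g depends on y, so no product bound is available for this exchange;
    Tonelli together with the invariance of \<open>N\<close> gives integrability on the
    product.\<close>
  define H where "H y x = p y * g (x + s y)" for y x
  have Hm: "(\<lambda>(y, x). H y x) \<in> borel_measurable (count_space UNIV \<Otimes>\<^sub>M N)"
    by (rule measurable_pair_measure_countable1) (auto simp: H_def)
  interpret c: pair_sigma_finite "count_space (UNIV :: (int^'b) set)" N
    by (simp add: pair_sigma_finite_def sf_count sigma_finite_measure_axioms)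
  have HI: "integrable (count_space UNIV \<Otimes>\<^sub>M N) (\<lambda>(y, x). H y x)"
  proof (rule c.Fubini_integrable[OF Hm])
    have "(\<integral>x. norm (H y x) \<partial>N) = p y * (\<integral>x. \<bar>g x\<bar> \<partial>N)" for y
      using p_nonneg[of y] shift_integral[of "\<lambda>x. \<bar>g x\<bar>" "s y"] by (simp add: H_def abs_mult)
    then show "lsummable (\<lambda>y. \<integral>x. norm (case (y, x) of (y, x) \<Rightarrow> H y x) \<partial>N)"
      using p_int by simp
  qed (use shift_integrable[OF g] in \<open>auto simp: H_def\<close>)
  show "integrable N (conv p s g)"
    using c.integrable_snd[OF HI] by (simp add: H_def conv_def[abs_def])
  have HFI: "integrable (count_space UNIV \<Otimes>\<^sub>M N) (\<lambda>(y, x). H y x * F x)"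
  proof (rule integrable_boundL[OF integrable_multc[OF HI, of C]])
    show "(\<lambda>(y, x). H y x * F x) \<in> borel_measurable (count_space UNIV \<Otimes>\<^sub>M N)"
      by (rule measurable_pair_measure_countable1) (auto simp: H_def)
  qed (use bndD[OF Fb] C0 in \<open>auto simp: abs_mult intro!: AE_I2 mult_left_mono\<close>)
  have e1: "(\<integral>x. g x * conv p s F x \<partial>N) = (LSUM y. \<integral>x. g x * (p y * F (x + s y)) \<partial>N)"
    unfolding conv_def fub1[symmetric] by (simp flip: integral_mult_right_zero)
  also have "\<dots> = (LSUM y. p y * (\<integral>x. g (x + s (- y)) * F x \<partial>N))"
  proof (rule integral_congL)
    fix y
    have "(\<integral>x. g x * (p y * F (x + s y)) \<partial>N) = p y * (\<integral>x. g (x + s y + s (- y)) * F (x + s y) \<partial>N)"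
      using s by (simp add: odd_shift_def mult.left_commute flip: integral_mult_right_zero)
    also have "(\<integral>x. g (x + s y + s (- y)) * F (x + s y) \<partial>N) = (\<integral>x. g (x + s (- y)) * F x \<partial>N)"
      by (rule shift_integral[of "\<lambda>x. g (x + s (- y)) * F x"]) measurable
    finally show "(\<integral>x. g x * (p y * F (x + s y)) \<partial>N) = p y * (\<integral>x. g (x + s (- y)) * F x \<partial>N)" .
  qed simp
  also have "\<dots> = (LSUM y. p (- y) * (\<integral>x. g (x + s (- y)) * F x \<partial>N))"
    by (simp add: p_even)
  also have "\<dots> = (LSUM y. p y * (\<integral>x. g (x + s y) * F x \<partial>N))"
    by (rule integral_bij_count_space) (auto intro!: bijI' simp: minus_equation_iff[of _ "_"] intro: exI[of _ "- _"])
  also have "\<dots> = (LSUM y. \<integral>x. H y x * F x \<partial>N)"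
    by (simp add: H_def mult.assoc)
  also have "\<dots> = (\<integral>x. (LSUM y. H y x * F x) \<partial>N)"
    using c.Fubini_integral[OF HFI] by simp
  also have "\<dots> = (\<integral>x. conv p s g x * F x \<partial>N)"
    by (simp add: H_def conv_def)
  finally show ?g1 .
qed

text \<open>Self-adjointness of the iterates, summed over the jump expansion. The side where g is
  evolved has to be summed in L^1, which works because each convolution multiplies the L^1 norm by
  at most the rate.\<close>

lemma semi_dual:
  fixes F g :: "'a \<Rightarrow> real"
  assumes w: "walk p" and s: "odd_shift s" and g: "integrable N g" and gb: "bnd C' g"
    and F[measurable]: "F \<in> borel_measurable N" and Fb: "bnd C F"
  shows "(\<integral>x. g x * semi p s t F x \<partial>N) = (\<integral>x. semi p s t g x * F x \<partial>N)" (is ?g1)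
    and "integrable N (\<lambda>x. semi p s t g x * F x)" (is ?g2)
proof -
  interpret walk p by fact
  have gm[measurable]: "g \<in> borel_measurable N" using g by auto
  have gi: "integrable N ((conv p s ^^ k) g)" for k
  proof (induction k)
    case (Suc k)
    show ?case
      using conv_dual(2)[where s=s, OF w s Suc iter_bnd[OF gb] F Fb] by simp
  qed (use g in simp)
  have it: "(\<integral>x. (conv p s ^^ j) g x * (conv p s ^^ k) F x \<partial>N) = (\<integral>x. (conv p s ^^ (j + k)) g x * F x \<partial>N)" for j k
  proof (induction k arbitrary: j)
    case (Suc k)
    have "(\<integral>x. (conv p s ^^ j) g x * (conv p s ^^ Suc k) F x \<partial>N) = (\<integral>x. (conv p s ^^ j) g x * conv p s ((conv p s ^^ k) F) x \<partial>N)" by simp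
    also have "\<dots> = (\<integral>x. (conv p s ^^ Suc j) g x * (conv p s ^^ k) F x \<partial>N)"
      by (subst conv_dual(1)[where s=s, OF w s gi iter_bnd[OF gb] iter_meas[OF F] iter_bnd[OF Fb]]) simp
    finally show ?case using Suc[of "Suc j"] by simp
  qed simp
  have "(\<integral>x. g x * semi p s t F x \<partial>N) = exp (- (rate p * t)) * (\<Sum>k. ((\<integral>z. g z * (conv p s ^^ k) F z \<partial>N) / fact k) * t ^ k)"
    by (rule semi_interchange(2)[where \<phi>="\<lambda>x. x", OF g Fb iter_meas[OF F]])
  also have "\<dots> = exp (- (rate p * t)) * (\<Sum>k. ((\<integral>z. F z * (conv p s ^^ k) g z \<partial>N) / fact k) * t ^ k)"
    using it[of 0] by (simp add: mult.commute)
  finally have e: "(\<integral>x. g x * semi p s t F x \<partial>N) = exp (- (rate p * t)) * (\<Sum>k. ((\<integral>z. F z * (conv p s ^^ k) g z \<partial>N) / fact k) * t ^ k)" .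
  have C0: "0 \<le> C" using Fb by (rule bnd_nonneg)
  define f where "f k z = F z * (conv p s ^^ k) g z / fact k * t ^ k" for k z
  have gn: "(\<integral>x. \<bar>(conv p s ^^ k) g x\<bar> \<partial>N) \<le> rate p ^ k * (\<integral>x. \<bar>g x\<bar> \<partial>N)" for k
  proof (induction k)
    case (Suc k)
    have "(\<integral>x. \<bar>(conv p s ^^ Suc k) g x\<bar> \<partial>N) \<le> (\<integral>x. 1 * conv p s (\<lambda>x. \<bar>(conv p s ^^ k) g x\<bar>) x \<partial>N)"
    proof (rule integral_mono)
      have "bnd (rate p ^ k * C') (\<lambda>x. \<bar>(conv p s ^^ k) g x\<bar>)" using iter_bnd[OF gb, of k s] by (simp add: bnd_def)
      then show "integrable N (\<lambda>x. 1 * conv p s (\<lambda>x. \<bar>(conv p s ^^ k) g x\<bar>) x)"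
        using conv_dual(2)[where s=s, OF w s integrable_abs[OF gi] _ F Fb] by simp
      show "\<bar>(conv p s ^^ Suc k) g x\<bar> \<le> 1 * conv p s (\<lambda>x. \<bar>(conv p s ^^ k) g x\<bar>) x" for x
        using integral_norm_bound[of "count_space UNIV" "\<lambda>y. p y * (conv p s ^^ k) g (x + s y)"] p_nonneg
        by (simp add: conv_def abs_mult)
    qed (use gi[of "Suc k"] in simp)
    also have "\<dots> = (\<integral>x. conv p s (\<lambda>x. \<bar>(conv p s ^^ k) g x\<bar>) x * 1 \<partial>N)" by simp
    \<comment> \<open>The L^1 norm is computed by duality with the constant 1, on which convolution
      acts as multiplication by the rate.\<close>
    also have "\<dots> = (\<integral>x. \<bar>(conv p s ^^ k) g x\<bar> * conv p s (\<lambda>x. 1) x \<partial>N)"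
      by (rule conv_dual(1)[symmetric, where s=s and C'="rate p ^ k * C'" and C=1, OF w s integrable_abs[OF gi]])
        (use iter_bnd[OF gb] in \<open>auto simp: bnd_def\<close>)
    also have "conv p s (\<lambda>x. 1) = (\<lambda>x. rate p)" by (simp add: conv_def rate_def fun_eq_iff)
    also have "(\<integral>x. \<bar>(conv p s ^^ k) g x\<bar> * rate p \<partial>N) \<le> rate p ^ k * (\<integral>x. \<bar>g x\<bar> \<partial>N) * rate p"
      using mult_right_mono[OF Suc rate_nonneg] by simp
    finally show ?case by (simp add: mult_ac)
  qed simp
  have [measurable]: "(conv p s ^^ k) g \<in> borel_measurable N" for k by (rule iter_meas[OF gm])
  have fI: "integrable N (f k)" for k
  proof -
    have "integrable N (\<lambda>z. F z * (conv p s ^^ k) g z)"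
      by (rule integrable_boundL[OF integrable_cmult[OF gi[of k], of C]])
        (use bndD[OF Fb] C0 in \<open>auto simp: abs_mult intro!: AE_I2 mult_right_mono\<close>)
    then show ?thesis by (simp add: f_def[abs_def])
  qed
  have s1: "AE z in N. summable (\<lambda>k. norm (f k z))"
  proof (rule AE_I2)
    fix z
    have "summable (\<lambda>k. \<bar>F z\<bar> * \<bar>(conv p s ^^ k) g z / fact k * t ^ k\<bar>)"
      by (rule summable_mult[OF semi_terms(5)[OF gb]])
    then show "summable (\<lambda>k. norm (f k z))" by (simp add: f_def abs_mult mult.assoc)
  qed
  have s2: "summable (\<lambda>k. \<integral>z. norm (f k z) \<partial>N)"
  \<comment> \<open>\<open>semi_terms\<close> is instantiated with a constant function on the
    integers only to borrow the summability of the exponential series with the right constant in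
    front.\<close>
  proof (rule summable_comparison_test'[OF semi_terms(1)[where F="\<lambda>_::int. C * (\<integral>x. \<bar>g x\<bar> \<partial>N)" and C="C * (\<integral>x. \<bar>g x\<bar> \<partial>N)" and t=t], of 0])
    show "bnd (C * (\<integral>x. \<bar>g x\<bar> \<partial>N)) (\<lambda>_::int. C * (\<integral>x. \<bar>g x\<bar> \<partial>N))" using C0 by (simp add: abs_mult bnd_def)
    fix k
    have "(\<integral>z. norm (f k z) \<partial>N) \<le> (\<integral>z. C * (\<bar>t\<bar> ^ k / fact k) * \<bar>(conv p s ^^ k) g z\<bar> \<partial>N)"
    proof (intro integral_mono integrable_norm fI integrable_mult_right integrable_abs gi)
      fix z
      have "norm (f k z) = \<bar>F z\<bar> * ((\<bar>t\<bar> ^ k / fact k) * \<bar>(conv p s ^^ k) g z\<bar>)"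
        by (simp add: f_def abs_mult power_abs)
      also have "\<dots> \<le> C * ((\<bar>t\<bar> ^ k / fact k) * \<bar>(conv p s ^^ k) g z\<bar>)"
        by (rule mult_right_mono[OF bndD[OF Fb]]) simp
      finally show "norm (f k z) \<le> C * (\<bar>t\<bar> ^ k / fact k) * \<bar>(conv p s ^^ k) g z\<bar>" by (simp add: mult.assoc)
    qed
    also have "\<dots> \<le> C * (\<bar>t\<bar> ^ k / fact k) * (rate p ^ k * (\<integral>x. \<bar>g x\<bar> \<partial>N))"
      using mult_left_mono[OF gn[of k], of "C * (\<bar>t\<bar> ^ k / fact k)"] C0 by simp
    finally show "norm (\<integral>z. norm (f k z) \<partial>N) \<le> C * (\<integral>x. \<bar>g x\<bar> \<partial>N) * ((rate p * \<bar>t\<bar>) ^ k / fact k)"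
      by (simp add: power_mult_distrib mult_ac)
  qed
  have eq: "semi p s t g z * F z = exp (- (rate p * t)) * (\<Sum>k. f k z)" for z
    using suminf_mult[OF semi_terms(4)[OF gb, where t=t], of "F z"]
    by (simp add: semi_def f_def mult_ac)
  show ?g1
    unfolding e eq integral_mult_right_zero integral_suminf[OF fI s1 s2] by (simp add: f_def[abs_def])
  show ?g2
    unfolding eq by (rule integrable_cmult[OF integrable_suminf[OF fI s1 s2]])
qed

lemma semi_integrable_N:
  fixes g :: "'a \<Rightarrow> real"
  assumes w: "walk p" and s: "odd_shift s" and g: "integrable N g" and gb: "bnd C' g"
  shows "integrable N (semi p s t g)"
  using semi_dual(2)[where F="\<lambda>_. 1" and C=1 and t=t, OF assms] by (simp add: bnd_def)

end

section \<open>Lattice cells and Riemann sums\<close>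

lemma lat_0[simp]: "lat 0 = 0" by (simp add: lat_def vec_eq_iff)
lemma lat_add: "lat (x + y) = lat x + lat y" by (simp add: lat_def vec_eq_iff)
lemma lat_minus: "lat (- x) = - lat x" by (simp add: lat_def vec_eq_iff)
lemma lat_eq_0: "lat x = 0 \<longleftrightarrow> x = 0" by (simp add: lat_def vec_eq_iff)

definition floor_vec :: "real^'d \<Rightarrow> int^'d" where
  "floor_vec v = (\<chi> i. \<lfloor>v $ i\<rfloor>)"

lemma floor_vec_measurable[measurable]: "floor_vec \<in> measurable borel (count_space UNIV)"
proof (subst measurable_count_space_eq2_countable)
  show "floor_vec \<in> space borel \<rightarrow> UNIV \<and> (\<forall>a\<in>UNIV. floor_vec -` {a} \<inter> space (borel :: (real^'a) measure) \<in> sets borel)"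
  proof (safe, goal_cases)
    case (2 a)
    have "floor_vec -` {a} \<inter> space borel = {v \<in> space borel. \<forall>i. \<lfloor>v $ i\<rfloor> = a $ i}"
      by (auto simp: floor_vec_def vec_eq_iff)
    also have "\<dots> \<in> sets borel" by measurable
    finally show ?case .
  qed simp
qed

text \<open>The half-open cell is squeezed between an open and a closed box of the same
  volume.\<close>

lemma emeasure_floor_cell: "emeasure lborel {v :: real^'d. floor_vec v = z} = 1"
proof -
  let ?S = "{v :: real^'d. floor_vec v = z}"
  let ?b = "lat z + (\<chi> i. 1)"
  have m: "?S \<in> sets lborel"
    using measurable_sets[OF floor_vec_measurable, of "{z}"] by (simp add: vimage_def)
  have S: "?S = {v. \<forall>i. lat z $ i \<le> v $ i \<and> v $ i < ?b $ i}"
    by (auto simp: floor_vec_def vec_eq_iff lat_def floor_eq_iff)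
  have 1: "box (lat z) ?b \<subseteq> ?S" unfolding S by (auto simp: mem_box_cart less_imp_le)
  have 2: "?S \<subseteq> cbox (lat z) ?b" unfolding S by (auto simp: mem_box_cart less_imp_le)
  have le: "lat z \<bullet> b \<le> ?b \<bullet> b" if "b \<in> Basis" for b
    using that by (auto simp: Basis_vec_def inner_axis)
  have pr: "prod ((\<bullet>) (vec_lambda (\<lambda>i. 1 :: real))) (Basis :: (real^'d) set) = 1"
    by (rule prod.neutral) (auto simp: Basis_vec_def inner_axis)
  have "emeasure lborel ?S \<le> emeasure lborel (cbox (lat z) ?b)" by (rule emeasure_mono[OF 2]) simp
  moreover have "emeasure lborel (box (lat z) ?b) \<le> emeasure lborel ?S" by (rule emeasure_mono[OF 1 m])
  ultimately show ?thesis
    using le by (simp add: emeasure_lborel_cbox emeasure_lborel_box pr del: inner_add_left)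
qed

text \<open>Cells have volume one, so lattice sums are exactly, not just approximately, Lebesgue
  integrals of step functions. The discrete generators thereby become integrals over one fixed
  space, where dominated convergence applies.\<close>

lemma distr_floor_vec: "distr lborel (count_space UNIV) (floor_vec :: real^'d \<Rightarrow> int^'d) = count_space UNIV"
proof (rule measure_eqI_countable[of _ UNIV])
  fix a :: "int^'d"
  have "floor_vec -` {a} \<inter> space lborel = {v :: real^'d. floor_vec v = a}" by auto
  then show "emeasure (distr lborel (count_space UNIV) floor_vec) {a} = emeasure (count_space UNIV) {a}"
    by (simp add: emeasure_distr emeasure_floor_cell)
qed auto

lemma floor_vec_integral:
  fixes f :: "int^'d \<Rightarrow> real"
  shows "(LSUM y. f y) = (LBINT v. f (floor_vec v))" (is ?g1)
    and "lsummable f \<longleftrightarrow> integrable lborel (\<lambda>v. f (floor_vec v))" (is ?g2)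
proof -
  have "(\<integral>y. f y \<partial>distr lborel (count_space UNIV) (floor_vec :: real^'d \<Rightarrow> int^'d)) = (LBINT v. f (floor_vec v))"
    by (rule integral_distr) auto
  then show ?g1 by (simp only: distr_floor_vec)
  have "integrable (distr lborel (count_space UNIV) (floor_vec :: real^'d \<Rightarrow> int^'d)) f \<longleftrightarrow> integrable lborel (\<lambda>v. f (floor_vec v))"
    by (rule integrable_distr_eq) auto
  then show ?g2 by (simp only: distr_floor_vec)
qed

lemma lborel_scale:
  fixes f :: "real^'d \<Rightarrow> real"
  assumes f[measurable]: "f \<in> borel_measurable borel" and c: "0 < c"
  shows "(LBINT x. f x) = c ^ CARD('d) * (LBINT x. f (c *\<^sub>R x))" (is ?g1)
    and "integrable lborel f \<longleftrightarrow> integrable lborel (\<lambda>x. f (c *\<^sub>R x))" (is ?g2)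
proof -
  have e: "(lborel :: (real^'d) measure) = density (distr lborel borel (\<lambda>x. 0 + c *\<^sub>R x)) (\<lambda>_. c ^ CARD('d))"
    using lborel_affine[of c "0 :: real^'d"] c by simp
  have c': "0 < c ^ CARD('d)" using c by simp
  have "(LBINT x. f x) = (\<integral>x. c ^ CARD('d) * f x \<partial>distr lborel borel (\<lambda>x :: real^'d. 0 + c *\<^sub>R x))"
    by (subst e, subst integral_density) (use c' in auto)
  also have "\<dots> = (LBINT x. c ^ CARD('d) * f (0 + c *\<^sub>R x))"
    by (rule integral_distr) auto
  finally show ?g1 by simp
  have "integrable lborel f \<longleftrightarrow> integrable (distr lborel borel (\<lambda>x :: real^'d. 0 + c *\<^sub>R x)) (\<lambda>x. c ^ CARD('d) * f x)"
    by (subst e, subst integrable_density) (use c' in auto)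
  also have "\<dots> \<longleftrightarrow> integrable lborel (\<lambda>x. c ^ CARD('d) * f (0 + c *\<^sub>R x))"
    by (rule integrable_distr_eq) auto
  finally show ?g2 using c' c by simp
qed

definition shiftn :: "nat \<Rightarrow> int^'d \<Rightarrow> real^'d" where
  "shiftn n y = (1 / real n) *\<^sub>R lat y"

text \<open>The corner of the cell of mesh 1/n that contains v.\<close>

definition cell :: "nat \<Rightarrow> real^'d \<Rightarrow> real^'d" where
  "cell n v = shiftn n (floor_vec (real n *\<^sub>R v))"

lemma shiftn_odd: "odd_shift (shiftn n)"
  by (simp add: odd_shift_def shiftn_def lat_minus)

lemma shiftn_add: "shiftn n (x + y) = shiftn n x + shiftn n y"
  by (simp add: shiftn_def lat_add scaleR_add_right)

lemma cell_measurable[measurable]: "cell n \<in> borel_measurable borel"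
proof -
  have [measurable]: "shiftn n \<in> measurable (count_space UNIV) borel" by simp
  show ?thesis unfolding cell_def[abs_def] by measurable
qed

lemma riemann_sum:
  fixes f :: "int^'d \<Rightarrow> real"
  assumes n: "0 < n"
  shows "(LSUM y. f y) = real n ^ CARD('d) * (LBINT v. f (floor_vec (real n *\<^sub>R v)))" (is ?g1)
    and "lsummable f \<longleftrightarrow> integrable lborel (\<lambda>v. f (floor_vec (real n *\<^sub>R v)))" (is ?g2)
proof -
  have [measurable]: "f \<in> measurable (count_space UNIV) borel" by simp
  have m: "(\<lambda>v. f (floor_vec v)) \<in> borel_measurable borel" by measurable
  show ?g1
    unfolding floor_vec_integral(1) using lborel_scale(1)[OF m, of "real n"] n by simp
  show ?g2
    unfolding floor_vec_integral(2) using lborel_scale(2)[OF m, of "real n"] n by simp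
qed

lemma cell_dist:
  fixes v :: "real^'d"
  assumes n: "0 < n"
  shows "norm (cell n v - v) \<le> real CARD('d) / real n"
proof -
  have "\<bar>(cell n v - v) $ i\<bar> \<le> 1 / real n" for i
  proof -
    have "cell n v $ i = \<lfloor>real n * v $ i\<rfloor> / real n" by (simp add: cell_def shiftn_def lat_def floor_vec_def)
    then have "(cell n v - v) $ i = (\<lfloor>real n * v $ i\<rfloor> - real n * v $ i) / real n"
      using n by (simp add: field_simps)
    moreover have "\<bar>\<lfloor>real n * v $ i\<rfloor> - real n * v $ i\<bar> \<le> 1" by linarith
    ultimately show ?thesis using n by (simp add: divide_right_mono)
  qed
  then have "(\<Sum>i\<in>UNIV. \<bar>(cell n v - v) $ i\<bar>) \<le> (\<Sum>i\<in>(UNIV :: 'd set). 1 / real n)"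
    by (intro sum_mono) auto
  then show ?thesis using norm_le_l1_cart[of "cell n v - v"] by simp
qed

text \<open>A nonzero corner is at distance at least 1/n from the origin, which is comparable with
  the cell size d/n. A kernel singular at 0 can therefore be compared at v and at its corner,
  uniformly in n.\<close>

lemma cell_norm_ge:
  fixes v :: "real^'d"
  assumes n: "0 < n" and nz: "cell n v \<noteq> 0"
  shows "norm v \<le> (1 + real CARD('d)) * norm (cell n v)"
proof -
  define z where "z = floor_vec (real n *\<^sub>R v)"
  have "lat z \<noteq> 0" using nz by (auto simp: cell_def shiftn_def z_def)
  then have "z \<noteq> 0" by auto
  then obtain i where i: "z $ i \<noteq> 0" by (auto simp: vec_eq_iff)
  then have "1 \<le> \<bar>lat z $ i\<bar>" by (simp add: lat_def)
  also have "\<dots> \<le> norm (lat z)" by (rule component_le_norm_cart)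
  finally have "1 / real n \<le> norm (cell n v)"
    using n by (simp add: cell_def shiftn_def z_def divide_right_mono)
  then have "real CARD('d) / real n \<le> real CARD('d) * norm (cell n v)"
    using mult_left_mono[of "1 / real n" "norm (cell n v)" "real CARD('d)"] by simp
  moreover have "norm v \<le> norm (cell n v) + norm (cell n v - v)"
    by (metis norm_triangle_sub norm_minus_commute)
  ultimately show ?thesis using cell_dist[OF n, of v] by (simp add: algebra_simps)
qed

lemma cell_tendsto: "(\<lambda>n. cell n v) \<longlonglongrightarrow> (v :: real^'d)"
proof (rule Lim_null_comparison[of "\<lambda>n. cell n v - v" "\<lambda>n. real CARD('d) / real n", THEN LIM_zero_cancel])
  show "\<forall>\<^sub>F n in sequentially. norm (cell n v - v) \<le> real CARD('d) / real n"
    using eventually_gt_at_top[of 0] by eventually_elim (rule cell_dist)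
  show "(\<lambda>n. real CARD('d) / real n) \<longlonglongrightarrow> 0" by (rule lim_const_over_n)
qed

section \<open>Integrability of powers of the norm\<close>

text \<open>A shell argument without polar coordinates: wherever f is nonzero it is bounded by one
  of the terms of the sum over k of a(k) times the indicator of the ball of radius \<rho>(k), and
  the integrals of these terms decay geometrically.\<close>

lemma nn_integral_geom_bound:
  fixes f :: "real^'d \<Rightarrow> real"
  assumes f[measurable]: "f \<in> borel_measurable borel" and f0: "\<And>x. 0 \<le> f x"
    and r: "0 \<le> r" "r < 1"
    and b: "\<And>x. f x \<noteq> 0 \<Longrightarrow> \<exists>k. f x \<le> a k \<and> norm x \<le> \<rho> k"
    and a0: "\<And>k. 0 \<le> a k" and \<rho>0: "\<And>k. 0 \<le> \<rho> k"
    and ar: "\<And>k. a k * \<rho> k ^ CARD('d) \<le> M * r ^ k"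
  shows "integrable lborel f"
proof (rule integrableI_bounded)
  let ?V = "unit_ball_vol (real CARD('d))"
  have M0: "0 \<le> M * r ^ k" for k using ar[of k] a0[of k] \<rho>0[of k] by (meson mult_nonneg_nonneg order_trans zero_le_power)
  have V0: "0 \<le> ?V" by simp
  have [measurable]: "cball (0 :: real^'d) r \<in> sets borel" for r by simp
  have "(\<integral>\<^sup>+x. ennreal (norm (f x)) \<partial>lborel) \<le> (\<integral>\<^sup>+x. (\<Sum>k. ennreal (a k) * indicator (cball 0 (\<rho> k)) (x :: real^'d)) \<partial>lborel)"
  proof (rule nn_integral_mono)
    fix x :: "real^'d"
    show "ennreal (norm (f x)) \<le> (\<Sum>k. ennreal (a k) * indicator (cball 0 (\<rho> k)) x)"
    proof (cases "f x = 0")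
      case False
      then obtain k where k: "f x \<le> a k" "norm x \<le> \<rho> k" using b by blast
      have "ennreal (norm (f x)) \<le> ennreal (a k) * indicator (cball 0 (\<rho> k)) x"
        using k f0[of x] by (auto intro: ennreal_leI)
      also have "\<dots> = (\<Sum>j\<in>{k}. ennreal (a j) * indicator (cball 0 (\<rho> j)) x)"
        by (simp only: sum.insert sum.empty finite.emptyI empty_iff not_False_eq_True add_0_right)
      also have "\<dots> \<le> (\<Sum>j. ennreal (a j) * indicator (cball 0 (\<rho> j)) x)"
        by (rule sum_le_suminf) auto
      finally show ?thesis .
    qed simp
  qed
  also have "\<dots> = (\<Sum>k. \<integral>\<^sup>+x. ennreal (a k) * indicator (cball 0 (\<rho> k)) (x :: real^'d) \<partial>lborel)"
    by (rule nn_integral_suminf) measurable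
  also have "\<dots> = (\<Sum>k. ennreal (?V * (a k * \<rho> k ^ CARD('d))))"
    using \<rho>0 a0 by (simp add: nn_integral_cmult emeasure_cball mult_ac flip: ennreal_mult)
  also have "\<dots> \<le> (\<Sum>k. ennreal (?V * (M * r ^ k)))"
    by (intro suminf_le ennreal_leI mult_left_mono ar V0) auto
  also have "\<dots> = ennreal (\<Sum>k. ?V * (M * r ^ k))"
    by (rule suminf_ennreal2) (use M0 V0 r in \<open>auto intro!: mult_nonneg_nonneg summable_mult summable_geometric\<close>)
  also have "\<dots> < \<infinity>" by simp
  finally show "(\<integral>\<^sup>+x. ennreal (norm (f x)) \<partial>lborel) < \<infinity>" .
qed simp

lemma integrable_norm_powr_large:
  assumes s: "real CARD('d) < s"
  shows "integrable lborel (\<lambda>x :: real^'d. if 1 \<le> norm x then norm x powr (- s) else 0)"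
\<comment> \<open>Shells 2^k \<le> |x| < 2^(k+1).\<close>
proof (rule nn_integral_geom_bound[where r="2 powr (real CARD('d) - s)" and a="\<lambda>k. 2 powr (- (s * real k))" and \<rho>="\<lambda>k. 2 ^ (Suc k)" and M="2 ^ CARD('d)"])
  fix x :: "real^'d" assume "(if 1 \<le> norm x then norm x powr (- s) else 0) \<noteq> 0"
  then have x: "1 \<le> norm x" by (auto split: if_splits)
  define k where "k = nat \<lfloor>log 2 (norm x)\<rfloor>"
  have nx0: "x \<noteq> 0" using x by auto
  have l0: "0 \<le> log 2 (norm x)" using x nx0 by simp
  have k1: "real k \<le> log 2 (norm x)" and k2: "log 2 (norm x) < real k + 1"
    unfolding k_def using l0 by linarith+
  have "2 powr real k \<le> norm x" using k1 nx0 by (simp add: le_log_iff)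
  then have "norm x powr (- s) \<le> (2 powr real k) powr (- s)"
    using s x by (intro powr_mono2') auto
  moreover have "norm x \<le> 2 ^ Suc k"
  proof -
    have "norm x < 2 powr (real k + 1)" using k2 nx0 by (simp add: log_less_iff)
    also have "\<dots> = 2 ^ Suc k" by (simp add: powr_add powr_realpow)
    finally show ?thesis by simp
  qed
  ultimately show "\<exists>k. (if 1 \<le> norm x then norm x powr (- s) else 0) \<le> 2 powr (- (s * real k)) \<and> norm x \<le> 2 ^ Suc k"
    using x by (auto simp: powr_powr mult.commute)
next
  fix k
  have "(2 ^ Suc k) ^ CARD('d) = 2 ^ CARD('d) * (2 powr (real CARD('d) * real k) :: real)"
    by (simp add: power_mult_distrib powr_powr[symmetric] powr_realpow flip: power_mult)
  moreover have "(2 powr (real CARD('d) - s)) ^ k = 2 powr (- (s * real k)) * 2 powr (real CARD('d) * real k)"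
    by (simp add: powr_realpow[symmetric] powr_powr algebra_simps flip: powr_add)
  ultimately show "2 powr (- (s * real k)) * (2 ^ Suc k) ^ CARD('d) \<le> 2 ^ CARD('d) * (2 powr (real CARD('d) - s)) ^ k"
    by (simp add: mult_ac)
next
  show "2 powr (real CARD('d) - s) < 1" using s by (simp add: powr_less_one)
qed (auto)

lemma integrable_norm_powr_small:
  assumes s: "s < real CARD('d)" "0 \<le> s"
  shows "integrable lborel (\<lambda>x :: real^'d. if norm x < 1 then norm x powr (- s) else 0)"
\<comment> \<open>Shells 2^(-k-1) < |x| \<le> 2^(-k).\<close>
proof (rule nn_integral_geom_bound[where r="2 powr (s - real CARD('d))" and a="\<lambda>k. 2 powr (s * (real k + 1))" and \<rho>="\<lambda>k. (1 / 2) ^ k" and M="2 powr s"])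
  fix x :: "real^'d" assume "(if norm x < 1 then norm x powr (- s) else 0) \<noteq> 0"
  then have x: "norm x < 1" "0 < norm x" by (auto split: if_splits)
  define l where "l = - log 2 (norm x)"
  have l0: "0 \<le> l" using x by (simp add: l_def)
  define k where "k = nat \<lfloor>l\<rfloor>"
  have k1: "real k \<le> l" and k2: "l < real k + 1"
    unfolding k_def using l0 by linarith+
  have nx: "norm x = 2 powr (- l)" using x by (simp add: l_def)
  have "norm x powr (- s) = 2 powr (s * l)" unfolding nx by (simp add: powr_powr mult.commute)
  also have "\<dots> \<le> 2 powr (s * (real k + 1))" using s k2 by (intro powr_mono mult_left_mono) auto
  finally have "norm x powr (- s) \<le> 2 powr (s * (real k + 1))" .
  moreover have "norm x \<le> (1 / 2) ^ k"
  proof -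
    have "norm x \<le> 2 powr (- real k)" unfolding nx using k1 by (intro powr_mono) auto
    also have "\<dots> = (1 / 2) ^ k" by (simp add: powr_minus powr_realpow power_divide inverse_eq_divide)
    finally show ?thesis .
  qed
  ultimately show "\<exists>k. (if norm x < 1 then norm x powr (- s) else 0) \<le> 2 powr (s * (real k + 1)) \<and> norm x \<le> (1 / 2) ^ k"
    using x by auto
next
  fix k
  have "((1 / 2 :: real) ^ k) ^ CARD('d) = 2 powr (- (real CARD('d) * real k))"
    by (simp add: powr_minus power_divide inverse_eq_divide flip: power_mult) (metis mult.commute of_nat_mult powr_realpow zero_less_numeral)
  moreover have "(2 powr (s - real CARD('d))) ^ k = 2 powr (s * real k) * 2 powr (- (real CARD('d) * real k))"
    by (simp add: powr_realpow[symmetric] powr_powr algebra_simps flip: powr_add)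
  ultimately show "2 powr (s * (real k + 1)) * ((1 / 2) ^ k) ^ CARD('d) \<le> 2 powr s * (2 powr (s - real CARD('d))) ^ k"
    by (simp add: mult_ac distrib_left powr_add)
next
  show "2 powr (s - real CARD('d)) < 1" using s by (simp add: powr_less_one)
qed auto

section \<open>The generators of the rescaled walks\<close>

text \<open>The symmetric second difference. For an even kernel the generator is half the kernel
  integrated against it, and its size |y|^2 near 0 is what makes the integral converge for all
  \<alpha> < 2.\<close>

definition Dlt :: "('a::ab_group_add \<Rightarrow> real) \<Rightarrow> 'a \<Rightarrow> 'a \<Rightarrow> real" where
  "Dlt F x y = F (x + y) + F (x - y) - 2 * F x"

text \<open>A quantitative test class with one constant for sup norm, Lipschitz norm and second
  differences. Differences rather than derivatives appear because this is the form in which the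
  generators use smoothness.\<close>

definition nice :: "real \<Rightarrow> real \<Rightarrow> (real^'d \<Rightarrow> real) \<Rightarrow> bool" where
  "nice R C F \<longleftrightarrow> 0 \<le> R \<and> bnd C F \<and> (\<forall>x. R < norm x \<longrightarrow> F x = 0) \<and>
     (\<forall>x y. \<bar>F x - F y\<bar> \<le> C * norm (x - y)) \<and> (\<forall>x y. \<bar>Dlt F x y\<bar> \<le> C * (norm y)\<^sup>2)"

lemma nice_continuous: "nice R C F \<Longrightarrow> continuous_on UNIV F"
proof -
  assume F: "nice R C F"
  then have "C-lipschitz_on UNIV F"
    by (intro lipschitz_onI) (auto simp: nice_def dist_real_def dist_norm bnd_def intro: order_trans[OF abs_ge_zero])
  then show ?thesis by (rule lipschitz_on_continuous_on)
qed

lemma nice_meas: "nice R C F \<Longrightarrow> F \<in> borel_measurable borel"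
  by (intro borel_measurable_continuous_onI nice_continuous)

text \<open>For R > 0 this is |x|^2 / (R^2 + |x|^2), a smooth stand-in for the indicator of |x| > R.
  Its second differences are explicitly controlled at scale R, so the walks increase it slowly and
  it can measure escaping mass.\<close>

definition psi :: "real \<Rightarrow> real^'d \<Rightarrow> real" where
  "psi R x = 1 - 1 / (1 + (norm x / R)\<^sup>2)"

lemma psi_range: "0 \<le> psi R x" "psi R x \<le> 1"
proof -
  have "1 / (1 + (norm x / R)\<^sup>2) \<le> 1 / 1" by (intro divide_left_mono) (auto simp: add_pos_nonneg)
  then show "0 \<le> psi R x" by (simp add: psi_def)
  have "0 \<le> 1 / (1 + (norm x / R)\<^sup>2)" by (intro divide_nonneg_nonneg) auto
  then show "psi R x \<le> 1" unfolding psi_def by linarith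
qed

lemma psi_bnd: "bnd 1 (psi R)"
  unfolding bnd_def
proof
  fix x show "\<bar>psi R x\<bar> \<le> 1" using psi_range[of R x] by linarith
qed

lemma psi_le:
  assumes "norm x \<le> r" "0 < R"
  shows "psi R x \<le> (r / R)\<^sup>2"
proof -
  let ?q = "(norm x / R)\<^sup>2"
  have "1 + ?q \<noteq> 0" by (smt (verit) zero_le_power2)
  then have "psi R x = ?q / (1 + ?q)" unfolding psi_def by (simp add: diff_divide_eq_iff)
  also have "\<dots> \<le> ?q / 1" by (intro divide_left_mono) (auto simp: add_pos_nonneg)
  also have "\<dots> \<le> (r / R)\<^sup>2" using assms by (auto intro!: power_mono divide_right_mono)
  finally show ?thesis .
qed

lemma psi_ge:
  assumes "R \<le> norm x" "0 < R"
  shows "1 / 2 \<le> psi R x"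
proof -
  have "1 \<le> (norm x / R)\<^sup>2" using assms by (simp add: one_le_power)
  then have "1 / (1 + (norm x / R)\<^sup>2) \<le> 1 / 2" by (intro divide_left_mono) auto
  then show ?thesis by (simp add: psi_def)
qed

lemma psi_meas[measurable]: "psi R \<in> borel_measurable borel"
  unfolding psi_def[abs_def] by measurable

text \<open>With 1 + |x + y|^2 = a + b + c and 1 + |x - y|^2 = a + b - c, the second difference is a
  rational function with numerator 2 (c^2 - b (a + b)). Cauchy-Schwarz gives c^2 \<le> 4 a b, and a
  lower bound on the denominator cancels the remaining factor.\<close>

lemma Dlt_inverse_quadratic:
  fixes x y :: "'a::real_inner"
  shows "\<bar>Dlt (\<lambda>x. 1 / (1 + (norm x)\<^sup>2)) x y\<bar> \<le> 10 * (norm y)\<^sup>2"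
proof -
  define a b c where "a = 1 + (norm x)\<^sup>2" and "b = (norm y)\<^sup>2" and "c = 2 * (x \<bullet> y)"
  have p: "1 + (norm (x + y))\<^sup>2 = a + b + c" "1 + (norm (x - y))\<^sup>2 = a + b - c"
    by (simp_all add: a_def b_def c_def power2_norm_eq_inner algebra_simps inner_commute)
  have a1: "1 \<le> a" and b0: "0 \<le> b" by (simp_all add: a_def b_def)
  have p1: "1 \<le> a + b + c" "1 \<le> a + b - c" using p by (metis le_add_same_cancel1 zero_le_power2)+
  have "(x \<bullet> y)\<^sup>2 \<le> (norm x)\<^sup>2 * (norm y)\<^sup>2" using Cauchy_Schwarz_ineq[of x y] by (simp add: power2_norm_eq_inner)
  also have "\<dots> \<le> a * b" unfolding a_def b_def by (intro mult_right_mono) auto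
  finally have c4: "c\<^sup>2 \<le> 4 * (a * b)" by (simp add: c_def power_mult_distrib)
  \<comment> \<open>Two factors that are at least 1 and have sum 2 (a + b) have product at least 2
    (a + b) - 1, which is at least a + b since a + b \<ge> 1.\<close>
  have prod_ge: "a + b \<le> (a + b + c) * (a + b - c)"
  proof -
    have "0 \<le> (a + b + c - 1) * (a + b - c - 1)" using p1 by (intro mult_nonneg_nonneg) auto
    then have "(a + b + c) * (a + b - c) \<ge> 2 * (a + b) - 1" by (simp add: algebra_simps)
    moreover have "a + b \<le> 2 * (a + b) - 1" using add_mono[OF a1 b0] by simp
    ultimately show ?thesis by (rule order_trans[rotated])
  qed
  have pp: "0 < a * ((a + b + c) * (a + b - c))" using a1 p1 by (intro mult_pos_pos) auto
  have "Dlt (\<lambda>x. 1 / (1 + (norm x)\<^sup>2)) x y = 1 / (a + b + c) + 1 / (a + b - c) - 2 / a"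
    by (simp add: Dlt_def p) (simp add: a_def)
  also have "\<dots> = 2 * (c\<^sup>2 - b * (a + b)) / (a * ((a + b + c) * (a + b - c)))"
    using a1 p1 by (simp add: divide_simps power2_eq_square) (simp add: algebra_simps)
  also have "\<bar>\<dots>\<bar> = 2 * \<bar>c\<^sup>2 - b * (a + b)\<bar> / (a * ((a + b + c) * (a + b - c)))"
    by (subst abs_divide, subst abs_of_pos[OF pp], subst abs_mult) simp
  also have "\<dots> \<le> (10 * b * (a * (a + b))) / (a * ((a + b + c) * (a + b - c)))"
  proof (rule divide_right_mono)
    have "\<bar>c\<^sup>2 - b * (a + b)\<bar> \<le> c\<^sup>2 + b * (a + b)"
      using a1 b0 by (smt (verit) mult_nonneg_nonneg zero_le_power2)
    also have "\<dots> \<le> 4 * (a * b) + b * (a + b)" using c4 by simp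
    also have "\<dots> \<le> 5 * (b * (a + b))" using b0 a1 by (simp add: algebra_simps)
    also have "\<dots> = 5 * b * (1 * (a + b))" by simp
    also have "\<dots> \<le> 5 * b * (a * (a + b))" using b0 a1 by (intro mult_left_mono mult_right_mono) auto
    also have "\<dots> = 10 * b * (a * (a + b)) / 2" by simp
    finally have le: "\<bar>c\<^sup>2 - b * (a + b)\<bar> \<le> 10 * b * (a * (a + b)) / 2" .
    have half: "u \<le> v / 2 \<Longrightarrow> 2 * u \<le> v" for u v :: real by simp
    show "2 * \<bar>c\<^sup>2 - b * (a + b)\<bar> \<le> 10 * b * (a * (a + b))" by (rule half[OF le])
  qed (use pp in simp)
  also have "\<dots> \<le> (10 * b * (a * ((a + b + c) * (a + b - c)))) / (a * ((a + b + c) * (a + b - c)))"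
    using prod_ge pp a1 b0 by (intro divide_right_mono mult_left_mono) auto
  also have "\<dots> = 10 * b" by (rule nonzero_mult_div_cancel_right[OF less_imp_neq[OF pp, symmetric]])
  finally show ?thesis by (simp add: b_def)
qed

lemma psi_Dlt:
  assumes R: "0 < R"
  shows "\<bar>Dlt (psi R) x y\<bar> \<le> 10 * (norm y / R)\<^sup>2" (is ?g1) "\<bar>Dlt (psi R) x y\<bar> \<le> 10" (is ?g2)
proof -
  have e: "1 - A + (1 - B) - 2 * (1 - C) = - (A + B - 2 * C)" for A B C :: real by simp
  have n: "norm z / R = norm ((1 / R) *\<^sub>R z)" for z :: "real^'d" using R by simp
  have "Dlt (psi R) x y = - Dlt (\<lambda>x. 1 / (1 + (norm x)\<^sup>2)) ((1 / R) *\<^sub>R x) ((1 / R) *\<^sub>R y)"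
    by (simp only: Dlt_def psi_def n scaleR_add_right scaleR_diff_right e)
  then show ?g1
    using Dlt_inverse_quadratic[of "(1 / R) *\<^sub>R x" "(1 / R) *\<^sub>R y"] R by simp
  show ?g2
    unfolding Dlt_def using psi_range[of R "x + y"] psi_range[of R "x - y"] psi_range[of R x] by linarith
qed

section \<open>Majorants for the jump kernel that are uniform in the mesh size\<close>

locale stable =
  fixes h :: "real^'d \<Rightarrow> real" and \<alpha> :: real
  assumes alpha: "0 < \<alpha>" "\<alpha> < 2"
    and h_cont: "continuous_on (- {0}) h"
    and h_pos: "\<forall>x. x \<noteq> 0 \<longrightarrow> h x > 0"
    and h_even: "\<forall>x. h (- x) = h x"
    and h_hom: "\<forall>c x. c > 0 \<and> x \<noteq> 0 \<longrightarrow> h (c *\<^sub>R x) = c powr (- (real CARD('d) + \<alpha>)) * h x"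
begin

text \<open>The value of \<open>h\<close> at the origin is arbitrary; 0 matches the jump rates and
  gives a nonnegative Borel function on all of R^d.\<close>

definition h0 :: "real^'d \<Rightarrow> real" where "h0 y = (if y = 0 then 0 else h y)"

lemma h0_nonneg: "0 \<le> h0 y" using h_pos by (auto simp: h0_def intro: less_imp_le)

lemma h0_meas[measurable]: "h0 \<in> borel_measurable borel"
proof -
  have "(\<lambda>x. indicator (- {0}) x *\<^sub>R h x) \<in> borel_measurable borel"
    by (rule borel_measurable_continuous_on_indicator) (use h_cont in auto)
  moreover have "(\<lambda>x. indicator (- {0}) x *\<^sub>R h x) = h0" by (auto simp: h0_def fun_eq_iff split: split_indicator)
  ultimately show ?thesis by simp
qed

text \<open>Homogeneity reduces the bound to the unit sphere, where it follows from continuity and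
  compactness.\<close>

lemma h0_bound_ex: "\<exists>C>0. \<forall>y. h0 y \<le> C * norm y powr (- (real CARD('d) + \<alpha>))"
proof -
  have "continuous_on (sphere 0 1) h" by (rule continuous_on_subset[OF h_cont]) auto
  then have "compact (h ` sphere 0 1)" by (intro compact_continuous_image) auto
  then have "bounded (h ` sphere 0 1)" by (rule compact_imp_bounded)
  then obtain C where C: "\<And>x. norm x = 1 \<Longrightarrow> \<bar>h x\<bar> \<le> C" by (force simp: bounded_iff)
  have "h0 y \<le> max C 1 * norm y powr (- (real CARD('d) + \<alpha>))" for y
  proof (cases "y = 0")
    case False
    then have "h (norm y *\<^sub>R ((1 / norm y) *\<^sub>R y)) = norm y powr (- (real CARD('d) + \<alpha>)) * h ((1 / norm y) *\<^sub>R y)"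
      using h_hom by (metis divide_eq_0_iff norm_eq_zero one_neq_zero scaleR_eq_0_iff zero_less_norm_iff)
    moreover have "h ((1 / norm y) *\<^sub>R y) \<le> max C 1" using C[of "(1 / norm y) *\<^sub>R y"] False by simp
    ultimately show ?thesis using False by (simp add: h0_def mult.commute mult_left_mono)
  qed (simp add: h0_def)
  then show ?thesis by (intro exI[of _ "max C 1"]) auto
qed

definition Ch :: real where "Ch = (SOME C. C > 0 \<and> (\<forall>y. h0 y \<le> C * norm y powr (- (real CARD('d) + \<alpha>))))"

lemma Ch: "0 < Ch" "h0 y \<le> Ch * norm y powr (- (real CARD('d) + \<alpha>))"
  using someI_ex[of "\<lambda>C. C > 0 \<and> (\<forall>y. h0 y \<le> C * norm y powr (- (real CARD('d) + \<alpha>)))"] h0_bound_ex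
  by (auto simp: Ch_def)

text \<open>A margin on both sides of \<alpha>: \<alpha> + kap < 2 serves integrability at 0,
  \<alpha> - kap > 0 serves integrability at infinity, and the 1 in the minimum keeps kap below the
  dimension.\<close>

definition kap :: real where "kap = min \<alpha> (min (2 - \<alpha>) 1) / 2"

lemma kap: "0 < kap" "kap < \<alpha>" "\<alpha> + kap < 2" "kap < (real CARD('d))"
proof -
  show "0 < kap" "kap < \<alpha>" "\<alpha> + kap < 2" using alpha by (auto simp: kap_def min_def field_simps)
  have "kap < 1" by (auto simp: kap_def min_def)
  moreover have "1 \<le> (real CARD('d))" by (simp add: Suc_leI)
  ultimately show "kap < (real CARD('d))" by linarith
qed

text \<open>A weight lying above |y|^2 in the unit ball and above 1 outside, hence above the second
  differences of every nice function up to a constant. It is still small enough that its product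
  with the kernel is bounded by a multiple of the integrable function \<open>J\<close>.\<close>

definition W :: "real^'d \<Rightarrow> real" where
  "W y = min (norm y powr (\<alpha> + kap)) (norm y powr (\<alpha> - kap))"

definition J :: "real^'d \<Rightarrow> real" where
  "J y = min (norm y powr (- ((real CARD('d)) - kap))) (norm y powr (- (real CARD('d) + kap)))"

lemma J_meas[measurable]: "J \<in> borel_measurable borel" unfolding J_def[abs_def] by measurable

lemma J_nonneg: "0 \<le> J y" by (simp add: J_def)

lemma W_nonneg: "0 \<le> W y" by (simp add: W_def)

lemma W_small: "norm y \<le> 1 \<Longrightarrow> (norm y)\<^sup>2 \<le> W y"
proof (cases "y = 0")
  case False
  assume "norm y \<le> 1"
  have "norm y powr 2 \<le> norm y powr (\<alpha> + kap)" "norm y powr 2 \<le> norm y powr (\<alpha> - kap)"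
    using False kap \<open>norm y \<le> 1\<close> by (intro powr_mono'; simp)+
  then show ?thesis using False by (simp add: W_def powr_numeral)
qed (simp add: W_def)

lemma W_large: "1 \<le> norm y \<Longrightarrow> 1 \<le> W y"
proof -
  assume y: "1 \<le> norm y"
  have "norm y powr 0 \<le> norm y powr (\<alpha> + kap)" "norm y powr 0 \<le> norm y powr (\<alpha> - kap)"
    using y kap alpha by (intro powr_mono; simp)+
  moreover have "norm y powr 0 = 1" using y by auto
  ultimately show ?thesis by (simp add: W_def)
qed

lemma J_int: "integrable lborel J"
proof -
  have i: "integrable lborel (\<lambda>x :: real^'d. (if norm x < 1 then norm x powr (- ((real CARD('d)) - kap)) else 0) + (if 1 \<le> norm x then norm x powr (- (real CARD('d) + kap)) else 0))"
    using kap by (intro Bochner_Integration.integrable_add integrable_norm_powr_large integrable_norm_powr_small) auto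
  show ?thesis
    by (rule integrable_boundL[OF i]) (auto simp: J_def intro!: AE_I2)
qed

lemma hW: "h0 y * W y \<le> Ch * J y"
proof (cases "y = 0")
  case False
  have "h0 y * W y \<le> Ch * norm y powr (- (real CARD('d) + \<alpha>)) * W y" by (intro mult_right_mono Ch W_nonneg)
  also have "norm y powr (- (real CARD('d) + \<alpha>)) * W y \<le> J y"
  proof -
    have "norm y powr (- (real CARD('d) + \<alpha>)) * W y \<le> norm y powr (- (real CARD('d) + \<alpha>)) * norm y powr (\<alpha> + kap)"
      "norm y powr (- (real CARD('d) + \<alpha>)) * W y \<le> norm y powr (- (real CARD('d) + \<alpha>)) * norm y powr (\<alpha> - kap)"
      by (auto intro!: mult_left_mono simp: W_def)
    then show ?thesis using False by (simp add: J_def flip: powr_add)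
  qed
  then have "Ch * norm y powr (- (real CARD('d) + \<alpha>)) * W y \<le> Ch * J y" using Ch(1) by (simp add: mult.assoc)
  finally show ?thesis .
qed (use Ch(1) in \<open>simp add: h0_def J_nonneg\<close>)

lemma powr_neg_scale:
  fixes a b c s :: real
  assumes "0 < b" "b \<le> c * a" "0 < c" "0 \<le> s"
  shows "a powr (- s) \<le> c powr s * b powr (- s)"
proof -
  have "b / c \<le> a" "0 < b / c" using assms by (auto simp: field_simps)
  then have "a powr (- s) \<le> (b / c) powr (- s)" using assms by (intro powr_mono2') auto
  also have "\<dots> = c powr s * b powr (- s)" using assms by (simp add: powr_divide powr_minus divide_simps)
  finally show ?thesis .
qed

text \<open>One integrable majorant for kernel times \<open>W\<close>, valid at v and at the corners
  of its cells for all n at once; the constant in front is the price of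
  \<open>cell_norm_ge\<close>.\<close>

definition HD :: "real^'d \<Rightarrow> real" where "HD v = Ch * (1 + real CARD('d)) powr (real CARD('d) + kap) * J v"

lemma HD_meas[measurable]: "HD \<in> borel_measurable borel" unfolding HD_def[abs_def] by measurable
lemma HD_int: "integrable lborel HD" unfolding HD_def[abs_def] using J_int by simp
lemma HD_nonneg: "0 \<le> HD v" using Ch(1) by (simp add: HD_def J_nonneg)

lemma J_cell:
  assumes n: "0 < n" and nz: "cell n v \<noteq> 0"
  shows "J (cell n v) \<le> (1 + real CARD('d)) powr (real CARD('d) + kap) * J v"
proof -
  have v: "v \<noteq> 0"
  proof
    assume "v = 0"
    then have "cell n v = 0" by (simp add: cell_def shiftn_def floor_vec_def lat_def vec_eq_iff)
    with nz show False by simp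
  qed
  note S = powr_neg_scale[of "norm v" "1 + (real CARD('d))" "norm (cell n v)"]
  have le: "norm v \<le> (1 + real CARD('d)) * norm (cell n v)" by (rule cell_norm_ge[OF n nz])
  have "norm (cell n v) powr (- ((real CARD('d)) - kap)) \<le> (1 + real CARD('d)) powr ((real CARD('d)) - kap) * norm v powr (- ((real CARD('d)) - kap))"
    by (rule S) (use v le kap in auto)
  also have "\<dots> \<le> (1 + real CARD('d)) powr (real CARD('d) + kap) * norm v powr (- ((real CARD('d)) - kap))"
    using kap by (intro mult_right_mono powr_mono) auto
  finally have 1: "norm (cell n v) powr (- ((real CARD('d)) - kap)) \<le> (1 + real CARD('d)) powr (real CARD('d) + kap) * norm v powr (- ((real CARD('d)) - kap))" .
  have 2: "norm (cell n v) powr (- (real CARD('d) + kap)) \<le> (1 + real CARD('d)) powr (real CARD('d) + kap) * norm v powr (- (real CARD('d) + kap))"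
    by (rule S) (use v le kap in auto)
  show ?thesis using 1 2 unfolding J_def by (auto simp: min_def)
qed

lemma hW_cell:
  assumes n: "0 < n"
  shows "h0 (cell n v) * W (cell n v) \<le> HD v"
proof (cases "cell n v = 0")
  case False
  have "h0 (cell n v) * W (cell n v) \<le> Ch * J (cell n v)" by (rule hW)
  also have "\<dots> \<le> Ch * ((1 + real CARD('d)) powr (real CARD('d) + kap) * J v)"
    using Ch(1) J_cell[OF n False] by (intro mult_left_mono) auto
  finally show ?thesis by (simp add: HD_def mult.assoc)
qed (simp add: h0_def HD_nonneg)

lemma hW_HD: "h0 v * W v \<le> HD v"
proof -
  have "1 \<le> (1 + real CARD('d)) powr (real CARD('d) + kap)" using kap by (intro ge_one_powr_ge_zero) auto
  then have "Ch * J v \<le> HD v"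
    using Ch(1) J_nonneg[of v] mult_right_mono[of 1 "(1 + real CARD('d)) powr (real CARD('d) + kap)" "Ch * J v"] by (simp add: HD_def mult_ac)
  then show ?thesis using hW[of v] by linarith
qed

definition C0 :: real where "C0 = (LBINT v. HD v) / 2"

lemma C0_nonneg: "0 \<le> C0" unfolding C0_def using HD_nonneg by (auto intro!: integral_nonnegL)

lemma jump_rate_h0: "jump_rate h y = h0 (lat y)"
  by (simp add: jump_rate_def h0_def lat_eq_0)

text \<open>Nonzero lattice points have norm at least 1, where \<open>W\<close> is at least 1, so
  the same majorant also proves the rates summable.\<close>

lemma walk_jump: "walk (jump_rate h)"
proof
  fix y
  show "0 \<le> jump_rate h y" by (simp add: jump_rate_h0 h0_nonneg)
  show "jump_rate h (- y) = jump_rate h y" using h_even by (simp add: jump_rate_def lat_minus)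
next
  have "integrable lborel (\<lambda>v. h0 (cell 1 v))"
  proof (rule integrable_boundL[OF HD_int])
    show "AE v in lborel. norm (h0 (cell 1 v)) \<le> norm (HD v)"
    proof (rule AE_I2)
      fix v :: "real^'d"
      show "norm (h0 (cell 1 v)) \<le> norm (HD v)"
      proof (cases "cell 1 v = 0")
        case False
        then obtain i where i: "cell 1 v $ i \<noteq> 0" by (auto simp: vec_eq_iff)
        then have "1 \<le> \<bar>cell 1 v $ i\<bar>" by (auto simp: cell_def shiftn_def lat_def)
        also have "\<dots> \<le> norm (cell 1 v)" by (rule component_le_norm_cart)
        finally have "1 \<le> W (cell 1 v)" by (rule W_large)
        then have "h0 (cell 1 v) * 1 \<le> h0 (cell 1 v) * W (cell 1 v)" by (intro mult_left_mono h0_nonneg)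
        then show ?thesis using hW_cell[of 1 v] h0_nonneg[of "cell 1 v"] HD_nonneg[of v] by simp
      qed (simp add: h0_def)
    qed
  qed measurable
  then show "lsummable (jump_rate h)"
    by (subst riemann_sum(2)[of 1]) (simp_all add: cell_def shiftn_def jump_rate_h0)
qed

definition pn :: "nat \<Rightarrow> int^'d \<Rightarrow> real" where
  "pn n y = real n powr \<alpha> * jump_rate h y"

text \<open>Homogeneity of degree -(d + \<alpha>): the acceleration n^\<alpha> is exactly what turns
  the rates into Riemann weights n^(-d) h(y/n).\<close>

lemma pn_eq:
  assumes n: "0 < n"
  shows "pn n y = h0 (shiftn n y) / real n ^ CARD('d)"
proof (cases "y = 0")
  case False
  then have l: "lat y \<noteq> 0" by (simp add: lat_eq_0)
  then have "h ((1 / real n) *\<^sub>R lat y) = (1 / real n) powr (- (real CARD('d) + \<alpha>)) * h (lat y)"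
    using h_hom n by simp
  also have "(1 / real n) powr (- (real CARD('d) + \<alpha>)) = real n powr \<alpha> * real n ^ CARD('d)"
  proof -
    have "(1 / real n) powr (- (real CARD('d) + \<alpha>)) = real n powr (real CARD('d) + \<alpha>)"
      using n by (simp add: powr_divide powr_minus_divide del: minus_add_distrib)
    also have "\<dots> = real n powr \<alpha> * real n ^ CARD('d)" using n by (simp add: powr_add powr_realpow)
    finally show ?thesis .
  qed
  finally have "h0 (shiftn n y) = real n powr \<alpha> * real n ^ CARD('d) * h (lat y)"
    using l n by (simp add: h0_def shiftn_def)
  then show ?thesis using n False by (simp add: pn_def jump_rate_def)
qed (simp add: pn_def jump_rate_def h0_def shiftn_def)

lemma pn_walk: "walk (pn n)"
proof -
  interpret w: walk "jump_rate h" by (rule walk_jump)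
  show ?thesis
    unfolding pn_def[abs_def] by standard (use w.p_nonneg w.p_even w.p_int in auto)
qed

section \<open>The rescaled generators acting on functions of R^d\<close>

abbreviation gn :: "nat \<Rightarrow> (real^'d \<Rightarrow> real) \<Rightarrow> real^'d \<Rightarrow> real" where
  "gn n \<equiv> gen (pn n) (shiftn n)"
abbreviation sn :: "nat \<Rightarrow> real \<Rightarrow> (real^'d \<Rightarrow> real) \<Rightarrow> real^'d \<Rightarrow> real" where
  "sn n \<equiv> semi (pn n) (shiftn n)"

text \<open>Averaging the jumps y and -y replaces first differences by second differences; only the
  latter are dominated uniformly in n when \<alpha> \<ge> 1.\<close>

lemma gn_repr:
  assumes n: "0 < n" and F: "bnd C F"
  shows "gn n F x = (LBINT v. h0 (cell n v) * Dlt F x (cell n v)) / 2" (is ?g1)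
    and "integrable lborel (\<lambda>v. h0 (cell n v) * Dlt F x (cell n v))" (is ?g2)
proof -
  interpret w: walk "pn n" by (rule pn_walk)
  let ?s = "shiftn n :: int^'d \<Rightarrow> real^'d"
  have i1: "lsummable (\<lambda>y. pn n y * F (x + ?s y))" by (rule conv_integrable[OF w.p_int F])
  have i2: "lsummable (\<lambda>y. pn n y * F (x + - ?s y))"
    by (rule conv_integrable[OF w.p_int F])
  have i3: "lsummable (\<lambda>y. pn n y * F x)" using w.p_int by simp
  have sm: "?s (- y) = - ?s y" for y by (simp add: shiftn_def lat_minus)
  have "conv (pn n) ?s F x = (LSUM y. pn n (- y) * F (x + ?s (- y)))"
    unfolding conv_def by (rule integral_bij_count_space[symmetric]) (auto intro!: bij_uminus)
  also have "\<dots> = (LSUM y. pn n y * F (x + - ?s y))" by (simp add: w.p_even sm)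
  finally have c2: "conv (pn n) ?s F x = (LSUM y. pn n y * F (x + - ?s y))" .
  have sp: "pn n y * Dlt F x (?s y) = (pn n y * F (x + ?s y) + pn n y * F (x + - ?s y)) - 2 * (pn n y * F x)" for y
    by (simp add: Dlt_def algebra_simps)
  have iD: "lsummable (\<lambda>y. pn n y * Dlt F x (?s y))"
    unfolding sp by (intro integrable_diffL Bochner_Integration.integrable_add i1 i2 integrable_cmult i3)
  have "(LSUM y. pn n y * Dlt F x (?s y)) =
      (LSUM y. pn n y * F (x + ?s y)) + (LSUM y. pn n y * F (x + - ?s y)) - 2 * (LSUM y. pn n y * F x)"
    unfolding sp by (simp only: integral_diffL Bochner_Integration.integral_add
        Bochner_Integration.integrable_add integrable_cmult i1 i2 i3 integral_mult_right_zero)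
  also have "\<dots> = 2 * gn n F x"
    using c2 by (simp add: gen_def conv_def rate_def)
  finally have e: "2 * gn n F x = (LSUM y. pn n y * Dlt F x (?s y))" by simp
  have pc: "pn n (floor_vec (real n *\<^sub>R v)) * Dlt F x (?s (floor_vec (real n *\<^sub>R v))) = h0 (cell n v) * Dlt F x (cell n v) / real n ^ CARD('d)" for v
    by (simp add: pn_eq[OF n] cell_def)
  show ?g1
    using e n unfolding riemann_sum(1)[OF n] pc by simp
  show ?g2
    using integrable_cmult[of lborel _ "real n ^ CARD('d)", OF iD[unfolded riemann_sum(2)[OF n] pc]] n by simp
qed

lemma gn_W_bound:
  assumes n: "0 < n" and F: "bnd C F" and B: "0 \<le> B" "\<And>y. \<bar>Dlt F x y\<bar> \<le> B * W y"
  shows "\<bar>gn n F x\<bar> \<le> B * C0"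
proof -
  have "\<bar>LBINT v. h0 (cell n v) * Dlt F x (cell n v)\<bar> \<le> (LBINT v. \<bar>h0 (cell n v) * Dlt F x (cell n v)\<bar>)"
    by (rule integral_abs_bound)
  also have "\<dots> \<le> (LBINT v. B * HD v)"
  proof (intro integral_mono integrable_abs gn_repr(2)[OF n F] integrable_cmult HD_int)
    fix v
    have "\<bar>h0 (cell n v) * Dlt F x (cell n v)\<bar> \<le> h0 (cell n v) * (B * W (cell n v))"
      using h0_nonneg B(2) by (simp add: abs_mult mult_left_mono)
    also have "\<dots> \<le> B * HD v" using mult_left_mono[OF hW_cell[OF n, of v] B(1)] by (simp add: mult_ac)
    finally show "\<bar>h0 (cell n v) * Dlt F x (cell n v)\<bar> \<le> B * HD v" .
  qed
  finally show ?thesis unfolding gn_repr(1)[OF n F] C0_def by simp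
qed

text \<open>The bound is uniform in n and in the starting point and decays as R grows; it controls
  how fast mass can leave a large ball.\<close>

lemma psi_gn:
  assumes n: "0 < n" and R: "1 \<le> R"
  shows "bnd (10 * R powr (- (\<alpha> - kap)) * C0) (gn n (psi R))"
  unfolding bnd_def
proof
  fix x :: "real^'d"
  show "\<bar>gn n (psi R) x\<bar> \<le> 10 * R powr (- (\<alpha> - kap)) * C0"
  proof (rule gn_W_bound[OF n psi_bnd])
    fix y :: "real^'d"
    show "\<bar>Dlt (psi R) x y\<bar> \<le> 10 * R powr (- (\<alpha> - kap)) * W y"
    \<comment> \<open>Short jumps use the quadratic bound and R^(-2) \<le> R^(-(\<alpha> - kap)).
      For long jumps the minimum of 1 and (|y|/R)^2 is at most (|y|/R)^(\<alpha> - kap), because the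
      exponent lies between 0 and 2.\<close>
    proof (cases "norm y \<le> 1")
      case True
      have "\<bar>Dlt (psi R) x y\<bar> \<le> 10 * (norm y / R)\<^sup>2" using psi_Dlt[of R x y] R by linarith
      also have "(norm y / R)\<^sup>2 = R powr (- 2) * (norm y)\<^sup>2" using R by (simp add: powr_minus power_divide powr_numeral divide_simps)
      also have "\<dots> \<le> R powr (- (\<alpha> - kap)) * W y"
        using R kap W_small[OF True] by (intro mult_mono powr_mono) auto
      finally show ?thesis by simp
    next
      case False
      then have y: "1 \<le> norm y" by simp
      have "\<bar>Dlt (psi R) x y\<bar> \<le> 10 * (norm y / R) powr (\<alpha> - kap)"
      proof (cases "norm y \<le> R")
        case True
        have "(norm y / R) powr 2 \<le> (norm y / R) powr (\<alpha> - kap)"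
          using True y R kap by (intro powr_mono') auto
        moreover have "(norm y / R) powr 2 = (norm y / R)\<^sup>2" using y R by (simp add: powr_numeral)
        moreover have "\<bar>Dlt (psi R) x y\<bar> \<le> 10 * (norm y / R)\<^sup>2" using psi_Dlt[of R x y] R by linarith
        ultimately show ?thesis by linarith
      next
        case False
        then have "1 \<le> (norm y / R) powr (\<alpha> - kap)" using R kap by (intro ge_one_powr_ge_zero) auto
        moreover have "\<bar>Dlt (psi R) x y\<bar> \<le> 10" using psi_Dlt[of R x y] R by linarith
        ultimately show ?thesis by linarith
      qed
      also have "(norm y / R) powr (\<alpha> - kap) = R powr (- (\<alpha> - kap)) * norm y powr (\<alpha> - kap)"
        using R y by (simp add: powr_divide powr_minus_divide del: minus_diff_eq)
      also have "norm y powr (\<alpha> - kap) = W y"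
      proof -
        have "norm y powr (\<alpha> - kap) \<le> norm y powr (\<alpha> + kap)" using y kap by (intro powr_mono) auto
        then show ?thesis by (simp add: W_def)
      qed
      finally show ?thesis by simp
    qed
  qed (use R in auto)
qed

lemma nice_W:
  assumes "nice R C F"
  shows "\<bar>Dlt F x y\<bar> \<le> 4 * C * W y" (is ?g1) "0 \<le> C"
proof -
  have b: "bnd C F" using assms by (simp add: nice_def)
  show C: "0 \<le> C" using b by (rule bnd_nonneg)
  show ?g1
  proof (cases "norm y \<le> 1")
    case True
    have "\<bar>Dlt F x y\<bar> \<le> C * (norm y)\<^sup>2" using assms by (simp add: nice_def)
    also have "\<dots> \<le> C * W y" using W_small[OF True] C by (rule mult_left_mono)
    also have "\<dots> \<le> 4 * C * W y" using C W_nonneg[of y] by (simp add: mult_right_mono)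
    finally show ?thesis .
  next
    case False
    have "\<bar>Dlt F x y\<bar> \<le> 4 * C * 1"
      unfolding Dlt_def using bndD[OF b, of "x + y"] bndD[OF b, of "x - y"] bndD[OF b, of x] by linarith
    also have "\<dots> \<le> 4 * C * W y" using W_large[of y] False C by (intro mult_left_mono) auto
    finally show ?thesis .
  qed
qed

lemma nice_gn_bnd: "0 < n \<Longrightarrow> nice R C F \<Longrightarrow> bnd (4 * C * C0) (gn n F)"
  unfolding bnd_def using gn_W_bound[of n C F "4 * C"] nice_W[of R C F] by (auto simp: nice_def)

section \<open>Convergence of the discrete generators to the fractional operator\<close>

lemma frac_gen_h0: "frac_gen h F x = (LBINT v. h0 v * Dlt F x v) / 2"
proof -
  have "h v * (F (x + v) + F (x - v) - 2 * F x) = h0 v * Dlt F x v" for v by (simp add: h0_def Dlt_def)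
  then show ?thesis by (simp add: frac_gen_def)
qed

lemma frac_integrable:
  assumes F: "nice R C F"
  shows "integrable lborel (\<lambda>v. h0 v * Dlt F x v)"
proof (rule integrable_boundL[OF integrable_cmult[OF HD_int, of "4 * C"]])
  have [measurable]: "F \<in> borel_measurable borel" by (rule nice_meas[OF F])
  show "(\<lambda>v. h0 v * Dlt F x v) \<in> borel_measurable lborel" unfolding Dlt_def by simp
  show "AE v in lborel. norm (h0 v * Dlt F x v) \<le> norm (4 * C * HD v)"
  proof (rule AE_I2)
    fix v
    have "norm (h0 v * Dlt F x v) \<le> h0 v * (4 * C * W v)"
      using h0_nonneg nice_W[OF F] by (simp add: abs_mult mult_left_mono)
    also have "\<dots> \<le> 4 * C * HD v" using mult_left_mono[OF hW_HD[of v], of "4 * C"] nice_W(2)[OF F] by (simp add: mult_ac)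
    finally show "norm (h0 v * Dlt F x v) \<le> norm (4 * C * HD v)" by simp
  qed
qed

text \<open>Convergence is uniform in x because the difference of the two integrands is bounded by a
  function of n and v alone, using only the constant C of F.\<close>

lemma gn_tendsto:
  assumes F: "nice R C F"
  shows "\<exists>e. e \<longlonglongrightarrow> 0 \<and> (\<forall>n>0. \<forall>x. \<bar>gn n F x - frac_gen h F x\<bar> \<le> e n)"
proof -
  have [measurable]: "F \<in> borel_measurable borel" by (rule nice_meas[OF F])
  have b: "bnd C F" using F by (simp add: nice_def)
  have C: "0 \<le> C" using b by (rule bnd_nonneg)
  \<comment> \<open>The first entry of the minimum is integrable but does not shrink; the second
    tends to 0 at every v other than 0 but need not be integrable. Their minimum satisfies both
    demands of dominated convergence.\<close>
  define g where "g n v = min (8 * C * HD v) (4 * C * \<bar>h0 (cell n v) - h0 v\<bar> + h0 v * (2 * C * ((real CARD('d)) / real n)))" for n v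
  have g0: "0 \<le> g n v" for n v using C HD_nonneg h0_nonneg by (auto simp: g_def)
  have gle: "g n v \<le> 8 * C * HD v" for n v by (simp add: g_def)
  have g_meas: "g n \<in> borel_measurable borel" for n unfolding g_def[abs_def] by measurable
  have gi: "integrable lborel (g n)" for n
    by (rule integrable_boundL[OF integrable_cmult[OF HD_int, of "8 * C"]])
      (use g0 gle in \<open>auto intro!: AE_I2 order_trans[OF _ abs_ge_self] simp: g_meas\<close>)
  have "(\<lambda>n. (LBINT v. g n v)) \<longlonglongrightarrow> (\<integral>v. 0 \<partial>(lborel :: (real^'d) measure))"
  proof (rule integral_dominated_convergence[where w="\<lambda>v. 8 * C * HD v"])
    show "integrable lborel (\<lambda>v. 8 * C * HD v)" by (rule integrable_cmult[OF HD_int])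
    show "AE v in lborel. norm (g n v) \<le> 8 * C * HD v" for n
      using g0 by (auto simp: g_def intro!: AE_I2)
    have "AE v in lborel. v \<noteq> (0 :: real^'d)" by (rule AE_lborel_singleton)
    then show "AE v in lborel. (\<lambda>n. g n v) \<longlonglongrightarrow> 0"
    proof eventually_elim
      fix v :: "real^'d" assume v: "v \<noteq> 0"
      have "isCont h v" using h_cont v by (simp add: continuous_on_eq_continuous_at open_Compl)
      then have "(\<lambda>n. h (cell n v)) \<longlonglongrightarrow> h v" by (rule isCont_tendsto_compose[OF _ cell_tendsto])
      moreover have "\<forall>\<^sub>F n in sequentially. cell n v \<noteq> 0"
        using tendsto_imp_eventually_ne[OF cell_tendsto v] .
      then have "\<forall>\<^sub>F n in sequentially. h (cell n v) = h0 (cell n v)" by eventually_elim (simp add: h0_def)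
      ultimately have hc: "(\<lambda>n. h0 (cell n v)) \<longlonglongrightarrow> h0 v"
        using v by (auto simp: h0_def[of v] elim: Lim_transform_eventually)
      have "(\<lambda>n. 4 * C * \<bar>h0 (cell n v) - h0 v\<bar> + h0 v * (2 * C * ((real CARD('d)) / real n))) \<longlonglongrightarrow> 4 * C * \<bar>h0 v - h0 v\<bar> + h0 v * (2 * C * 0)"
        by (intro tendsto_intros hc lim_const_over_n)
      then have lim: "(\<lambda>n. 4 * C * \<bar>h0 (cell n v) - h0 v\<bar> + h0 v * (2 * C * ((real CARD('d)) / real n))) \<longlonglongrightarrow> 0" by simp
      show "(\<lambda>n. g n v) \<longlonglongrightarrow> 0"
        by (rule tendsto_sandwich[OF _ _ tendsto_const lim]) (use g0 in \<open>auto simp: g_def intro!: always_eventually\<close>)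
    qed
  qed (use gi in auto)
  then have lim: "(\<lambda>n. (LBINT v. g n v) / 2) \<longlonglongrightarrow> 0" using tendsto_divide[of _ 0 sequentially "\<lambda>_. 2" 2] by fastforce
  have "\<bar>gn n F x - frac_gen h F x\<bar> \<le> (LBINT v. g n v) / 2" if n: "0 < n" for n x
  proof -
    let ?d = "\<lambda>v. h0 (cell n v) * Dlt F x (cell n v) - h0 v * Dlt F x v"
    have "gn n F x - frac_gen h F x = (LBINT v. ?d v) / 2"
      unfolding gn_repr(1)[OF n b] frac_gen_h0
      by (subst integral_diffL[OF gn_repr(2)[OF n b] frac_integrable[OF F]]) (simp add: diff_divide_distrib)
    moreover have "\<bar>LBINT v. ?d v\<bar> \<le> (LBINT v. \<bar>?d v\<bar>)" by (rule integral_abs_bound)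
    moreover have "(LBINT v. \<bar>?d v\<bar>) \<le> (LBINT v. g n v)"
    proof (intro integral_mono integrable_abs integrable_diffL gn_repr(2)[OF n b] frac_integrable[OF F] gi)
      fix v
      have "\<bar>?d v\<bar> \<le> \<bar>h0 (cell n v) * Dlt F x (cell n v)\<bar> + \<bar>h0 v * Dlt F x v\<bar>" by linarith
      also have "\<dots> \<le> h0 (cell n v) * (4 * C * W (cell n v)) + h0 v * (4 * C * W v)"
        using h0_nonneg nice_W[OF F] by (auto simp: abs_mult intro!: add_mono mult_left_mono)
      also have "\<dots> \<le> 4 * C * HD v + 4 * C * HD v"
        using mult_left_mono[OF hW_HD[of v], of "4 * C"] mult_left_mono[OF hW_cell[OF n, of v], of "4 * C"] C by (simp add: mult_ac)
      finally have 1: "\<bar>?d v\<bar> \<le> 8 * C * HD v" by simp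
      have L: "\<bar>F x - F y\<bar> \<le> C * norm (x - y)" for x y using F by (simp add: nice_def)
      have "\<bar>Dlt F x (cell n v) - Dlt F x v\<bar> \<le> \<bar>F (x + cell n v) - F (x + v)\<bar> + \<bar>F (x - cell n v) - F (x - v)\<bar>"
        unfolding Dlt_def by linarith
      also have "\<dots> \<le> C * norm (cell n v - v) + C * norm (cell n v - v)"
        using L[of "x + cell n v" "x + v"] L[of "x - cell n v" "x - v"] by (simp add: norm_minus_commute)
      also have "\<dots> \<le> 2 * C * ((real CARD('d)) / real n)" using mult_left_mono[OF cell_dist[OF n, of v] C] by simp
      finally have D: "\<bar>Dlt F x (cell n v) - Dlt F x v\<bar> \<le> 2 * C * ((real CARD('d)) / real n)" .
      have D4: "\<bar>Dlt F x (cell n v)\<bar> \<le> 4 * C"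
        unfolding Dlt_def using bndD[OF b, of "x + cell n v"] bndD[OF b, of "x - cell n v"] bndD[OF b, of x] by linarith
      have "?d v = (h0 (cell n v) - h0 v) * Dlt F x (cell n v) + h0 v * (Dlt F x (cell n v) - Dlt F x v)" by (simp add: algebra_simps)
      then have "\<bar>?d v\<bar> \<le> \<bar>h0 (cell n v) - h0 v\<bar> * \<bar>Dlt F x (cell n v)\<bar> + h0 v * \<bar>Dlt F x (cell n v) - Dlt F x v\<bar>"
        using abs_triangle_ineq[of "(h0 (cell n v) - h0 v) * Dlt F x (cell n v)" "h0 v * (Dlt F x (cell n v) - Dlt F x v)"]
          h0_nonneg[of v] by (simp only: abs_mult abs_of_nonneg)
      also have "\<dots> \<le> \<bar>h0 (cell n v) - h0 v\<bar> * (4 * C) + h0 v * (2 * C * ((real CARD('d)) / real n))"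
        using D D4 h0_nonneg by (intro add_mono mult_left_mono) auto
      finally show "\<bar>?d v\<bar> \<le> g n v" using 1 by (simp add: g_def mult.commute)
    qed
    ultimately show ?thesis by linarith
  qed
  then show ?thesis using lim by (intro exI[of _ "\<lambda>n. (LBINT v. g n v) / 2"]) auto
qed

lemma gn_tendsto_pt:
  assumes F: "nice R C F"
  shows "(\<lambda>n. gn n F x) \<longlonglongrightarrow> frac_gen h F x"
proof -
  obtain e where e: "e \<longlonglongrightarrow> 0" "\<forall>n>0. \<forall>x. \<bar>gn n F x - frac_gen h F x\<bar> \<le> e n" using gn_tendsto[OF F] by blast
  have "(\<lambda>n. gn n F x - frac_gen h F x) \<longlonglongrightarrow> 0"
    by (rule Lim_null_comparison[OF _ e(1)]) (use e(2) in \<open>auto intro!: eventually_mono[OF eventually_gt_at_top[of 0]]\<close>)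
  then show ?thesis by (rule LIM_zero_cancel)
qed

section \<open>Decay at infinity of the generators on compactly supported functions\<close>

definition wt :: "real^'d \<Rightarrow> real" where "wt x = (1 + norm x) powr (- (real CARD('d) + \<alpha>))"

lemma wt_meas[measurable]: "wt \<in> borel_measurable borel" unfolding wt_def[abs_def] by measurable
lemma wt_pos: "0 < wt x" by (simp add: wt_def add_pos_nonneg[of 1 "norm x", THEN less_imp_neq, symmetric])

lemma wt_le1: "wt x \<le> 1"
proof -
  have "(1 + norm x) powr (- (real CARD('d) + \<alpha>)) \<le> 1 powr (- (real CARD('d) + \<alpha>))"
    using alpha by (intro powr_mono2') auto
  then show ?thesis by (simp add: wt_def)
qed

lemma wt_int: "integrable lborel wt"
proof -
  have i1: "integrable lborel (\<lambda>x :: real^'d. if 1 \<le> norm x then norm x powr (- (real CARD('d) + \<alpha>)) else 0)"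
    using alpha by (intro integrable_norm_powr_large) auto
  have i2: "integrable lborel (indicator (cball 0 1) :: real^'d \<Rightarrow> real)"
    by (rule integrable_real_indicator) (auto intro: emeasure_lborel_cball_finite[unfolded infinity_ennreal_def])
  show ?thesis
  proof (rule integrable_boundL[OF Bochner_Integration.integrable_add[OF i1 i2]])
    show "AE x in lborel. norm (wt x) \<le> norm ((if 1 \<le> norm x then norm x powr (- (real CARD('d) + \<alpha>)) else 0) + indicator (cball 0 1) x)"
    proof (rule AE_I2)
      fix x :: "real^'d"
      show "norm (wt x) \<le> norm ((if 1 \<le> norm x then norm x powr (- (real CARD('d) + \<alpha>)) else 0) + indicator (cball 0 1) x)"
      proof (cases "1 \<le> norm x")
        case True
        have "wt x \<le> norm x powr (- (real CARD('d) + \<alpha>))" unfolding wt_def using True alpha by (intro powr_mono2') auto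
        then show ?thesis using True wt_pos[of x] by (auto split: split_indicator)
      next
        case False
        then show ?thesis using wt_pos[of x] wt_le1[of x] by (auto split: split_indicator)
      qed
    qed
  qed measurable
qed

definition Cw :: real where "Cw = (1 + real CARD('d)) powr (real CARD('d) + \<alpha>) * (LBINT x. wt x)"

lemma wt_cell:
  assumes n: "0 < n"
  shows "wt (cell n v) \<le> (1 + real CARD('d)) powr (real CARD('d) + \<alpha>) * wt v"
proof -
  have "norm v \<le> norm (cell n v) + norm (cell n v - v)" by (metis norm_triangle_sub norm_minus_commute)
  also have "norm (cell n v - v) \<le> (real CARD('d))"
    using cell_dist[OF n, of v] n by (smt (verit) divide_le_eq_1 le_divide_eq_1 mult_left_le of_nat_0_le_iff of_nat_1 of_nat_le_iff Suc_leI One_nat_def divide_inverse inverse_le_1_iff)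
  finally have "1 + norm v \<le> (1 + real CARD('d)) * (1 + norm (cell n v))" 
    using mult_nonneg_nonneg[OF of_nat_0_le_iff norm_ge_zero, of "CARD('d)" "cell n v"] unfolding distrib_left distrib_right by linarith
  then show ?thesis unfolding wt_def using alpha by (intro powr_neg_scale) (auto simp: add_pos_nonneg)
qed

lemma wt_lattice:
  assumes n: "0 < n"
  shows "lsummable (\<lambda>z. wt (shiftn n z))" (is ?g1)
    and "(LSUM z. wt (shiftn n z)) \<le> real n ^ CARD('d) * Cw" (is ?g2)
proof -
  have i: "integrable lborel (\<lambda>v. wt (cell n v))"
  proof (rule integrable_boundL[OF integrable_cmult[OF wt_int, of "(1 + real CARD('d)) powr (real CARD('d) + \<alpha>)"]])
    show "AE v in lborel. norm (wt (cell n v)) \<le> norm ((1 + real CARD('d)) powr (real CARD('d) + \<alpha>) * wt v)"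
      using wt_cell[OF n] wt_pos by (auto simp: abs_mult less_imp_le intro!: AE_I2)
  qed measurable
  then show ?g1
    by (subst riemann_sum(2)[OF n]) (simp add: cell_def)
  have "(LBINT v. wt (cell n v)) \<le> (LBINT v. (1 + real CARD('d)) powr (real CARD('d) + \<alpha>) * wt v)"
    by (intro integral_mono i integrable_cmult wt_int wt_cell[OF n])
  then show ?g2
    by (subst riemann_sum(1)[OF n]) (simp add: cell_def Cw_def mult_left_mono)
qed

lemma compact_le_wt:
  assumes "bnd C F" "\<And>x. R < norm x \<Longrightarrow> F x = 0" "0 \<le> R"
  shows "\<bar>F x\<bar> \<le> C * (1 + R) powr (real CARD('d) + \<alpha>) * wt x"
proof (cases "R < norm x")
  case True
  then show ?thesis using assms(2) wt_pos[of x] bnd_nonneg[OF assms(1)] by (simp add: less_imp_le)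
next
  case False
  have "(1 + R) powr (- (real CARD('d) + \<alpha>)) \<le> wt x" unfolding wt_def using False alpha by (intro powr_mono2') (auto simp: add_pos_nonneg)
  then have "(1 + R) powr (real CARD('d) + \<alpha>) * (1 + R) powr (- (real CARD('d) + \<alpha>)) \<le> (1 + R) powr (real CARD('d) + \<alpha>) * wt x" by (intro mult_left_mono) auto
  then have "1 \<le> (1 + R) powr (real CARD('d) + \<alpha>) * wt x" using assms(3) by (simp flip: powr_add)
  then have "C * 1 \<le> C * ((1 + R) powr (real CARD('d) + \<alpha>) * wt x)" using bnd_nonneg[OF assms(1)] by (rule mult_left_mono)
  then show ?thesis using bndD[OF assms(1), of x] by (simp add: mult.assoc)
qed

text \<open>Far from its support F is seen only by a single long jump into the support, so the
  generator decays like the kernel itself. The constant depends on R and C only and hence serves all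
  time slices of a test function.\<close>

lemma gn_decay:
  assumes R0: "0 \<le> R" and C: "0 \<le> C"
  shows "\<exists>A\<ge>0. \<forall>F. nice R C F \<longrightarrow> (\<forall>n>0. \<forall>x. \<bar>gn n F x\<bar> \<le> A * wt x) \<and> (\<forall>x. \<bar>frac_gen h F x\<bar> \<le> A * wt x)"
proof -
  \<comment> \<open>Beyond R1 a jump into the support has length at least |x| - R, which is at least
    (1 + |x|)/4, so the kernel there is of order \<open>wt x\<close>.\<close>
  define R1 where "R1 = 2 * R + 1"
  define A where "A = 4 * C * C0 * (1 + R1) powr (real CARD('d) + \<alpha>) + 4 powr (real CARD('d) + \<alpha>) * Ch * (C * (unit_ball_vol (real CARD('d)) * (R + (real CARD('d))) ^ CARD('d)))"
  have A0: "0 \<le> A" unfolding A_def using C C0_nonneg Ch(1) R0 by (intro add_nonneg_nonneg mult_nonneg_nonneg) auto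
  have bound: "\<bar>gn n F x\<bar> \<le> A * wt x" if n: "0 < n" and F: "nice R C F" for n x F
  proof (cases "norm x \<le> R1")
    case True
    have "\<bar>gn n F x\<bar> \<le> 4 * C * C0" using bndD[OF nice_gn_bnd[OF n F]] .
    also have "1 \<le> (1 + R1) powr (real CARD('d) + \<alpha>) * wt x"
    proof -
      have "(1 + R1) powr (- (real CARD('d) + \<alpha>)) \<le> wt x" unfolding wt_def using True alpha by (intro powr_mono2') (auto simp: add_pos_nonneg)
      then have "(1 + R1) powr (real CARD('d) + \<alpha>) * (1 + R1) powr (- (real CARD('d) + \<alpha>)) \<le> (1 + R1) powr (real CARD('d) + \<alpha>) * wt x" by (intro mult_left_mono) auto
      then show ?thesis using R0 by (simp add: R1_def flip: powr_add)
    qed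
    then have "4 * C * C0 * 1 \<le> 4 * C * C0 * ((1 + R1) powr (real CARD('d) + \<alpha>) * wt x)" using C C0_nonneg by (intro mult_left_mono) auto
    also have "\<dots> \<le> A * wt x"
    proof -
      have "0 \<le> 4 powr (real CARD('d) + \<alpha>) * Ch * (C * (unit_ball_vol (real CARD('d)) * (R + (real CARD('d))) ^ CARD('d))) * wt x"
        using Ch(1) C R0 wt_pos[of x] by (intro mult_nonneg_nonneg) (auto simp: less_imp_le)
      then show ?thesis unfolding A_def distrib_right by (simp only: mult.assoc)
    qed
    finally show ?thesis by simp
  next
    case False
    then have x: "R1 < norm x" by simp
    interpret w: walk "pn n" by (rule pn_walk)
    have b: "bnd C F" and supp: "\<And>x. R < norm x \<Longrightarrow> F x = 0" using F by (auto simp: nice_def)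
    have Fx: "F x = 0" using x R0 by (intro supp) (simp add: R1_def)
    have "gn n F x = conv (pn n) (shiftn n) F x" by (simp add: gen_def Fx)
    also have "\<dots> = (LBINT v. h0 (cell n v) * F (x + cell n v))"
      unfolding conv_def by (subst riemann_sum(1)[OF n]) (use n in \<open>simp add: pn_eq[OF n] cell_def\<close>)
    finally have e: "gn n F x = (LBINT v. h0 (cell n v) * F (x + cell n v))" .
    \<comment> \<open>Kernel size times the bound on F. The ball of integration below is enlarged by
      the dimension d, since v may differ from its cell corner by d/n \<le> d.\<close>
    let ?B = "4 powr (real CARD('d) + \<alpha>) * Ch * wt x * C"
    have i: "integrable lborel (\<lambda>v. ?B * indicator (cball (- x) (R + (real CARD('d)))) v)"
      by (intro integrable_cmult integrable_real_indicator) (auto intro: emeasure_lborel_cball_finite[unfolded infinity_ennreal_def])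
    have "\<bar>gn n F x\<bar> \<le> (LBINT v. ?B * indicator (cball (- x) (R + (real CARD('d)))) v)"
      unfolding e real_norm_def[symmetric]
    proof (rule Bochner_Integration.integral_norm_bound_integral[OF _ i])
      show "integrable lborel (\<lambda>v. h0 (cell n v) * F (x + cell n v))"
        using integrable_cmult[OF conv_integrable[OF w.p_int b, of x "shiftn n", unfolded riemann_sum(2)[OF n]], of "real n ^ CARD('d)"] n
        by (simp add: pn_eq[OF n] cell_def)
      fix v :: "real^'d"
      show "norm (h0 (cell n v) * F (x + cell n v)) \<le> ?B * indicator (cball (- x) (R + (real CARD('d)))) v"
      proof (cases "R < norm (x + cell n v)")
        case True
        then show ?thesis using supp Ch(1) wt_pos[of x] C by (simp add: less_imp_le)
      next
        case False
        have nx: "norm x \<le> norm (x + cell n v) + norm (cell n v)" by (metis add_diff_cancel_right' norm_triangle_ineq4)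
        have cd: "norm (cell n v - v) \<le> (real CARD('d))"
          using cell_dist[OF n, of v] n by (smt (verit) divide_le_eq_1 le_divide_eq_1 mult_left_le of_nat_0_le_iff of_nat_1 of_nat_le_iff Suc_leI One_nat_def divide_inverse inverse_le_1_iff)
        have "norm (v - (- x)) = norm ((x + cell n v) - (cell n v - v))" by (simp add: algebra_simps)
        also have "\<dots> \<le> norm (x + cell n v) + norm (cell n v - v)" by (rule norm_triangle_ineq4)
        also have "\<dots> \<le> R + (real CARD('d))" using False cd by simp
        finally have mem: "v \<in> cball (- x) (R + (real CARD('d)))" by (simp add: dist_norm norm_minus_commute)
        have "1 + norm x \<le> 4 * norm (cell n v)" using nx False x R0 by (simp add: R1_def)
        then have "norm (cell n v) powr (- (real CARD('d) + \<alpha>)) \<le> 4 powr (real CARD('d) + \<alpha>) * wt x"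
          unfolding wt_def using alpha by (intro powr_neg_scale) (auto simp: add_pos_nonneg)
        then have "h0 (cell n v) \<le> Ch * (4 powr (real CARD('d) + \<alpha>) * wt x)"
          using Ch(2)[of "cell n v"] Ch(1) by (meson less_imp_le mult_left_mono order_trans)
        then have "h0 (cell n v) * \<bar>F (x + cell n v)\<bar> \<le> Ch * (4 powr (real CARD('d) + \<alpha>) * wt x) * C"
          using bndD[OF b] h0_nonneg Ch(1) wt_pos[of x] by (intro mult_mono) (auto simp: less_imp_le)
        then show ?thesis using mem h0_nonneg by (simp add: abs_mult mult_ac)
      qed
    qed
    also have "\<dots> = ?B * (unit_ball_vol (real CARD('d)) * (R + (real CARD('d))) ^ CARD('d))"
      using R0 by (simp add: content_cball)
    also have "\<dots> \<le> A * wt x"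
    proof -
      have "0 \<le> 4 * C * C0 * (1 + R1) powr (real CARD('d) + \<alpha>) * wt x"
        using C C0_nonneg wt_pos[of x] by (intro mult_nonneg_nonneg) (auto simp: less_imp_le)
      then show ?thesis unfolding A_def distrib_right by (simp add: mult_ac)
    qed
    finally show ?thesis .
  qed
  have "\<bar>frac_gen h F x\<bar> \<le> A * wt x" if F: "nice R C F" for x F
  proof -
    have "(\<lambda>n. gn n F x) \<longlonglongrightarrow> frac_gen h F x" by (rule gn_tendsto_pt[OF F])
    then have "(\<lambda>n. \<bar>gn n F x\<bar>) \<longlonglongrightarrow> \<bar>frac_gen h F x\<bar>" by (rule tendsto_rabs)
    then show ?thesis
      by (rule tendsto_upperbound) (use bound F in \<open>auto intro!: eventually_mono[OF eventually_gt_at_top[of 0]]\<close>)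
  qed
  then show ?thesis using A0 bound by auto
qed

end

section \<open>Smooth functions with compact support\<close>

text \<open>Powers of 1/s times exp(-1/s), continued by 0. The whole family in k is introduced
  because differentiation raises k.\<close>

definition flat_exp :: "nat \<Rightarrow> real \<Rightarrow> real" where
  "flat_exp k s = (if 0 < s then (1 / s) ^ k * exp (- (1 / s)) else 0)"

lemma flat_tendsto_0: "(flat_exp k \<longlongrightarrow> 0) (at 0)"
proof (rule filterlim_split_at)
  show "(flat_exp k \<longlongrightarrow> 0) (at_left 0)"
    by (rule tendsto_eventually) (auto simp: eventually_at_left_field flat_exp_def intro!: exI[of _ "-1"])
  have "((\<lambda>x. inverse x ^ k / exp (inverse x)) \<longlongrightarrow> (0::real)) (at_right 0)"
    by (rule filterlim_compose[OF tendsto_power_div_exp_0 filterlim_inverse_at_top_right])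
  moreover have "\<forall>\<^sub>F x in at_right 0. inverse x ^ k / exp (inverse x) = flat_exp k x"
    by (auto simp: eventually_at_right_field flat_exp_def divide_inverse exp_minus intro!: exI[of _ 1])
  ultimately show "(flat_exp k \<longlongrightarrow> 0) (at_right 0)" by (rule Lim_transform_eventually)
qed

lemma flat_deriv: "(flat_exp k has_real_derivative (flat_exp (k + 2) s - real k * flat_exp (k + 1) s)) (at s)"
proof (cases "s = 0")
  case True
  have "(\<lambda>y. (flat_exp k y - flat_exp k 0) / (y - 0)) = flat_exp (Suc k)"
    by (auto simp: flat_exp_def fun_eq_iff field_simps)
  then show ?thesis using flat_tendsto_0[of "Suc k"] unfolding has_field_derivative_iff True by (simp add: flat_exp_def)
next
  case False
  show ?thesis
  proof (cases "0 < s")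
    case True
    have "((\<lambda>s. (1 / s) ^ k * exp (- (1 / s))) has_real_derivative (flat_exp (k + 2) s - real k * flat_exp (k + 1) s)) (at s)"
      using True by (auto intro!: derivative_eq_intros simp: flat_exp_def power2_eq_square divide_simps)
        (cases k; simp add: field_simps)
    then show ?thesis
      by (rule has_field_derivative_transform_within_open[of _ _ _ "{0<..}"]) (use True in \<open>auto simp: flat_exp_def\<close>)
  next
    case F: False
    have "((\<lambda>_. 0) has_real_derivative 0) (at s)" by simp
    then have "(flat_exp k has_real_derivative 0) (at s)"
      by (rule has_field_derivative_transform_within_open[of _ _ _ "{..<0}"]) (use False F in \<open>auto simp: flat_exp_def\<close>)
    then show ?thesis using F by (simp add: flat_exp_def)
  qed
qed

lemma flat0_range: "0 \<le> flat_exp 0 s" "flat_exp 0 s \<le> 1" "0 < flat_exp 0 s \<longleftrightarrow> 0 < s"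
  by (auto simp: flat_exp_def)

lemma flat_cont: "continuous_on S (flat_exp k)"
  by (rule continuous_at_imp_continuous_on) (auto intro: DERIV_isCont[OF flat_deriv])

text \<open>\<open>smooth_fun\<close> quantifies over all iterated directional derivatives; a class
  closed under differentiation settles them all by one induction. The class contains just the
  operations from which the cutoffs are built.\<close>

inductive SM :: "('a::euclidean_space \<Rightarrow> real) \<Rightarrow> bool" where
  SM_lin: "bounded_linear f \<Longrightarrow> SM f"
| SM_const: "SM (\<lambda>x. c)"
| SM_add: "SM f \<Longrightarrow> SM g \<Longrightarrow> SM (\<lambda>x. f x + g x)"
| SM_mult: "SM f \<Longrightarrow> SM g \<Longrightarrow> SM (\<lambda>x. f x * g x)"
| SM_flat: "SM f \<Longrightarrow> SM (\<lambda>x. flat_exp k (f x))"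

lemma SM_deriv:
  assumes "SM f"
  shows "\<exists>f'. (\<forall>x. (f has_derivative f' x) (at x)) \<and> (\<forall>v. SM (\<lambda>x. f' x v))"
  using assms
proof induction
  case (SM_lin f)
  then show ?case by (intro exI[of _ "\<lambda>x. f"]) (auto intro: bounded_linear_imp_has_derivative SM.intros)
next
  case (SM_const c)
  show ?case by (intro exI[of _ "\<lambda>x v. 0"]) (auto intro: SM.intros)
next
  case (SM_add f g)
  then obtain f' g' where "\<And>x. (f has_derivative f' x) (at x)" "\<And>v. SM (\<lambda>x. f' x v)"
    "\<And>x. (g has_derivative g' x) (at x)" "\<And>v. SM (\<lambda>x. g' x v)" by blast
  then show ?case by (intro exI[of _ "\<lambda>x v. f' x v + g' x v"]) (auto intro: SM.intros has_derivative_add)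
next
  case (SM_mult f g)
  then obtain f' g' where "\<And>x. (f has_derivative f' x) (at x)" "\<And>v. SM (\<lambda>x. f' x v)"
    "\<And>x. (g has_derivative g' x) (at x)" "\<And>v. SM (\<lambda>x. g' x v)" by blast
  then show ?case
    by (intro exI[of _ "\<lambda>x v. f x * g' x v + f' x v * g x"])
      (auto intro!: SM.SM_add SM.SM_mult SM_mult.hyps has_derivative_mult)
next
  case (SM_flat f k)
  then obtain f' where f': "\<And>x. (f has_derivative f' x) (at x)" "\<And>v. SM (\<lambda>x. f' x v)" by blast
  have "((\<lambda>x. flat_exp k (f x)) has_derivative (\<lambda>v. f' x v * (flat_exp (k + 2) (f x) + (- real k) * flat_exp (k + 1) (f x)))) (at x)" for x
    using has_derivative_compose[OF f'(1), of "flat_exp k" "\<lambda>y. y * (flat_exp (k + 2) (f x) - real k * flat_exp (k + 1) (f x))" x]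
      flat_deriv[of k "f x"] by (simp add: has_field_derivative_def mult.commute[of _ "flat_exp (k + 2) (f x) - real k * flat_exp (k + 1) (f x)"] mult_commute_abs)
  then show ?case
    by (intro exI[of _ "\<lambda>x v. f' x v * (flat_exp (k + 2) (f x) + (- real k) * flat_exp (k + 1) (f x))"] conjI allI
        SM.SM_add SM.SM_mult SM.SM_flat SM.SM_const SM_flat.hyps f'(2))
qed

lemma SM_smooth:
  assumes "SM f"
  shows "smooth_fun f"
proof -
  have "SM (iter_deriv vs f)" for vs
  proof (induction vs)
    case (Cons v vs)
    obtain f' where f': "\<And>x. (iter_deriv vs f has_derivative f' x) (at x)" "\<And>v. SM (\<lambda>x. f' x v)"
      using SM_deriv[OF Cons] by blast
    have "frechet_derivative (iter_deriv vs f) (at x) = f' x" for x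
      using frechet_derivative_at[OF f'(1)] by simp
    then show ?case using f'(2) by simp
  qed (use assms in simp)
  then show ?thesis
    unfolding smooth_fun_def using SM_deriv differentiableI by blast
qed

lemma SM_affine:
  assumes "SM F" "bounded_linear L"
  shows "SM (\<lambda>z. F (L z + c))"
  using assms(1)
proof induction
  case (SM_lin f)
  then have "SM (\<lambda>z. f (L z) + f c)"
    by (intro SM.SM_add SM.SM_const SM.SM_lin bounded_linear_compose[OF _ assms(2)])
  then show ?case using SM_lin by (simp add: linear_add bounded_linear.linear)
qed (auto intro: SM.intros)

lemma SM_polynomial: "real_polynomial_function f \<Longrightarrow> SM f"
  by (induction rule: real_polynomial_function.induct) (auto intro: SM.intros)

text \<open>A factor q times a fixed flat cutoff of radius R. For polynomial q the product is
  smooth, and such products are dense by Stone-Weierstrass.\<close>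

definition bump :: "real \<Rightarrow> ('a::euclidean_space \<Rightarrow> real) \<Rightarrow> 'a \<Rightarrow> real" where
  "bump R q x = q x * flat_exp 0 (R\<^sup>2 - x \<bullet> x)"

lemma SM_bump: "real_polynomial_function q \<Longrightarrow> SM (bump R q)"
proof -
  assume q: "real_polynomial_function q"
  have e: "x \<bullet> x = (\<Sum>b\<in>Basis. (x \<bullet> b) * (x \<bullet> b))" for x :: 'a by (rule euclidean_inner)
  have "real_polynomial_function (\<lambda>x::'a. R\<^sup>2 - x \<bullet> x)"
    unfolding e by (intro real_polynomial_function_diff real_polynomial_function_sum real_polynomial_function.intros bounded_linear_inner_left) auto
  then show ?thesis
    unfolding bump_def[abs_def] by (intro SM.SM_mult SM.SM_flat SM_polynomial q)
qed

lemma bump_supp: "0 \<le> R \<Longrightarrow> R < norm x \<Longrightarrow> bump R q x = 0"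
proof -
  assume "0 \<le> R" "R < norm x"
  then have "R\<^sup>2 < (norm x)\<^sup>2" by (intro power_strict_mono) auto
  then show ?thesis by (simp add: bump_def flat_exp_def power2_norm_eq_inner)
qed

section \<open>Finite difference bounds for smooth functions\<close>

lemma gradient_bound:
  fixes H :: "'a::euclidean_space \<Rightarrow> real" and C :: real
  assumes d: "\<And>x. (H has_derivative H' x) (at x)" and b: "\<And>x b. b \<in> Basis \<Longrightarrow> \<bar>H' x b\<bar> \<le> C" and C: "0 \<le> C"
  shows "\<bar>H' x y\<bar> \<le> DIM('a) * C * norm y" (is ?g1) "\<bar>H x - H y\<bar> \<le> DIM('a) * C * norm (x - y)" (is ?g2)
proof -
  have g: "\<bar>H' x y\<bar> \<le> DIM('a) * C * norm y" for x y
  proof -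
    interpret linear "H' x" using has_derivative_linear[OF d] .
    have "H' x y = (\<Sum>b\<in>Basis. (y \<bullet> b) * H' x b)"
      by (subst euclidean_representation[symmetric, of y]) (simp add: sum scale del: euclidean_representation)
    also have "\<bar>\<dots>\<bar> \<le> (\<Sum>b\<in>Basis. \<bar>(y \<bullet> b) * H' x b\<bar>)" by (rule sum_abs)
    also have "\<dots> \<le> (\<Sum>b\<in>(Basis :: 'a set). norm y * C)"
      unfolding abs_mult by (intro sum_mono mult_mono b Basis_le_norm) auto
    finally show ?thesis by (simp add: mult_ac)
  qed
  then show ?g1 .
  have "norm (H x - H y) \<le> (DIM('a) * C) * norm (x - y)"
  proof (rule differentiable_bound[of UNIV])
    show "onorm (H' x) \<le> DIM('a) * C" for x
      by (rule onorm_bound) (use g C in auto)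
  qed (use d in auto)
  then show ?g2 by simp
qed

text \<open>A single mean value theorem for t -> H(x + t y) + H(x - t y) - 2 H(x): its derivative is
  a difference of directional derivatives at two points 2 t y apart, so Lipschitz partial
  derivatives suffice.\<close>

lemma second_difference_bound:
  fixes H :: "'a::euclidean_space \<Rightarrow> real" and C :: real
  assumes d: "\<And>x. (H has_derivative H' x) (at x)"
    and L: "\<And>x y b. b \<in> Basis \<Longrightarrow> \<bar>H' x b - H' y b\<bar> \<le> C * norm (x - y)" and C: "0 \<le> C"
  shows "\<bar>Dlt H x y\<bar> \<le> 2 * DIM('a) * C * (norm y)\<^sup>2"
proof -
  define \<phi> where "\<phi> t = H (x + t *\<^sub>R y) + H (x - t *\<^sub>R y) - 2 * H x" for t :: real
  have lin: "H' z v = (\<Sum>b\<in>Basis. (v \<bullet> b) * H' z b)" for z v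
  proof -
    interpret linear "H' z" using has_derivative_linear[OF d] .
    show ?thesis by (subst euclidean_representation[symmetric, of v]) (simp add: sum scale del: euclidean_representation)
  qed
  have d1: "((\<lambda>t. H (x + t *\<^sub>R y)) has_real_derivative H' (x + t *\<^sub>R y) y) (at t)" for t
  proof -
    have "((\<lambda>t. H (x + t *\<^sub>R y)) has_derivative (\<lambda>s. H' (x + t *\<^sub>R y) (s *\<^sub>R y))) (at t)"
      by (rule has_derivative_compose[OF _ d]) (auto intro!: derivative_eq_intros)
    moreover have "(\<lambda>s. H' (x + t *\<^sub>R y) (s *\<^sub>R y)) = (*) (H' (x + t *\<^sub>R y) y)"
      using has_derivative_linear[OF d, of "x + t *\<^sub>R y"] by (auto simp: linear_scale fun_eq_iff)
    ultimately show ?thesis by (simp add: has_field_derivative_def)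
  qed
  have d2: "((\<lambda>t. H (x - t *\<^sub>R y)) has_real_derivative - H' (x - t *\<^sub>R y) y) (at t)" for t
  proof -
    have "((\<lambda>t. H (x - t *\<^sub>R y)) has_derivative (\<lambda>s. H' (x - t *\<^sub>R y) (- (s *\<^sub>R y)))) (at t)"
      by (rule has_derivative_compose[OF _ d]) (auto intro!: derivative_eq_intros)
    moreover have "(\<lambda>s. H' (x - t *\<^sub>R y) (- (s *\<^sub>R y))) = (*) (- H' (x - t *\<^sub>R y) y)"
      using has_derivative_linear[OF d, of "x - t *\<^sub>R y"] by (auto simp: linear_scale linear_neg fun_eq_iff)
    ultimately show ?thesis by (simp add: has_field_derivative_def)
  qed
  have d\<phi>: "(\<phi> has_real_derivative (H' (x + t *\<^sub>R y) y - H' (x - t *\<^sub>R y) y)) (at t)" for t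
    unfolding \<phi>_def by (rule derivative_eq_intros d1 d2 refl | simp)+
  obtain z where z: "0 < z" "z < 1" "\<phi> 1 - \<phi> 0 = (1 - 0) * (H' (x + z *\<^sub>R y) y - H' (x - z *\<^sub>R y) y)"
    using MVT2[of 0 1 \<phi> "\<lambda>t. H' (x + t *\<^sub>R y) y - H' (x - t *\<^sub>R y) y"] d\<phi> by auto
  have "Dlt H x y = (\<Sum>b\<in>Basis. (y \<bullet> b) * (H' (x + z *\<^sub>R y) b - H' (x - z *\<^sub>R y) b))"
  proof -
    have "Dlt H x y = H' (x + z *\<^sub>R y) y - H' (x - z *\<^sub>R y) y" using z(3) by (simp add: \<phi>_def Dlt_def)
    then show ?thesis using lin[of "x + z *\<^sub>R y" y] lin[of "x - z *\<^sub>R y" y] by (simp add: sum_subtractf right_diff_distrib)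
  qed
  also have "\<bar>\<dots>\<bar> \<le> (\<Sum>b\<in>Basis. \<bar>(y \<bullet> b) * (H' (x + z *\<^sub>R y) b - H' (x - z *\<^sub>R y) b)\<bar>)" by (rule sum_abs)
  also have "\<dots> \<le> (\<Sum>b\<in>(Basis :: 'a set). norm y * (C * (2 * norm y)))"
  proof (rule sum_mono)
    fix b :: 'a assume b: "b \<in> Basis"
    have "\<bar>H' (x + z *\<^sub>R y) b - H' (x - z *\<^sub>R y) b\<bar> \<le> C * norm ((x + z *\<^sub>R y) - (x - z *\<^sub>R y))" by (rule L[OF b])
    also have "(x + z *\<^sub>R y) - (x - z *\<^sub>R y) = (2 * z) *\<^sub>R y"
      using scaleR_add_left[of z z y] by simp
    also have "C * norm ((2 * z) *\<^sub>R y) \<le> C * (2 * norm y)" using z C by (intro mult_left_mono) (auto simp: mult_right_mono)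
    finally show "\<bar>(y \<bullet> b) * (H' (x + z *\<^sub>R y) b - H' (x - z *\<^sub>R y) b)\<bar> \<le> norm y * (C * (2 * norm y))"
      unfolding abs_mult by (intro mult_mono Basis_le_norm b) auto
  qed
  finally show ?thesis by (simp add: power2_eq_square mult_ac)
qed

text \<open>The complement of K is open and the function vanishes on it, so all derivatives vanish
  there; on K they are bounded by continuity and compactness.\<close>

lemma iter_deriv_bounded:
  fixes G :: "'a::euclidean_space \<Rightarrow> real"
  assumes G: "smooth_fun G" and K: "compact K" "\<And>z. z \<notin> K \<Longrightarrow> G z = 0"
  shows "\<exists>C. bnd C (iter_deriv vs G)" (is ?g1) "z \<notin> K \<Longrightarrow> iter_deriv vs G z = 0"
    "(iter_deriv vs G has_derivative (\<lambda>v. iter_deriv (v # vs) G x)) (at x)" (is ?g2)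
    "continuous_on UNIV (iter_deriv vs G)" (is ?g3)
proof -
  have d: "(iter_deriv vs G has_derivative (\<lambda>v. iter_deriv (v # vs) G x)) (at x)" for vs x
    using G unfolding smooth_fun_def by (simp add: frechet_derivative_works)
  then show ?g2 .
  have z: "z \<notin> K \<Longrightarrow> iter_deriv vs G z = 0" for z vs
  proof (induction vs arbitrary: z)
    case (Cons v vs)
    have "open (- K)" using compact_imp_closed[OF K(1)] by (simp add: open_Compl)
    have "((\<lambda>_. 0) has_derivative (\<lambda>_. 0)) (at z)" by simp
    then have "(iter_deriv vs G has_derivative (\<lambda>_. 0)) (at z)"
      by (rule has_derivative_transform_within_open[OF _ \<open>open (- K)\<close>]) (use Cons in auto)
    then have "(\<lambda>v. iter_deriv (v # vs) G z) = (\<lambda>_. 0)" using d has_derivative_unique by blast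
    then show ?case by metis
  qed (use K in auto)
  then show "z \<notin> K \<Longrightarrow> iter_deriv vs G z = 0" .
  have c: "continuous_on UNIV (iter_deriv vs G)" for vs
    by (rule continuous_at_imp_continuous_on) (use has_derivative_continuous[OF d] in auto)
  then show ?g3 .
  have "bounded (iter_deriv vs G ` K)"
    by (intro compact_imp_bounded compact_continuous_image continuous_on_subset[OF c] K) auto
  then obtain B where B: "\<And>x. x \<in> K \<Longrightarrow> \<bar>iter_deriv vs G x\<bar> \<le> B" by (auto simp: bounded_iff)
  have "\<bar>iter_deriv vs G x\<bar> \<le> max B 0" for x using B[of x] z[of x vs] by (cases "x \<in> K") auto
  then show ?g1 by (auto simp: bnd_def)
qed

lemma smooth_compact_bounds:
  fixes G :: "'a::euclidean_space \<Rightarrow> real"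
  assumes G: "smooth_fun G" and K: "compact K" "\<And>z. z \<notin> K \<Longrightarrow> G z = 0"
  shows "\<exists>C\<ge>0. bnd C G \<and> (\<forall>x y. \<bar>G x - G y\<bar> \<le> C * norm (x - y)) \<and> (\<forall>x y. \<bar>Dlt G x y\<bar> \<le> C * (norm y)\<^sup>2)"
proof -
  note I = iter_deriv_bounded[OF G K]
  obtain c0 where c0: "bnd c0 G" using I(1)[of "[]"] by auto
  have "\<forall>b\<in>(Basis :: 'a set). \<exists>C. bnd C (iter_deriv [b] G)" using I(1) by blast
  then obtain f1 where f1: "\<And>b. b \<in> (Basis :: 'a set) \<Longrightarrow> bnd (f1 b) (iter_deriv [b] G)" by metis
  define c1 where "c1 = (\<Sum>b\<in>Basis. f1 b)"
  have f1c: "0 \<le> f1 b" "f1 b \<le> c1" if "b \<in> Basis" for b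
    using bnd_nonneg[OF f1] that unfolding c1_def by (auto intro!: member_le_sum)
  have c1: "\<bar>iter_deriv [b] G x\<bar> \<le> c1" if "b \<in> Basis" for b x
    using bndD[OF f1[OF that], of x] f1c[OF that] by linarith
  have "\<forall>p\<in>(Basis :: 'a set) \<times> (Basis :: 'a set). \<exists>C. bnd C (iter_deriv [fst p, snd p] G)" using I(1) by blast
  then obtain f2 where f2: "\<And>p. p \<in> (Basis :: 'a set) \<times> (Basis :: 'a set) \<Longrightarrow> bnd (f2 p) (iter_deriv [fst p, snd p] G)" by metis
  define c2 where "c2 = (\<Sum>p\<in>Basis \<times> Basis. f2 p)"
  have f2c: "0 \<le> f2 p" "f2 p \<le> c2" if "p \<in> Basis \<times> Basis" for p
    using bnd_nonneg[OF f2] that unfolding c2_def by (auto intro!: member_le_sum)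
  have c2: "\<bar>iter_deriv [b, b'] G x\<bar> \<le> c2" if "b \<in> Basis" "b' \<in> Basis" for b b' x
    using bndD[OF f2[of "(b, b')"], of x] f2c[of "(b, b')"] that by auto
  obtain b0 :: 'a where b0: "b0 \<in> Basis" using nonempty_Basis by blast
  have c10: "0 \<le> c1" and c20: "0 \<le> c2" using f1c[OF b0] f2c[of "(b0, b0)"] b0 by auto
  have A1: "\<And>x. (G has_derivative (\<lambda>v. iter_deriv [v] G x)) (at x)" using I(3)[of "[]"] by simp
  have d1: "\<bar>G x - G y\<bar> \<le> DIM('a) * c1 * norm (x - y)" for x y
    using gradient_bound(2)[where H=G, OF A1 c1 c10] by simp
  have d2: "\<bar>iter_deriv [b] G x - iter_deriv [b] G y\<bar> \<le> DIM('a) * c2 * norm (x - y)" if "b \<in> Basis" for b x y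
    using gradient_bound(2)[where H="iter_deriv [b] G", OF I(3) c2[OF _ that] c20] by simp
  have d3: "\<bar>Dlt G x y\<bar> \<le> 2 * DIM('a) * (DIM('a) * c2) * (norm y)\<^sup>2" for x y
    using second_difference_bound[where H=G, OF A1 d2] c20 by simp
  define C where "C = max c0 (max (DIM('a) * c1) (2 * DIM('a) * (DIM('a) * c2)))"
  have "c0 \<le> C" "DIM('a) * c1 \<le> C" "2 * DIM('a) * (DIM('a) * c2) \<le> C" by (auto simp: C_def)
  moreover have "0 \<le> C" using bnd_nonneg[OF c0] by (simp add: C_def)
  moreover have "\<bar>G x - G y\<bar> \<le> C * norm (x - y)" for x y
    by (rule order_trans[OF d1 mult_right_mono]) (simp_all add: C_def)
  moreover have "\<bar>Dlt G x y\<bar> \<le> C * (norm y)\<^sup>2" for x y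
    by (rule order_trans[OF d3 mult_right_mono]) (simp_all add: C_def)
  moreover have "bnd C G" using c0 by (auto simp: bnd_def C_def intro: order_trans)
  ultimately show ?thesis by blast
qed

lemma compact_radius:
  assumes "compact (K :: 'a::real_normed_vector set)"
  obtains R where "0 \<le> R" "\<And>x. x \<in> K \<Longrightarrow> norm x \<le> R"
proof -
  obtain R where R: "\<forall>x\<in>K. norm x \<le> R" using compact_imp_bounded[OF assms] by (auto simp: bounded_iff)
  show thesis by (rule that[of "max R 0"]) (use R in auto)
qed

lemma smooth_nice:
  fixes F :: "real^'d \<Rightarrow> real"
  assumes "smooth_fun F" "\<And>x. R < norm x \<Longrightarrow> F x = 0" "0 \<le> R"
  shows "\<exists>C. nice R C F"
  using smooth_compact_bounds[OF assms(1), of "cball 0 R"] assms by (auto simp: nice_def)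

section \<open>Density of the polynomial cutoffs\<close>

lemma bump_nice: "real_polynomial_function q \<Longrightarrow> 0 \<le> R \<Longrightarrow> \<exists>C. nice R C (bump R q :: real^'d \<Rightarrow> real)"
  by (intro smooth_nice SM_smooth SM_bump bump_supp)

text \<open>Divide F by the cutoff of radius R + 1, approximate the quotient by a polynomial, and
  multiply back: the cutoff is at most 1, so the error does not grow. The extra unit of radius keeps
  the divisor positive on the support of F.\<close>

lemma bump_dense:
  fixes F :: "real^'d \<Rightarrow> real"
  assumes F: "continuous_on UNIV F" "\<And>x. R < norm x \<Longrightarrow> F x = 0" and R: "0 \<le> R" and \<delta>: "0 < \<delta>"
  shows "\<exists>q. real_polynomial_function q \<and> (\<forall>x. \<bar>F x - bump (R + 1) q x\<bar> \<le> \<delta>)"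
proof -
  define cut where "cut x = flat_exp 0 ((R + 1)\<^sup>2 - x \<bullet> x)" for x :: "real^'d"
  have cutpos: "0 < cut x" if "norm x < R + 1" for x
  proof -
    have "(norm x)\<^sup>2 < (R + 1)\<^sup>2" using that by (intro power_strict_mono) auto
    then show ?thesis by (simp add: cut_def flat0_range(3) power2_norm_eq_inner)
  qed
  have cutc: "continuous_on S cut" for S
    unfolding cut_def[abs_def] by (rule continuous_on_compose2[OF flat_cont[of UNIV]]) (auto intro!: continuous_intros)
  \<comment> \<open>Outside the ball of radius R the quotient is 0, also where the cutoff vanishes,
    by the convention 0/0 = 0. Two overlapping open sets therefore give continuity
    everywhere.\<close>
  define g where "g x = F x / cut x" for x
  have "continuous_on (ball 0 (R + 1) \<union> - cball 0 R) g"
  proof (rule continuous_on_open_Un)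
    show "continuous_on (ball 0 (R + 1)) g"
      unfolding g_def by (intro continuous_on_divide continuous_on_subset[OF F(1)] cutc) (use cutpos in force)+
    show "continuous_on (- cball 0 R) g"
      by (rule continuous_on_eq[of _ "\<lambda>_. 0"]) (use F(2) in \<open>auto simp: g_def\<close>)
  qed auto
  moreover have "ball 0 (R + 1) \<union> - cball 0 R = (UNIV :: (real^'d) set)" by auto
  ultimately have gc: "continuous_on UNIV g" by simp
  obtain q where q: "real_polynomial_function q" "\<And>x. x \<in> cball 0 (R + 1) \<Longrightarrow> \<bar>g x - q x\<bar> < \<delta>"
    using Stone_Weierstrass_real_polynomial_function[of "cball 0 (R + 1)" g \<delta>] \<delta> continuous_on_subset[OF gc] by (metis compact_cball subset_UNIV)
  have "\<bar>F x - bump (R + 1) q x\<bar> \<le> \<delta>" for x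
  proof (cases "norm x < R + 1")
    case True
    have "F x - bump (R + 1) q x = (g x - q x) * cut x"
      using cutpos[OF True] by (simp add: g_def bump_def cut_def field_simps)
    also have "\<bar>\<dots>\<bar> \<le> \<delta> * 1"
      unfolding abs_mult using q(2)[of x] True flat0_range \<delta> by (intro mult_mono) (auto simp: cut_def)
    finally show ?thesis by simp
  next
    case False
    then have "(R + 1)\<^sup>2 \<le> (norm x)\<^sup>2" using R by (intro power_mono) auto
    then have "bump (R + 1) q x = 0" by (simp add: bump_def flat_exp_def power2_norm_eq_inner)
    then show ?thesis using F(2)[of x] False \<delta> by simp
  qed
  then show ?thesis using q(1) by blast
qed

text \<open>A measurable function is an almost everywhere limit of continuous ones; clipping and
  localising these gives L^1 convergence, after which uniform approximation applies. Each of the two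
  steps costs one unit of radius, whence R + 2.\<close>

lemma L1_dense:
  fixes f :: "real^'d \<Rightarrow> real"
  assumes f[measurable]: "f \<in> borel_measurable borel" and fb: "bnd 1 f" and R: "0 \<le> R" and \<delta>: "0 < \<delta>"
  shows "\<exists>q. real_polynomial_function q \<and> (LBINT x. \<bar>f x * indicator (cball 0 R) x - bump (R + 2) q x\<bar>) \<le> \<delta>"
proof -
  have cb[measurable]: "cball (0 :: real^'d) r \<in> sets borel" for r by simp
  have "f \<in> borel_measurable lebesgue" using f by (simp add: borel_measurable_if_D measurable_completion)
  then have "f measurable_on cball 0 R" by (rule lebesgue_measurable_imp_measurable_on) auto
  then obtain N g where N: "negligible N" and g: "\<And>n. continuous_on UNIV (g n)"
    and lim: "\<And>x. x \<notin> N \<Longrightarrow> (\<lambda>n. g n x) \<longlonglongrightarrow> (if x \<in> cball 0 R then f x else 0)"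
    unfolding measurable_on_def by blast
  \<comment> \<open>Localisation by \<kappa> and clipping to [-1, 1] provide the integrable
    majorant. Neither changes the limit, since \<kappa> is 1 on the ball of radius R and |f| \<le>
    1.\<close>
  define \<kappa> where "\<kappa> x = max 0 (min 1 (R + 1 - norm x))" for x :: "real^'d"
  define F where "F n x = \<kappa> x * max (- 1) (min 1 (g n x))" for n x
  have \<kappa>r: "0 \<le> \<kappa> x" "\<kappa> x \<le> 1" for x by (auto simp: \<kappa>_def)
  have Fc: "continuous_on UNIV (F n)" for n
    unfolding F_def \<kappa>_def by (intro continuous_intros g)
  have Fm[measurable]: "F n \<in> borel_measurable borel" for n by (rule borel_measurable_continuous_onI[OF Fc])
  have Fs: "F n x = 0" if "R + 1 < norm x" for n x using that by (simp add: F_def \<kappa>_def)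
  have Fb: "\<bar>F n x\<bar> \<le> 1" for n x
  proof -
    have "\<bar>max (- 1) (min 1 (g n x))\<bar> \<le> 1" by (auto simp: max_def min_def)
    then have "\<bar>\<kappa> x\<bar> * \<bar>max (- 1) (min 1 (g n x))\<bar> \<le> 1 * 1" using \<kappa>r[of x] by (intro mult_mono) auto
    then show ?thesis by (simp add: F_def abs_mult)
  qed
  have iB: "integrable lborel (\<lambda>x :: real^'d. c * indicator (cball 0 r) x :: real)" for c r
    by (intro integrable_cmult integrable_real_indicator) (auto intro: emeasure_lborel_cball_finite[unfolded infinity_ennreal_def])
  have fb': "\<bar>f x\<bar> \<le> 1" for x using bndD[OF fb] .
  have bd: "\<bar>f x * indicator (cball 0 R) x - F n x\<bar> \<le> 2 * indicator (cball 0 (R + 1)) x" for x n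
    using Fb[of n x] Fs[of x n] fb'[of x] by (auto split: split_indicator)
  have "AE x in lebesgue. x \<notin> N" using N by (simp add: negligible_iff_null_sets AE_not_in)
  then have "AE x in lborel. x \<notin> N" by (simp only: AE_completion_iff)
  then have AEN: "AE x in lborel. (\<lambda>n. g n x) \<longlonglongrightarrow> (if x \<in> cball 0 R then f x else 0)"
    by (rule eventually_mono) (rule lim)
  have "(\<lambda>n. LBINT x. \<bar>f x * indicator (cball 0 R) x - F n x\<bar>) \<longlonglongrightarrow> (\<integral>x. 0 \<partial>(lborel :: (real^'d) measure))"
  proof (rule integral_dominated_convergence[where w="\<lambda>x. 2 * indicator (cball 0 (R + 1)) x"])
    show "integrable lborel (\<lambda>x :: real^'d. 2 * indicator (cball 0 (R + 1)) x :: real)" by (rule iB)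
    show "AE x in lborel. (\<lambda>n. \<bar>f x * indicator (cball 0 R) x - F n x\<bar>) \<longlonglongrightarrow> 0"
      using AEN
    proof eventually_elim
      fix x assume l: "(\<lambda>n. g n x) \<longlonglongrightarrow> (if x \<in> cball 0 R then f x else 0)"
      let ?l = "if x \<in> cball 0 R then f x else 0"
      have "(\<lambda>n. \<bar>f x * indicator (cball 0 R) x - F n x\<bar>) \<longlonglongrightarrow> \<bar>f x * indicator (cball 0 R) x - \<kappa> x * max (- 1) (min 1 ?l)\<bar>"
        unfolding F_def by (intro tendsto_intros l)
      moreover have "f x * indicator (cball 0 R) x - \<kappa> x * max (- 1) (min 1 ?l) = 0"
        using fb'[of x] by (auto simp: \<kappa>_def abs_le_iff split: split_indicator)
      ultimately show "(\<lambda>n. \<bar>f x * indicator (cball 0 R) x - F n x\<bar>) \<longlonglongrightarrow> 0" by simp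
    qed
  qed (use bd in auto)
  then have "(\<lambda>n. LBINT x. \<bar>f x * indicator (cball 0 R) x - F n x\<bar>) \<longlonglongrightarrow> 0" by simp
  then obtain n where n: "(LBINT x. \<bar>f x * indicator (cball 0 R) x - F n x\<bar>) < \<delta> / 2"
    using eventually_happens'[OF sequentially_bot order_tendstoD(2)[of _ 0 sequentially "\<delta> / 2"]] \<delta> by force
  define V where "V = measure lborel (cball (0 :: real^'d) (R + 2))"
  have V: "0 \<le> V" by (simp add: V_def)
  obtain q where q: "real_polynomial_function q" "\<And>x. \<bar>F n x - bump (R + 1 + 1) q x\<bar> \<le> \<delta> / (2 * (V + 1))"
    using bump_dense[of "F n" "R + 1" "\<delta> / (2 * (V + 1))", OF Fc Fs] R \<delta> V by auto
  have q2: "\<bar>F n x - bump (R + 2) q x\<bar> \<le> \<delta> / (2 * (V + 1)) * indicator (cball 0 (R + 2)) x" for x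
    using q(2)[of x] Fs[of x n] bump_supp[of "R + 2" x q] R by (auto simp: add.assoc split: split_indicator)
  have bm[measurable]: "bump (R + 2) q \<in> borel_measurable borel"
  proof -
    obtain C where "nice (R + 2) C (bump (R + 2) q)" using bump_nice[OF q(1), of "R + 2"] R by auto
    then show ?thesis by (rule nice_meas)
  qed
  have i1: "integrable lborel (\<lambda>x. \<bar>f x * indicator (cball 0 R) x - F n x\<bar>)"
    by (rule integrable_boundL[OF iB[of 2 "R + 1"]]) (use bd in auto)
  have i2: "integrable lborel (\<lambda>x. \<bar>F n x - bump (R + 2) q x\<bar>)"
  proof (rule integrable_boundL[OF iB[of "\<delta> / (2 * (V + 1))" "R + 2"]])
    show "AE x in lborel. norm \<bar>F n x - bump (R + 2) q x\<bar> \<le> norm (\<delta> / (2 * (V + 1)) * indicator (cball 0 (R + 2)) x)"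
      by (rule AE_I2) (simp only: real_norm_def abs_abs order_trans[OF q2 abs_ge_self])
  qed measurable
  have i3: "integrable lborel (\<lambda>x. \<bar>f x * indicator (cball 0 R) x - bump (R + 2) q x\<bar>)"
    by (rule integrable_boundL[OF Bochner_Integration.integrable_add[OF i1 i2]]) auto
  have "(LBINT x. \<bar>f x * indicator (cball 0 R) x - bump (R + 2) q x\<bar>) \<le> (LBINT x. \<bar>f x * indicator (cball 0 R) x - F n x\<bar> + \<bar>F n x - bump (R + 2) q x\<bar>)"
    by (intro integral_mono i3 Bochner_Integration.integrable_add i1 i2) auto
  also have "\<dots> = (LBINT x. \<bar>f x * indicator (cball 0 R) x - F n x\<bar>) + (LBINT x. \<bar>F n x - bump (R + 2) q x\<bar>)"
    by (rule Bochner_Integration.integral_add[OF i1 i2])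
  also have "(LBINT x. \<bar>F n x - bump (R + 2) q x\<bar>) \<le> (LBINT x. \<delta> / (2 * (V + 1)) * indicator (cball (0 :: real^'d) (R + 2)) x)"
    by (intro integral_mono i2 iB q2)
  also have "\<dots> = \<delta> / (2 * (V + 1)) * V" by (simp add: V_def)
  also have "\<dots> \<le> \<delta> / 2" using V \<delta> by (simp add: field_simps)
  finally show ?thesis using n q(1) by (intro exI[of _ q]) auto
qed

section \<open>Existence of the macroscopic evolution\<close>

lemma transl_inv_lborel: "transl_inv (lborel :: (real^'d) measure)"
proof -
  have "distr lborel lborel (\<lambda>x. x + a) = (lborel :: (real^'d) measure)" for a
  proof -
    have "distr lborel lborel (\<lambda>x. x + a) = distr lborel borel ((+) a)" by (rule distr_cong) (auto simp: add.commute)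
    then show ?thesis by (simp add: lborel_distr_plus)
  qed
  then show ?thesis
    by (auto simp: transl_inv_def transl_inv_axioms_def sigma_finite_lborel)
qed

lemma transl_inv_count: "transl_inv (count_space (UNIV :: (int^'d) set))"
proof -
  have "distr (count_space UNIV) (count_space UNIV) (\<lambda>x. x + a) = count_space (UNIV :: (int^'d) set)" for a
    by (rule distr_bij_count_space) (auto intro!: bijI' exI[of _ "_ - a"])
  then show ?thesis
    by (auto simp: transl_inv_def transl_inv_axioms_def sf_count)
qed

lemma (in walk) semi_abs:
  assumes "bnd C F" "0 \<le> t"
  shows "\<bar>semi p s t F x\<bar> \<le> semi p s t (\<lambda>x. \<bar>F x\<bar>) x"
proof -
  have a: "bnd C (\<lambda>x. \<bar>F x\<bar>)" "bnd C (\<lambda>x. - F x)" using assms(1) by (auto simp: bnd_def)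
  have "semi p s t F x \<le> semi p s t (\<lambda>x. \<bar>F x\<bar>) x" by (rule semi_mono[OF assms(1) a(1) _ assms(2)]) auto
  moreover have "semi p s t (\<lambda>x. - F x) x \<le> semi p s t (\<lambda>x. \<bar>F x\<bar>) x" by (rule semi_mono[OF a(2) a(1) _ assms(2)]) auto
  moreover have "semi p s t (\<lambda>x. - F x) x = - semi p s t F x"
    using semi_lin[OF assms(1) assms(1), of s t "- 1" 0 x] by simp
  ultimately show ?thesis by linarith
qed

context stable
begin

text \<open>Bound on the expected \<open>psi R\<close> up to time T for a walk started in the ball
  of radius r: the initial value plus T times the bound on the generator.\<close>

definition tl :: "real \<Rightarrow> real \<Rightarrow> real \<Rightarrow> real" where
  "tl R r T = (r / R)\<^sup>2 + 10 * R powr (- (\<alpha> - kap)) * C0 * T"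

lemma tl_tendsto: "((\<lambda>R. tl R r T) \<longlongrightarrow> 0) at_top"
proof -
  have "((\<lambda>R. (r / R)\<^sup>2 + 10 * R powr (- (\<alpha> - kap)) * C0 * T) \<longlongrightarrow> 0\<^sup>2 + 10 * 0 * C0 * T) at_top"
    by (intro tendsto_intros tendsto_divide_0[OF tendsto_const] tendsto_neg_powr filterlim_at_top_imp_at_infinity filterlim_ident)
      (use kap in auto)
  then show ?thesis by (simp add: tl_def[abs_def])
qed

lemma tl_nonneg: "0 \<le> T \<Longrightarrow> 0 \<le> tl R r T"
  unfolding tl_def using C0_nonneg by (intro add_nonneg_nonneg mult_nonneg_nonneg) auto

lemma sn_psi_le:
  assumes "0 < n" "1 \<le> R" "0 \<le> t" "t \<le> T" "norm x \<le> r"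
  shows "sn n t (psi R) x \<le> tl R r T"
proof -
  interpret w: walk "pn n" by (rule pn_walk)
  have "\<bar>sn n t (psi R) x - sn n 0 (psi R) x\<bar> \<le> 10 * R powr (- (\<alpha> - kap)) * C0 * (t - 0)"
    by (rule w.semi_time_lipschitz[OF psi_bnd psi_gn]) (use assms in auto)
  also have "\<dots> \<le> 10 * R powr (- (\<alpha> - kap)) * C0 * T" using assms C0_nonneg by (intro mult_left_mono) auto
  finally show ?thesis using psi_le[OF assms(5), of R] assms(2) by (simp add: w.semi_0 tl_def)
qed

text \<open>Duality moves the semigroup from g to \<open>psi R\<close>, where it is small on the
  support of g. The measure and the map \<phi> are free so that the estimate covers both integrals
  over R^d and sums over the lattice.\<close>

lemma tail_bound:
  fixes N :: "'a::ab_group_add measure" and g :: "real^'d \<Rightarrow> real"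
  assumes N: "transl_inv N" and n: "0 < n" and R: "1 \<le> R" and t: "0 \<le> t" "t \<le> T"
    and \<phi>: "\<And>z y. \<phi> (z + sh y) = \<phi> z + shiftn n y" and sh: "odd_shift sh"
    and m: "\<phi> \<in> measurable N borel"
    and g: "integrable N (\<lambda>z. g (\<phi> z))" "bnd C g" "\<And>x. 0 \<le> g x" "\<And>x. r < norm x \<Longrightarrow> g x = 0"
  shows "(\<integral>z. sn n t g (\<phi> z) * psi R (\<phi> z) \<partial>N) \<le> tl R r T * (\<integral>z. g (\<phi> z) \<partial>N)" (is ?g1)
    and "integrable N (\<lambda>z. sn n t g (\<phi> z) * psi R (\<phi> z))" (is ?g2)
    and "integrable N (\<lambda>z. sn n t g (\<phi> z))" (is ?g3)
proof -
  interpret N: transl_inv N by fact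
  interpret w: walk "pn n" by (rule pn_walk)
  note [measurable] = m
  have bg: "bnd C (\<lambda>z. g (\<phi> z))" using g(2) by (auto simp: bnd_def)
  have bp: "bnd 1 (\<lambda>z. psi R (\<phi> z))" using psi_bnd[of R] by (auto simp: bnd_def)
  have mp: "(\<lambda>z. psi R (\<phi> z)) \<in> borel_measurable N" by measurable
  note sd = N.semi_dual[where s=sh and t=t, OF pn_walk[of n] sh g(1) bg mp bp]
  have f: "semi (pn n) sh t (\<lambda>z. g (\<phi> z)) z = sn n t g (\<phi> z)" "semi (pn n) sh t (\<lambda>z. psi R (\<phi> z)) z = sn n t (psi R) (\<phi> z)" for z
    by (rule semi_factor[of \<phi> sh "shiftn n", OF \<phi>])+
  show ?g2 using sd(2) by (simp add: f)
  show ?g3 using N.semi_integrable_N[where s=sh and t=t, OF pn_walk[of n] sh g(1) bg] by (simp add: f[abs_def])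
  have "(\<integral>z. sn n t g (\<phi> z) * psi R (\<phi> z) \<partial>N) = (\<integral>z. g (\<phi> z) * sn n t (psi R) (\<phi> z) \<partial>N)"
    using sd(1) by (simp add: f)
  also have "\<dots> \<le> (\<integral>z. g (\<phi> z) * tl R r T \<partial>N)"
  proof (rule integral_mono)
    show "integrable N (\<lambda>z. g (\<phi> z) * tl R r T)" using g(1) by simp
    have mm: "(\<lambda>z. sn n t (psi R) (\<phi> z)) \<in> borel_measurable N"
      using N.semi_meas(1)[OF mp, of "pn n" sh t] by (simp add: f[abs_def])
    show "integrable N (\<lambda>z. g (\<phi> z) * sn n t (psi R) (\<phi> z))"
    proof (rule integrable_boundL[OF integrable_abs[OF g(1)]])
      show "AE z in N. norm (g (\<phi> z) * sn n t (psi R) (\<phi> z)) \<le> norm \<bar>g (\<phi> z)\<bar>"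
        using bndD[OF w.semi_bnd[OF psi_bnd t(1)]] by (auto simp: abs_mult intro!: AE_I2 mult_left_le)
    qed (use mm g(1) in auto)
    show "g (\<phi> z) * sn n t (psi R) (\<phi> z) \<le> g (\<phi> z) * tl R r T" for z
    proof (cases "r < norm (\<phi> z)")
      case False
      then show ?thesis using sn_psi_le[OF n R t, of "\<phi> z" r] g(3) by (intro mult_left_mono) auto
    qed (use g(4) in simp)
  qed
  finally show ?g1 by (simp add: mult.commute)
qed

lemmas tail_lborel = tail_bound[where \<phi>="\<lambda>x. x", OF transl_inv_lborel _ _ _ _ refl shiftn_odd, simplified]

lemma tail_lattice:
  fixes g :: "real^'d \<Rightarrow> real"
  assumes n: "0 < n" and R: "1 \<le> R" and t: "0 \<le> t" "t \<le> T"
    and g: "lsummable (\<lambda>z. g (shiftn n z))" "bnd C g" "\<And>x. 0 \<le> g x" "\<And>x. r < norm x \<Longrightarrow> g x = 0"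
  shows "(LSUM z. sn n t g (shiftn n z) * psi R (shiftn n z)) \<le> tl R r T * (LSUM z. g (shiftn n z))"
    and "lsummable (\<lambda>z. sn n t g (shiftn n z) * psi R (shiftn n z))"
    and "lsummable (\<lambda>z. sn n t g (shiftn n z))"
  using tail_bound[where \<phi>="shiftn n" and sh="\<lambda>y. y", OF transl_inv_count n R t shiftn_add _ _ g] by (auto simp: odd_shift_def)

end

lemma integrable_indicator_cball:
  "integrable lborel (\<lambda>x :: real^'d. c * indicator (cball 0 r) x :: real)"
  by (intro integrable_cmult integrable_real_indicator) (auto intro: emeasure_lborel_cball_finite[unfolded infinity_ennreal_def])

section \<open>Local L^1 compactness of the evolved initial profiles\<close>

locale stable_init = stable h \<alpha> for h :: "real^'d \<Rightarrow> real" and \<alpha> +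
  fixes u0 :: "real^'d \<Rightarrow> real" and T :: real
  assumes u0_meas: "u0 \<in> borel_measurable lborel"
    and u0_range: "\<forall>x. 0 \<le> u0 x \<and> u0 x \<le> 1"
    and T: "T > 0"
begin

lemma u0_m[measurable]: "u0 \<in> borel_measurable borel" using u0_meas by simp

lemma u0_bnd: "bnd 1 u0" using u0_range by (auto simp: bnd_def)

text \<open>The n-th walk semigroup acts on the profile as a function on R^d, not on its grid
  values, which would be meaningless for a merely measurable profile.\<close>

abbreviation un :: "nat \<Rightarrow> real \<Rightarrow> real^'d \<Rightarrow> real" where
  "un n t \<equiv> sn n t u0"

lemma un_range: "0 \<le> t \<Longrightarrow> 0 \<le> un n t x \<and> un n t x \<le> 1"
proof -
  assume t: "0 \<le> t"
  interpret w: walk "pn n" by (rule pn_walk)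
  have "0 \<le> un n t x" by (rule w.semi_nonneg[OF _ u0_bnd t]) (use u0_range in auto)
  moreover have "\<bar>un n t x\<bar> \<le> 1" by (rule bndD[OF w.semi_bnd[OF u0_bnd t]])
  ultimately show ?thesis by auto
qed

lemma sn_meas:
  fixes F :: "real^'d \<Rightarrow> real"
  assumes "F \<in> borel_measurable borel"
  shows "sn n t F \<in> borel_measurable borel" (is ?g1) "(\<lambda>(t, x). sn n t F x) \<in> borel_measurable (lborel \<Otimes>\<^sub>M lborel)" (is ?g2)
proof -
  interpret l: transl_inv "lborel :: (real^'d) measure" by (rule transl_inv_lborel)
  have F: "F \<in> borel_measurable lborel" using assms by simp
  show ?g1 using l.semi_meas(1)[OF F, of "pn n" "shiftn n" t] by simp
  have "sets (lborel \<Otimes>\<^sub>M lborel) = sets (borel \<Otimes>\<^sub>M (lborel :: (real^'d) measure))" by (intro sets_pair_measure_cong) auto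
  then show ?g2
    using l.semi_meas(2)[OF F, of "pn n" "shiftn n"] by (simp cong: measurable_cong_sets)
qed

text \<open>Generators cannot be compared on a merely measurable \<open>u0\<close>. A smooth F close
  to \<open>u0\<close> in L^1 of a large ball replaces it; duality brings the evolution onto the
  indicator of the small ball, and the tail bound absorbs what F misses outside.\<close>

lemma un_local_cauchy:
  assumes r: "0 \<le> r" and \<epsilon>: "0 < \<epsilon>"
  shows "\<exists>N>0. \<forall>n\<ge>N. \<forall>m\<ge>N. \<forall>t\<in>{0..T}. (LBINT x. indicator (cball 0 r) x * \<bar>un n t x - un m t x\<bar>) \<le> \<epsilon>"
proof -
  interpret l: transl_inv "lborel :: (real^'d) measure" by (rule transl_inv_lborel)
  have cb[measurable]: "cball (0 :: real^'d) r \<in> sets borel" for r by simp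
  \<comment> \<open>The budget: \<epsilon>/4 for each of the two replacements of \<open>u0\<close>
    by F (\<epsilon>/8 from the L^1 distance, twice \<epsilon>/16 from the tail) and \<epsilon>/2
    for comparing the two walks on F.\<close>
  define V where "V = measure lborel (cball (0 :: real^'d) r)"
  have V: "0 \<le> V" by (simp add: V_def)
  have "\<forall>\<^sub>F R in at_top. tl R r T < \<epsilon> / (16 * (V + 1))"
    by (rule order_tendstoD(2)[OF tl_tendsto]) (use \<epsilon> V in auto)
  then obtain R1 where R1: "\<forall>R\<ge>R1. tl R r T < \<epsilon> / (16 * (V + 1))" by (auto simp: eventually_at_top_linorder)
  define R where "R = max 1 R1"
  have R: "1 \<le> R" "tl R r T < \<epsilon> / (16 * (V + 1))" using R1 by (auto simp: R_def)
  obtain q where q: "real_polynomial_function q" "(LBINT x. \<bar>u0 x * indicator (cball 0 R) x - bump (R + 2) q x\<bar>) \<le> \<epsilon> / 8"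
    using L1_dense[OF u0_m u0_bnd, of R "\<epsilon> / 8"] R \<epsilon> by auto
  define F where "F = bump (R + 2) q"
  obtain C where F: "nice (R + 2) C F" using bump_nice[OF q(1), of "R + 2"] R by (auto simp: F_def)
  have Fm[measurable]: "F \<in> borel_measurable borel" by (rule nice_meas[OF F])
  have Fb: "bnd C F" using F by (simp add: nice_def)
  have C: "0 \<le> C" by (rule bnd_nonneg[OF Fb])
  obtain e where e: "e \<longlonglongrightarrow> 0" "\<forall>n>0. \<forall>x. \<bar>gn n F x - frac_gen h F x\<bar> \<le> e n" using gn_tendsto[OF F] by blast
  have "\<forall>\<^sub>F n in sequentially. e n < \<epsilon> / (4 * (V + 1) * (T + 1))"
    by (rule order_tendstoD(2)[OF e(1)]) (use \<epsilon> V T in auto)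
  then obtain N0 where N0: "\<And>n. n \<ge> N0 \<Longrightarrow> e n < \<epsilon> / (4 * (V + 1) * (T + 1))" by (auto simp: eventually_sequentially)
  have dist: "(LBINT x. indicator (cball 0 r) x * \<bar>un n t x - sn n t F x\<bar>) \<le> \<epsilon> / 4"
    and dint: "integrable lborel (\<lambda>x. indicator (cball 0 r) x * \<bar>un n t x - sn n t F x\<bar>)"
    if n: "0 < n" and t: "0 \<le> t" "t \<le> T" for n t
  proof -
    interpret w: walk "pn n" by (rule pn_walk)
    let ?D = "\<lambda>x. \<bar>u0 x - F x\<bar>"
    have bD: "bnd (1 + C) ?D" unfolding bnd_def
    proof
      fix x show "\<bar>?D x\<bar> \<le> 1 + C" using bndD[OF u0_bnd, of x] bndD[OF Fb, of x] by linarith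
    qed
    have bD': "bnd (1 + C) (\<lambda>x. u0 x - F x)" using bD by (simp add: bnd_def)
    have mD: "?D \<in> borel_measurable lborel" by measurable
    let ?g = "indicator (cball 0 r) :: real^'d \<Rightarrow> real"
    have gi: "integrable lborel ?g" using integrable_indicator_cball[of 1 r] by simp
    have gb: "bnd 1 ?g" by (auto simp: bnd_def split: split_indicator)
    have [measurable]: "sn n t ?D \<in> borel_measurable borel" "sn n t F \<in> borel_measurable borel" "un n t \<in> borel_measurable borel" "sn n t ?g \<in> borel_measurable borel"
      by (auto intro!: sn_meas)
    have pw: "\<bar>un n t x - sn n t F x\<bar> \<le> sn n t ?D x" for x
      using w.semi_abs[OF bD' t(1)] w.semi_diff[OF u0_bnd Fb] by simp
    have sb: "\<bar>sn n t ?D x\<bar> \<le> 1 + C" for x by (rule bndD[OF w.semi_bnd[OF bD t(1)]])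
    have i1: "integrable lborel (\<lambda>x. ?g x * sn n t ?D x)"
      by (rule integrable_boundL[OF integrable_indicator_cball[of "1 + C" r]])
        (use sb C in \<open>auto simp: abs_mult split: split_indicator intro!: AE_I2\<close>)
    show dint: "integrable lborel (\<lambda>x. ?g x * \<bar>un n t x - sn n t F x\<bar>)"
      by (rule integrable_boundL[OF i1])
        (use pw in \<open>auto simp: abs_mult split: split_indicator intro!: AE_I2 order_trans[OF _ abs_ge_self]\<close>)
    have "(LBINT x. ?g x * \<bar>un n t x - sn n t F x\<bar>) \<le> (LBINT x. ?g x * sn n t ?D x)"
      by (intro integral_mono dint i1 mult_left_mono pw) auto
    also have "\<dots> = (LBINT x. sn n t ?g x * ?D x)"
      by (rule l.semi_dual(1)[OF pn_walk shiftn_odd gi gb mD bD])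
    \<comment> \<open>Outside the ball of radius R the profile is at most 1 and \<open>psi R\<close>
      at least 1/2, so the restriction of \<open>u0\<close> to the ball is paid for by twice
      \<open>psi R\<close>.\<close>
    also have "\<dots> \<le> (LBINT x. \<bar>u0 x * indicator (cball 0 R) x - F x\<bar> + 2 * (sn n t ?g x * psi R x))"
    proof (rule integral_mono)
      show "integrable lborel (\<lambda>x. sn n t ?g x * ?D x)"
        by (rule l.semi_dual(2)[OF pn_walk shiftn_odd gi gb mD bD])
      show "integrable lborel (\<lambda>x. \<bar>u0 x * indicator (cball 0 R) x - F x\<bar> + 2 * (sn n t ?g x * psi R x))"
      proof (intro Bochner_Integration.integrable_add integrable_cmult)
        show "integrable lborel (\<lambda>x. \<bar>u0 x * indicator (cball 0 R) x - F x\<bar>)"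
        proof (rule integrable_boundL[OF integrable_indicator_cball[of "1 + C" "R + 2"]])
          show "AE x in lborel. norm \<bar>u0 x * indicator (cball 0 R) x - F x\<bar> \<le> norm ((1 + C) * indicator (cball 0 (R + 2)) x)"
          proof (rule AE_I2)
            fix x :: "real^'d"
            have "\<bar>u0 x * indicator (cball 0 R) x - F x\<bar> \<le> 1 + C"
              using bndD[OF u0_bnd, of x] bndD[OF Fb, of x] by (auto split: split_indicator)
            moreover have "x \<notin> cball 0 (R + 2) \<Longrightarrow> F x = 0" using F by (simp add: nice_def)
            ultimately show "norm \<bar>u0 x * indicator (cball 0 R) x - F x\<bar> \<le> norm ((1 + C) * indicator (cball 0 (R + 2)) x)"
              by (auto split: split_indicator)
          qed
        qed measurable
        show "integrable lborel (\<lambda>x. sn n t ?g x * psi R x)"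
          by (rule tail_lborel(2)[where r=r, OF n R(1) t gi gb]) auto
      qed
      fix x
      have s: "0 \<le> sn n t ?g x" "sn n t ?g x \<le> 1"
        using w.semi_nonneg[where F="?g", OF _ gb t(1), of "shiftn n" x] bndD[OF w.semi_bnd[OF gb t(1), of "shiftn n"], of x] by auto
      have "?D x \<le> \<bar>u0 x * indicator (cball 0 R) x - F x\<bar> + 2 * psi R x"
      proof (cases "norm x \<le> R")
        case True
        then show ?thesis using psi_range[of R x] by simp
      next
        case False
        then show ?thesis using psi_ge[of R x] R u0_range[rule_format, of x] by auto
      qed
      then have "sn n t ?g x * ?D x \<le> sn n t ?g x * (\<bar>u0 x * indicator (cball 0 R) x - F x\<bar> + 2 * psi R x)"
        using s by (intro mult_left_mono) auto
      also have "\<dots> \<le> \<bar>u0 x * indicator (cball 0 R) x - F x\<bar> + 2 * (sn n t ?g x * psi R x)"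
        using s mult_right_mono[of "sn n t ?g x" 1 "\<bar>u0 x * indicator (cball 0 R) x - F x\<bar>"] by (simp add: distrib_left)
      finally show "sn n t ?g x * ?D x \<le> \<bar>u0 x * indicator (cball 0 R) x - F x\<bar> + 2 * (sn n t ?g x * psi R x)" .
    qed
    also have "\<dots> = (LBINT x. \<bar>u0 x * indicator (cball 0 R) x - F x\<bar>) + 2 * (LBINT x. sn n t ?g x * psi R x)"
    proof -
      have ia: "integrable lborel (\<lambda>x. \<bar>u0 x * indicator (cball 0 R) x - F x\<bar>)"
      proof (rule integrable_boundL[OF integrable_indicator_cball[of "1 + C" "R + 2"]])
        show "AE x in lborel. norm \<bar>u0 x * indicator (cball 0 R) x - F x\<bar> \<le> norm ((1 + C) * indicator (cball 0 (R + 2)) x)"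
        proof (rule AE_I2)
          fix x :: "real^'d"
          have "\<bar>u0 x * indicator (cball 0 R) x - F x\<bar> \<le> 1 + C"
            using bndD[OF u0_bnd, of x] bndD[OF Fb, of x] by (auto split: split_indicator)
          moreover have "x \<notin> cball 0 (R + 2) \<Longrightarrow> F x = 0" using F by (simp add: nice_def)
          ultimately show "norm \<bar>u0 x * indicator (cball 0 R) x - F x\<bar> \<le> norm ((1 + C) * indicator (cball 0 (R + 2)) x)"
            by (auto split: split_indicator)
        qed
      qed measurable
      have ib: "integrable lborel (\<lambda>x. sn n t ?g x * psi R x)"
        by (rule tail_lborel(2)[where r=r, OF n R(1) t gi gb]) auto
      show ?thesis by (subst Bochner_Integration.integral_add[OF ia integrable_cmult[OF ib]]) simp
    qed
    also have "\<dots> \<le> \<epsilon> / 8 + 2 * (tl R r T * V)"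
    proof -
      have "(LBINT x. sn n t ?g x * psi R x) \<le> tl R r T * (LBINT x. ?g x)"
        by (rule tail_lborel(1)[where r=r, OF n R(1) t gi gb]) auto
      then show ?thesis using q(2) by (simp add: F_def V_def)
    qed
    also have "tl R r T * V \<le> \<epsilon> / (16 * (V + 1)) * (V + 1)"
      using R(2) V tl_nonneg[of T R r] T by (intro mult_mono) auto
    also have "\<epsilon> / (16 * (V + 1)) * (V + 1) = \<epsilon> / 16"
    proof -
      have "X / (16 * a) * a = X / 16" if "a \<noteq> 0" for X a :: real using that by simp
      then show ?thesis by (rule) (use V in auto)
    qed
    finally show "(LBINT x. ?g x * \<bar>un n t x - sn n t F x\<bar>) \<le> \<epsilon> / 4" by simp
  qed
  have "(LBINT x. indicator (cball 0 r) x * \<bar>un n t x - un m t x\<bar>) \<le> \<epsilon>"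
    if nm: "max N0 1 \<le> n" "max N0 1 \<le> m" and t: "t \<in> {0..T}" for n m t
  proof -
    have n: "0 < n" "N0 \<le> n" and m: "0 < m" "N0 \<le> m" and t': "0 \<le> t" "t \<le> T" using nm t by auto
    let ?g = "indicator (cball 0 r) :: real^'d \<Rightarrow> real"
    define c where "c = e n + e m"
    have cb': "bnd c (\<lambda>x. gn n F x - gn m F x)" unfolding bnd_def
    proof
      fix x show "\<bar>gn n F x - gn m F x\<bar> \<le> c" using e(2)[rule_format, OF n(1), of x] e(2)[rule_format, OF m(1), of x] by (simp add: c_def)
    qed
    have sc: "\<bar>sn n t F x - sn m t F x\<bar> \<le> c * t" for x by (rule semi_compare[OF pn_walk pn_walk Fb cb' t'(1)])
    have c0: "0 \<le> c" by (rule bnd_nonneg[OF cb'])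
    have cs: "c \<le> \<epsilon> / (2 * (V + 1) * (T + 1))" 
    proof -
      have e2: "\<epsilon> / (4 * (V + 1) * (T + 1)) = \<epsilon> / (2 * (V + 1) * (T + 1)) / 2" by simp
      have half: "x < X / 2 \<Longrightarrow> y < X / 2 \<Longrightarrow> x + y \<le> X" for x y X :: real by simp
      show ?thesis unfolding c_def by (rule half) (use N0[OF n(2)] N0[OF m(2)] in \<open>simp_all only: e2\<close>)
    qed
    have [measurable]: "un n t \<in> borel_measurable borel" "un m t \<in> borel_measurable borel" by (auto intro!: sn_meas)
    note ii = Bochner_Integration.integrable_add[OF Bochner_Integration.integrable_add[OF dint[OF n(1) t'] integrable_indicator_cball[of "c * t" r]] dint[OF m(1) t']]
    have pw: "?g x * \<bar>un n t x - un m t x\<bar> \<le> ?g x * \<bar>un n t x - sn n t F x\<bar> + c * t * ?g x + ?g x * \<bar>un m t x - sn m t F x\<bar>" for x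
      using sc[of x] by (auto split: split_indicator)
    have "(LBINT x. ?g x * \<bar>un n t x - un m t x\<bar>) \<le> (LBINT x. ?g x * \<bar>un n t x - sn n t F x\<bar> + c * t * ?g x + ?g x * \<bar>un m t x - sn m t F x\<bar>)"
    proof (rule integral_mono[OF _ ii pw])
      show "integrable lborel (\<lambda>x. ?g x * \<bar>un n t x - un m t x\<bar>)"
        by (rule integrable_boundL[OF ii])
          (use order_trans[OF pw abs_ge_self] in \<open>auto intro!: AE_I2\<close>)
    qed
    also have "\<dots> = (LBINT x. ?g x * \<bar>un n t x - sn n t F x\<bar>) + c * t * V + (LBINT x. ?g x * \<bar>un m t x - sn m t F x\<bar>)"
      by (subst Bochner_Integration.integral_add[OF Bochner_Integration.integrable_add[OF dint[OF n(1) t'] integrable_indicator_cball] dint[OF m(1) t']],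
          subst Bochner_Integration.integral_add[OF dint[OF n(1) t'] integrable_indicator_cball]) (simp add: V_def)
    also have "\<dots> \<le> \<epsilon> / 4 + c * t * V + \<epsilon> / 4" using dist[OF n(1) t'] dist[OF m(1) t'] by simp
    also have "c * t * V \<le> \<epsilon> / (2 * (V + 1) * (T + 1)) * (T + 1) * (V + 1)"
      using cs c0 t' V \<epsilon> T by (intro mult_mono) auto
    also have "\<dots> = \<epsilon> / 2"
    proof -
      have "X / (2 * a * b) * b * a = X / 2" if "a \<noteq> 0" "b \<noteq> 0" for X a b :: real using that by simp
      then show ?thesis by (rule) (use V T in auto)
    qed
    finally show ?thesis by simp
  qed
  then show ?thesis by (intro exI[of _ "max N0 1"]) auto
qed

text \<open>The Cauchy estimate is uniform in time, so one subsequence with summable local L^1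
  increments converges almost everywhere at each time of [0, T].\<close>

lemma macroscopic_limit:
  "\<exists>u k. (\<lambda>(t, x). u t x) \<in> borel_measurable (lborel \<Otimes>\<^sub>M lborel) \<and> (\<forall>t x. 0 \<le> u t x \<and> u t x \<le> 1) \<and>
     (\<forall>j. 0 < k j) \<and> filterlim k at_top sequentially \<and>
     (\<forall>t\<in>{0..T}. AE x in lborel. (\<lambda>j. un (k j) t x) \<longlonglongrightarrow> u t x)"
proof -
  have cb[measurable]: "cball (0 :: real^'d) r \<in> sets borel" for r by simp
  have "\<forall>j. \<exists>N>0. \<forall>n\<ge>N. \<forall>m\<ge>N. \<forall>t\<in>{0..T}. (LBINT x. indicator (cball 0 (real j)) x * \<bar>un n t x - un m t x\<bar>) \<le> (1 / 2) ^ j"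
    by (intro allI un_local_cauchy) auto
  from choice[OF this] obtain N where N': "\<forall>j. 0 < N j \<and> (\<forall>n\<ge>N j. \<forall>m\<ge>N j. \<forall>t\<in>{0..T}. (LBINT x. indicator (cball 0 (real j)) x * \<bar>un n t x - un m t x\<bar>) \<le> (1 / 2) ^ j)"
    by blast
  then have N: "\<And>j n m t. N j \<le> n \<Longrightarrow> N j \<le> m \<Longrightarrow> t \<in> {0..T} \<Longrightarrow>
     (LBINT x. indicator (cball 0 (real j)) x * \<bar>un n t x - un m t x\<bar>) \<le> (1 / 2) ^ j" by blast
  \<comment> \<open>The partial sums make k(j) and k(j+1) both exceed N(j), and the summand j + 1
    makes the sequence positive and divergent.\<close>
  define k where "k j = Suc j + (\<Sum>i\<le>j. N i)" for j
  have kN: "N j \<le> k j" "N j \<le> k (Suc j)" for j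
  proof -
    have "N j \<le> (\<Sum>i\<le>j. N i)" by (rule member_le_sum) auto
    then show "N j \<le> k j" "N j \<le> k (Suc j)" by (auto simp: k_def)
  qed
  have kpos: "0 < k j" for j by (simp add: k_def)
  have kinf: "filterlim k at_top sequentially"
    by (rule filterlim_at_top_mono[OF filterlim_ident]) (auto simp: k_def intro!: always_eventually)
  define D where "D t j x = \<bar>un (k (Suc j)) t x - un (k j) t x\<bar>" for t j x
  have conv: "AE x in lborel. convergent (\<lambda>j. un (k j) t x)" if t: "t \<in> {0..T}" for t
  proof -
    have t0: "0 \<le> t" using t by simp
    have [measurable]: "un n t \<in> borel_measurable borel" for n by (rule sn_meas) simp
    have "AE x in lborel. x \<in> cball 0 (real i) \<longrightarrow> summable (\<lambda>j. D t (j + i) x)" for i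
    proof -
      have Dr: "0 \<le> D t j x" "D t j x \<le> 1" for j x
        using un_range[OF t0, of "k (Suc j)" x] un_range[OF t0, of "k j" x] by (auto simp: D_def)
      have int: "(\<integral>\<^sup>+x. ennreal (indicator (cball 0 (real i)) x * D t (j + i) x) \<partial>lborel) \<le> ennreal ((1 / 2) ^ (j + i))" for j
      proof -
        have "integrable lborel (\<lambda>x. indicator (cball 0 (real i)) x * D t (j + i) x)"
          by (rule integrable_boundL[OF integrable_indicator_cball[of 1 "real i"]])
            (use Dr in \<open>auto simp: D_def abs_mult split: split_indicator intro!: AE_I2\<close>)
        moreover have i2: "integrable lborel (\<lambda>x. indicator (cball 0 (real (j + i))) x * D t (j + i) x)"
          by (rule integrable_boundL[OF integrable_indicator_cball[of 1 "real (j + i)"]])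
            (use Dr in \<open>auto simp: D_def abs_mult split: split_indicator intro!: AE_I2\<close>)
        ultimately have "(LBINT x. indicator (cball 0 (real i)) x * D t (j + i) x) \<le> (LBINT x. indicator (cball 0 (real (j + i))) x * D t (j + i) x)"
          by (rule integral_mono) (use Dr in \<open>auto split: split_indicator\<close>)
        also have "\<dots> \<le> (1 / 2) ^ (j + i)" unfolding D_def by (rule N[OF _ _ t]) (use kN[of "j + i"] in auto)
        finally show ?thesis
          by (subst nn_integral_eq_integral[OF \<open>integrable lborel (\<lambda>x. indicator (cball 0 (real i)) x * D t (j + i) x)\<close>])
            (use Dr in \<open>auto intro!: ennreal_leI\<close>)
      qed
      have "(\<integral>\<^sup>+x. (\<Sum>j. ennreal (indicator (cball 0 (real i)) x * D t (j + i) x)) \<partial>lborel) =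
         (\<Sum>j. \<integral>\<^sup>+x. ennreal (indicator (cball 0 (real i)) x * D t (j + i) x) \<partial>lborel)"
        by (rule nn_integral_suminf) (simp add: D_def)
      also have "\<dots> \<le> (\<Sum>j. ennreal ((1 / 2) ^ (j + i)))" by (intro suminf_le int) auto
      also have "\<dots> = ennreal (\<Sum>j. (1 / 2) ^ (j + i))"
        by (rule suminf_ennreal2) (auto intro!: summable_ignore_initial_segment[where f="\<lambda>j. (1/2)^j"] summable_geometric)
      also have "\<dots> < top" by simp
      finally have fin: "(\<integral>\<^sup>+x. (\<Sum>j. ennreal (indicator (cball 0 (real i)) x * D t (j + i) x)) \<partial>lborel) \<noteq> \<infinity>" by auto
      have "AE x in lborel. (\<Sum>j. ennreal (indicator (cball 0 (real i)) x * D t (j + i) x)) \<noteq> \<infinity>"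
        by (rule nn_integral_PInf_AE[OF _ fin]) (simp add: D_def)
      then show ?thesis
      proof eventually_elim
        fix x assume *: "(\<Sum>j. ennreal (indicator (cball 0 (real i)) x * D t (j + i) x)) \<noteq> \<infinity>"
        show "x \<in> cball 0 (real i) \<longrightarrow> summable (\<lambda>j. D t (j + i) x)"
        proof
          assume "x \<in> cball 0 (real i)"
          then have "(\<Sum>j. ennreal (D t (j + i) x)) \<noteq> top" using * by simp
          then show "summable (\<lambda>j. D t (j + i) x)" by (intro summable_suminf_not_top Dr)
        qed
      qed
    qed
    then have "AE x in lborel. \<forall>i. x \<in> cball 0 (real i) \<longrightarrow> summable (\<lambda>j. D t (j + i) x)" by (simp add: AE_all_countable)
    then show ?thesis
    proof eventually_elim
      fix x assume *: "\<forall>i. x \<in> cball 0 (real i) \<longrightarrow> summable (\<lambda>j. D t (j + i) x)"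
      obtain i where "norm x \<le> real i" using real_arch_simple by blast
      then have "summable (\<lambda>j. D t (j + i) x)" using * by simp
      then have "summable (\<lambda>j. D t j x)" using summable_iff_shift[of "\<lambda>j. D t j x" i] by blast
      then have "summable (\<lambda>j. un (k (Suc j)) t x - un (k j) t x)" unfolding D_def by (rule summable_rabs_cancel)
      then have "convergent (\<lambda>n. \<Sum>j<n. un (k (Suc j)) t x - un (k j) t x)" by (simp add: summable_iff_convergent)
      then have "convergent (\<lambda>n. un (k n) t x - un (k 0) t x)" 
        using sum_lessThan_telescope[of "\<lambda>j. un (k j) t x"] by simp
      then have "convergent (\<lambda>n. (un (k n) t x - un (k 0) t x) + un (k 0) t x)" by (intro convergent_add convergent_const)
      then show "convergent (\<lambda>j. un (k j) t x)" by simp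
    qed
  qed
  \<comment> \<open>Where the sequence diverges the value of \<open>lim\<close> is unspecified, yet
    the formula is jointly measurable; clipping forces the range [0, 1] everywhere.\<close>
  define u where "u t x = max 0 (min 1 (lim (\<lambda>j. un (k j) t x)))" for t x
  have um: "(\<lambda>(t, x). u t x) \<in> borel_measurable (lborel \<Otimes>\<^sub>M lborel)"
  proof -
    have [measurable]: "(\<lambda>z. un n (fst z) (snd z)) \<in> borel_measurable (lborel \<Otimes>\<^sub>M lborel)" for n
      using sn_meas(2)[OF u0_m, of n] by (simp add: case_prod_beta)
    show ?thesis unfolding u_def case_prod_beta by measurable
  qed
  have "AE x in lborel. (\<lambda>j. un (k j) t x) \<longlonglongrightarrow> u t x" if t: "t \<in> {0..T}" for t
    using conv[OF t]
  proof eventually_elim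
    fix x assume "convergent (\<lambda>j. un (k j) t x)"
    then have l: "(\<lambda>j. un (k j) t x) \<longlonglongrightarrow> lim (\<lambda>j. un (k j) t x)" by (simp add: convergent_LIMSEQ_iff)
    have "0 \<le> lim (\<lambda>j. un (k j) t x)" by (rule LIMSEQ_le_const[OF l]) (use un_range t in auto)
    moreover have "lim (\<lambda>j. un (k j) t x) \<le> 1" by (rule LIMSEQ_le_const2[OF l]) (use un_range t in auto)
    ultimately show "(\<lambda>j. un (k j) t x) \<longlonglongrightarrow> u t x" using l by (simp add: u_def)
  qed
  moreover have "0 \<le> u t x \<and> u t x \<le> 1" for t x by (auto simp: u_def)
  ultimately show ?thesis using um kpos kinf by blast
qed

end

section \<open>Weak solutions\<close>

lemma borel_measurable_lborel_pair:
  fixes f :: "'a::euclidean_space \<times> 'b::euclidean_space \<Rightarrow> real"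
  assumes "f \<in> borel_measurable borel"
  shows "f \<in> borel_measurable (lborel \<Otimes>\<^sub>M lborel)"
proof -
  have "sets (lborel \<Otimes>\<^sub>M lborel) = sets (borel \<Otimes>\<^sub>M borel :: ('a \<times> 'b) measure)" by (intro sets_pair_measure_cong) auto
  then have "sets (lborel \<Otimes>\<^sub>M lborel) = sets (borel :: ('a \<times> 'b) measure)" by (simp only: borel_prod)
  then show ?thesis using assms by (simp cong: measurable_cong_sets)
qed

text \<open>The bounds are taken on space-time, so all time slices share one radius and one
  constant; dominating functions can then be chosen independently of time.\<close>

lemma test_fun_bounds:
  fixes G :: "real \<times> (real^'d) \<Rightarrow> real"
  assumes "test_fun G"
  shows "\<exists>R C. 0 \<le> R \<and> 0 \<le> C \<and> (\<forall>s. nice R C (\<lambda>x. G (s, x))) \<and>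
     (\<forall>s x. ((\<lambda>r. G (r, x)) has_real_derivative deriv (\<lambda>r. G (r, x)) s) (at s)) \<and>
     (\<forall>s x. \<bar>deriv (\<lambda>r. G (r, x)) s\<bar> \<le> C) \<and> (\<forall>s x. R < norm x \<longrightarrow> deriv (\<lambda>r. G (r, x)) s = 0) \<and>
     continuous_on UNIV (\<lambda>z. deriv (\<lambda>r. G (r, snd z)) (fst z)) \<and> continuous_on UNIV G"
proof -
  obtain K where G: "smooth_fun G" and K: "compact K" "\<And>z. z \<notin> K \<Longrightarrow> G z = 0"
    using assms by (auto simp: test_fun_def)
  note I = iter_deriv_bounded[OF G K]
  obtain C1 where C1: "0 \<le> C1" "bnd C1 G" "\<And>x y. \<bar>G x - G y\<bar> \<le> C1 * norm (x - y)" "\<And>x y. \<bar>Dlt G x y\<bar> \<le> C1 * (norm y)\<^sup>2"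
    using smooth_compact_bounds[OF G K] by blast
  obtain C2 where C2: "bnd C2 (iter_deriv [(1, 0)] G)" using I(1) by blast
  obtain R where R: "0 \<le> R" "\<And>z. z \<in> K \<Longrightarrow> norm z \<le> R" using compact_radius[OF K(1)] by blast
  have out: "(s, x) \<notin> K" if "R < norm x" for s x
    using R(2)[of "(s, x)"] norm_snd_le[of x s] that by auto
  have dd: "((\<lambda>r. G (r, x)) has_real_derivative iter_deriv [(1, 0)] G (s, x)) (at s)" for s x
  proof -
    have "(G has_derivative (\<lambda>v. iter_deriv [v] G (s, x))) (at (s, x))" using I(3)[of "[]" "(s, x)"] by simp
    moreover have "((\<lambda>r. (r, x)) has_derivative (\<lambda>r. (r, 0))) (at s)" by (auto intro!: derivative_eq_intros)
    ultimately have d: "((\<lambda>r. G (r, x)) has_derivative (\<lambda>r. iter_deriv [(r, 0)] G (s, x))) (at s)"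
      using has_derivative_compose[of "\<lambda>r. (r, x)" _ s UNIV G] by blast
    have "linear (\<lambda>r. iter_deriv [(r, 0)] G (s, x))" by (rule has_derivative_linear[OF d])
    then have "iter_deriv [(r, 0)] G (s, x) = iter_deriv [(1, 0)] G (s, x) * r" for r
      using linear_scale[of "\<lambda>r. iter_deriv [(r, 0)] G (s, x)" r 1] by simp
    then have fn: "(\<lambda>r. iter_deriv [(r, 0)] G (s, x)) = (*) (iter_deriv [(1, 0)] G (s, x))" by (rule ext)
    show ?thesis using d unfolding has_field_derivative_def fn .
  qed
  have de: "deriv (\<lambda>r. G (r, x)) s = iter_deriv [(1, 0)] G (s, x)" for s x by (rule DERIV_imp_deriv[OF dd])
  define C where "C = max C1 C2"
  have "nice R C (\<lambda>x. G (s, x))" for s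
    unfolding nice_def
  proof (intro conjI allI impI)
    show "bnd C (\<lambda>x. G (s, x))" using C1(2) by (auto simp: bnd_def C_def le_max_iff_disj)
    fix x y :: "real^'d"
    have "\<bar>G (s, x) - G (s, y)\<bar> \<le> C1 * norm (x - y)" using C1(3)[of "(s, x)" "(s, y)"] by (simp add: norm_Pair)
    then show "\<bar>G (s, x) - G (s, y)\<bar> \<le> C * norm (x - y)" by (rule order_trans) (auto simp: C_def intro!: mult_right_mono)
    have "\<bar>Dlt (\<lambda>x. G (s, x)) x y\<bar> \<le> C1 * (norm y)\<^sup>2" using C1(4)[of "(s, x)" "(0, y)"] by (simp add: Dlt_def norm_Pair)
    then show "\<bar>Dlt (\<lambda>x. G (s, x)) x y\<bar> \<le> C * (norm y)\<^sup>2" by (rule order_trans) (auto simp: C_def intro!: mult_right_mono)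
  qed (use R out K in auto)
  moreover have "0 \<le> C" using C1(1) by (simp add: C_def)
  moreover have "\<bar>deriv (\<lambda>r. G (r, x)) s\<bar> \<le> C" for s x using bndD[OF C2, of "(s, x)"] unfolding de C_def by linarith
  moreover have "deriv (\<lambda>r. G (r, x)) s = 0" if "R < norm x" for s x unfolding de by (rule I(2)) (use out[OF that] in auto)
  moreover have "continuous_on UNIV (\<lambda>z. deriv (\<lambda>r. G (r, snd z)) (fst z))" unfolding de using I(4)[of "[(1, 0)]"] by simp
  moreover have "continuous_on UNIV G" using I(4)[of "[]"] by simp
  moreover have "((\<lambda>r. G (r, x)) has_real_derivative deriv (\<lambda>r. G (r, x)) s) (at s)" for s x unfolding de by (rule dd)
  ultimately show ?thesis using R(1) by (intro exI[of _ R] exI[of _ C]) blast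
qed

context stable
begin

lemma gn_meas:
  fixes F :: "real^'d \<Rightarrow> real"
  assumes [measurable]: "F \<in> borel_measurable borel"
  shows "gn n F \<in> borel_measurable borel"
proof -
  interpret l: transl_inv "lborel :: (real^'d) measure" by (rule transl_inv_lborel)
  have [measurable]: "conv (pn n) (shiftn n) F \<in> borel_measurable borel" using l.conv_meas[of F] by simp
  show ?thesis unfolding gen_def[abs_def] by measurable
qed

lemma frac_gen_meas:
  fixes F :: "real^'d \<Rightarrow> real"
  assumes F: "nice R C F"
  shows "frac_gen h F \<in> borel_measurable borel"
  by (rule borel_measurable_LIMSEQ_real[where u="\<lambda>n. gn n F"]) (use gn_tendsto_pt[OF F] gn_meas[OF nice_meas[OF F]] in auto)

lemma gn_dual:
  fixes F g :: "real^'d \<Rightarrow> real"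
  assumes g: "integrable lborel g" "bnd C' g" and F[measurable]: "F \<in> borel_measurable borel" and Fb: "bnd C F"
  shows "(LBINT x. g x * gn n F x) = (LBINT x. gn n g x * F x)"
proof -
  interpret l: transl_inv "lborel :: (real^'d) measure" by (rule transl_inv_lborel)
  interpret w: walk "pn n" by (rule pn_walk)
  have Fm: "F \<in> borel_measurable lborel" by simp
  have [measurable]: "conv (pn n) (shiftn n) F \<in> borel_measurable borel" using l.conv_meas[OF Fm] by simp
  have gm[measurable]: "g \<in> borel_measurable borel" using g(1) by auto
  note cd = l.conv_dual[OF pn_walk[of n] shiftn_odd[of n] g Fm Fb]
  have mul: "integrable lborel (\<lambda>x. f x * H x)" if f: "integrable lborel f" and H: "H \<in> borel_measurable borel" "bnd D H" for f H :: "real^'d \<Rightarrow> real" and D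
  proof (rule integrable_boundL[OF integrable_cmult[OF integrable_abs[OF f], of D]])
    show "AE x in lborel. norm (f x * H x) \<le> norm (D * \<bar>f x\<bar>)"
      using bndD[OF H(2)] bnd_nonneg[OF H(2)] by (auto simp: abs_mult mult.commute[of D] intro!: AE_I2 mult_left_mono)
  qed (use f H in auto)
  have "(LBINT x. g x * gn n F x) = (LBINT x. g x * conv (pn n) (shiftn n) F x - rate (pn n) * (g x * F x))"
    by (rule integral_congL) (auto simp: gen_def algebra_simps)
  also have "\<dots> = (LBINT x. g x * conv (pn n) (shiftn n) F x) - rate (pn n) * (LBINT x. g x * F x)"
    by (subst integral_diffL[OF mul[OF g(1) _ w.conv_bnd[OF Fb]] integrable_cmult[OF mul[OF g(1) F Fb]]]) auto
  also have "\<dots> = (LBINT x. conv (pn n) (shiftn n) g x * F x) - rate (pn n) * (LBINT x. g x * F x)"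
    by (simp add: cd(1))
  also have "\<dots> = (LBINT x. conv (pn n) (shiftn n) g x * F x - rate (pn n) * (g x * F x))"
    by (subst integral_diffL[OF mul[OF cd(2) F Fb] integrable_cmult[OF mul[OF g(1) F Fb]]]) auto
  also have "\<dots> = (LBINT x. gn n g x * F x)"
    by (rule integral_congL) (auto simp: gen_def algebra_simps)
  finally show ?thesis .
qed

lemma nice_integrable: "nice R C F \<Longrightarrow> integrable lborel F"
  by (rule integrable_boundL[OF integrable_indicator_cball[of C R]])
    (auto simp: nice_def bnd_def nice_meas[unfolded nice_def] intro!: AE_I2 split: split_indicator intro: order_trans[OF _ abs_ge_self])

end

context stable_init
begin

text \<open>The weak formulation with \<open>gn n\<close> in place of the fractional operator:
  product rule in time at a fixed point, Fubini, and self-adjointness to move the generator from the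
  profile to G.\<close>

lemma un_identity:
  assumes n: "0 < n" and G: "test_fun G" and t: "0 \<le> t"
  shows "(LBINT x. un n t x * G (t, x)) - (LBINT x. u0 x * G (0, x)) =
     (LBINT s:{0..t}. LBINT x. un n s x * (deriv (\<lambda>r. G (r, x)) s + gn n (\<lambda>y. G (s, y)) x))" (is ?eq)
    and "set_integrable lborel {0..t} (\<lambda>s. LBINT x. un n s x * (deriv (\<lambda>r. G (r, x)) s + gn n (\<lambda>y. G (s, y)) x))" (is ?int)
proof -
  interpret w: walk "pn n" by (rule pn_walk)
  have cb[measurable]: "cball (0 :: real^'d) r \<in> sets borel" for r by simp
  obtain R C where R: "0 \<le> R" and C: "0 \<le> C" and nG: "\<And>s. nice R C (\<lambda>x. G (s, x))"
    and dG: "\<And>s x. ((\<lambda>r. G (r, x)) has_real_derivative deriv (\<lambda>r. G (r, x)) s) (at s)"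
    and bG: "\<And>s x. \<bar>deriv (\<lambda>r. G (r, x)) s\<bar> \<le> C" and sG: "\<And>s x. R < norm x \<Longrightarrow> deriv (\<lambda>r. G (r, x)) s = 0"
    and cG: "continuous_on UNIV (\<lambda>z. deriv (\<lambda>r. G (r, snd z)) (fst z))" "continuous_on UNIV G"
    using test_fun_bounds[OF G] by blast
  define Gt where "Gt s x = deriv (\<lambda>r. G (r, x)) s" for s x
  have Gb: "\<bar>G (s, x)\<bar> \<le> C" "R < norm x \<Longrightarrow> G (s, x) = 0" for s x using nG[of s] by (auto simp: nice_def bnd_def)
  have Gm[measurable]: "G \<in> borel_measurable (lborel \<Otimes>\<^sub>M lborel)"
    by (intro borel_measurable_lborel_pair borel_measurable_continuous_onI cG)
  have Gtm[measurable]: "(\<lambda>(s, x). Gt s x) \<in> borel_measurable (lborel \<Otimes>\<^sub>M lborel)"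
    using borel_measurable_lborel_pair[OF borel_measurable_continuous_onI[OF cG(1)]] by (simp add: Gt_def case_prod_beta)
  have gu: "bnd (2 * rate (pn n) * 1) (gn n u0)" by (rule w.gen_bnd[OF u0_bnd])
  have gum: "gn n u0 \<in> borel_measurable borel" by (rule gn_meas) simp
  have m1[measurable]: "(\<lambda>(s, x). sn n s (gn n u0) x) \<in> borel_measurable (lborel \<Otimes>\<^sub>M lborel)" by (rule sn_meas(2)[OF gum])
  have m2[measurable]: "(\<lambda>(s, x). un n s x) \<in> borel_measurable (lborel \<Otimes>\<^sub>M lborel)" by (rule sn_meas(2)[OF u0_m])
  \<comment> \<open>The time derivative of un n s x times G(s, x), cut to [0, t]. Integrated over
    time it gives the boundary terms, integrated over space the right-hand side.\<close>
  define H where "H s x = indicator {0..t} s * (sn n s (gn n u0) x * G (s, x) + un n s x * Gt s x)" for s x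
  have Hm: "(\<lambda>(s, x). H s x) \<in> borel_measurable (lborel \<Otimes>\<^sub>M lborel)"
  proof -
    have "(\<lambda>(s, x). H s x) = (\<lambda>z. indicator {0..t} (fst z) * ((\<lambda>(s, x). sn n s (gn n u0) x) z * G z + (\<lambda>(s, x). un n s x) z * (\<lambda>(s, x). Gt s x) z))"
      by (auto simp: H_def fun_eq_iff)
    also have "\<dots> \<in> borel_measurable (lborel \<Otimes>\<^sub>M lborel)" by measurable
    finally show ?thesis .
  qed
  define c where "c = (2 * rate (pn n) + 1) * C"
  have Hb: "\<bar>H s x\<bar> \<le> (c * indicator {0..t} s) * indicator (cball 0 R) x" for s x
  proof (cases "s \<in> {0..t} \<and> norm x \<le> R")
    case True
    then have s: "0 \<le> s" by simp
    have "\<bar>sn n s (gn n u0) x * G (s, x) + un n s x * Gt s x\<bar> \<le> \<bar>sn n s (gn n u0) x\<bar> * \<bar>G (s, x)\<bar> + \<bar>un n s x\<bar> * \<bar>Gt s x\<bar>"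
      using abs_triangle_ineq[of "sn n s (gn n u0) x * G (s, x)" "un n s x * Gt s x"] by (simp add: abs_mult)
    also have "\<dots> \<le> (2 * rate (pn n) * 1) * C + 1 * C"
      using bndD[OF w.semi_bnd[OF gu s]] bndD[OF w.semi_bnd[OF u0_bnd s]] Gb bG w.rate_nonneg C
      by (intro add_mono mult_mono) (auto simp: Gt_def)
    also have "\<dots> = c" by (simp add: c_def distrib_right)
    finally show ?thesis using True by (simp add: H_def)
  next
    case False
    then have "H s x = 0" using Gb(2)[of x s] sG[of x s] by (auto simp: H_def Gt_def split: split_indicator)
    then show ?thesis using C w.rate_nonneg by (simp add: c_def)
  qed
  have ci: "integrable lborel (\<lambda>s. c * indicator {0..t} s :: real)"
    by (intro integrable_cmult integrable_real_indicator) (auto simp: emeasure_lborel_Icc_eq)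
  have bi: "integrable lborel (indicator (cball 0 R) :: real^'d \<Rightarrow> real)" using integrable_indicator_cball[of 1 R] by simp
  note fub = fubini_dom[where f=H, OF sigma_finite_lborel sigma_finite_lborel Hm ci bi Hb]
  have pt: "(LBINT s. H s x) = un n t x * G (t, x) - u0 x * G (0, x)" for x
  proof -
    have "((\<lambda>s. un n s x * G (s, x)) has_real_derivative sn n s (gn n u0) x * G (s, x) + un n s x * Gt s x) (at s)" for s
      using DERIV_mult[OF w.semi_DERIV[OF u0_bnd, of "shiftn n" x s] dG[of x s]] by (simp add: Gt_def algebra_simps)
    moreover have "isCont (\<lambda>s. sn n s (gn n u0) x * G (s, x) + un n s x * Gt s x) s" for s
    proof -
      have "isCont (\<lambda>s. Gt s x) s"
      proof -
        have "continuous_on UNIV (\<lambda>s. (\<lambda>z. deriv (\<lambda>r. G (r, snd z)) (fst z)) (s, x))"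
          by (rule continuous_on_compose2[OF cG(1)]) (auto intro!: continuous_intros)
        then show ?thesis by (simp add: continuous_on_eq_continuous_at Gt_def)
      qed
      then show ?thesis
        by (intro continuous_intros w.semi_cont[OF gu] w.semi_cont[OF u0_bnd] DERIV_isCont[OF dG])
    qed
    ultimately have "(LBINT s. (sn n s (gn n u0) x * G (s, x) + un n s x * Gt s x) * indicator {0..t} s) = un n t x * G (t, x) - un n 0 x * G (0, x)"
      by (intro integral_FTC_Icc_real[OF t]) auto
    then show ?thesis by (simp add: H_def w.semi_0 mult.commute)
  qed
  have sec: "(LBINT x. H s x) = indicator {0..t} s * (LBINT x. un n s x * (Gt s x + gn n (\<lambda>y. G (s, y)) x))" for s
  proof (cases "s \<in> {0..t}")
    case True
    then have s: "0 \<le> s" by simp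
    have [measurable]: "un n s \<in> borel_measurable borel" by (rule sn_meas) simp
    have [measurable]: "sn n s (gn n u0) \<in> borel_measurable borel" by (rule sn_meas[OF gum])
    have [measurable]: "(\<lambda>x. G (s, x)) \<in> borel_measurable borel" by (rule nice_meas[OF nG])
    have [measurable]: "Gt s \<in> borel_measurable borel" using measurable_Pair2[OF Gtm, of s] by simp
    have [measurable]: "gn n (\<lambda>x. G (s, x)) \<in> borel_measurable borel" by (rule gn_meas) simp
    have gG: "bnd C (\<lambda>x. G (s, x))" using nG by (simp add: nice_def)
    from gn_decay[OF R C] obtain A where A': "0 \<le> A"
      "\<forall>F. nice R C F \<longrightarrow> (\<forall>n>0. \<forall>x. \<bar>gn n F x\<bar> \<le> A * wt x) \<and> (\<forall>x. \<bar>frac_gen h F x\<bar> \<le> A * wt x)" by (elim exE conjE)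
    have A: "\<bar>gn n (\<lambda>x. G (s, x)) x\<bar> \<le> A * wt x" for x
      using A'(2)[rule_format, OF nG[of s]] n by simp
    have i1: "integrable lborel (\<lambda>x. un n s x * Gt s x)"
    proof (rule integrable_boundL[OF integrable_indicator_cball[of C R]])
      have "\<bar>un n s x\<bar> * \<bar>Gt s x\<bar> \<le> 1 * C" for x using un_range[OF s, of n x] bG[of x s] by (intro mult_mono) (auto simp: Gt_def)
      then show "AE x in lborel. norm (un n s x * Gt s x) \<le> norm (C * indicator (cball 0 R) x)"
        using sG C by (auto simp: abs_mult Gt_def split: split_indicator intro!: AE_I2)
    qed measurable
    have i2: "integrable lborel (\<lambda>x. un n s x * gn n (\<lambda>y. G (s, y)) x)"
    proof (rule integrable_boundL[OF integrable_cmult[OF wt_int, of A]])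
      have "\<bar>un n s x\<bar> * \<bar>gn n (\<lambda>y. G (s, y)) x\<bar> \<le> 1 * (A * wt x)" for x using un_range[OF s, of n x] A by (intro mult_mono) auto
      then show "AE x in lborel. norm (un n s x * gn n (\<lambda>y. G (s, y)) x) \<le> norm (A * wt x)"
        by (auto simp: abs_mult intro!: AE_I2 intro: order_trans[OF _ abs_ge_self] simp flip: abs_mult)
    qed measurable
    have i3: "integrable lborel (\<lambda>x. sn n s (gn n u0) x * G (s, x))"
    proof (rule integrable_boundL[OF integrable_cmult[OF integrable_abs[OF nice_integrable[OF nG[of s]]], of "2 * rate (pn n) * 1"]])
      show "AE x in lborel. norm (sn n s (gn n u0) x * G (s, x)) \<le> norm (2 * rate (pn n) * 1 * \<bar>G (s, x)\<bar>)"
        using bndD[OF w.semi_bnd[OF gu s, of "shiftn n"]] w.rate_nonneg by (auto simp: abs_mult intro!: AE_I2 mult_right_mono)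
    qed measurable
    have "(LBINT x. H s x) = (LBINT x. sn n s (gn n u0) x * G (s, x)) + (LBINT x. un n s x * Gt s x)"
      using True i1 i3 by (simp add: H_def)
    also have "(LBINT x. sn n s (gn n u0) x * G (s, x)) = (LBINT x. G (s, x) * gn n (un n s) x)"
      by (simp add: w.semi_gen_commute[OF pn_walk u0_bnd] mult.commute)
    also have "\<dots> = (LBINT x. gn n (\<lambda>y. G (s, y)) x * un n s x)"
      by (rule gn_dual[OF nice_integrable[OF nG] gG _ w.semi_bnd[OF u0_bnd s]]) simp
    also have "\<dots> + (LBINT x. un n s x * Gt s x) = (LBINT x. un n s x * Gt s x + un n s x * gn n (\<lambda>y. G (s, y)) x)"
      using i1 i2 by (simp add: mult.commute)
    finally show ?thesis using True by (simp add: distrib_left)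
  qed (simp add: H_def)
  have i0: "integrable lborel (\<lambda>x. u0 x * G (0, x))" "integrable lborel (\<lambda>x. un n t x * G (t, x))"
  proof -
    have [measurable]: "(\<lambda>x. G (s, x)) \<in> borel_measurable borel" for s by (rule nice_meas[OF nG])
    have [measurable]: "un n t \<in> borel_measurable borel" by (rule sn_meas) simp
    show "integrable lborel (\<lambda>x. u0 x * G (0, x))"
      by (rule integrable_boundL[OF nice_integrable[OF nG[of 0]]])
        (use u0_range in \<open>auto simp: abs_mult intro!: AE_I2 mult_left_le_one_le\<close>)
    show "integrable lborel (\<lambda>x. un n t x * G (t, x))"
      by (rule integrable_boundL[OF nice_integrable[OF nG[of t]]])
        (use un_range[OF t] in \<open>auto simp: abs_mult intro!: AE_I2 mult_left_le_one_le\<close>)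
  qed
  show ?eq
    using fub(1) i0 by (simp add: pt sec set_lebesgue_integral_def Gt_def)
  show ?int
    using fub(2) by (simp add: sec set_integrable_def Gt_def)
qed

text \<open>Dominated convergence twice: in space with a majorant built from the ball and
  \<open>wt\<close>, in time with its integral. Almost everywhere convergence at each fixed time
  suffices.\<close>

lemma weak_sol_limit:
  assumes um: "(\<lambda>(t, x). u t x) \<in> borel_measurable (lborel \<Otimes>\<^sub>M lborel)" and ur: "\<And>t x. 0 \<le> u t x \<and> u t x \<le> 1"
    and k: "\<And>j. 0 < k j" "filterlim k at_top sequentially"
    and lim: "\<And>t. t \<in> {0..T} \<Longrightarrow> AE x in lborel. (\<lambda>j. un (k j) t x) \<longlonglongrightarrow> u t x"
  shows "weak_sol T h u0 u"
proof -
  have cb[measurable]: "cball (0 :: real^'d) r \<in> sets borel" for r by simp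
  have usec[measurable]: "u t \<in> borel_measurable borel" for t using measurable_Pair2[OF um, of t] by simp
  have unm[measurable]: "un n t \<in> borel_measurable borel" for n t by (rule sn_meas) simp
  have pair: "(\<lambda>j. LBINT x. un (k j) t x * f j x) \<longlonglongrightarrow> (LBINT x. u t x * f' x)"
    if t: "t \<in> {0..T}" and fm: "\<And>j. f j \<in> borel_measurable borel" and fl: "\<And>x. (\<lambda>j. f j x) \<longlonglongrightarrow> f' x"
      and fb: "\<And>j x. \<bar>f j x\<bar> \<le> D x" and D: "integrable lborel D" for t f f' D
  proof (rule integral_dominated_convergence[where w=D])
    note [measurable] = fm
    have [measurable]: "f' \<in> borel_measurable borel" by (rule borel_measurable_LIMSEQ_real[OF fl fm])
    show "(\<lambda>x. u t x * f' x) \<in> borel_measurable lborel" "(\<lambda>x. un (k j) t x * f j x) \<in> borel_measurable lborel" for j by simp_all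
    show "AE x in lborel. (\<lambda>j. un (k j) t x * f j x) \<longlonglongrightarrow> u t x * f' x"
      using lim[OF t] by eventually_elim (intro tendsto_mult fl)
    show "AE x in lborel. norm (un (k j) t x * f j x) \<le> D x" for j
    proof (rule AE_I2)
      fix x
      have "\<bar>un (k j) t x\<bar> * \<bar>f j x\<bar> \<le> 1 * D x" using un_range[of t "k j" x] t fb by (intro mult_mono) auto
      then show "norm (un (k j) t x * f j x) \<le> D x" by (simp add: abs_mult)
    qed
  qed (rule D)
  show ?thesis
    unfolding weak_sol_def
  proof (intro conjI ballI allI impI)
    show "\<exists>B. \<forall>t\<in>{0..T}. \<forall>x. \<bar>u t x\<bar> \<le> B" using ur by (intro exI[of _ 1]) auto
    fix t G assume t: "t \<in> {0..T}" and G: "test_fun (G :: real \<times> (real^'d) \<Rightarrow> real)"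
    have t0: "0 \<le> t" using t by simp
    obtain R C where R: "0 \<le> R" and C: "0 \<le> C" and nG: "\<And>s. nice R C (\<lambda>x. G (s, x))"
      and bG: "\<And>s x. \<bar>deriv (\<lambda>r. G (r, x)) s\<bar> \<le> C" and sG: "\<And>s x. R < norm x \<Longrightarrow> deriv (\<lambda>r. G (r, x)) s = 0"
      and cG: "continuous_on UNIV (\<lambda>z. deriv (\<lambda>r. G (r, snd z)) (fst z))"
      using test_fun_bounds[OF G] by blast
    from gn_decay[OF R C] obtain A where A': "0 \<le> A"
      "\<forall>F. nice R C F \<longrightarrow> (\<forall>n>0. \<forall>x. \<bar>gn n F x\<bar> \<le> A * wt x) \<and> (\<forall>x. \<bar>frac_gen h F x\<bar> \<le> A * wt x)" by (elim exE conjE)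
    have A: "0 \<le> A" "\<And>F n x. nice R C F \<Longrightarrow> 0 < n \<Longrightarrow> \<bar>gn n F x\<bar> \<le> A * wt x" using A' by simp_all
    have Gtm[measurable]: "(\<lambda>x. deriv (\<lambda>r. G (r, x)) s) \<in> borel_measurable borel" for s
    proof -
      have "continuous_on UNIV (\<lambda>x. (\<lambda>z. deriv (\<lambda>r. G (r, snd z)) (fst z)) (s, x))"
        by (rule continuous_on_compose2[OF cG]) (auto intro!: continuous_intros)
      then show ?thesis by (intro borel_measurable_continuous_onI) simp
    qed
    have [measurable]: "(\<lambda>x. G (s, x)) \<in> borel_measurable borel" for s by (rule nice_meas[OF nG])
    have gnm[measurable]: "gn n (\<lambda>y. G (s, y)) \<in> borel_measurable borel" for n s by (rule gn_meas) simp
    define D where "D x = C * indicator (cball 0 R) x + A * wt x" for x :: "real^'d"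
    have Di: "integrable lborel D"
      unfolding D_def by (intro Bochner_Integration.integrable_add integrable_indicator_cball integrable_cmult wt_int)
    have D0: "0 \<le> D x" for x using C A wt_pos[of x] by (simp add: D_def)
    have gb: "\<bar>deriv (\<lambda>r. G (r, x)) s + gn n (\<lambda>y. G (s, y)) x\<bar> \<le> D x" if "0 < n" for s x n
    proof -
      have "\<bar>deriv (\<lambda>r. G (r, x)) s\<bar> \<le> C * indicator (cball 0 R) x" using bG[of x s] sG[of x s] by (auto split: split_indicator)
      moreover have "\<bar>gn n (\<lambda>y. G (s, y)) x\<bar> \<le> A * wt x" by (rule A(2)[OF nG that])
      ultimately show ?thesis unfolding D_def by linarith
    qed
    define a where "a s = (LBINT x. u s x * (deriv (\<lambda>r. G (r, x)) s + frac_gen h (\<lambda>y. G (s, y)) x))" for s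
    define an where "an j s = (LBINT x. un (k j) s x * (deriv (\<lambda>r. G (r, x)) s + gn (k j) (\<lambda>y. G (s, y)) x))" for j s
    have kl: "(\<lambda>j. gn (k j) (\<lambda>y. G (s, y)) x) \<longlonglongrightarrow> frac_gen h (\<lambda>y. G (s, y)) x" for s x
      using filterlim_compose[OF gn_tendsto_pt[OF nG] k(2)] .
    have l1: "(\<lambda>j. an j s) \<longlonglongrightarrow> a s" if "s \<in> {0..T}" for s
      unfolding an_def a_def
      by (rule pair[OF that _ _ gb[OF k(1)] Di]) (auto intro!: tendsto_intros kl)
    have anb: "\<bar>an j s\<bar> \<le> (LBINT x. D x)" if "s \<in> {0..T}" for j s
      unfolding an_def real_norm_def[symmetric]
    proof (rule Bochner_Integration.integral_norm_bound_integral[OF _ Di])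
      have b: "norm (un (k j) s x * (deriv (\<lambda>r. G (r, x)) s + gn (k j) (\<lambda>y. G (s, y)) x)) \<le> D x" for x
      proof -
        have "\<bar>un (k j) s x\<bar> * \<bar>deriv (\<lambda>r. G (r, x)) s + gn (k j) (\<lambda>y. G (s, y)) x\<bar> \<le> 1 * D x"
          using un_range[of s "k j" x] that gb[OF k(1)] by (intro mult_mono) auto
        then show ?thesis by (simp add: abs_mult)
      qed
      then show "\<And>x. norm (un (k j) s x * (deriv (\<lambda>r. G (r, x)) s + gn (k j) (\<lambda>y. G (s, y)) x)) \<le> D x" .
      show "integrable lborel (\<lambda>x. un (k j) s x * (deriv (\<lambda>r. G (r, x)) s + gn (k j) (\<lambda>y. G (s, y)) x))"
        by (rule integrable_boundL[OF Di]) (use b D0 in \<open>auto intro!: AE_I2\<close>)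
    qed
    have l2: "(\<lambda>j. LBINT s:{0..t}. an j s) \<longlonglongrightarrow> (LBINT s:{0..t}. a s)"
      unfolding set_lebesgue_integral_def
    proof (rule integral_dominated_convergence[where w="\<lambda>s. (LBINT x. D x) * indicator {0..t} s"])
      have ptl: "(\<lambda>j. indicator {0..t} s *\<^sub>R an j s) \<longlonglongrightarrow> indicator {0..t} s *\<^sub>R a s" for s
        using l1[of s] t by (auto split: split_indicator)
      then show "AE s in lborel. (\<lambda>j. indicator {0..t} s *\<^sub>R an j s) \<longlonglongrightarrow> indicator {0..t} s *\<^sub>R a s" by simp
      show m: "(\<lambda>s. indicator {0..t} s *\<^sub>R an j s) \<in> borel_measurable lborel" for j
        using un_identity(2)[OF k(1) G t0, of j] unfolding set_integrable_def an_def by auto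
      show "(\<lambda>s. indicator {0..t} s *\<^sub>R a s) \<in> borel_measurable lborel"
        by (rule borel_measurable_LIMSEQ_real[OF ptl m])
      show "integrable lborel (\<lambda>s. (LBINT x. D x) * indicator {0..t} s)"
        by (intro integrable_cmult integrable_real_indicator) (auto simp: emeasure_lborel_Icc_eq)
      show "AE s in lborel. norm (indicator {0..t} s *\<^sub>R an j s) \<le> (LBINT x. D x) * indicator {0..t} s" for j
        using anb t by (auto split: split_indicator intro!: AE_I2)
    qed
    have l3: "(\<lambda>j. LBINT x. un (k j) t x * G (t, x)) \<longlonglongrightarrow> (LBINT x. u t x * G (t, x))"
      by (rule pair[OF t, where D="\<lambda>x. \<bar>G (t, x)\<bar>"]) (use nice_integrable[OF nG] in auto)
    have "(\<lambda>j. (LBINT x. un (k j) t x * G (t, x)) - (LBINT x. u0 x * G (0, x)) - (LBINT s:{0..t}. an j s)) \<longlonglongrightarrow>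
       (LBINT x. u t x * G (t, x)) - (LBINT x. u0 x * G (0, x)) - (LBINT s:{0..t}. a s)"
      by (intro tendsto_intros l2 l3)
    moreover have "(LBINT x. un (k j) t x * G (t, x)) - (LBINT x. u0 x * G (0, x)) - (LBINT s:{0..t}. an j s) = 0" for j
      using un_identity(1)[OF k(1) G t0, of j] unfolding an_def by simp
    ultimately have "(\<lambda>j::nat. 0::real) \<longlonglongrightarrow> (LBINT x. u t x * G (t, x)) - (LBINT x. u0 x * G (0, x)) - (LBINT s:{0..t}. a s)" by simp
    then show "(LBINT x. u t x * G (t, x)) - (LBINT x. u0 x * G (0, x))
        - (LBINT s:{0..t}. LBINT x. u s x * (deriv (\<lambda>r. G (r, x)) s + frac_gen h (\<lambda>y. G (s, y)) x)) = 0"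
      unfolding a_def by (rule LIMSEQ_unique[OF _ tendsto_const])
  qed (rule um)
qed

text \<open>The Cauchy bound concerns the full sequence and is uniform in time; letting the second
  index run along the subsequence upgrades its limit to a limit of the full sequence, uniformly in
  time.\<close>

lemma un_pairing_uniform:
  assumes um: "(\<lambda>(t, x). u t x) \<in> borel_measurable (lborel \<Otimes>\<^sub>M lborel)" and ur: "\<And>t x. 0 \<le> u t x \<and> u t x \<le> 1"
    and k: "\<And>j. 0 < k j" "filterlim k at_top sequentially"
    and lim: "\<And>t. t \<in> {0..T} \<Longrightarrow> AE x in lborel. (\<lambda>j. un (k j) t x) \<longlonglongrightarrow> u t x"
    and F: "nice r C F" and \<epsilon>: "0 < \<epsilon>"
  shows "\<exists>N>0. \<forall>n\<ge>N. \<forall>t\<in>{0..T}. \<bar>(LBINT x. un n t x * F x) - (LBINT x. u t x * F x)\<bar> \<le> \<epsilon>"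
proof -
  have cb[measurable]: "cball (0 :: real^'d) r \<in> sets borel" for r by simp
  have usec[measurable]: "u t \<in> borel_measurable borel" for t using measurable_Pair2[OF um, of t] by simp
  have unm[measurable]: "un n t \<in> borel_measurable borel" for n t by (rule sn_meas) simp
  have Fm[measurable]: "F \<in> borel_measurable borel" by (rule nice_meas[OF F])
  have Fi: "integrable lborel F" by (rule nice_integrable[OF F])
  have Fb: "\<bar>F x\<bar> \<le> C" "r < norm x \<Longrightarrow> F x = 0" for x using F by (auto simp: nice_def bnd_def)
  have r0: "0 \<le> r" using F by (simp add: nice_def)
  have C: "0 \<le> C" using Fb(1)[of undefined] by linarith
  obtain N where N: "0 < N" "\<And>n m t. N \<le> n \<Longrightarrow> N \<le> m \<Longrightarrow> t \<in> {0..T} \<Longrightarrow> (LBINT x. indicator (cball 0 r) x * \<bar>un n t x - un m t x\<bar>) \<le> \<epsilon> / (C + 1)"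
    using un_local_cauchy[OF r0, of "\<epsilon> / (C + 1)"] \<epsilon> C by auto
  have "\<bar>(LBINT x. un n t x * F x) - (LBINT x. u t x * F x)\<bar> \<le> \<epsilon>" if n: "N \<le> n" and t: "t \<in> {0..T}" for n t
  proof -
    have t0: "0 \<le> t" using t by simp
    have ui: "integrable lborel (\<lambda>x. un n t x * F x)" for n
      by (rule integrable_boundL[OF Fi]) (use un_range[OF t0] in \<open>auto simp: abs_mult intro!: AE_I2 mult_left_le_one_le\<close>)
    have nm: "\<bar>(LBINT x. un n t x * F x) - (LBINT x. un m t x * F x)\<bar> \<le> \<epsilon>" if m: "N \<le> m" for m
    proof -
      have i: "integrable lborel (\<lambda>x. indicator (cball 0 r) x * \<bar>un n t x - un m t x\<bar>)"
      proof (rule integrable_boundL[OF integrable_indicator_cball[of 1 r]])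
        have "\<bar>un n t x - un m t x\<bar> \<le> 1" for x using un_range[OF t0, of n x] un_range[OF t0, of m x] by auto
        then show "AE x in lborel. norm (indicator (cball 0 r) x * \<bar>un n t x - un m t x\<bar>) \<le> norm (1 * indicator (cball 0 r) x :: real)"
          by (auto split: split_indicator intro!: AE_I2)
      qed measurable
      have e0: "(LBINT x. un n t x * F x) - (LBINT x. un m t x * F x) = (LBINT x. un n t x * F x - un m t x * F x)"
        using ui by simp
      have e1: "\<bar>LBINT x. un n t x * F x - un m t x * F x\<bar> \<le> (LBINT x. C * (indicator (cball 0 r) x * \<bar>un n t x - un m t x\<bar>))"
        unfolding real_norm_def[symmetric]
      proof (rule Bochner_Integration.integral_norm_bound_integral)
        fix x
        have "\<bar>un n t x - un m t x\<bar> * \<bar>F x\<bar> \<le> \<bar>un n t x - un m t x\<bar> * (C * indicator (cball 0 r) x)"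
          using Fb[of x] by (intro mult_left_mono) (auto split: split_indicator)
        then show "norm (un n t x * F x - un m t x * F x) \<le> C * (indicator (cball 0 r) x * norm (un n t x - un m t x))"
          unfolding left_diff_distrib[symmetric] real_norm_def abs_mult by (simp only: mult_ac)
      qed (use ui i in auto)
      have e2: "(LBINT x. C * (indicator (cball 0 r) x * \<bar>un n t x - un m t x\<bar>)) \<le> C * (\<epsilon> / (C + 1))"
        unfolding integral_mult_right_zero using N(2)[OF n m t] C by (rule mult_left_mono)
      have e3: "C * (\<epsilon> / (C + 1)) \<le> \<epsilon>" using C \<epsilon> by (simp add: field_simps)
      show ?thesis unfolding e0 by (rule order_trans[OF e1 order_trans[OF e2 e3]])
    qed
    have "(\<lambda>j. LBINT x. un (k j) t x * F x) \<longlonglongrightarrow> (LBINT x. u t x * F x)"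
    proof (rule integral_dominated_convergence[where w="\<lambda>x. \<bar>F x\<bar>"])
      show "AE x in lborel. (\<lambda>j. un (k j) t x * F x) \<longlonglongrightarrow> u t x * F x"
        using lim[OF t] by eventually_elim (intro tendsto_mult tendsto_const)
      show "AE x in lborel. norm (un (k j) t x * F x) \<le> \<bar>F x\<bar>" for j
        using un_range[OF t0] by (auto simp: abs_mult intro!: AE_I2 mult_left_le_one_le)
    qed (use Fi in auto)
    then have l: "(\<lambda>j. \<bar>(LBINT x. un n t x * F x) - (LBINT x. un (k j) t x * F x)\<bar>) \<longlonglongrightarrow> \<bar>(LBINT x. un n t x * F x) - (LBINT x. u t x * F x)\<bar>"
      by (intro tendsto_intros)
    have "\<forall>\<^sub>F j in sequentially. N \<le> k j" using k(2) by (simp add: filterlim_at_top)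
    then show ?thesis by (intro tendsto_upperbound[OF l]) (auto elim!: eventually_mono intro: nm)
  qed
  then show ?thesis using N(1) by blast
qed

end

section \<open>Uniqueness of weak solutions\<close>

lemma integrable_mult_bnd:
  fixes f H :: "'a \<Rightarrow> real"
  assumes f: "integrable M f" and H: "H \<in> borel_measurable M" "\<And>x. \<bar>H x\<bar> \<le> D"
  shows "integrable M (\<lambda>x. H x * f x)"
proof (rule integrable_boundL[OF integrable_cmult[OF integrable_abs[OF f], of D]])
  have "0 \<le> D" using H(2)[of undefined] by linarith
  then show "AE x in M. norm (H x * f x) \<le> norm (D * \<bar>f x\<bar>)"
    using H(2) by (auto simp: abs_mult intro!: AE_I2 mult_right_mono)
qed (use f H in auto)

lemma set_integrable_pairing:
  fixes v :: "real \<Rightarrow> real^'d \<Rightarrow> real" and F :: "real^'d \<Rightarrow> real"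
  assumes v: "(\<lambda>(t, x). v t x) \<in> borel_measurable (lborel \<Otimes>\<^sub>M lborel)" and vb: "\<And>t x. t \<in> {0..T} \<Longrightarrow> \<bar>v t x\<bar> \<le> B"
    and F: "integrable lborel F" and c: "continuous_on UNIV c"
  shows "set_integrable lborel {0..T} (\<lambda>s. c s * (LBINT x. v s (y + x) * F x))"
proof -
  have [measurable]: "F \<in> borel_measurable borel" using F by auto
  have [measurable]: "c \<in> borel_measurable borel" by (rule borel_measurable_continuous_onI[OF c])
  obtain Bc where Bc: "\<And>s. s \<in> {0..T} \<Longrightarrow> \<bar>c s\<bar> \<le> Bc"
  proof -
    have "bounded (c ` {0..T})" by (intro compact_imp_bounded compact_continuous_image continuous_on_subset[OF c]) auto
    then obtain b where "\<forall>x\<in>c ` {0..T}. norm x \<le> b" by (auto simp: bounded_iff)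
    then show thesis by (intro that[of b]) auto
  qed
  have vm[measurable]: "(\<lambda>z. v (fst z) (y + snd z)) \<in> borel_measurable (lborel \<Otimes>\<^sub>M lborel)"
    using measurable_compose[OF _ v, of "\<lambda>z. (fst z, y + snd z)"] by (simp add: case_prod_beta)
  define f where "f s x = indicator {0..T} s * c s * (v s (y + x) * F x)" for s x
  have fm: "case_prod f \<in> borel_measurable (lborel \<Otimes>\<^sub>M lborel)"
    unfolding f_def case_prod_beta by measurable
  have fb: "\<bar>f s x\<bar> \<le> (\<bar>Bc\<bar> * indicator {0..T} s) * (\<bar>B\<bar> * \<bar>F x\<bar>)" for s x
  proof (cases "s \<in> {0..T}")
    case True
    have "\<bar>v s (y + x)\<bar> * \<bar>F x\<bar> \<le> \<bar>B\<bar> * \<bar>F x\<bar>" using vb[OF True, of "y + x"] by (intro mult_right_mono) auto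
    then have "\<bar>c s\<bar> * (\<bar>v s (y + x)\<bar> * \<bar>F x\<bar>) \<le> \<bar>Bc\<bar> * (\<bar>B\<bar> * \<bar>F x\<bar>)"
      by (rule mult_mono[rotated]) (use Bc[OF True] in auto)
    then show ?thesis using True by (simp add: f_def abs_mult)
  qed (simp add: f_def)
  have "integrable lborel (\<lambda>s. LBINT x. f s x)"
    by (rule fubini_dom(2)[OF sigma_finite_lborel sigma_finite_lborel fm _ _ fb])
      (use F in \<open>auto intro!: integrable_cmult integrable_real_indicator simp: emeasure_lborel_Icc_eq\<close>)
  then show ?thesis by (simp add: f_def set_integrable_def mult.assoc)
qed

context stable
begin

lemma frac_gen_translate: "frac_gen h (\<lambda>y. c * F (y - x0)) x = c * frac_gen h F (x - x0)"
proof -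
  have e: "h y * (c * F (x + y - x0) + c * F (x - y - x0) - 2 * (c * F (x - x0))) = c * (h y * (F (x - x0 + y) + F (x - x0 - y) - 2 * F (x - x0)))" for y
    by (simp add: algebra_simps)
  show ?thesis unfolding frac_gen_def e by simp
qed

text \<open>Pairing with translates is a mollification, and it commutes with the walk. It turns a
  bounded function without regularity into one to which generator estimates apply, with the
  generator falling on F.\<close>

lemma gn_pairing:
  fixes w F :: "real^'d \<Rightarrow> real"
  assumes [measurable]: "w \<in> borel_measurable borel" and wb: "bnd B w" and F: "nice R C F"
  shows "gn n (\<lambda>y. LBINT x. w (y + x) * F x) y = (LBINT x. w (y + x) * gn n F x)" (is ?g1)
    and "bnd (B * (LBINT x. \<bar>F x\<bar>)) (\<lambda>y. LBINT x. w (y + x) * F x)" (is ?g2)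
proof -
  interpret p: walk "pn n" by (rule pn_walk)
  have [measurable]: "F \<in> borel_measurable borel" by (rule nice_meas[OF F])
  have Fi: "integrable lborel F" by (rule nice_integrable[OF F])
  have Fb: "bnd C F" using F by (simp add: nice_def)
  have wb': "bnd B (\<lambda>x. w (y + x))" for y using wb by (simp add: bnd_def)
  have B0: "0 \<le> B" by (rule bnd_nonneg[OF wb])
  have sw: "conv (pn n) (shiftn n) (\<lambda>y. LBINT x. w (y + x) * F x) y = (LBINT x. F x * conv (pn n) (shiftn n) (\<lambda>x. w (y + x)) x)"
  proof -
    have "(LSUM z. (LBINT x. pn n z * (w (y + shiftn n z + x) * F x))) =
       (LBINT x. (LSUM z. pn n z * (w (y + shiftn n z + x) * F x)))"
    proof (rule fubini_dom(1)[OF sf_count sigma_finite_lborel, where u="pn n" and v="\<lambda>x. B * \<bar>F x\<bar>"])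
      show "(\<lambda>(z, x). pn n z * (w (y + shiftn n z + x) * F x)) \<in> borel_measurable (count_space UNIV \<Otimes>\<^sub>M lborel)"
        by (rule measurable_pair_measure_countable1) auto
      show "\<bar>pn n z * (w (y + shiftn n z + x) * F x)\<bar> \<le> pn n z * (B * \<bar>F x\<bar>)" for z x
        unfolding abs_mult using p.p_nonneg[of z] bndD[OF wb] by (intro mult_mono) (auto simp: B0)
    qed (use p.p_int Fi in auto)
    then show ?thesis
      unfolding conv_def by (simp add: algebra_simps flip: integral_mult_right_zero)
  qed
  have "(LBINT x. F x * conv (pn n) (shiftn n) (\<lambda>x. w (y + x)) x) - rate (pn n) * (LBINT x. w (y + x) * F x)
     = (LBINT x. F x * gn n (\<lambda>x. w (y + x)) x)"
  proof -
    interpret l: transl_inv "lborel :: (real^'d) measure" by (rule transl_inv_lborel)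
    have cm: "conv (pn n) (shiftn n) (\<lambda>x. w (y + x)) \<in> borel_measurable lborel" by (rule l.conv_meas) simp
    have i1: "integrable lborel (\<lambda>x. conv (pn n) (shiftn n) (\<lambda>x. w (y + x)) x * F x)"
      by (rule integrable_mult_bnd[OF Fi cm bndD[OF p.conv_bnd[OF wb']]])
    have i2: "integrable lborel (\<lambda>x. w (y + x) * F x)"
      by (rule integrable_mult_bnd[OF Fi _ bndD[OF wb']]) simp
    have "(LBINT x. F x * gn n (\<lambda>x. w (y + x)) x) = (LBINT x. conv (pn n) (shiftn n) (\<lambda>x. w (y + x)) x * F x - rate (pn n) * (w (y + x) * F x))"
      by (rule integral_congL) (auto simp: gen_def algebra_simps)
    then show ?thesis using i1 i2 by (simp add: mult.commute)
  qed
  also have "\<dots> = (LBINT x. gn n F x * w (y + x))" by (rule gn_dual[OF Fi Fb _ wb']) simp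
  finally show ?g1
    unfolding gen_def[of _ _ "\<lambda>y. LBINT x. w (y + x) * F x"] sw by (simp add: mult.commute)
  show ?g2
    unfolding bnd_def
  proof
    fix y
    have "\<bar>LBINT x. w (y + x) * F x\<bar> \<le> (LBINT x. B * \<bar>F x\<bar>)"
      unfolding real_norm_def[symmetric]
    proof (rule Bochner_Integration.integral_norm_bound_integral)
      show "integrable lborel (\<lambda>x. w (y + x) * F x)"
        by (rule integrable_mult_bnd[OF Fi _ bndD[OF wb']]) simp
      show "norm (w (y + x) * F x) \<le> B * norm (F x)" for x using bndD[OF wb] by (auto simp: abs_mult intro!: mult_right_mono)
    qed (use Fi in auto)
    then show "\<bar>LBINT x. w (y + x) * F x\<bar> \<le> B * (LBINT x. \<bar>F x\<bar>)" by simp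
  qed
qed

text \<open>L^1 is the norm dual to bounded differences of solutions; it follows from pointwise
  convergence and the common decay \<open>wt\<close>. The sequence is shifted by one because the
  decay bound requires n > 0.\<close>

lemma gn_tendsto_L1:
  assumes F: "nice R C F"
  shows "(\<lambda>n. LBINT x. \<bar>frac_gen h F x - gn n F x\<bar>) \<longlonglongrightarrow> 0" (is ?g1)
    and "integrable lborel (frac_gen h F)" (is ?g2) and "0 < n \<Longrightarrow> integrable lborel (gn n F)"
proof -
  have R: "0 \<le> R" using F by (simp add: nice_def)
  from gn_decay[OF R nice_W(2)[OF F]] obtain A where A': "0 \<le> A"
    "\<forall>F. nice R C F \<longrightarrow> (\<forall>n>0. \<forall>x. \<bar>gn n F x\<bar> \<le> A * wt x) \<and> (\<forall>x. \<bar>frac_gen h F x\<bar> \<le> A * wt x)" by (elim exE conjE)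
  have A: "0 \<le> A" "\<And>n x. 0 < n \<Longrightarrow> \<bar>gn n F x\<bar> \<le> A * wt x" "\<And>x. \<bar>frac_gen h F x\<bar> \<le> A * wt x"
    using A' F by simp_all
  have [measurable]: "gn n F \<in> borel_measurable borel" for n by (rule gn_meas[OF nice_meas[OF F]])
  have [measurable]: "frac_gen h F \<in> borel_measurable borel" by (rule frac_gen_meas[OF F])
  show ?g2
    by (rule integrable_boundL[OF integrable_cmult[OF wt_int, of A]])
      (use order_trans[OF A(3) abs_ge_self] in \<open>auto intro!: AE_I2\<close>)
  show "integrable lborel (gn n F)" if "0 < n"
    by (rule integrable_boundL[OF integrable_cmult[OF wt_int, of A]])
      (use order_trans[OF A(2)[OF that] abs_ge_self] in \<open>auto intro!: AE_I2\<close>)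
  have "(\<lambda>n. LBINT x. \<bar>frac_gen h F x - gn (Suc n) F x\<bar>) \<longlonglongrightarrow> (\<integral>x. 0 \<partial>(lborel :: (real^'d) measure))"
  proof (rule integral_dominated_convergence[where w="\<lambda>x. 2 * (A * wt x)"])
    show "AE x in lborel. (\<lambda>n. \<bar>frac_gen h F x - gn (Suc n) F x\<bar>) \<longlonglongrightarrow> 0"
    proof (rule AE_I2)
      fix x
      have "(\<lambda>n. \<bar>frac_gen h F x - gn (Suc n) F x\<bar>) \<longlonglongrightarrow> \<bar>frac_gen h F x - frac_gen h F x\<bar>"
        by (intro tendsto_intros LIMSEQ_Suc gn_tendsto_pt[OF F])
      then show "(\<lambda>n. \<bar>frac_gen h F x - gn (Suc n) F x\<bar>) \<longlonglongrightarrow> 0" by simp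
    qed
    show "AE x in lborel. norm \<bar>frac_gen h F x - gn (Suc n) F x\<bar> \<le> 2 * (A * wt x)" for n
    proof (rule AE_I2)
      fix x show "norm \<bar>frac_gen h F x - gn (Suc n) F x\<bar> \<le> 2 * (A * wt x)"
        using A(2)[of "Suc n" x] A(3)[of x] by (simp add: abs_if split: if_splits)
    qed
  qed (auto intro!: integrable_cmult wt_int)
  then have "(\<lambda>n. LBINT x. \<bar>frac_gen h F x - gn (Suc n) F x\<bar>) \<longlonglongrightarrow> 0" by simp
  then show ?g1 by (rule LIMSEQ_imp_Suc)
qed

end

context stable_init
begin

text \<open>Test functions have compact support in time as well. This flat cutoff is positive on all
  of [0, T], so testing with it loses nothing there.\<close>

definition th :: "real \<Rightarrow> real" where "th s = flat_exp 0 ((T + 1)\<^sup>2 - s * s)"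

definition th' :: "real \<Rightarrow> real" where "th' s = - (2 * s * flat_exp 2 ((T + 1)\<^sup>2 - s * s))"

lemma th_deriv: "(th has_real_derivative th' s) (at s)"
proof -
  have "((\<lambda>s. (T + 1)\<^sup>2 - s * s) has_real_derivative - (2 * s)) (at s)" by (auto intro!: derivative_eq_intros)
  from DERIV_chain2[OF flat_deriv this, of 0] show ?thesis
    unfolding th_def[abs_def] th'_def by (simp add: mult.commute numeral_2_eq_2)
qed

lemma th_range: "0 \<le> th s" "th s \<le> 1" "s \<in> {0..T} \<Longrightarrow> 0 < th s"
proof -
  show "0 \<le> th s" "th s \<le> 1" using flat0_range by (auto simp: th_def)
  assume s: "s \<in> {0..T}"
  have "s * s \<le> T * T" using s by (intro mult_mono) auto
  also have "\<dots> < (T + 1)\<^sup>2" using T by (simp add: power2_eq_square algebra_simps)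
  finally show "0 < th s" by (simp add: th_def flat0_range)
qed

text \<open>The derivative of the cutoff acts as a damping with a bounded coefficient: (T + 1)^2 -
  s^2 is at least 1 on [0, T], which leaves at most 2 T.\<close>

lemma th_ratio: "s \<in> {0..T} \<Longrightarrow> \<exists>\<rho>\<ge>0. \<rho> \<le> 2 * T \<and> th' s = - \<rho> * th s"
proof -
  assume s: "s \<in> {0..T}"
  define y where "y = (T + 1)\<^sup>2 - s * s"
  have "s * s \<le> T * T" using s by (intro mult_mono) auto
  then have y: "1 \<le> y" using T by (simp add: y_def power2_eq_square algebra_simps)
  define \<rho> where "\<rho> = 2 * s * (1 / y)\<^sup>2"
  have "(1 / y)\<^sup>2 \<le> 1" using y by (simp add: power_le_one)
  then have "\<rho> \<le> 2 * s * 1" unfolding \<rho>_def using s by (intro mult_left_mono) auto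
  then have "\<rho> \<le> 2 * T" using s by simp
  moreover have "0 \<le> \<rho>" using s by (simp add: \<rho>_def)
  moreover have "th' s = - \<rho> * th s" using y by (simp add: th'_def th_def \<rho>_def flat_exp_def y_def[symmetric])
  ultimately show ?thesis by blast
qed

lemma th_cont: "continuous_on UNIV th" "continuous_on UNIV th'"
proof -
  show "continuous_on UNIV th" by (rule continuous_at_imp_continuous_on) (use DERIV_isCont[OF th_deriv] in auto)
  show "continuous_on UNIV th'"
    unfolding th'_def[abs_def] by (intro continuous_intros continuous_on_compose2[OF flat_cont[of UNIV]]) auto
qed

text \<open>Testing with th(s) F(x - y) turns the weak equation into an integral equation in time
  for the mollified solution, as a function of the shift y.\<close>

lemma weak_sol_tested:
  fixes F :: "real^'d \<Rightarrow> real"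
  assumes v: "weak_sol T h u0 v" and F: "SM F" "nice R C F" and t: "t \<in> {0..T}"
  shows "th t * (LBINT x. v t (y + x) * F x) = (LBINT x. u0 x * (th 0 * F (x - y))) +
    (LBINT s:{0..t}. th' s * (LBINT x. v s (y + x) * F x) + th s * (LBINT x. v s (y + x) * frac_gen h F x))"
proof -
  interpret l: transl_inv "lborel :: (real^'d) measure" by (rule transl_inv_lborel)
  define G where "G z = th (fst z) * F (snd z - y)" for z
  have "SM (\<lambda>z :: real \<times> (real^'d). th (fst z + 0))"
  proof (rule SM_affine)
    have "SM (bump (T + 1) (\<lambda>s::real. 1))" by (rule SM_bump) (rule real_polynomial_function.intros(2))
    moreover have "bump (T + 1) (\<lambda>s::real. 1) = th" by (auto simp: bump_def th_def fun_eq_iff)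
    ultimately show "SM th" by simp
  qed (rule bounded_linear_fst)
  moreover have "SM (\<lambda>z :: real \<times> (real^'d). F (snd z + (- y)))" by (rule SM_affine[OF F(1) bounded_linear_snd])
  ultimately have "SM G" using SM_mult unfolding G_def by fastforce
  then have sG: "smooth_fun G" by (rule SM_smooth)
  have Fs: "\<And>x. R < norm x \<Longrightarrow> F x = 0" using F(2) by (simp add: nice_def)
  have ths: "th s = 0" if "s \<notin> cball 0 (T + 1)" for s
  proof -
    have "T + 1 < \<bar>s\<bar>" using that by (simp add: dist_real_def)
    then have "(T + 1)\<^sup>2 < \<bar>s\<bar>\<^sup>2" using T by (intro power_strict_mono) auto
    then show ?thesis by (simp add: th_def flat_exp_def power2_eq_square)
  qed
  have "test_fun G"
    unfolding test_fun_def
  proof (intro conjI sG exI[of _ "cball 0 (T + 1) \<times> cball y R"] allI impI)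
    show "compact (cball (0::real) (T + 1) \<times> cball y R)" by (intro compact_Times compact_cball)
    fix z assume "z \<notin> cball (0::real) (T + 1) \<times> cball y R"
    then show "G z = 0" using ths[of "fst z"] Fs[of "snd z - y"] by (cases z) (auto simp: G_def dist_norm norm_minus_commute)
  qed
  then have eq: "(LBINT x. v t x * G (t, x)) - (LBINT x. u0 x * G (0, x))
        - (LBINT s:{0..t}. LBINT x. v s x * (deriv (\<lambda>r. G (r, x)) s + frac_gen h (\<lambda>y. G (s, y)) x)) = 0"
    using v t unfolding weak_sol_def by blast
  obtain B where B: "\<And>t x. t \<in> {0..T} \<Longrightarrow> \<bar>v t x\<bar> \<le> B" using v unfolding weak_sol_def by blast
  have vm: "(\<lambda>(t, x). v t x) \<in> borel_measurable (lborel \<Otimes>\<^sub>M lborel)" using v unfolding weak_sol_def by blast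
  have vs[measurable]: "v s \<in> borel_measurable borel" for s using measurable_Pair2[OF vm, of s] by simp
  have [measurable]: "F \<in> borel_measurable borel" by (rule nice_meas[OF F(2)])
  have [measurable]: "frac_gen h F \<in> borel_measurable borel" by (rule frac_gen_meas[OF F(2)])
  have de: "deriv (\<lambda>r. G (r, x)) s = th' s * F (x - y)" for s x
    unfolding G_def fst_conv snd_conv by (rule DERIV_imp_deriv) (rule DERIV_cmult_right[OF th_deriv])
  have fe: "frac_gen h (\<lambda>y. G (s, y)) x = th s * frac_gen h F (x - y)" for s x
    unfolding G_def fst_conv snd_conv by (rule frac_gen_translate)
  have sh: "(LBINT x. f x) = (LBINT x. f (y + x))" if "f \<in> borel_measurable borel" for f :: "real^'d \<Rightarrow> real"
    using l.shift_integral[of f y] that by (simp add: add.commute)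
  have e1: "(LBINT x. v t x * G (t, x)) = th t * (LBINT x. v t (y + x) * F x)"
    by (subst sh) (simp_all add: G_def mult.left_commute)
  have e2: "(LBINT x. v s x * (deriv (\<lambda>r. G (r, x)) s + frac_gen h (\<lambda>y. G (s, y)) x)) =
     th' s * (LBINT x. v s (y + x) * F x) + th s * (LBINT x. v s (y + x) * frac_gen h F x)" if s: "s \<in> {0..t}" for s
  proof -
    have sT: "s \<in> {0..T}" using s t by auto
    have i1: "integrable lborel (\<lambda>x. v s (y + x) * F x)" by (rule integrable_mult_bnd[OF nice_integrable[OF F(2)] _ B[OF sT]]) simp
    have i2: "integrable lborel (\<lambda>x. v s (y + x) * frac_gen h F x)" by (rule integrable_mult_bnd[OF gn_tendsto_L1(2)[OF F(2)] _ B[OF sT]]) simp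
    have "(LBINT x. v s x * (th' s * F (x - y) + th s * frac_gen h F (x - y))) =
      (LBINT x. v s (y + x) * (th' s * F (y + x - y) + th s * frac_gen h F (y + x - y)))" by (rule sh) simp
    also have "\<dots> = (LBINT x. th' s * (v s (y + x) * F x) + th s * (v s (y + x) * frac_gen h F x))"
      by (rule integral_congL) (auto simp: algebra_simps)
    also have "\<dots> = th' s * (LBINT x. v s (y + x) * F x) + th s * (LBINT x. v s (y + x) * frac_gen h F x)"
      using i1 i2 by simp
    finally show ?thesis by (simp add: de fe)
  qed
  have "(LBINT s:{0..t}. LBINT x. v s x * (deriv (\<lambda>r. G (r, x)) s + frac_gen h (\<lambda>y. G (s, y)) x)) =
    (LBINT s:{0..t}. th' s * (LBINT x. v s (y + x) * F x) + th s * (LBINT x. v s (y + x) * frac_gen h F x))"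
    by (rule set_lebesgue_integral_cong) (use e2 in auto)
  then show ?thesis using eq by (simp add: e1) (simp add: G_def)
qed

text \<open>The mollified difference f of two solutions starts from 0. Its generator term is
  replaced by that of the n-th walk at the cost of the L^1 distance of \<open>frac_gen h F\<close>
  and \<open>gn n F\<close>, which is a constant source in the maximum principle; then n tends to
  infinity.\<close>

lemma weak_sol_unique_tested:
  fixes F :: "real^'d \<Rightarrow> real"
  assumes v: "weak_sol T h u0 v" and u: "weak_sol T h u0 u" and F: "SM F" "nice R C F" and t: "t \<in> {0..T}"
  shows "(LBINT x. (v t x - u t x) * F x) = 0"
proof -
  obtain B1 where B1: "\<And>t x. t \<in> {0..T} \<Longrightarrow> \<bar>v t x\<bar> \<le> B1" using v unfolding weak_sol_def by blast
  obtain B2 where B2: "\<And>t x. t \<in> {0..T} \<Longrightarrow> \<bar>u t x\<bar> \<le> B2" using u unfolding weak_sol_def by blast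
  have vm: "(\<lambda>(t, x). v t x) \<in> borel_measurable (lborel \<Otimes>\<^sub>M lborel)" using v unfolding weak_sol_def by blast
  have um: "(\<lambda>(t, x). u t x) \<in> borel_measurable (lborel \<Otimes>\<^sub>M lborel)" using u unfolding weak_sol_def by blast
  have vs[measurable]: "v s \<in> borel_measurable borel" for s using measurable_Pair2[OF vm, of s] by simp
  have us[measurable]: "u s \<in> borel_measurable borel" for s using measurable_Pair2[OF um, of s] by simp
  have Fm[measurable]: "F \<in> borel_measurable borel" by (rule nice_meas[OF F(2)])
  have LFm[measurable]: "frac_gen h F \<in> borel_measurable borel" by (rule frac_gen_meas[OF F(2)])
  have Fi: "integrable lborel F" by (rule nice_integrable[OF F(2)])
  have LFi: "integrable lborel (frac_gen h F)" by (rule gn_tendsto_L1(2)[OF F(2)])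
  define w where "w s x = v s x - u s x" for s x
  define B where "B = B1 + B2"
  have wb: "bnd B (w s)" if "s \<in> {0..T}" for s unfolding bnd_def
  proof
    fix x show "\<bar>w s x\<bar> \<le> B" using B1[OF that, of x] B2[OF that, of x] by (simp add: w_def B_def)
  qed
  have wm[measurable]: "w s \<in> borel_measurable borel" for s unfolding w_def[abs_def] by measurable
  have B0: "0 \<le> B" using bnd_nonneg[OF wb[OF t]] .
  define f where "f s y = th s * (LBINT x. w s (y + x) * F x)" for s y
  define a where "a s y = th' s * (LBINT x. w s (y + x) * F x) + th s * (LBINT x. w s (y + x) * frac_gen h F x)" for s y
  define av where "av v s y = th' s * (LBINT x. v s (y + x) * F x) + th s * (LBINT x. v s (y + x) * frac_gen h F x)" for v :: "real \<Rightarrow> real^'d \<Rightarrow> real" and s y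
  have split: "(LBINT x. w s (y + x) * H x) = (LBINT x. v s (y + x) * H x) - (LBINT x. u s (y + x) * H x)"
    if s: "s \<in> {0..T}" and H: "integrable lborel H" for s y H
  proof -
    have "integrable lborel (\<lambda>x. v s (y + x) * H x)" by (rule integrable_mult_bnd[OF H _ B1[OF s]]) simp
    moreover have "integrable lborel (\<lambda>x. u s (y + x) * H x)" by (rule integrable_mult_bnd[OF H _ B2[OF s]]) simp
    ultimately show ?thesis by (simp add: w_def left_diff_distrib)
  qed
  have aw: "a s y = av v s y - av u s y" if "s \<in> {0..T}" for s y
    unfolding a_def av_def split[OF that Fi] split[OF that LFi] by (simp add: algebra_simps)
  have avi: "set_integrable lborel {0..T} (\<lambda>s. av v s y)" for y
    unfolding av_def by (intro set_integral_add(1) set_integrable_pairing[OF vm B1] Fi LFi th_cont)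
  have aui: "set_integrable lborel {0..T} (\<lambda>s. av u s y)" for y
    unfolding av_def by (intro set_integral_add(1) set_integrable_pairing[OF um B2] Fi LFi th_cont)
  have feq0: "f s y = (LBINT r:{0..s}. a r y)" if s: "s \<in> {0..T}" for s y
  proof -
    have sub: "set_integrable lborel {0..s} (\<lambda>r. av v r y)" "set_integrable lborel {0..s} (\<lambda>r. av u r y)"
      using set_integrable_Icc_subset[OF avi] set_integrable_Icc_subset[OF aui] s by auto
    have "(LBINT r:{0..s}. a r y) = (LBINT r:{0..s}. av v r y - av u r y)"
      by (rule set_lebesgue_integral_cong) (use aw s in auto)
    also have "\<dots> = (LBINT r:{0..s}. av v r y) - (LBINT r:{0..s}. av u r y)" by (rule set_integral_diff(2)[OF sub])
    also have "\<dots> = f s y"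
      unfolding f_def split[OF s Fi] av_def
      using weak_sol_tested[OF v F s, of y] weak_sol_tested[OF u F s, of y] by (simp add: right_diff_distrib)
    finally show ?thesis by simp
  qed
  have f0: "f 0 y = 0" for y
  proof -
    have "(LBINT r:{0..0}. a r y) = 0"
    proof -
      have "AE r in lborel. indicator {0..0} r *\<^sub>R a r y = 0" using AE_lborel_singleton[of "0::real"] by eventually_elim auto
      then show ?thesis unfolding set_lebesgue_integral_def by (rule integral_eq_zero_AE)
    qed
    then show ?thesis using feq0[of 0 y] T by simp
  qed
  have ai: "set_integrable lborel {0..T} (\<lambda>r. a r y)" for y
  proof -
    have "set_integrable lborel {0..T} (\<lambda>r. av v r y - av u r y)" by (rule set_integral_diff(1)[OF avi aui])
    moreover have "(\<lambda>r. indicator {0..T} r *\<^sub>R (av v r y - av u r y)) = (\<lambda>r. indicator {0..T} r *\<^sub>R a r y)"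
      using aw by (auto simp: fun_eq_iff split: split_indicator)
    ultimately show ?thesis by (simp only: set_integrable_def)
  qed
  let ?I = "LBINT x. \<bar>F x\<bar>"
  define e where "e n = B * (LBINT x. \<bar>frac_gen h F x - gn n F x\<bar>)" for n
  have e0: "0 \<le> e n" for n using B0 by (simp add: e_def)
  have main: "\<bar>f t 0\<bar> \<le> e n * t" if n: "0 < n" for n
  proof -
    interpret p: walk "pn n" by (rule pn_walk)
    have "\<forall>s. \<exists>\<rho>. s \<in> {0..T} \<longrightarrow> 0 \<le> \<rho> \<and> \<rho> \<le> 2 * T \<and> th' s = - \<rho> * th s" using th_ratio by meson
    then obtain \<rho> where \<rho>: "\<And>s. s \<in> {0..T} \<Longrightarrow> 0 \<le> \<rho> s \<and> \<rho> s \<le> 2 * T \<and> th' s = - \<rho> s * th s" by metis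
    define I where "I s y = (LBINT x. w s (y + x) * F x)" for s y
    have Ib: "bnd (B * ?I) (I s)" if "s \<in> {0..T}" for s unfolding I_def by (rule gn_pairing(2)[OF wm wb[OF that] F(2)])
    have fI: "f s = (\<lambda>y. th s * I s y)" for s by (simp add: f_def I_def fun_eq_iff)
    have fb: "bnd (B * ?I) (f s)" if "s \<in> {0..T}" for s unfolding bnd_def
    proof
      fix y
      have "\<bar>th s\<bar> * \<bar>I s y\<bar> \<le> 1 * (B * ?I)" using th_range[of s] bndD[OF Ib[OF that], of y] by (intro mult_mono) auto
      then show "\<bar>f s y\<bar> \<le> B * ?I" by (simp add: fI abs_mult)
    qed
    have fc: "conv (pn n) (shiftn n) (f s) y = th s * conv (pn n) (shiftn n) (I s) y" if "s \<in> {0..T}" for s y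
      unfolding fI using conv_lin[OF p.p_int Ib[OF that] Ib[OF that], of "shiftn n" "th s" 0 y] by simp
    have "\<bar>f t 0\<bar> \<le> 0 + e n * t"
    \<comment> \<open>Adding 2 T to the rate leaves the damping term as (2 T - \<rho>) f, whose
      coefficient is nonnegative, so that \<open>b\<close> is monotone in f.\<close>
    proof (rule max_principle_abs[where T=T and X=UNIV and a=a and K="rate (pn n) + 2 * T" and Bd="B * ?I" and b="\<lambda>s y. conv (pn n) (shiftn n) (f s) y + (2 * T - \<rho> s) * f s y"])
      show "f s y = f 0 y + (LBINT r:{0..s}. a r y)" if "s \<in> {0..T}" for s y using feq0[OF that] f0 by simp
      show "set_integrable lborel {0..T} (\<lambda>r. a r x)" for x by (rule ai)
      fix s y assume s: "s \<in> {0..T}"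
      have g: "gn n (I s) y = (LBINT x. w s (y + x) * gn n F x)" unfolding I_def by (rule gn_pairing(1)[OF wm wb[OF s] F(2)])
      have cI: "conv (pn n) (shiftn n) (I s) y = (LBINT x. w s (y + x) * gn n F x) + rate (pn n) * I s y"
        using g by (simp add: gen_def)
      have i1: "integrable lborel (\<lambda>x. w s (y + x) * frac_gen h F x)" by (rule integrable_mult_bnd[OF LFi _ bndD[OF wb[OF s]]]) simp
      have i2: "integrable lborel (\<lambda>x. w s (y + x) * gn n F x)" by (rule integrable_mult_bnd[OF gn_tendsto_L1(3)[OF F(2) n] _ bndD[OF wb[OF s]]]) simp
      have "a s y + (rate (pn n) + 2 * T) * f s y - (conv (pn n) (shiftn n) (f s) y + (2 * T - \<rho> s) * f s y)
         = th s * ((LBINT x. w s (y + x) * frac_gen h F x) - (LBINT x. w s (y + x) * gn n F x))"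
      proof -
        have aI: "a s y = - \<rho> s * th s * I s y + th s * (LBINT x. w s (y + x) * frac_gen h F x)"
          using \<rho>[OF s] by (simp add: a_def I_def)
        have fy: "f s y = th s * I s y" by (simp add: fI)
        show ?thesis unfolding fc[OF s] cI aI fy by (simp add: algebra_simps)
      qed
      also have "(LBINT x. w s (y + x) * frac_gen h F x) - (LBINT x. w s (y + x) * gn n F x) = (LBINT x. w s (y + x) * frac_gen h F x - w s (y + x) * gn n F x)"
        using i1 i2 by simp
      also have "\<bar>th s * \<dots>\<bar> \<le> 1 * e n"
        unfolding abs_mult
      proof (rule mult_mono)
        show "\<bar>LBINT x. w s (y + x) * frac_gen h F x - w s (y + x) * gn n F x\<bar> \<le> e n"
          unfolding e_def integral_mult_right_zero[symmetric] real_norm_def[symmetric]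
        proof (rule Bochner_Integration.integral_norm_bound_integral)
          show "integrable lborel (\<lambda>x. B * norm (frac_gen h F x - gn n F x))"
            by (intro integrable_cmult integrable_norm integrable_diffL LFi gn_tendsto_L1(3)[OF F(2) n])
          show "norm (w s (y + x) * frac_gen h F x - w s (y + x) * gn n F x) \<le> B * norm (frac_gen h F x - gn n F x)" for x
            unfolding right_diff_distrib[symmetric] norm_mult using bndD[OF wb[OF s]] by (intro mult_right_mono) auto
        qed (use i1 i2 in auto)
      qed (use th_range[of s] in auto)
      finally show "\<bar>a s y + (rate (pn n) + 2 * T) * f s y - (conv (pn n) (shiftn n) (f s) y + (2 * T - \<rho> s) * f s y)\<bar> \<le> e n" by simp
      { fix m :: real assume m: "0 \<le> m" and "\<And>y. y \<in> UNIV \<Longrightarrow> - m \<le> f s y"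
        then have lo: "\<forall>y. - m \<le> f s y" by simp
        have "rate (pn n) * (- m) \<le> conv (pn n) (shiftn n) (f s) y" by (rule p.conv_ge[OF fb[OF s] lo])
        moreover have "(2 * T - \<rho> s) * (- m) \<le> (2 * T - \<rho> s) * f s y" using lo \<rho>[OF s] by (intro mult_left_mono) auto
        moreover have "0 \<le> \<rho> s * m" using \<rho>[OF s] m by simp
        ultimately show "- ((rate (pn n) + 2 * T) * m) \<le> conv (pn n) (shiftn n) (f s) y + (2 * T - \<rho> s) * f s y" by (simp add: algebra_simps) }
      { fix m :: real assume m: "0 \<le> m" and "\<And>y. y \<in> UNIV \<Longrightarrow> f s y \<le> m"
        then have hi: "\<forall>y. f s y \<le> m" by simp
        have "conv (pn n) (shiftn n) (f s) y \<le> rate (pn n) * m" by (rule p.conv_le[OF fb[OF s] hi])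
        moreover have "(2 * T - \<rho> s) * f s y \<le> (2 * T - \<rho> s) * m" using hi \<rho>[OF s] by (intro mult_left_mono) auto
        moreover have "0 \<le> \<rho> s * m" using \<rho>[OF s] m by simp
        ultimately show "conv (pn n) (shiftn n) (f s) y + (2 * T - \<rho> s) * f s y \<le> (rate (pn n) + 2 * T) * m" by (simp add: algebra_simps) }
    qed (use T p.rate_nonneg e0 f0 t bndD[OF fb] in auto)
    then show ?thesis by simp
  qed
  have "e \<longlonglongrightarrow> B * 0" unfolding e_def[abs_def] by (intro tendsto_mult tendsto_const gn_tendsto_L1(1)[OF F(2)])
  then have el: "(\<lambda>n. e n * t) \<longlonglongrightarrow> 0 * t" by (intro tendsto_mult tendsto_const) simp
  have "\<bar>f t 0\<bar> \<le> 0"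
    using tendsto_lowerbound[OF el, of "\<bar>f t 0\<bar>"] main by (auto intro!: eventually_mono[OF eventually_gt_at_top[of 0]])
  then have "f t 0 = 0" by simp
  then show ?thesis using th_range(3)[OF t] by (simp add: f_def w_def)
qed

text \<open>Test the difference w with a smooth F that is \<delta>-close in L^1 to the sign of w on
  a ball. As w is bounded by B, the integral of |w| over the ball is at most B \<delta>.\<close>

lemma weak_sol_unique:
  assumes v: "weak_sol T h u0 v" and u: "weak_sol T h u0 u" and t: "t \<in> {0..T}"
  shows "AE x in lborel. v t x = u t x"
proof -
  obtain B1 where B1: "\<And>x. \<bar>v t x\<bar> \<le> B1" using v t unfolding weak_sol_def by blast
  obtain B2 where B2: "\<And>x. \<bar>u t x\<bar> \<le> B2" using u t unfolding weak_sol_def by blast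
  have vm: "(\<lambda>(t, x). v t x) \<in> borel_measurable (lborel \<Otimes>\<^sub>M lborel)" using v unfolding weak_sol_def by blast
  have um: "(\<lambda>(t, x). u t x) \<in> borel_measurable (lborel \<Otimes>\<^sub>M lborel)" using u unfolding weak_sol_def by blast
  have vs[measurable]: "v t \<in> borel_measurable borel" using measurable_Pair2[OF vm, of t] by simp
  have us[measurable]: "u t \<in> borel_measurable borel" using measurable_Pair2[OF um, of t] by simp
  define w where "w x = v t x - u t x" for x
  define B where "B = B1 + B2"
  have wb: "\<bar>w x\<bar> \<le> B" for x using B1[of x] B2[of x] by (simp add: w_def B_def)
  have B0: "0 \<le> B" using wb[of undefined] by linarith
  have wm[measurable]: "w \<in> borel_measurable borel" unfolding w_def[abs_def] by measurable
  have cb[measurable]: "cball (0 :: real^'d) r \<in> sets borel" for r by simp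
  have "AE x in lborel. indicator (cball 0 (real j)) x * \<bar>w x\<bar> = 0" for j
  proof -
    have i: "integrable lborel (\<lambda>x. indicator (cball 0 (real j)) x * \<bar>w x\<bar>)"
      by (rule integrable_boundL[OF integrable_indicator_cball[of B "real j"]])
        (use wb B0 in \<open>auto split: split_indicator intro!: AE_I2\<close>)
    have le: "(LBINT x. indicator (cball 0 (real j)) x * \<bar>w x\<bar>) \<le> B * \<delta>" if \<delta>: "0 < \<delta>" for \<delta>
    proof -
      have sb: "bnd 1 (\<lambda>x. sgn (w x))" by (auto simp: bnd_def sgn_if)
      obtain q where q: "real_polynomial_function q" "(LBINT x. \<bar>sgn (w x) * indicator (cball 0 (real j)) x - bump (real j + 2) q x\<bar>) \<le> \<delta>"
        using L1_dense[of "\<lambda>x. sgn (w x)" "real j" \<delta>] sb \<delta> by auto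
      define F where "F = bump (real j + 2) q"
      obtain C where F: "nice (real j + 2) C F" using bump_nice[OF q(1), of "real j + 2"] by (auto simp: F_def)
      have [measurable]: "F \<in> borel_measurable borel" by (rule nice_meas[OF F])
      have z: "(LBINT x. w x * F x) = 0"
        using weak_sol_unique_tested[OF v u _ F t] SM_bump[OF q(1)] by (simp add: F_def w_def)
      have iF: "integrable lborel (\<lambda>x. w x * F x)" by (rule integrable_mult_bnd[OF nice_integrable[OF F] _ wb]) simp
      have d: "\<bar>indicator (cball 0 (real j)) x * \<bar>w x\<bar> - w x * F x\<bar> \<le> B * \<bar>sgn (w x) * indicator (cball 0 (real j)) x - F x\<bar>" for x
      proof -
        have "indicator (cball 0 (real j)) x * \<bar>w x\<bar> - w x * F x = w x * (sgn (w x) * indicator (cball 0 (real j)) x - F x)"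
          by (simp add: algebra_simps abs_sgn)
        then show ?thesis using wb[of x] by (simp add: abs_mult mult_right_mono)
      qed
      have id: "integrable lborel (\<lambda>x. sgn (w x) * indicator (cball 0 (real j)) x - F x)"
      proof (rule integrable_diffL[OF _ nice_integrable[OF F]])
        show "integrable lborel (\<lambda>x. sgn (w x) * indicator (cball 0 (real j)) x)"
          by (rule integrable_mult_bnd[where D=1]) (use integrable_indicator_cball[of 1 "real j"] in \<open>auto simp: sgn_if\<close>)
      qed
      have "(LBINT x. indicator (cball 0 (real j)) x * \<bar>w x\<bar>) = (LBINT x. indicator (cball 0 (real j)) x * \<bar>w x\<bar> - w x * F x)"
        using i iF z by simp
      also have "\<dots> \<le> (LBINT x. B * \<bar>sgn (w x) * indicator (cball 0 (real j)) x - F x\<bar>)"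
        by (intro integral_mono integrable_diffL i iF integrable_cmult integrable_abs id) (use order_trans[OF abs_ge_self d] in auto)
      also have "\<dots> \<le> B * \<delta>" using q(2) B0 by (simp add: F_def mult_left_mono)
      finally show ?thesis .
    qed
    have "(LBINT x. indicator (cball 0 (real j)) x * \<bar>w x\<bar>) \<le> 0"
    proof (rule field_le_epsilon)
      fix e :: real assume e: "0 < e"
      have "B * (e / (B + 1)) \<le> e" using B0 e by (simp add: field_simps)
      then show "(LBINT x. indicator (cball 0 (real j)) x * \<bar>w x\<bar>) \<le> 0 + e" using le[of "e / (B + 1)"] e B0 by simp
    qed
    moreover have "0 \<le> (LBINT x. indicator (cball 0 (real j)) x * \<bar>w x\<bar>)" by (intro integral_nonnegL) auto
    ultimately have "(LBINT x. indicator (cball 0 (real j)) x * \<bar>w x\<bar>) = 0" by linarith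
    then show ?thesis using integral_nonneg_eq_0_iff_AE[OF i] by simp
  qed
  then have "AE x in lborel. \<forall>j. indicator (cball 0 (real j)) x * \<bar>w x\<bar> = 0"
    using AE_all_countable[of "\<lambda>j x. indicator (cball 0 (real j)) x * \<bar>w x\<bar> = 0" lborel] by blast
  then show ?thesis
  proof eventually_elim
    fix x assume *: "\<forall>j. indicator (cball 0 (real j)) x * \<bar>w x\<bar> = 0"
    obtain j where "norm x \<le> real j" using real_arch_simple by blast
    then have "w x = 0" using *[rule_format, of j] by simp
    then show "v t x = u t x" by (simp add: w_def)
  qed
qed

end

section \<open>A maximal inequality\<close>

lemma (in prob_space) integrable_bdd:
  fixes f :: "'a \<Rightarrow> real"
  assumes "f \<in> borel_measurable M" "\<And>w. w \<in> space M \<Longrightarrow> \<bar>f w\<bar> \<le> D"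
  shows "integrable M f"
  by (rule integrable_const_bound[where B=D]) (use assms in auto)

lemma (in prob_space) abs_expectation_le:
  fixes f :: "'a \<Rightarrow> real"
  assumes "f \<in> borel_measurable M" "\<And>w. w \<in> space M \<Longrightarrow> \<bar>f w\<bar> \<le> D"
  shows "\<bar>\<integral>w. f w \<partial>M\<bar> \<le> D"
  using integral_abs_bound[of M f] integral_mono[of M "\<lambda>w. \<bar>f w\<bar>" "\<lambda>_. D"] integrable_bdd[OF assms] assms(2)
  by (simp add: prob_space del: integral_abs_bound)

text \<open>Kolmogorov's inequality with the martingale property expressed, as in
  \<open>martingale_problem\<close>, by orthogonality of increments to bounded variables of the
  past; no conditional expectation is formed.\<close>

lemma (in prob_space) maximal_inequality_finite:
  fixes X :: "nat \<Rightarrow> 'a \<Rightarrow> real" and Z :: "'a \<Rightarrow> real"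
  assumes F: "\<And>i. (\<lambda>w. w) \<in> measurable M (F i)" "\<And>i j. i \<le> j \<Longrightarrow> (\<lambda>w. w) \<in> measurable (F j) (F i)"
    and space_F: "\<And>i. space (F i) = space M"
    and X: "\<And>i. X i \<in> borel_measurable (F i)" and Xb: "\<And>i w. w \<in> space M \<Longrightarrow> \<bar>X i w\<bar> \<le> B"
    and Z: "Z \<in> borel_measurable M" and Zb: "\<And>w. w \<in> space M \<Longrightarrow> \<bar>Z w\<bar> \<le> B"
    and mart: "\<And>i Y. Y \<in> borel_measurable (F i) \<Longrightarrow> bounded (Y ` space M) \<Longrightarrow> (\<integral>w. (Z w - X i w) * Y w \<partial>M) = 0"
    and \<epsilon>: "0 < \<epsilon>"
  shows "measure M {w \<in> space M. \<exists>i<n. \<epsilon> < \<bar>X i w\<bar>} * \<epsilon>\<^sup>2 \<le> (\<integral>w. (Z w)\<^sup>2 \<partial>M)"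
proof -
  have XM[measurable]: "X i \<in> borel_measurable M" for i using measurable_compose[OF F(1) X] by simp
  note Z[measurable]
  \<comment> \<open>The event that i is the first index at which the bound fails. It belongs to the
    past at i, so X i times its indicator is an admissible test variable.\<close>
  define A where "A i = {w \<in> space M. \<epsilon> < \<bar>X i w\<bar> \<and> (\<forall>j<i. \<bar>X j w\<bar> \<le> \<epsilon>)}" for i
  have AF: "A i \<in> sets (F i)" for i
  proof -
    have Xj: "X j \<in> borel_measurable (F i)" if "j \<le> i" for j using measurable_compose[OF F(2)[OF that] X] by simp
    have 1: "{w \<in> space (F i). \<epsilon> < \<bar>X i w\<bar>} \<in> sets (F i)" using Xj[of i] by measurable
    have 2: "{w \<in> space (F i). \<forall>j\<in>{..<i}. \<bar>X j w\<bar> \<le> \<epsilon>} \<in> sets (F i)"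
    proof (rule sets.sets_Collect_finite_All)
      fix j assume "j \<in> {..<i}"
      then have [measurable]: "X j \<in> borel_measurable (F i)" by (intro Xj) simp
      show "{w \<in> space (F i). \<bar>X j w\<bar> \<le> \<epsilon>} \<in> sets (F i)" by measurable
    qed simp
    have "A i = {w \<in> space (F i). \<epsilon> < \<bar>X i w\<bar>} \<inter> {w \<in> space (F i). \<forall>j\<in>{..<i}. \<bar>X j w\<bar> \<le> \<epsilon>}"
      by (auto simp: A_def space_F)
    then show ?thesis using 1 2 by auto
  qed
  have AM[measurable]: "A i \<in> sets M" for i
    using measurable_sets[OF F(1)[of i] AF] sets.sets_into_space[OF AF[of i]] by (simp add: space_F Int_absorb2 vimage_def)
  have U: "{w \<in> space M. \<exists>i<n. \<epsilon> < \<bar>X i w\<bar>} = (\<Union>i<n. A i)"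
  proof (intro equalityI subsetI)
    fix w assume "w \<in> {w \<in> space M. \<exists>i<n. \<epsilon> < \<bar>X i w\<bar>}"
    then obtain i where i: "w \<in> space M" "i < n" "\<epsilon> < \<bar>X i w\<bar>" by auto
    define i0 where "i0 = (LEAST i. \<epsilon> < \<bar>X i w\<bar>)"
    have "\<epsilon> < \<bar>X i0 w\<bar>" unfolding i0_def by (rule LeastI[of _ i]) fact
    moreover have "i0 \<le> i" unfolding i0_def by (rule Least_le) fact
    moreover have "\<bar>X j w\<bar> \<le> \<epsilon>" if "j < i0" for j using not_less_Least[of j "\<lambda>i. \<epsilon> < \<bar>X i w\<bar>"] that by (simp add: i0_def not_less)
    ultimately show "w \<in> (\<Union>i<n. A i)" using i by (auto simp: A_def intro!: bexI[of _ i0])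
  qed (auto simp: A_def)
  have dj: "disjoint_family_on A {..<n}"
    unfolding disjoint_family_on_def
  proof (intro ballI impI)
    fix i j :: nat assume "i \<noteq> j"
    then show "A i \<inter> A j = {}" by (rule linorder_neqE_nat) (force simp: A_def)+
  qed
  have B0: "0 \<le> B" using Zb not_empty by (metis abs_ge_zero ex_in_conv order_trans)
  have sq: "\<bar>x * y\<bar> \<le> B * B" if "\<bar>x\<bar> \<le> B" "\<bar>y\<bar> \<le> B" for x y :: real
    unfolding abs_mult using that by (intro mult_mono) auto
  have Zsq: "(Z w)\<^sup>2 \<le> B * B" and Xsq: "(X i w)\<^sup>2 \<le> B * B" if "w \<in> space M" for w i
    using sq[OF Zb[OF that] Zb[OF that]] sq[OF Xb[OF that] Xb[OF that], of i i] by (auto simp: power2_eq_square)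
  have step: "\<epsilon>\<^sup>2 * measure M (A i) \<le> (\<integral>w. (Z w)\<^sup>2 * indicator (A i) w \<partial>M)" for i
  proof -
    have i1: "integrable M (\<lambda>w. (Z w)\<^sup>2 * indicator (A i) w)"
      by (rule integrable_bdd[where D="B * B"]) (use Zsq B0 in \<open>auto split: split_indicator\<close>)
    have i2: "integrable M (\<lambda>w. (X i w)\<^sup>2 * indicator (A i) w)"
      by (rule integrable_bdd[where D="B * B"]) (use Xsq B0 in \<open>auto split: split_indicator\<close>)
    have i3: "integrable M (\<lambda>w. (Z w - X i w) * (X i w * indicator (A i) w))"
    proof (rule integrable_bdd[where D="(B + B) * B"])
      fix w assume w: "w \<in> space M"
      have "\<bar>Z w - X i w\<bar> * \<bar>X i w * indicator (A i) w\<bar> \<le> (B + B) * B"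
        using Zb[OF w] Xb[OF w, of i] B0 by (intro mult_mono) (auto split: split_indicator)
      then show "\<bar>(Z w - X i w) * (X i w * indicator (A i) w)\<bar> \<le> (B + B) * B" by (simp add: abs_mult)
    qed measurable
    have m: "(\<integral>w. (Z w - X i w) * (X i w * indicator (A i) w) \<partial>M) = 0"
    proof (rule mart)
      show "(\<lambda>w. X i w * indicator (A i) w) \<in> borel_measurable (F i)" using X AF by (intro borel_measurable_times borel_measurable_indicator) auto
      show "bounded ((\<lambda>w. X i w * indicator (A i) w) ` space M)"
        unfolding bounded_iff using Xb B0 by (intro exI[of _ B]) (auto split: split_indicator)
    qed
    have "\<epsilon>\<^sup>2 * measure M (A i) = (\<integral>w. \<epsilon>\<^sup>2 * indicator (A i) w \<partial>M)" by simp
    also have "\<dots> \<le> (\<integral>w. (X i w)\<^sup>2 * indicator (A i) w \<partial>M)"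
    proof (rule integral_mono)
      show "integrable M (\<lambda>w. \<epsilon>\<^sup>2 * indicator (A i) w)" by (rule integrable_bdd[where D="\<epsilon>\<^sup>2"]) (auto split: split_indicator)
      fix w
      show "\<epsilon>\<^sup>2 * indicator (A i) w \<le> (X i w)\<^sup>2 * indicator (A i) w"
      proof (cases "w \<in> A i")
        case True
        then have "\<epsilon> \<le> \<bar>X i w\<bar>" by (auto simp: A_def)
        then have "\<epsilon>\<^sup>2 \<le> \<bar>X i w\<bar>\<^sup>2" using \<epsilon> by (intro power_mono) auto
        then show ?thesis using True by simp
      qed simp
    qed (rule i2)
    \<comment> \<open>The added cross term has mean zero; it completes the expansion of the square
      of Z = X i + (Z - X i) up to a nonnegative remainder.\<close>
    also have "\<dots> = (\<integral>w. (X i w)\<^sup>2 * indicator (A i) w + 2 * ((Z w - X i w) * (X i w * indicator (A i) w)) \<partial>M)"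
      using i2 i3 m by simp
    also have "\<dots> \<le> (\<integral>w. (Z w)\<^sup>2 * indicator (A i) w \<partial>M)"
    proof (rule integral_mono)
      fix w
      have "0 \<le> (Z w - X i w)\<^sup>2 * indicator (A i) w" by simp
      then show "(X i w)\<^sup>2 * indicator (A i) w + 2 * ((Z w - X i w) * (X i w * indicator (A i) w)) \<le> (Z w)\<^sup>2 * indicator (A i) w"
        by (simp add: power2_eq_square algebra_simps split: split_indicator)
    qed (use i1 i2 i3 in auto)
    finally show ?thesis .
  qed
  have "measure M (\<Union>i<n. A i) = (\<Sum>i<n. measure M (A i))"
    by (rule finite_measure_finite_Union) (use dj in auto)
  then have "measure M {w \<in> space M. \<exists>i<n. \<epsilon> < \<bar>X i w\<bar>} * \<epsilon>\<^sup>2 = (\<Sum>i<n. \<epsilon>\<^sup>2 * measure M (A i))"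
    by (simp add: U sum_distrib_left mult.commute)
  also have "\<dots> \<le> (\<Sum>i<n. \<integral>w. (Z w)\<^sup>2 * indicator (A i) w \<partial>M)" by (intro sum_mono step)
  also have "\<dots> = (\<integral>w. (\<Sum>i<n. (Z w)\<^sup>2 * indicator (A i) w) \<partial>M)"
    by (rule Bochner_Integration.integral_sum[symmetric], rule integrable_bdd[where D="B * B"])
      (use Zsq B0 in \<open>auto split: split_indicator\<close>)
  also have "\<dots> \<le> (\<integral>w. (Z w)\<^sup>2 \<partial>M)"
  proof (rule integral_mono)
    have s1: "(\<Sum>i<n. (Z w)\<^sup>2 * indicator (A i) w) = (Z w)\<^sup>2 * indicator (\<Union>i<n. A i) w" for w
      by (subst indicator_UN_disjoint[OF finite_lessThan dj]) (simp only: sum_distrib_left)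
    show "integrable M (\<lambda>w. \<Sum>i<n. (Z w)\<^sup>2 * indicator (A i) w)"
      unfolding s1 by (rule integrable_bdd[where D="B * B"]) (use Zsq B0 in \<open>auto split: split_indicator\<close>)
    show "integrable M (\<lambda>w. (Z w)\<^sup>2)" by (rule integrable_bdd[where D="B * B"]) (use Zsq in \<open>auto\<close>)
    show "(\<Sum>i<n. (Z w)\<^sup>2 * indicator (A i) w) \<le> (Z w)\<^sup>2" for w unfolding s1 by (auto split: split_indicator)
  qed
  finally show ?thesis .
qed

text \<open>The discrete inequality on dyadic grids has a bound independent of the grid; the bad
  events increase, and right continuity extends control from grid times to all times. A measurable
  good set is returned, so the supremum itself need not be measurable.\<close>

lemma (in prob_space) maximal_inequality:
  fixes X :: "real \<Rightarrow> 'a \<Rightarrow> real"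
  assumes S: "0 < S" and F: "\<And>s. (\<lambda>w. w) \<in> measurable M (F s)" "\<And>s t. s \<le> t \<Longrightarrow> (\<lambda>w. w) \<in> measurable (F t) (F s)"
    and space_F: "\<And>s. space (F s) = space M"
    and X: "\<And>s. s \<in> {0..S} \<Longrightarrow> X s \<in> borel_measurable (F s)"
    and Xb: "\<And>s w. s \<in> {0..S} \<Longrightarrow> w \<in> space M \<Longrightarrow> \<bar>X s w\<bar> \<le> B"
    and mart: "\<And>s Y. s \<in> {0..S} \<Longrightarrow> Y \<in> borel_measurable (F s) \<Longrightarrow> bounded (Y ` space M) \<Longrightarrow> (\<integral>w. (X S w - X s w) * Y w \<partial>M) = 0"
    and rc: "\<And>w t e. w \<in> space M \<Longrightarrow> t \<in> {0..<S} \<Longrightarrow> 0 < e \<Longrightarrow> \<exists>\<delta>>0. \<forall>s. t \<le> s \<and> s < t + \<delta> \<and> s \<le> S \<longrightarrow> \<bar>X s w - X t w\<bar> < e"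
    and \<epsilon>: "0 < \<epsilon>"
  shows "\<exists>A\<in>sets M. (\<forall>w\<in>A. \<forall>t\<in>{0..S}. \<bar>X t w\<bar> \<le> \<epsilon>) \<and> 1 - (\<integral>w. (X S w)\<^sup>2 \<partial>M) / \<epsilon>\<^sup>2 \<le> measure M A"
proof -
  \<comment> \<open>Capping at S keeps every index inside [0, S]; doubling i shows each grid to be
    contained in the next.\<close>
  define \<tau> where "\<tau> k i = min S (S * real i / 2 ^ k)" for k i :: nat
  have \<tau>r: "\<tau> k i \<in> {0..S}" for k i using S by (auto simp: \<tau>_def)
  have \<tau>m: "\<tau> k i \<le> \<tau> k j" if "i \<le> j" for k i j
    using that S unfolding \<tau>_def by (intro min.mono divide_right_mono mult_left_mono) auto
  define N where "N k = {w \<in> space M. \<exists>i<Suc (2 ^ k). \<epsilon> < \<bar>X (\<tau> k i) w\<bar>}" for k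
  have XM: "X s \<in> borel_measurable M" if "s \<in> {0..S}" for s using measurable_compose[OF F(1) X[OF that]] by simp
  have SS: "S \<in> {0..S}" using S by simp
  have Nb: "measure M (N k) \<le> (\<integral>w. (X S w)\<^sup>2 \<partial>M) / \<epsilon>\<^sup>2" for k
  proof -
    have "measure M (N k) * \<epsilon>\<^sup>2 \<le> (\<integral>w. (X S w)\<^sup>2 \<partial>M)"
      unfolding N_def
      by (rule maximal_inequality_finite[where F="\<lambda>i. F (\<tau> k i)" and B=B])
        (use F \<tau>m space_F X[OF \<tau>r] Xb[OF \<tau>r] Xb[OF SS] XM[OF SS] mart[OF \<tau>r] \<epsilon> in auto)
    then show ?thesis using \<epsilon> by (simp add: field_simps)
  qed
  have Nm: "N k \<in> sets M" for k
  proof -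
    have "N k = (\<Union>i\<in>{..<Suc (2 ^ k)}. {w \<in> space M. \<epsilon> < \<bar>X (\<tau> k i) w\<bar>})" by (auto simp: N_def)
    also have "\<dots> \<in> sets M" using XM[OF \<tau>r] by (intro sets.finite_UN) auto
    finally show ?thesis .
  qed
  have inc: "incseq N"
  proof (rule incseq_SucI, rule subsetI)
    fix k w assume "w \<in> N k"
    then obtain i where i: "w \<in> space M" "i < Suc (2 ^ k)" "\<epsilon> < \<bar>X (\<tau> k i) w\<bar>" by (auto simp: N_def)
    have "\<tau> (Suc k) (2 * i) = \<tau> k i" by (simp add: \<tau>_def)
    moreover have "2 * i < Suc (2 ^ Suc k)" using i(2) by simp
    ultimately show "w \<in> N (Suc k)" using i unfolding N_def by (metis (mono_tags, lifting) mem_Collect_eq)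
  qed
  have "(\<lambda>k. measure M (N k)) \<longlonglongrightarrow> measure M (\<Union>k. N k)"
    by (rule finite_Lim_measure_incseq) (use Nm inc in auto)
  then have le: "measure M (\<Union>k. N k) \<le> (\<integral>w. (X S w)\<^sup>2 \<partial>M) / \<epsilon>\<^sup>2"
    by (rule LIMSEQ_le_const2) (use Nb in auto)
  have UN: "(\<Union>k. N k) \<in> sets M" using Nm by auto
  have "\<bar>X t w\<bar> \<le> \<epsilon>" if w: "w \<in> space M - (\<Union>k. N k)" and t: "t \<in> {0..S}" for w t
  proof -
    have wS: "w \<in> space M" using w by simp
    have grid: "\<bar>X (\<tau> k i) w\<bar> \<le> \<epsilon>" if "i \<le> 2 ^ k" for k i
      using w that by (auto simp: N_def not_less less_Suc_eq_le)
    show ?thesis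
    proof (cases "t = S")
      case True
      have "\<tau> 0 1 = S" by (simp add: \<tau>_def)
      then show ?thesis using grid[of 1 0] True by simp
    next
      case False
      then have tS: "t \<in> {0..<S}" using t by auto
      show ?thesis
      proof (rule field_le_epsilon)
        fix e :: real assume e: "0 < e"
        obtain \<delta> where \<delta>: "0 < \<delta>" "\<And>s. t \<le> s \<Longrightarrow> s < t + \<delta> \<Longrightarrow> s \<le> S \<Longrightarrow> \<bar>X s w - X t w\<bar> < e"
          using rc[OF wS tS e] by blast
        obtain k where k: "S / \<delta> < 2 ^ k" using real_arch_pow[of 2 "S / \<delta>"] by auto
        \<comment> \<open>The first grid point at or after t; it lies within S / 2^k < \<delta> to
          the right, where right continuity applies.\<close>
        define i where "i = nat \<lceil>t * 2 ^ k / S\<rceil>"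
        have "0 \<le> t * 2 ^ k / S" using tS S by simp
        then have ii: "t * 2 ^ k / S \<le> real i" "real i < t * 2 ^ k / S + 1" unfolding i_def by linarith+
        have "t * 2 ^ k / S \<le> 2 ^ k" using tS S by (simp add: field_simps)
        then have "real i < 2 ^ k + 1" using ii by linarith
        then have "real i < real (2 ^ k + 1)" by simp
        then have i2: "i \<le> 2 ^ k" unfolding of_nat_less_iff by simp
        have lo: "t \<le> S * real i / 2 ^ k" using ii(1) S by (simp add: field_simps)
        have "S * real i / 2 ^ k < S * (t * 2 ^ k / S + 1) / 2 ^ k" using ii(2) S by (simp add: divide_strict_right_mono)
        also have "\<dots> = t + S / 2 ^ k" using S by (simp add: field_simps)
        also have "S / 2 ^ k < \<delta>" using k \<delta>(1) by (simp add: field_simps)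
        finally have hi: "S * real i / 2 ^ k < t + \<delta>" by simp
        have "\<bar>X (\<tau> k i) w - X t w\<bar> < e"
          by (rule \<delta>(2)) (use lo hi tS in \<open>auto simp: \<tau>_def min_def\<close>)
        then show "\<bar>X t w\<bar> \<le> \<epsilon> + e" using grid[OF i2] by linarith
      qed
    qed
  qed
  moreover have "1 - (\<integral>w. (X S w)\<^sup>2 \<partial>M) / \<epsilon>\<^sup>2 \<le> measure M (space M - (\<Union>k. N k))"
    using le prob_compl[OF UN] by simp
  ultimately show ?thesis using UN by (intro bexI[of _ "space M - (\<Union>k. N k)"]) auto
qed

section \<open>The exclusion generator on one and two sites\<close>

lemma has_sum_count_space:
  fixes k :: "'a \<Rightarrow> real"
  assumes "lsummable k"
  shows "(k has_sum (LSUM y. k y)) UNIV"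
proof -
  have "Infinite_Set_Sum.abs_summable_on k UNIV" using assms by (simp add: abs_summable_on_def)
  then have a: "Infinite_Sum.abs_summable_on k UNIV" using abs_summable_equivalent[of k UNIV] by blast
  then have "k summable_on UNIV" by (rule abs_summable_summable)
  moreover have "infsum k UNIV = (LSUM y. k y)"
    using infsetsum_infsum[OF \<open>Infinite_Set_Sum.abs_summable_on k UNIV\<close>] by (simp add: infsetsum_def)
  ultimately show ?thesis using has_sum_infsum by metis
qed

text \<open>A local function of x is changed only by exchanges that involve x, so the double sum of
  \<open>excl_gen\<close> reduces to a row and a column.\<close>

lemma has_sum_row:
  fixes k :: "'a::ab_group_add \<Rightarrow> real"
  assumes "lsummable k"
  shows "((\<lambda>(u, v). if u = x then k (v - x) else 0) has_sum (LSUM y. k y)) UNIV" (is ?g1)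
    and "((\<lambda>(u, v). if v = x then k (u - x) else 0) has_sum (LSUM y. k y)) UNIV" (is ?g2)
proof -
  have 1: "((\<lambda>(u, v). if u = x then k (v - x) else 0) has_sum (LSUM y. k y)) (range (\<lambda>y. (x, x + y)))"
    by (subst has_sum_reindex) (auto simp: inj_on_def o_def has_sum_count_space[OF assms])
  show ?g1
    by (rule has_sum_cong_neutral[THEN iffD1, OF _ _ _ 1]) (auto simp: image_iff, metis add_diff_cancel_left' add.commute diff_add_cancel)
  have 2: "((\<lambda>(u, v). if v = x then k (u - x) else 0) has_sum (LSUM y. k y)) (range (\<lambda>y. (x + y, x)))"
    by (subst has_sum_reindex) (auto simp: inj_on_def o_def has_sum_count_space[OF assms])
  show ?g2
    by (rule has_sum_cong_neutral[THEN iffD1, OF _ _ _ 2]) (auto simp: image_iff, metis add_diff_cancel_left' add.commute diff_add_cancel)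
qed

abbreviation occ :: "'d config \<Rightarrow> int^'d \<Rightarrow> real" where
  "occ \<xi> z \<equiv> of_bool (\<xi> z)"

lemma integrable_rate_bounded:
  fixes k :: "int^'d \<Rightarrow> real"
  assumes "walk p" "\<And>y. \<bar>k y\<bar> \<le> C"
  shows "lsummable (\<lambda>y. p y * k y)"
proof -
  interpret walk p by fact
  show ?thesis
    using conv_integrable[OF p_int, of C k 0 "\<lambda>y. y"] assms(2) by (simp add: bnd_def)
qed

text \<open>The gain and the loss through the bond from x to x + y carry equal rates by evenness,
  and their quadratic terms cancel. What remains is the linear walk generator, and this is why the
  one-point equation closes.\<close>

lemma excl_gen_site:
  fixes \<xi> :: "('d::finite) config"
  assumes w: "walk (jump_rate h)"
  shows "excl_gen h (\<lambda>\<xi>. occ \<xi> x) \<xi> = gen (jump_rate h) (\<lambda>y. y) (occ \<xi>) x"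
proof -
  interpret walk "jump_rate h" by fact
  define k1 where "k1 y = jump_rate h y * (- occ \<xi> x * (1 - occ \<xi> (x + y)))" for y
  define k2 where "k2 y = jump_rate h y * (occ \<xi> (x + y) * (1 - occ \<xi> x))" for y
  have i1: "lsummable k1" unfolding k1_def by (rule integrable_rate_bounded[OF w, where C=1]) auto
  have i2: "lsummable k2" unfolding k2_def by (rule integrable_rate_bounded[OF w, where C=1]) auto
  have hs: "((\<lambda>z. (\<lambda>(u, v). if u = x then k1 (v - x) else 0) z + (\<lambda>(u, v). if v = x then k2 (u - x) else 0) z) has_sum
     ((LSUM y. k1 y) + (LSUM y. k2 y))) UNIV"
    by (intro has_sum_add has_sum_row i1 i2)
  have e: "(\<lambda>(u, v). jump_rate h (v - u) * occ \<xi> u * (1 - occ \<xi> v) * (occ (swap_conf \<xi> u v) x - occ \<xi> x)) z =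
     (\<lambda>(u, v). if u = x then k1 (v - x) else 0) z + (\<lambda>(u, v). if v = x then k2 (u - x) else 0) z" for z
  proof (cases z)
    case (Pair u v)
    have ev: "jump_rate h (x - u) = jump_rate h (u - x)" using p_even[of "x - u"] by simp
    show ?thesis unfolding Pair by (auto simp: k1_def k2_def swap_conf_def ev)
  qed
  have "excl_gen h (\<lambda>\<xi>. occ \<xi> x) \<xi> = (LSUM y. k1 y) + (LSUM y. k2 y)"
    unfolding excl_gen_def by (rule infsumI, rule has_sum_cong[THEN iffD2, OF _ hs]) (rule e)
  also have "\<dots> = (LSUM y. k1 y + k2 y)" using i1 i2 by simp
  also have "\<dots> = (LSUM y. jump_rate h y * occ \<xi> (x + y) - jump_rate h y * occ \<xi> x)"
    by (rule integral_congL) (auto simp: k1_def k2_def algebra_simps)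
  also have "\<dots> = gen (jump_rate h) (\<lambda>y. y) (occ \<xi>) x"
    using integrable_rate_bounded[OF w, of "\<lambda>y. occ \<xi> (x + y)" 1] p_int by (simp add: gen_def conv_def rate_def)
  finally show ?thesis .
qed

text \<open>Quadratic cancellation as for one site, performed in each coordinate. An exchange of the
  two sites themselves leaves the product unchanged, which explains the zero entries.\<close>

lemma excl_gen_pair:
  fixes \<xi> :: "('d::finite) config"
  assumes w: "walk (jump_rate h)" and xy: "x \<noteq> y"
  shows "excl_gen h (\<lambda>\<xi>. occ \<xi> x * occ \<xi> y) \<xi> =
     (LSUM z. jump_rate h z * (if x + z = y then 0 else occ \<xi> (x + z) * occ \<xi> y - occ \<xi> x * occ \<xi> y)) +
     (LSUM z. jump_rate h z * (if y + z = x then 0 else occ \<xi> x * occ \<xi> (y + z) - occ \<xi> x * occ \<xi> y))"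
proof -
  interpret walk "jump_rate h" by fact
  define k1 where "k1 x y z = jump_rate h z * (if x + z = y then 0 else - occ \<xi> x * (1 - occ \<xi> (x + z)) * occ \<xi> y)" for x y z
  define k2 where "k2 x y z = jump_rate h z * (if x + z = y then 0 else occ \<xi> (x + z) * (1 - occ \<xi> x) * occ \<xi> y)" for x y z
  have i1: "lsummable (k1 x y)" for x y unfolding k1_def[abs_def] by (rule integrable_rate_bounded[OF w, where C=1]) auto
  have i2: "lsummable (k2 x y)" for x y unfolding k2_def[abs_def] by (rule integrable_rate_bounded[OF w, where C=1]) auto
  define f1 where "f1 x y = (\<lambda>(u, v). if u = x then k1 x y (v - x) else 0)" for x y
  define f2 where "f2 x y = (\<lambda>(u, v). if v = x then k2 x y (u - x) else 0)" for x y
  have hs: "((\<lambda>z. f1 x y z + f2 x y z + (f1 y x z + f2 y x z)) has_sum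
     ((LSUM z. k1 x y z) + (LSUM z. k2 x y z) + ((LSUM z. k1 y x z) + (LSUM z. k2 y x z)))) UNIV"
    unfolding f1_def f2_def by (intro has_sum_add has_sum_row i1 i2)
  have e: "(\<lambda>(u, v). jump_rate h (v - u) * occ \<xi> u * (1 - occ \<xi> v) * (occ (swap_conf \<xi> u v) x * occ (swap_conf \<xi> u v) y - occ \<xi> x * occ \<xi> y)) z =
     f1 x y z + f2 x y z + (f1 y x z + f2 y x z)" for z
  proof (cases z)
    case (Pair u v)
    have ev: "jump_rate h (a - u) = jump_rate h (u - a)" for a using p_even[of "a - u"] by simp
    show ?thesis unfolding Pair f1_def f2_def
      using xy by (auto simp: k1_def k2_def swap_conf_def ev) (metis p_even minus_diff_eq)+
  qed
  have E: "excl_gen h (\<lambda>\<xi>. occ \<xi> x * occ \<xi> y) \<xi> = (LSUM z. k1 x y z) + (LSUM z. k2 x y z) + ((LSUM z. k1 y x z) + (LSUM z. k2 y x z))"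
    unfolding excl_gen_def by (rule infsumI, rule has_sum_cong[THEN iffD2, OF _ hs]) (rule e)
  have s1: "(LSUM z. k1 x y z) + (LSUM z. k2 x y z) = (LSUM z. k1 x y z + k2 x y z)" for x y
    using i1 i2 by simp
  have s2: "k1 x y z + k2 x y z = jump_rate h z * (if x + z = y then 0 else occ \<xi> (x + z) * occ \<xi> y - occ \<xi> x * occ \<xi> y)" for x y z
    by (auto simp: k1_def k2_def)
  have sw: "occ \<xi> (y + z) * occ \<xi> x - occ \<xi> y * occ \<xi> x = occ \<xi> x * occ \<xi> (y + z) - occ \<xi> x * occ \<xi> y" for z
    by (simp only: mult.commute)
  show ?thesis unfolding E s1 s2 sw ..
qed

section \<open>One- and two-point functions of the exclusion process\<close>

lemma conv_param_meas:
  fixes f :: "'w \<Rightarrow> 'a::ab_group_add \<Rightarrow> real"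
  assumes "\<And>z. (\<lambda>w. f w z) \<in> borel_measurable N"
  shows "(\<lambda>w. conv p s (f w) x) \<in> borel_measurable N" (is ?g1)
    and "(\<lambda>w. gen p s (f w) x) \<in> borel_measurable N" (is ?g2)
proof -
  interpret c: sigma_finite_measure "count_space (UNIV :: (int^'b) set)" by (rule sf_count)
  have "(\<lambda>(w, y). p y * f w (x + s y)) \<in> borel_measurable (N \<Otimes>\<^sub>M count_space UNIV)"
    by (rule measurable_pair_countable2) (use assms in simp)
  then show 1: ?g1
    unfolding conv_def by (rule c.borel_measurable_lebesgue_integral)
  show ?g2
    unfolding gen_def using 1 assms[of x] by measurable
qed

lemma semi_param_meas:
  fixes f :: "'w \<Rightarrow> 'a::ab_group_add \<Rightarrow> real"
  assumes "\<And>z. (\<lambda>w. f w z) \<in> borel_measurable N"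
  shows "(\<lambda>(t, w). semi p s t (f w) x) \<in> borel_measurable (borel \<Otimes>\<^sub>M N)"
proof -
  have [measurable]: "(\<lambda>w. (conv p s ^^ k) (f w) x) \<in> borel_measurable N" for k x
  proof (induction k arbitrary: x)
    case (Suc k)
    show ?case unfolding funpow.simps o_apply by (rule conv_param_meas(1)[OF Suc])
  qed (use assms in simp)
  show ?thesis unfolding semi_def by measurable
qed

lemma gen_cmult: "gen p s (\<lambda>z. c * f z) x = c * gen p s f x"
proof -
  have "(LSUM y. p y * (c * f (x + s y))) = c * (LSUM y. p y * f (x + s y))"
    by (simp add: mult.left_commute[of _ c])
  then show ?thesis by (simp add: gen_def conv_def algebra_simps)
qed

lemma (in walk) gen_diff:
  assumes "bnd C F" "bnd C' G"
  shows "gen p s (\<lambda>x. F x - G x) x = gen p s F x - gen p s G x"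
  using conv_lin[OF p_int assms, of s 1 "-1" x] by (simp add: gen_def algebra_simps)

abbreviation (in prob_space) mean :: "('a \<Rightarrow> real) \<Rightarrow> real" (binder "\<E> " 10) where
  "mean X \<equiv> integral\<^sup>L M X"

section \<open>Path measurability, one-site martingales and the one-point function\<close>

locale particle = prob_space M + walk "jump_rate h"
  for M :: "'w measure" and h :: "real^'d \<Rightarrow> real" +
  fixes \<eta> :: "'w \<Rightarrow> real \<Rightarrow> 'd config"
  assumes meas: "t \<ge> 0 \<Longrightarrow> {w \<in> space M. \<eta> w t z} \<in> sets M"
    and cadlag: "w \<in> space M \<Longrightarrow> cadlag_coords (\<eta> w)"
    and mp: "martingale_problem M h \<eta>"
begin

abbreviation p :: "int^'d \<Rightarrow> real" where "p \<equiv> jump_rate h"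
abbreviation A :: "(int^'d \<Rightarrow> real) \<Rightarrow> int^'d \<Rightarrow> real" where "A \<equiv> gen p (\<lambda>y. y)"
abbreviation F :: "real \<Rightarrow> 'w measure" where "F s \<equiv> nat_filt M \<eta> s"

text \<open>By \<open>one_point\<close> below, this is the conditional expectation of the occupation
  variable given the initial configuration.\<close>

definition R :: "real \<Rightarrow> int^'d \<Rightarrow> 'w \<Rightarrow> real" where
  "R t x w = semi p (\<lambda>y. y) t (occ (\<eta> w 0)) x"

definition dl :: "real \<Rightarrow> int^'d \<Rightarrow> 'w \<Rightarrow> real" where
  "dl t x w = occ (\<eta> w t) x - R t x w"

lemma occ_bnd: "bnd 1 (occ \<xi>)" by (simp add: bnd_def)

lemma space_F: "space (F s) = space M" by (simp add: nat_filt_def space_measure_of_conv)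

lemma sets_F: "0 \<le> r \<Longrightarrow> r \<le> s \<Longrightarrow> {w \<in> space M. \<eta> w r z} \<in> sets (F s)"
  unfolding nat_filt_def by (subst sets_measure_of) (auto intro!: sigma_sets.Basic)

lemma F_sub: "(\<lambda>w. w) \<in> measurable M (F s)"
  unfolding nat_filt_def
proof (rule measurable_measure_of)
  fix B assume "B \<in> {{w \<in> space M. \<eta> w r z} |r z. r \<in> {0..s}}"
  then obtain r z where B: "B = {w \<in> space M. \<eta> w r z}" "0 \<le> r" by auto
  then have "(\<lambda>w. w) -` B \<inter> space M = {w \<in> space M. \<eta> w r z}" by auto
  then show "(\<lambda>w. w) -` B \<inter> space M \<in> sets M" using meas[OF B(2)] by simp
qed auto

lemma F_mono: "s \<le> t \<Longrightarrow> (\<lambda>w. w) \<in> measurable (F t) (F s)"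
  unfolding nat_filt_def[of M \<eta> s]
proof (rule measurable_measure_of)
  assume st: "s \<le> t"
  fix B assume "B \<in> {{w \<in> space M. \<eta> w r z} |r z. r \<in> {0..s}}"
  then obtain r z where B: "B = {w \<in> space M. \<eta> w r z}" "0 \<le> r" "r \<le> s" by auto
  then have "(\<lambda>w. w) -` B \<inter> space (F t) = {w \<in> space M. \<eta> w r z}" by (auto simp: space_F)
  then show "(\<lambda>w. w) -` B \<inter> space (F t) \<in> sets (F t)" using sets_F[OF B(2), of t z] B st by simp
qed (auto simp: space_F)

lemma occ_F: "0 \<le> r \<Longrightarrow> r \<le> s \<Longrightarrow> (\<lambda>w. occ (\<eta> w r) z) \<in> borel_measurable (F s)"
proof -
  assume "0 \<le> r" "r \<le> s"
  then have [measurable]: "{w \<in> space M. \<eta> w r z} \<in> sets (F s)" by (rule sets_F)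
  have "indicator {w \<in> space M. \<eta> w r z} \<in> borel_measurable (F s)" by simp
  then show ?thesis by (rule measurable_cong[THEN iffD1, rotated]) (auto simp: space_F split: split_indicator)
qed

lemma occ_M[measurable]: "0 \<le> r \<Longrightarrow> (\<lambda>w. occ (\<eta> w r) z) \<in> borel_measurable M"
  using measurable_compose[OF F_sub occ_F[of r r z]] by simp

lemma occ_right_const:
  assumes "w \<in> space M" "0 \<le> t"
  shows "\<exists>\<delta>>0. \<forall>s. t \<le> s \<and> s < t + \<delta> \<longrightarrow> \<eta> w s z = \<eta> w t z"
  using cadlag[OF assms(1)] assms(2) unfolding cadlag_coords_def by blast

text \<open>Progressive measurability. The path is read at the next point of a grid of mesh 1/(k+1),
  capped at S so that no information beyond S is used, and right continuity gives the limit.\<close>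

lemma occ_joint_F:
  assumes S: "0 \<le> S"
  shows "(\<lambda>(r, w). indicator {0..S} r * occ (\<eta> w r) z) \<in> borel_measurable (borel \<Otimes>\<^sub>M F S)"
proof -
  define \<tau> where "\<tau> k i = max 0 (min S (real_of_int i / real (Suc k)))" for k :: nat and i :: int
  have \<tau>: "0 \<le> \<tau> k i" "\<tau> k i \<le> S" for k i using S by (auto simp: \<tau>_def)
  define f where "f k = (\<lambda>(r, w). indicator {0..S} r * occ (\<eta> w (\<tau> k \<lceil>real (Suc k) * r\<rceil>)) z)" for k
  have fm: "f k \<in> borel_measurable (borel \<Otimes>\<^sub>M F S)" for k
  proof -
    have "(\<lambda>q. (\<lambda>i q. indicator {0..S} (fst q) * occ (\<eta> (snd q) (\<tau> k i)) z) \<lceil>real (Suc k) * fst q\<rceil> q) \<in> borel_measurable (borel \<Otimes>\<^sub>M F S)"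
    proof (rule measurable_compose_countable[where f="\<lambda>i q. indicator {0..S} (fst q) * occ (\<eta> (snd q) (\<tau> k i)) z" and g="\<lambda>q. \<lceil>real (Suc k) * fst q\<rceil>"])
      fix i :: int
      have [measurable]: "(\<lambda>w. occ (\<eta> w (\<tau> k i)) z) \<in> borel_measurable (F S)" by (rule occ_F[OF \<tau>])
      show "(\<lambda>q. indicator {0..S} (fst q) * occ (\<eta> (snd q) (\<tau> k i)) z) \<in> borel_measurable (borel \<Otimes>\<^sub>M F S)" by measurable
    qed measurable
    then show ?thesis by (simp add: f_def case_prod_beta)
  qed
  show ?thesis
  proof (rule borel_measurable_LIMSEQ_real[where u=f])
    fix q :: "real \<times> 'w" assume q: "q \<in> space (borel \<Otimes>\<^sub>M F S)"
    obtain r w where rw: "q = (r, w)" by (cases q)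
    have w: "w \<in> space M" using q by (simp add: rw space_pair_measure space_F)
    show "(\<lambda>k. f k q) \<longlonglongrightarrow> (\<lambda>(r, w). indicator {0..S} r * occ (\<eta> w r) z) q"
    proof (cases "r \<in> {0..S}")
      case True
      then have r: "0 \<le> r" "r \<le> S" by auto
      obtain \<delta> where \<delta>: "0 < \<delta>" "\<And>s. r \<le> s \<Longrightarrow> s < r + \<delta> \<Longrightarrow> \<eta> w s z = \<eta> w r z" using occ_right_const[OF w r(1), of z] by blast
      have "\<forall>\<^sub>F k in sequentially. 1 / real (Suc k) < \<delta>"
        using order_tendstoD(2)[OF LIMSEQ_inverse_real_of_nat \<delta>(1)] by (simp add: inverse_eq_divide)
      then have "\<forall>\<^sub>F k in sequentially. f k q = indicator {0..S} r * occ (\<eta> w r) z"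
      proof eventually_elim
        fix k assume k: "1 / real (Suc k) < \<delta>"
        define c where "c = real_of_int \<lceil>real (Suc k) * r\<rceil> / real (Suc k)"
        have "real (Suc k) * r \<le> real_of_int \<lceil>real (Suc k) * r\<rceil>" "real_of_int \<lceil>real (Suc k) * r\<rceil> \<le> real (Suc k) * r + 1" by linarith+
        then have "real (Suc k) * r / real (Suc k) \<le> c" "c \<le> (real (Suc k) * r + 1) / real (Suc k)" unfolding c_def by (intro divide_right_mono; simp)+
        then have c: "r \<le> c" "c \<le> r + 1 / real (Suc k)" by (simp_all add: add_divide_distrib del: of_nat_Suc)
        then have "\<tau> k \<lceil>real (Suc k) * r\<rceil> = min S c" using r unfolding \<tau>_def c_def[symmetric] by simp
        moreover have "r \<le> min S c" "min S c < r + \<delta>" using c k r by auto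
        ultimately show "f k q = indicator {0..S} r * occ (\<eta> w r) z" using \<delta>(2)[of "min S c"] by (simp add: f_def rw)
      qed
      then show ?thesis by (simp add: rw tendsto_eventually)
    qed (simp add: f_def rw)
  qed (rule fm)
qed

lemma R_joint_F: "(\<lambda>(r, w). R r z w) \<in> borel_measurable (borel \<Otimes>\<^sub>M F 0)"
  unfolding R_def by (rule semi_param_meas) (rule occ_F, auto)

lemma pair_id: 
  assumes "f \<in> borel_measurable (borel \<Otimes>\<^sub>M F s)"
  shows "f \<in> borel_measurable (lborel \<Otimes>\<^sub>M M)" (is ?g1) "s \<le> t \<Longrightarrow> f \<in> borel_measurable (borel \<Otimes>\<^sub>M F t)"
proof -
  have "(\<lambda>z. (fst z, snd z)) \<in> measurable (lborel \<Otimes>\<^sub>M M) (borel \<Otimes>\<^sub>M F s)"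
    by (rule measurable_Pair) (use measurable_compose[OF measurable_snd F_sub] in \<open>auto\<close>)
  from measurable_compose[OF this assms] show ?g1 by simp
  assume "s \<le> t"
  have "(\<lambda>z. (fst z, snd z)) \<in> measurable (borel \<Otimes>\<^sub>M F t) (borel \<Otimes>\<^sub>M F s)"
    by (rule measurable_Pair) (use measurable_compose[OF measurable_snd F_mono[OF \<open>s \<le> t\<close>]] in \<open>auto\<close>)
  from measurable_compose[OF this assms] show "f \<in> borel_measurable (borel \<Otimes>\<^sub>M F t)" by simp
qed

lemma R_bnd: "0 \<le> t \<Longrightarrow> 0 \<le> R t x w \<and> R t x w \<le> 1"
  unfolding R_def using semi_nonneg[of "occ (\<eta> w 0)" 1 t "\<lambda>y. y" x] bndD[OF semi_bnd[OF occ_bnd, of t "\<lambda>y. y" "\<eta> w 0"], of x] occ_bnd by auto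

lemma R_F0: "(\<lambda>w. R t x w) \<in> borel_measurable (F 0)"
  using measurable_Pair2[OF R_joint_F, of t] by simp

lemma R_M[measurable]: "(\<lambda>w. R t x w) \<in> borel_measurable M"
  using measurable_compose[OF F_sub R_F0] by simp

lemma R_0: "R 0 x w = occ (\<eta> w 0) x" by (simp add: R_def semi_0)

lemma dl_0: "dl 0 x w = 0" by (simp add: dl_def R_0)

lemma dl_bnd: "0 \<le> t \<Longrightarrow> bnd 1 (\<lambda>x. dl t x w)"
  unfolding bnd_def dl_def
proof
  fix x assume "0 \<le> t"
  then show "\<bar>occ (\<eta> w t) x - R t x w\<bar> \<le> 1" using R_bnd[of t x w] by (cases "\<eta> w t x") auto
qed

lemma dl_M[measurable]: "0 \<le> t \<Longrightarrow> (\<lambda>w. dl t x w) \<in> borel_measurable M"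
  unfolding dl_def by measurable

text \<open>The time cutoff sits on the configuration itself, so joint measurability holds for all
  real times; by linearity the generator carries the indicator outside.\<close>

definition occS :: "real \<Rightarrow> real \<Rightarrow> int^'d \<Rightarrow> 'w \<Rightarrow> real" where
  "occS S r z w = indicator {0..S} r * occ (\<eta> w r) z"

definition dlS :: "real \<Rightarrow> real \<Rightarrow> int^'d \<Rightarrow> 'w \<Rightarrow> real" where
  "dlS S r z w = indicator {0..S} r * dl r z w"

lemma dlS_joint_F:
  assumes S: "0 \<le> S"
  shows "(\<lambda>q. dlS S (fst q) z (snd q)) \<in> borel_measurable (borel \<Otimes>\<^sub>M F S)"
proof -
  have [measurable]: "(\<lambda>q. indicator {0..S} (fst q) * occ (\<eta> (snd q) (fst q)) z) \<in> borel_measurable (borel \<Otimes>\<^sub>M F S)"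
    using occ_joint_F[OF S, of z] by (simp add: case_prod_beta)
  have [measurable]: "(\<lambda>q. R (fst q) z (snd q)) \<in> borel_measurable (borel \<Otimes>\<^sub>M F S)"
    using pair_id(2)[OF R_joint_F S, of z] by (simp add: case_prod_beta)
  have "(\<lambda>q. dlS S (fst q) z (snd q)) = (\<lambda>q. indicator {0..S} (fst q) * occ (\<eta> (snd q) (fst q)) z - indicator {0..S} (fst q) * R (fst q) z (snd q))"
    by (auto simp: dlS_def dl_def fun_eq_iff algebra_simps)
  also have "\<dots> \<in> borel_measurable (borel \<Otimes>\<^sub>M F S)" by measurable
  finally show ?thesis .
qed

lemma occS_joint_F:
  assumes S: "0 \<le> S"
  shows "(\<lambda>q. occS S (fst q) z (snd q)) \<in> borel_measurable (borel \<Otimes>\<^sub>M F S)"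
  using occ_joint_F[OF S, of z] by (simp add: occS_def case_prod_beta)

lemma gen_dlS: "A (\<lambda>z. dlS S r z w) x = indicator {0..S} r * A (\<lambda>z. dl r z w) x"
  unfolding dlS_def by (rule gen_cmult)

lemma gen_dlS_joint:
  assumes S: "0 \<le> S"
  shows "(\<lambda>q. A (\<lambda>z. dlS S (fst q) z (snd q)) x) \<in> borel_measurable (borel \<Otimes>\<^sub>M F S)"
  by (rule conv_param_meas(2)) (rule dlS_joint_F[OF S])

lemma gen_occS_joint:
  assumes S: "0 \<le> S"
  shows "(\<lambda>q. A (\<lambda>z. occS S (fst q) z (snd q)) x) \<in> borel_measurable (borel \<Otimes>\<^sub>M F S)"
  by (rule conv_param_meas(2)) (rule occS_joint_F[OF S])

lemma time_integrable:
  fixes f :: "real \<Rightarrow> real"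
  assumes "(\<lambda>r. indicator {0..S} r * f r) \<in> borel_measurable borel" "\<And>r. r \<in> {0..S} \<Longrightarrow> \<bar>f r\<bar> \<le> C"
  shows "set_integrable lborel {0..S} f"
  unfolding set_integrable_def
proof (rule integrable_boundL[of _ "\<lambda>r. \<bar>C\<bar> * indicator {0..S} r"])
  show "integrable lborel (\<lambda>r. \<bar>C\<bar> * indicator {0..S} r :: real)"
    by (intro integrable_cmult integrable_real_indicator) (auto simp: emeasure_lborel_Icc_eq)
  show "AE r in lborel. norm (indicator {0..S} r *\<^sub>R f r) \<le> norm (\<bar>C\<bar> * indicator {0..S} r)"
    using assms(2) by (auto split: split_indicator intro!: AE_I2 intro: order_trans[OF _ abs_ge_self])
qed (use assms(1) in simp)

lemma gen_path_integrable:
  assumes S: "0 \<le> S" and w: "w \<in> space M"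
  shows "set_integrable lborel {0..S} (\<lambda>r. A (occ (\<eta> w r)) x)" (is ?g1)
    and "set_integrable lborel {0..S} (\<lambda>r. A (\<lambda>z. dl r z w) x)" (is ?g2)
proof -
  have ws: "w \<in> space (F S)" using w by (simp add: space_F)
  show ?g1
  proof (rule time_integrable)
    have "(\<lambda>r. A (\<lambda>z. occS S r z w) x) \<in> borel_measurable borel"
      using measurable_Pair1[OF gen_occS_joint[OF S] ws, of x] by simp
    then show "(\<lambda>r. indicator {0..S} r * A (occ (\<eta> w r)) x) \<in> borel_measurable borel" by (simp add: occS_def gen_cmult)
    show "\<bar>A (occ (\<eta> w r)) x\<bar> \<le> 2 * rate p * 1" for r by (rule bndD[OF gen_bnd[OF occ_bnd]])
  qed
  show ?g2
  proof (rule time_integrable)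
    have "(\<lambda>r. A (\<lambda>z. dlS S r z w) x) \<in> borel_measurable borel"
      using measurable_Pair1[OF gen_dlS_joint[OF S] ws, of x] by simp
    then show "(\<lambda>r. indicator {0..S} r * A (\<lambda>z. dl r z w) x) \<in> borel_measurable borel" by (simp add: gen_dlS)
    show "\<bar>A (\<lambda>z. dl r z w) x\<bar> \<le> 2 * rate p * 1" if "r \<in> {0..S}" for r by (rule bndD[OF gen_bnd[OF dl_bnd]]) (use that in simp)
  qed
qed

definition D :: "int^'d \<Rightarrow> real \<Rightarrow> 'w \<Rightarrow> real" where
  "D x t w = dynkin_mart h \<eta> (\<lambda>\<xi>. occ \<xi> x) t w"

lemma D_eq: "D x t w = occ (\<eta> w t) x - occ (\<eta> w 0) x - (LBINT r:{0..t}. A (occ (\<eta> w r)) x)"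
  by (simp add: D_def dynkin_mart_def excl_gen_site[OF walk_axioms])

text \<open>\<open>R\<close> solves the walk equation path by path and has no martingale part, so
  subtracting it changes the drift but not the martingale.\<close>

lemma D_dl:
  assumes t: "0 \<le> t" and w: "w \<in> space M"
  shows "D x t w = dl t x w - (LBINT r:{0..t}. A (\<lambda>z. dl r z w) x)"
proof -
  have Rb: "bnd 1 (\<lambda>z. R r z w)" if "0 \<le> r" for r unfolding bnd_def using R_bnd[OF that] by auto
  have "R t x w = occ (\<eta> w 0) x + (LBINT r:{0..t}. A (\<lambda>z. R r z w) x)"
    unfolding R_def by (rule semi_eq_gen[OF occ_bnd t])
  moreover have "(LBINT r:{0..t}. A (\<lambda>z. dl r z w) x) = (LBINT r:{0..t}. A (occ (\<eta> w r)) x - A (\<lambda>z. R r z w) x)"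
    by (rule set_lebesgue_integral_cong) (auto simp: dl_def gen_diff[OF occ_bnd Rb])
  moreover have "\<dots> = (LBINT r:{0..t}. A (occ (\<eta> w r)) x) - (LBINT r:{0..t}. A (\<lambda>z. R r z w) x)"
  proof (rule set_integral_diff(2)[OF gen_path_integrable(1)[OF t w]])
    have "(\<lambda>r. A (\<lambda>z. R r z w) x) = (\<lambda>r. semi p (\<lambda>y. y) r (A (occ (\<eta> w 0))) x)"
      unfolding R_def by (rule ext) (rule semi_gen_commute[OF walk_axioms occ_bnd])
    then show "set_integrable lborel {0..t} (\<lambda>r. A (\<lambda>z. R r z w) x)" by (simp add: semi_integrable[OF gen_bnd[OF occ_bnd]])
  qed
  ultimately show ?thesis unfolding D_eq dl_def by linarith
qed

lemma D_mart:
  assumes "0 \<le> s" "s \<le> t" "Y \<in> borel_measurable (F s)" "bounded (Y ` space M)"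
  shows "(\<E> w. (D x t w - D x s w) * Y w) = 0"
proof -
  have "local_fun (\<lambda>\<xi>. occ \<xi> x)" unfolding local_fun_def by (intro exI[of _ "{x}"]) auto
  then show ?thesis using mp assms unfolding martingale_problem_def D_def by blast
qed

lemma D_0: "D x 0 w = 0"
proof -
  have "AE r in lborel. indicator {0..0} r *\<^sub>R A (occ (\<eta> w r)) x = 0" using AE_lborel_singleton[of "0::real"] by eventually_elim auto
  then have "(LBINT r:{0..0}. A (occ (\<eta> w r)) x) = 0" unfolding set_lebesgue_integral_def by (rule integral_eq_zero_AE)
  then show ?thesis by (simp add: D_eq)
qed

lemma D_F:
  assumes t: "0 \<le> t"
  shows "(\<lambda>w. D x t w) \<in> borel_measurable (F t)"
proof -
  have "(\<lambda>w. LBINT r. A (\<lambda>z. occS t r z w) x) \<in> borel_measurable (F t)"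
  proof (rule lborel.borel_measurable_lebesgue_integral)
    have "(\<lambda>q. A (\<lambda>z. occS t (fst (snd q, fst q)) z (snd (snd q, fst q))) x) \<in> borel_measurable (F t \<Otimes>\<^sub>M lborel)"
      by (rule measurable_compose[OF _ gen_occS_joint[OF t]]) (intro measurable_Pair; simp)
    then show "(\<lambda>(w, r). A (\<lambda>z. occS t r z w) x) \<in> borel_measurable (F t \<Otimes>\<^sub>M lborel)" by (simp add: case_prod_beta)
  qed
  then have [measurable]: "(\<lambda>w. LBINT r:{0..t}. A (occ (\<eta> w r)) x) \<in> borel_measurable (F t)"
    by (simp add: set_lebesgue_integral_def occS_def gen_cmult)
  have [measurable]: "(\<lambda>w. occ (\<eta> w t) x) \<in> borel_measurable (F t)" "(\<lambda>w. occ (\<eta> w 0) x) \<in> borel_measurable (F t)"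
    using t by (auto intro: occ_F)
  show ?thesis unfolding D_eq by measurable
qed

lemma gen_path_bound:
  assumes "0 \<le> s" "s \<le> t" "w \<in> space M"
  shows "\<bar>(LBINT r:{0..t}. A (occ (\<eta> w r)) x) - (LBINT r:{0..s}. A (occ (\<eta> w r)) x)\<bar> \<le> 2 * rate p * (t - s)"
proof -
  have U: "{0..t} = {0..s} \<union> {s<..t}" using assms by auto
  have i1: "set_integrable lborel {0..t} (\<lambda>r. A (occ (\<eta> w r)) x)" by (rule gen_path_integrable) (use assms in auto)
  have i2: "set_integrable lborel {s<..t} (\<lambda>r. A (occ (\<eta> w r)) x)" by (rule set_integrable_subset[OF i1]) (use assms in auto)
  have i3: "set_integrable lborel {0..s} (\<lambda>r. A (occ (\<eta> w r)) x)" by (rule set_integrable_subset[OF i1]) (use assms in auto)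
  have "(LBINT r:{0..t}. A (occ (\<eta> w r)) x) = (LBINT r:{0..s}. A (occ (\<eta> w r)) x) + (LBINT r:{s<..t}. A (occ (\<eta> w r)) x)"
    unfolding U by (rule set_integral_Un[OF _ i3 i2]) auto
  moreover have "\<bar>LBINT r:{s<..t}. A (occ (\<eta> w r)) x\<bar> \<le> (LBINT r:{s<..t}. \<bar>A (occ (\<eta> w r)) x\<bar>)"
    using set_integral_norm_bound[OF i2] by simp
  moreover have "(LBINT r:{s<..t}. \<bar>A (occ (\<eta> w r)) x\<bar>) \<le> (LBINT r:{s<..t}. 2 * rate p * 1)"
  proof (rule set_integral_mono)
    show "set_integrable lborel {s<..t} (\<lambda>r. \<bar>A (occ (\<eta> w r)) x\<bar>)" by (rule set_integrable_abs[OF i2])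
    show "set_integrable lborel {s<..t} (\<lambda>r. 2 * rate p * 1)"
      unfolding set_integrable_def using assms by (auto simp: emeasure_lborel_Ioc)
    show "\<bar>A (occ (\<eta> w r)) x\<bar> \<le> 2 * rate p * 1" for r by (rule bndD[OF gen_bnd[OF occ_bnd]])
  qed
  moreover have "(LBINT r:{s<..t}. 2 * rate p * 1) = 2 * rate p * (t - s)"
    using assms by (simp add: set_lebesgue_integral_def)
  ultimately show ?thesis by linarith
qed

lemma D_bound:
  assumes "0 \<le> t" "w \<in> space M"
  shows "\<bar>D x t w\<bar> \<le> 1 + 2 * rate p * t"
proof -
  have "(LBINT r:{0..0}. A (occ (\<eta> w r)) x) = 0" using D_0[of x w] by (simp add: D_eq)
  then have "\<bar>LBINT r:{0..t}. A (occ (\<eta> w r)) x\<bar> \<le> 2 * rate p * t"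
    using gen_path_bound[of 0 t w x] assms by simp
  moreover have "\<bar>occ (\<eta> w t) x - occ (\<eta> w 0) x\<bar> \<le> 1" by auto
  ultimately show ?thesis unfolding D_eq by linarith
qed

lemma D_right_cont:
  assumes "0 \<le> t" "w \<in> space M" "0 < e"
  shows "\<exists>\<delta>>0. \<forall>s. t \<le> s \<and> s < t + \<delta> \<longrightarrow> \<bar>D x s w - D x t w\<bar> < e"
proof -
  obtain \<delta> where \<delta>: "0 < \<delta>" "\<And>s. t \<le> s \<Longrightarrow> s < t + \<delta> \<Longrightarrow> \<eta> w s x = \<eta> w t x" using occ_right_const[OF assms(2,1), of x] by blast
  define \<delta>' where "\<delta>' = min \<delta> (e / (2 * rate p + 1))"
  have r: "0 < 2 * rate p + 1" using rate_nonneg by simp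
  have "\<bar>D x s w - D x t w\<bar> < e" if s: "t \<le> s" "s < t + \<delta>'" for s
  proof -
    have "\<eta> w s x = \<eta> w t x" by (rule \<delta>(2)) (use s in \<open>simp_all add: \<delta>'_def\<close>)
    then have "\<bar>D x s w - D x t w\<bar> \<le> 2 * rate p * (s - t)" using gen_path_bound[OF assms(1) s(1) assms(2), of x] unfolding D_eq by simp
    also have "\<dots> \<le> (2 * rate p + 1) * (s - t)" using s by (intro mult_right_mono) auto
    also have "\<dots> < (2 * rate p + 1) * (e / (2 * rate p + 1))" using s r by (intro mult_strict_left_mono) (auto simp: \<delta>'_def)
    also have "\<dots> = e" using r by simp
    finally show ?thesis .
  qed
  moreover have "0 < \<delta>'" using \<delta>(1) assms(3) r by (simp add: \<delta>'_def)
  ultimately show ?thesis by blast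
qed

lemma time_fubini:
  fixes f :: "real \<Rightarrow> 'w \<Rightarrow> real"
  assumes S: "0 \<le> S" and f: "(\<lambda>q. indicator {0..S} (fst q) * f (fst q) (snd q)) \<in> borel_measurable (lborel \<Otimes>\<^sub>M M)"
    and fb: "\<And>r w. r \<in> {0..S} \<Longrightarrow> w \<in> space M \<Longrightarrow> \<bar>f r w\<bar> \<le> C"
  shows "(\<E> w. (LBINT r:{0..S}. f r w)) = (LBINT r:{0..S}. \<E> w. f r w)" (is ?g1)
    and "set_integrable lborel {0..S} (\<lambda>r. \<E> w. f r w)" (is ?g2)
    and "integrable M (\<lambda>w. LBINT r:{0..S}. f r w)" (is ?g3)
proof -
  define g where "g r w = indicator {0..S} r * f r w" for r w
  have gm: "case_prod g \<in> borel_measurable (lborel \<Otimes>\<^sub>M M)" using f by (simp add: g_def[abs_def] case_prod_beta)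
  have gb: "\<bar>g r w\<bar> \<le> (\<bar>C\<bar> * indicator {0..S} r) * 1" if "w \<in> space M" for r w
    using fb[of r w] that by (auto simp: g_def split: split_indicator)
  have ci: "integrable lborel (\<lambda>r. \<bar>C\<bar> * indicator {0..S} r :: real)"
    by (intro integrable_cmult integrable_real_indicator) (auto simp: emeasure_lborel_Icc_eq)
  have i1: "integrable M (\<lambda>_. 1 :: real)" by simp
  note fub = fubini_dom[where f=g, OF sigma_finite_lborel sigma_finite_measure_axioms gm ci i1]
  have fub1: "(LBINT x. (\<E> y. g x y)) = (\<E> y. (LBINT x. g x y))" "integrable lborel (\<lambda>x. \<E> y. g x y)" "integrable M (\<lambda>y. LBINT x. g x y)"
    by (rule fub, use gb in auto)+
  show ?g1
    using fub1(1) by (simp add: g_def set_lebesgue_integral_def)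
  show ?g2 using fub1(2) by (simp add: g_def set_integrable_def)
  show ?g3 using fub1(3) by (simp add: g_def set_lebesgue_integral_def)
qed

lemma expect_conv:
  fixes f :: "int^'d \<Rightarrow> 'w \<Rightarrow> real" and k :: "int^'d \<Rightarrow> real"
  assumes k: "lsummable k" and f: "\<And>z. f z \<in> borel_measurable M" and fb: "\<And>z w. w \<in> space M \<Longrightarrow> \<bar>f z w\<bar> \<le> C"
  shows "(\<E> w. (LSUM z. k z * f z w)) = (LSUM z. k z * (\<E> w. f z w))" (is ?g1)
    and "integrable M (\<lambda>w. LSUM z. k z * f z w)" (is ?g2)
proof -
  have m: "(\<lambda>(w, z). k z * f z w) \<in> borel_measurable (M \<Otimes>\<^sub>M count_space UNIV)"
    by (rule measurable_pair_countable2) (use f in simp)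
  have C: "0 \<le> C" using fb not_empty by (metis abs_ge_zero ex_in_conv order_trans)
  have b: "\<bar>k z * f z w\<bar> \<le> C * \<bar>k z\<bar>" if "w \<in> space M" for z w
    using mult_left_mono[OF fb[OF that, of z], of "\<bar>k z\<bar>"] by (simp add: abs_mult mult.commute)
  have b': "\<And>x y. x \<in> space M \<Longrightarrow> y \<in> space (count_space UNIV) \<Longrightarrow> \<bar>k y * f y x\<bar> \<le> C * \<bar>k y\<bar>" using b by simp
  note fub = fubini_dom[where f="\<lambda>w z. k z * f z w" and u="\<lambda>_. C" and v="\<lambda>z. \<bar>k z\<bar>", OF sigma_finite_measure_axioms sf_count m _ _ b']
  show ?g1
    using fub(1) k by simp
  show ?g2 using fub(2) k by simp
qed

text \<open>For Y known at time 0 the function E[dl Y] solves the closed linear walk equation with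
  initial value 0, and the maximum principle makes it vanish. Weighting with Y makes this a
  statement conditional on the start, which is needed with Y = R.\<close>

lemma one_point:
  assumes Y: "Y \<in> borel_measurable (F 0)" and Yb: "\<And>w. w \<in> space M \<Longrightarrow> \<bar>Y w\<bar> \<le> 1" and t: "0 \<le> t"
  shows "(\<E> w. dl t x w * Y w) = 0"
proof -
  have YM[measurable]: "Y \<in> borel_measurable M" using measurable_compose[OF F_sub Y] by simp
  define f where "f r x = (\<E> w. dl r x w * Y w)" for r x
  have dYb: "\<bar>dl r x w * Y w\<bar> \<le> 1" if "0 \<le> r" "w \<in> space M" for r x w
  proof -
    have "\<bar>dl r x w\<bar> * \<bar>Y w\<bar> \<le> 1 * 1" using bndD[OF dl_bnd[OF that(1)]] Yb[OF that(2)] by (intro mult_mono) auto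
    then show ?thesis by (simp add: abs_mult)
  qed
  have fb: "bnd 1 (f r)" if "0 \<le> r" for r
    unfolding bnd_def f_def by (intro allI abs_expectation_le[OF _ dYb[OF that]]) (use that in measurable)
  have EA: "(\<E> w. A (\<lambda>z. dl r z w) x * Y w) = A (f r) x" if r: "0 \<le> r" for r x
  proof -
    have di: "integrable M (\<lambda>w. dl r x w * Y w)" by (rule integrable_bdd[OF _ dYb[OF r]]) (use r in measurable)
    have e: "(LSUM z. p z * (dl r (x + z) w * Y w)) = conv p (\<lambda>y. y) (\<lambda>z. dl r z w) x * Y w" for w
      by (simp add: conv_def mult.assoc flip: integral_mult_left_zero)
    have m: "(\<lambda>w. dl r (x + z) w * Y w) \<in> borel_measurable M" for z using r by measurable
    note ec = expect_conv[OF p_int, of "\<lambda>z w. dl r (x + z) w * Y w", OF m dYb[OF r]]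
    have "A (\<lambda>z. dl r z w) x * Y w = conv p (\<lambda>y. y) (\<lambda>z. dl r z w) x * Y w - rate p * (dl r x w * Y w)" for w
      by (simp add: gen_def algebra_simps)
    then have "(\<E> w. A (\<lambda>z. dl r z w) x * Y w) = (\<E> w. conv p (\<lambda>y. y) (\<lambda>z. dl r z w) x * Y w) - rate p * (\<E> w. dl r x w * Y w)"
      using ec(2) di by (simp add: e)
    also have "(\<E> w. conv p (\<lambda>y. y) (\<lambda>z. dl r z w) x * Y w) = conv p (\<lambda>y. y) (f r) x"
      using ec(1) by (simp add: e) (simp add: conv_def f_def)
    finally show ?thesis by (simp add: gen_def f_def)
  qed
  have AYb: "\<bar>A (\<lambda>z. dl r z w) x * Y w\<bar> \<le> 2 * rate p" if "r \<in> {0..s}" "w \<in> space M" for r s x w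
  proof -
    have "\<bar>A (\<lambda>z. dl r z w) x\<bar> * \<bar>Y w\<bar> \<le> (2 * rate p * 1) * 1"
      using bndD[OF gen_bnd[OF dl_bnd[where t=r]]] that Yb[OF that(2)] rate_nonneg by (intro mult_mono) auto
    then show ?thesis by (simp add: abs_mult)
  qed
  have Am: "(\<lambda>q. indicator {0..s} (fst q) * (A (\<lambda>z. dl (fst q) z (snd q)) x * Y (snd q))) \<in> borel_measurable (lborel \<Otimes>\<^sub>M M)" if s: "0 \<le> s" for s x
  proof -
    have [measurable]: "(\<lambda>q. indicator {0..s} (fst q) * A (\<lambda>z. dl (fst q) z (snd q)) x) \<in> borel_measurable (lborel \<Otimes>\<^sub>M M)"
      using pair_id(1)[OF gen_dlS_joint[OF s, of x]] by (simp add: gen_dlS)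
    have "(\<lambda>q. indicator {0..s} (fst q) * A (\<lambda>z. dl (fst q) z (snd q)) x * Y (snd q)) \<in> borel_measurable (lborel \<Otimes>\<^sub>M M)" by measurable
    then show ?thesis by (simp add: mult.assoc)
  qed
  note TF = time_fubini[OF _ Am AYb]
  have feq: "f s x = f 0 x + (LBINT r:{0..s}. A (f r) x)" if s: "0 \<le> s" for s x
  proof -
    have Yb': "bounded (Y ` space M)" unfolding bounded_iff using Yb by (intro exI[of _ 1]) auto
    have "(\<E> w. (D x s w - D x 0 w) * Y w) = 0" by (rule D_mart[OF order_refl s Y Yb'])
    then have "0 = (\<E> w. dl s x w * Y w - (LBINT r:{0..s}. A (\<lambda>z. dl r z w) x * Y w))"
      by (subst (asm) integral_congL[OF refl, of M _ "\<lambda>w. dl s x w * Y w - (LBINT r:{0..s}. A (\<lambda>z. dl r z w) x * Y w)"])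
        (auto simp: D_0 D_dl[OF s] left_diff_distrib)
    also have "\<dots> = f s x - (\<E> w. (LBINT r:{0..s}. A (\<lambda>z. dl r z w) x * Y w))"
    proof -
      have "integrable M (\<lambda>w. dl s x w * Y w)" by (rule integrable_bdd[OF _ dYb[OF s]]) (use s in measurable)
      then show ?thesis unfolding f_def by (rule integral_diffL) (rule TF(3)[OF s s])
    qed
    also have "(\<E> w. (LBINT r:{0..s}. A (\<lambda>z. dl r z w) x * Y w)) = (LBINT r:{0..s}. \<E> w. A (\<lambda>z. dl r z w) x * Y w)"
      by (rule TF(1)[OF s s])
    also have "\<dots> = (LBINT r:{0..s}. A (f r) x)" by (rule set_lebesgue_integral_cong) (auto simp: EA)
    finally show ?thesis by (simp add: f_def dl_0)
  qed
  have "\<bar>f t x\<bar> \<le> 0 + 0 * t"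
  proof (rule max_principle_abs[where T=t and X=UNIV and a="\<lambda>r. A (f r)" and K="rate p" and Bd=1 and b="\<lambda>r. conv p (\<lambda>y. y) (f r)"])
    show "set_integrable lborel {0..t} (\<lambda>r. A (f r) x)" for x
    proof -
      have "(\<lambda>r. indicator {0..t} r *\<^sub>R A (f r) x) = (\<lambda>r. indicator {0..t} r *\<^sub>R (\<E> w. A (\<lambda>z. dl r z w) x * Y w))"
        by (auto simp: fun_eq_iff EA split: split_indicator)
      then show ?thesis using TF(2)[OF t t] by (simp only: set_integrable_def)
    qed
    show "f s x = f 0 x + (LBINT r:{0..s}. A (f r) x)" if "s \<in> {0..t}" for s x by (rule feq) (use that in simp)
    fix r x assume r: "r \<in> {0..t}"
    then have r0: "0 \<le> r" by simp
    show "\<bar>A (f r) x + rate p * f r x - conv p (\<lambda>y. y) (f r) x\<bar> \<le> 0" by (simp add: gen_def)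
    { fix m assume "\<And>y. y \<in> UNIV \<Longrightarrow> - m \<le> f r y"
      then show "- (rate p * m) \<le> conv p (\<lambda>y. y) (f r) x" using conv_ge[OF fb[OF r0], of "- m" "\<lambda>y. y" x] by simp }
    { fix m assume "\<And>y. y \<in> UNIV \<Longrightarrow> f r y \<le> m"
      then show "conv p (\<lambda>y. y) (f r) x \<le> rate p * m" using conv_le[OF fb[OF r0], of m "\<lambda>y. y" x] by simp }
  qed (use t rate_nonneg bndD[OF fb] in \<open>auto simp: f_def dl_0\<close>)
  then show ?thesis by (simp add: f_def)
qed

section \<open>Two-point functions\<close>

lemma count_single:
  fixes k :: "int^'d \<Rightarrow> real"
  shows "(LSUM z. (if z = z0 then k z else 0)) = k z0" (is ?g1)
    and "lsummable (\<lambda>z. if z = z0 then k z else 0)" (is ?g2)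
proof -
  have e: "(\<lambda>z. if z = z0 then k z else 0) = (\<lambda>z. k z0 * indicator {z0} z)" by (auto simp: fun_eq_iff split: split_indicator)
  show ?g2
    unfolding e by (intro integrable_cmult integrable_real_indicator) auto
  show ?g1
    unfolding e by simp
qed

definition b :: "real \<Rightarrow> int^'d \<Rightarrow> int^'d \<Rightarrow> real" where
  "b r x y = (\<E> w. occ (\<eta> w r) x * occ (\<eta> w r) y)"

definition c :: "real \<Rightarrow> int^'d \<Rightarrow> int^'d \<Rightarrow> real" where
  "c r x y = (\<E> w. R r x w * R r y w)"

text \<open>The pair exclusion generator applied to \<open>b\<close>: a step onto the other site
  contributes nothing, so for distinct sites only off-diagonal values occur.\<close>

definition Ab :: "real \<Rightarrow> int^'d \<Rightarrow> int^'d \<Rightarrow> real" where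
  "Ab r x y = (LSUM z. p z * (if x + z = y then 0 else b r (x + z) y - b r x y)) +
     (LSUM z. p z * (if y + z = x then 0 else b r x (y + z) - b r x y))"

definition Ac :: "real \<Rightarrow> int^'d \<Rightarrow> int^'d \<Rightarrow> real" where
  "Ac r x y = A (\<lambda>z. c r z y) x + A (\<lambda>z. c r x z) y"

lemma expect_unit:
  assumes "f \<in> borel_measurable M" "\<And>w. w \<in> space M \<Longrightarrow> 0 \<le> f w \<and> f w \<le> 1"
  shows "0 \<le> (\<E> w. f w) \<and> (\<E> w. f w) \<le> (1::real)"
proof -
  have i: "integrable M f" by (rule integrable_bdd[where D=1]) (use assms in auto)
  have "(\<E> w. f w) \<le> (\<E> w. 1)" by (rule integral_mono[OF i]) (use assms in auto)
  moreover have "0 \<le> (\<E> w. f w)" by (rule integral_nonnegL) (use assms in auto)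
  ultimately show ?thesis by (simp add: prob_space)
qed

lemma b_range: "0 \<le> r \<Longrightarrow> 0 \<le> b r x y \<and> b r x y \<le> 1"
  unfolding b_def by (rule expect_unit) auto

lemma c_range: "0 \<le> r \<Longrightarrow> 0 \<le> c r x y \<and> c r x y \<le> 1"
  unfolding c_def by (rule expect_unit) (use R_bnd in \<open>auto intro: mult_le_one\<close>)

text \<open>The martingale problem for the product of two occupations, tested with the constant 1.
  The generator of the pair is bounded by twice the rate, so the expectation passes through the time
  integral and the jump sums.\<close>

lemma b_eq:
  assumes t: "0 \<le> t" and xy: "x \<noteq> y"
  shows "b t x y = b 0 x y + (LBINT r:{0..t}. Ab r x y)" (is ?g1) and "set_integrable lborel {0..t} (\<lambda>r. Ab r x y)" (is ?g2)
proof -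
  define g1 where "g1 \<xi> z = (if x + z = y then 0 else occ \<xi> (x + z) * occ \<xi> y - occ \<xi> x * occ \<xi> y)" for \<xi> :: "'d config" and z
  define g2 where "g2 \<xi> z = (if y + z = x then 0 else occ \<xi> x * occ \<xi> (y + z) - occ \<xi> x * occ \<xi> y)" for \<xi> :: "'d config" and z
  define L where "L r w = (LSUM z. p z * g1 (\<eta> w r) z) + (LSUM z. p z * g2 (\<eta> w r) z)" for r w
  have gb: "\<bar>g1 \<xi> z\<bar> \<le> 1" "\<bar>g2 \<xi> z\<bar> \<le> 1" for \<xi> z by (auto simp: g1_def g2_def)
  have Lg: "excl_gen h (\<lambda>\<xi>. occ \<xi> x * occ \<xi> y) (\<eta> w r) = L r w" for r w
    unfolding L_def g1_def g2_def by (rule excl_gen_pair[OF walk_axioms xy])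
  have cb: "\<bar>LSUM z. p z * k z\<bar> \<le> rate p" if "\<And>z. \<bar>k z\<bar> \<le> 1" for k
    using bndD[OF conv_bnd[of 1 k "\<lambda>y. y"], of 0] that by (simp add: bnd_def conv_def)
  have Lb: "\<bar>L r w\<bar> \<le> 2 * rate p" for r w
    using cb[of "g1 (\<eta> w r)", OF gb(1)] cb[of "g2 (\<eta> w r)", OF gb(2)] unfolding L_def by linarith
  have Lm: "(\<lambda>q. indicator {0..t} (fst q) * L (fst q) (snd q)) \<in> borel_measurable (lborel \<Otimes>\<^sub>M M)"
  proof -
    have [measurable]: "(\<lambda>q. occS t (fst q) z (snd q)) \<in> borel_measurable (lborel \<Otimes>\<^sub>M M)" for z by (rule pair_id(1)[OF occS_joint_F[OF t]])
    have 1: "(\<lambda>q. conv p (\<lambda>y. y) (\<lambda>z. if x + z = y then 0 else occS t (fst q) (x + z) (snd q) * occS t (fst q) y (snd q) - occS t (fst q) x (snd q) * occS t (fst q) y (snd q)) 0) \<in> borel_measurable (lborel \<Otimes>\<^sub>M M)"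
    proof (rule conv_param_meas(1))
      show "(\<lambda>q. if x + z = y then 0 else occS t (fst q) (x + z) (snd q) * occS t (fst q) y (snd q) - occS t (fst q) x (snd q) * occS t (fst q) y (snd q)) \<in> borel_measurable (lborel \<Otimes>\<^sub>M M)" for z
        by (cases "x + z = y") simp_all
    qed
    have 2: "(\<lambda>q. conv p (\<lambda>y. y) (\<lambda>z. if y + z = x then 0 else occS t (fst q) x (snd q) * occS t (fst q) (y + z) (snd q) - occS t (fst q) x (snd q) * occS t (fst q) y (snd q)) 0) \<in> borel_measurable (lborel \<Otimes>\<^sub>M M)"
    proof (rule conv_param_meas(1))
      show "(\<lambda>q. if y + z = x then 0 else occS t (fst q) x (snd q) * occS t (fst q) (y + z) (snd q) - occS t (fst q) x (snd q) * occS t (fst q) y (snd q)) \<in> borel_measurable (lborel \<Otimes>\<^sub>M M)" for z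
        by (cases "y + z = x") simp_all
    qed
    have e: "indicator {0..t} (fst q) * L (fst q) (snd q) =
       conv p (\<lambda>y. y) (\<lambda>z. if x + z = y then 0 else occS t (fst q) (x + z) (snd q) * occS t (fst q) y (snd q) - occS t (fst q) x (snd q) * occS t (fst q) y (snd q)) 0 +
       conv p (\<lambda>y. y) (\<lambda>z. if y + z = x then 0 else occS t (fst q) x (snd q) * occS t (fst q) (y + z) (snd q) - occS t (fst q) x (snd q) * occS t (fst q) y (snd q)) 0" for q
      unfolding L_def conv_def g1_def g2_def occS_def by (cases "fst q \<in> {0..t}") (auto cong: if_cong)
    show ?thesis unfolding e using 1 2 by (rule borel_measurable_add)
  qed
  have EL: "(\<E> w. L r w) = Ab r x y" if r: "0 \<le> r" for r
  proof -
    have m1: "(\<lambda>w. g1 (\<eta> w r) z) \<in> borel_measurable M" "(\<lambda>w. g2 (\<eta> w r) z) \<in> borel_measurable M" for z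
      unfolding g1_def g2_def using r by measurable
    note e1 = expect_conv[OF p_int m1(1) gb(1)] and e2 = expect_conv[OF p_int m1(2) gb(2)]
    have io: "integrable M (\<lambda>w. occ (\<eta> w r) u * occ (\<eta> w r) v)" for u v
      by (rule integrable_bdd[where D=1]) (use r in auto)
    have "(\<E> w. g1 (\<eta> w r) z) = (if x + z = y then 0 else b r (x + z) y - b r x y)" for z
      unfolding g1_def b_def using io by auto
    moreover have "(\<E> w. g2 (\<eta> w r) z) = (if y + z = x then 0 else b r x (y + z) - b r x y)" for z
      unfolding g2_def b_def using io by auto
    ultimately show ?thesis unfolding L_def Ab_def using e1 e2 by simp
  qed
  note TF = time_fubini[OF t Lm Lb]
  have TFe: "(LBINT r:{0..t}. \<E> w. L r w) = (LBINT r:{0..t}. Ab r x y)"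
    by (rule set_lebesgue_integral_cong) (auto simp: EL)
  have "(\<lambda>r. indicator {0..t} r *\<^sub>R (\<E> w. L r w)) = (\<lambda>r. indicator {0..t} r *\<^sub>R Ab r x y)"
    by (auto simp: fun_eq_iff EL split: split_indicator)
  then show ?g2 using TF(2) by (simp only: set_integrable_def)
  have lf: "local_fun (\<lambda>\<xi>. occ \<xi> x * occ \<xi> y)" unfolding local_fun_def by (intro exI[of _ "{x, y}"]) auto
  have one: "(\<lambda>_. 1 :: real) \<in> borel_measurable (F 0)" "bounded ((\<lambda>_. 1 :: real) ` space M)" by (auto simp: bounded_iff intro: exI[of _ 1])
  have dm: "dynkin_mart h \<eta> (\<lambda>\<xi>. occ \<xi> x * occ \<xi> y) s w = occ (\<eta> w s) x * occ (\<eta> w s) y - occ (\<eta> w 0) x * occ (\<eta> w 0) y - (LBINT r:{0..s}. L r w)" for s w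
    by (simp add: dynkin_mart_def Lg)
  have L0: "(LBINT r:{0..0}. L r w) = 0" for w
  proof -
    have "AE r in lborel. indicator {0..0} r *\<^sub>R L r w = 0" using AE_lborel_singleton[of "0::real"] by eventually_elim auto
    then show ?thesis unfolding set_lebesgue_integral_def by (rule integral_eq_zero_AE)
  qed
  have "(\<E> w. (dynkin_mart h \<eta> (\<lambda>\<xi>. occ \<xi> x * occ \<xi> y) t w - dynkin_mart h \<eta> (\<lambda>\<xi>. occ \<xi> x * occ \<xi> y) 0 w) * 1) = 0"
    using mp lf one t unfolding martingale_problem_def by blast
  then have "0 = (\<E> w. occ (\<eta> w t) x * occ (\<eta> w t) y - occ (\<eta> w 0) x * occ (\<eta> w 0) y - (LBINT r:{0..t}. L r w))"
    unfolding dm L0 by simp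
  also have "\<dots> = b t x y - b 0 x y - (\<E> w. (LBINT r:{0..t}. L r w))"
  proof -
    have io: "integrable M (\<lambda>w. occ (\<eta> w r) u * occ (\<eta> w r) v)" if "0 \<le> r" for u v r
      by (rule integrable_bdd[where D=1]) (use that in auto)
    show ?thesis unfolding b_def
      by (subst integral_diffL[OF integrable_diffL[OF io[OF t] io[OF order_refl]] TF(3)],
          subst integral_diffL[OF io[OF t] io[OF order_refl]]) simp
  qed
  finally show ?g1 using TF(1) TFe by simp
qed

text \<open>For each initial configuration the product rule applies to two solutions of the walk
  equation; expectations are taken afterwards. This is the generator of two independent
  walks.\<close>

lemma c_eq:
  assumes t: "0 \<le> t"
  shows "c t x y = c 0 x y + (LBINT r:{0..t}. Ac r x y)" (is ?g1) and "set_integrable lborel {0..t} (\<lambda>r. Ac r x y)" (is ?g2)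
proof -
  define L where "L r w = A (\<lambda>z. R r z w) x * R r y w + R r x w * A (\<lambda>z. R r z w) y" for r w
  have Rb: "bnd 1 (\<lambda>z. R r z w)" if "0 \<le> r" for r w unfolding bnd_def using R_bnd[OF that] by auto
  have gR: "A (\<lambda>z. R r z w) x = semi p (\<lambda>y. y) r (A (occ (\<eta> w 0))) x" for r w x
    unfolding R_def by (rule semi_gen_commute[OF walk_axioms occ_bnd])
  have Lb: "\<bar>L r w\<bar> \<le> 4 * rate p" if "r \<in> {0..t}" for r w
  proof -
    have r: "0 \<le> r" using that by simp
    have "\<bar>A (\<lambda>z. R r z w) x\<bar> * \<bar>R r y w\<bar> \<le> (2 * rate p * 1) * 1" for x y
      using bndD[OF gen_bnd[OF Rb[OF r]]] bndD[OF Rb[OF r]] rate_nonneg by (intro mult_mono) auto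
    from this[of x y] this[of y x] have "\<bar>A (\<lambda>z. R r z w) x * R r y w\<bar> \<le> 2 * rate p" "\<bar>R r x w * A (\<lambda>z. R r z w) y\<bar> \<le> 2 * rate p"
      by (simp_all add: abs_mult mult.commute)
    then show ?thesis unfolding L_def by linarith
  qed
  have Lm: "(\<lambda>q. indicator {0..t} (fst q) * L (fst q) (snd q)) \<in> borel_measurable (lborel \<Otimes>\<^sub>M M)"
  proof -
    have Rm[measurable]: "(\<lambda>q. R (fst q) z (snd q)) \<in> borel_measurable (lborel \<Otimes>\<^sub>M M)" for z
      using pair_id(1)[OF R_joint_F, of z] by (simp add: case_prod_beta)
    have [measurable]: "(\<lambda>q. A (\<lambda>z. R (fst q) z (snd q)) x) \<in> borel_measurable (lborel \<Otimes>\<^sub>M M)" for x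
      by (rule conv_param_meas(2)) (rule Rm)
    show ?thesis unfolding L_def by measurable
  qed
  have pt: "R t x w * R t y w = R 0 x w * R 0 y w + (LBINT r:{0..t}. L r w)" for w
  proof -
    have d: "((\<lambda>r. R r u w) has_real_derivative A (\<lambda>z. R r z w) u) (at v)" if "v = r" for r u v
      unfolding that
      unfolding gR unfolding R_def by (rule semi_DERIV[OF occ_bnd])
    have "((\<lambda>r. R r x w * R r y w) has_real_derivative L r w) (at r)" for r
      using DERIV_mult[OF d[OF refl, of x r] d[OF refl, of y r]] by (simp add: L_def algebra_simps)
    moreover have "isCont (\<lambda>r. L r w) r" for r
      unfolding L_def gR by (intro continuous_intros semi_cont[OF gen_bnd[OF occ_bnd]] DERIV_isCont[OF d[OF refl]])
    ultimately have "(LBINT r. L r w * indicator {0..t} r) = R t x w * R t y w - R 0 x w * R 0 y w"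
      by (intro integral_FTC_Icc_real[OF t]) auto
    then show ?thesis by (simp add: set_lebesgue_integral_def mult.commute)
  qed
  have RR: "integrable M (\<lambda>w. R r u w * R r v w)" and RRb: "\<bar>R r u w * R r v w\<bar> \<le> 1" if "0 \<le> r" for r u v w
  proof -
    have b: "\<bar>R r u w * R r v w\<bar> \<le> 1" for w using R_bnd[OF that, of u w] R_bnd[OF that, of v w] by (auto simp: abs_mult intro: mult_le_one)
    then show "\<bar>R r u w * R r v w\<bar> \<le> 1" .
    show "integrable M (\<lambda>w. R r u w * R r v w)" by (rule integrable_bdd[OF _ b]) measurable
  qed
  have EA: "(\<E> w. A (\<lambda>z. R r z w) x * R r y w) = A (\<lambda>z. c r z y) x" and iA: "integrable M (\<lambda>w. A (\<lambda>z. R r z w) x * R r y w)" if r: "0 \<le> r" for r x y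
  proof -
    have e: "(LSUM z. p z * (R r (x + z) w * R r y w)) = conv p (\<lambda>y. y) (\<lambda>z. R r z w) x * R r y w" for w
      by (simp add: conv_def mult.assoc flip: integral_mult_left_zero)
    have m: "(\<lambda>w. R r (x + z) w * R r y w) \<in> borel_measurable M" for z by measurable
    note ec = expect_conv[OF p_int, of "\<lambda>z w. R r (x + z) w * R r y w", OF m RRb[OF r]]
    have sp: "A (\<lambda>z. R r z w) x * R r y w = conv p (\<lambda>y. y) (\<lambda>z. R r z w) x * R r y w - rate p * (R r x w * R r y w)" for w
      by (simp add: gen_def algebra_simps)
    have ic: "integrable M (\<lambda>w. conv p (\<lambda>y. y) (\<lambda>z. R r z w) x * R r y w)" using ec(2) by (simp add: e)
    show "integrable M (\<lambda>w. A (\<lambda>z. R r z w) x * R r y w)"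
      unfolding sp by (intro integrable_diffL ic integrable_cmult RR[OF r])
    have "(\<E> w. A (\<lambda>z. R r z w) x * R r y w) = (\<E> w. conv p (\<lambda>y. y) (\<lambda>z. R r z w) x * R r y w) - rate p * (\<E> w. R r x w * R r y w)"
      unfolding sp using ic RR[OF r] by simp
    also have "(\<E> w. conv p (\<lambda>y. y) (\<lambda>z. R r z w) x * R r y w) = conv p (\<lambda>y. y) (\<lambda>z. c r z y) x"
      using ec(1) by (simp add: e) (simp add: conv_def c_def)
    finally show "(\<E> w. A (\<lambda>z. R r z w) x * R r y w) = A (\<lambda>z. c r z y) x" by (simp add: gen_def c_def)
  qed
  have EL: "(\<E> w. L r w) = Ac r x y" if r: "0 \<le> r" for r
  proof -
    have "(\<E> w. L r w) = (\<E> w. A (\<lambda>z. R r z w) x * R r y w) + (\<E> w. A (\<lambda>z. R r z w) y * R r x w)"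
      unfolding L_def using iA[OF r, of x y] iA[OF r, of y x] by (simp add: mult.commute)
    also have "\<dots> = A (\<lambda>z. c r z y) x + A (\<lambda>z. c r z x) y" by (simp add: EA[OF r])
    also have "(\<lambda>z. c r z x) = (\<lambda>z. c r x z)" by (simp add: c_def mult.commute)
    finally show ?thesis by (simp add: Ac_def)
  qed
  note TF = time_fubini[OF t Lm Lb]
  have "(\<lambda>r. indicator {0..t} r *\<^sub>R (\<E> w. L r w)) = (\<lambda>r. indicator {0..t} r *\<^sub>R Ac r x y)"
    by (auto simp: fun_eq_iff EL split: split_indicator)
  then show ?g2 using TF(2) by (simp only: set_integrable_def)
  have "c t x y = c 0 x y + (\<E> w. (LBINT r:{0..t}. L r w))"
    unfolding c_def pt by (rule Bochner_Integration.integral_add[OF RR[OF order_refl] TF(3)])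
  also have "(\<E> w. (LBINT r:{0..t}. L r w)) = (LBINT r:{0..t}. \<E> w. L r w)" by (rule TF(1))
  also have "\<dots> = (LBINT r:{0..t}. Ac r x y)" by (rule set_lebesgue_integral_cong) (auto simp: EL)
  finally show ?g1 .
qed

text \<open>Negative dependence: the pair exclusion generator differs from the generator of two
  independent walkers only through the jump onto the occupied site, which contributes
  \<open>p (y - x) E (R x - R y)\<^sup>2 \<ge> 0\<close>.\<close>

lemma two_point:
  assumes t: "0 \<le> t" and xy: "x \<noteq> y"
  shows "b t x y \<le> c t x y"
proof -
  define f where "f r = (\<lambda>(x, y). c r x y - b r x y)" for r
  define a where "a r = (\<lambda>(x, y). Ac r x y - Ab r x y)" for r
  let ?X = "{(x, y). x \<noteq> y} :: ((int^'d) \<times> (int^'d)) set"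
  have f0: "f 0 q = 0" for q by (cases q) (simp add: f_def c_def b_def R_0)
  have fb: "\<bar>f r q\<bar> \<le> 1" if "0 \<le> r" for r q 
  proof -
    obtain x y where "q = (x, y)" by (cases q)
    then show ?thesis using b_range[OF that, of x y] c_range[OF that, of x y] by (simp add: f_def abs_le_iff)
  qed
  have pi: "lsummable (\<lambda>z. p z * k z)" if "\<And>z. \<bar>k z\<bar> \<le> C" for k C
    by (rule integrable_rate_bounded[OF walk_axioms that])
  have "- (0 + 0 * t) \<le> f t (x, y)"
  \<comment> \<open>The diagonal must be left out: there f is E R^2 - E R by
    \<open>one_point\<close>, which has the wrong sign. The constant K counts the rate once for each
    coordinate.\<close>
  proof (rule max_principle[where T=t and X="?X" and a=a and K="2 * rate p" and Bd=1])
    show "set_integrable lborel {0..t} (\<lambda>r. a r q)" if "q \<in> ?X" for q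
      using that set_integral_diff(1)[OF c_eq(2)[OF t] b_eq(2)[OF t]] by (cases q) (auto simp: a_def)
    show "f s q = f 0 q + (LBINT r:{0..s}. a r q)" if s: "s \<in> {0..t}" and q: "q \<in> ?X" for s q
    proof -
      obtain x y where xy: "q = (x, y)" "x \<noteq> y" using q by auto
      have s0: "0 \<le> s" using s by simp
      have "(LBINT r:{0..s}. a r q) = (LBINT r:{0..s}. Ac r x y) - (LBINT r:{0..s}. Ab r x y)"
        unfolding a_def xy(1) prod.case by (rule set_integral_diff(2)[OF c_eq(2)[OF s0] b_eq(2)[OF s0 xy(2)]])
      then show ?thesis using c_eq(1)[OF s0, of x y] b_eq(1)[OF s0 xy(2)] unfolding f_def xy(1) prod.case by linarith
    qed
    fix r q m assume r: "r \<in> {0..t}" and q: "q \<in> ?X" and m: "0 \<le> m" and lo: "\<And>q. q \<in> ?X \<Longrightarrow> - m \<le> f r q"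
    have r0: "0 \<le> r" using r by simp
    obtain x y where xy: "q = (x, y)" "x \<noteq> y" using q by auto
    have half: "A (\<lambda>z. g z) x - (LSUM z. p z * (if x + z = y then 0 else k (x + z) - k x)) + rate p * (g x - k x)
        \<ge> - (rate p * m) + p (y - x) * (g y - g x)"
      if gb: "\<And>z. \<bar>g z\<bar> \<le> 1" and kb: "\<And>z. \<bar>k z\<bar> \<le> 1" and l: "\<And>z. z \<noteq> y \<Longrightarrow> - m \<le> g z - k z" and xy: "x \<noteq> y" for g k :: "int^'d \<Rightarrow> real" and x y
    proof -
      \<comment> \<open>The forbidden jump is replaced by staying put. Then only off-diagonal values
        enter, where the lower bound -m is available, and what is left over is the single term at z
        = y - x.\<close>
      define \<phi> where "\<phi> z = (if x + z = y then g x - k x else g (x + z) - k (x + z))" for z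
      have \<phi>b: "\<bar>\<phi> z\<bar> \<le> 2" for z using gb[of x] kb[of x] gb[of "x + z"] kb[of "x + z"] unfolding \<phi>_def by (auto simp: abs_le_iff)
      have bb: "\<bar>if x + z = y then 0 else k (x + z) - k x\<bar> \<le> 2" for z using kb[of x] kb[of "x + z"] by (auto simp: abs_le_iff)
      have i1: "lsummable (\<lambda>z. p z * g (x + z))" by (rule pi) (rule gb)
      have i2: "lsummable (\<lambda>z. p z * (if x + z = y then 0 else k (x + z) - k x))" by (rule pi) (rule bb)
      have i3: "lsummable (\<lambda>z. p z * \<phi> z)" by (rule pi) (rule \<phi>b)
      note single = count_single[of "y - x" "\<lambda>z. p z * (g y - g x)"]
      have e: "p z * g (x + z) - p z * (if x + z = y then 0 else k (x + z) - k x) - k x * p z = p z * \<phi> z + (if z = y - x then p z * (g y - g x) else 0)" for z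
        using xy by (auto simp: \<phi>_def algebra_simps)
      have "A (\<lambda>z. g z) x - (LSUM z. p z * (if x + z = y then 0 else k (x + z) - k x)) + rate p * (g x - k x)
         = (LSUM z. p z * g (x + z) - p z * (if x + z = y then 0 else k (x + z) - k x) - k x * p z)"
        using i1 i2 p_int by (simp add: gen_def conv_def rate_def algebra_simps)
      also have "\<dots> = (LSUM z. p z * \<phi> z) + p (y - x) * (g y - g x)"
        unfolding e using i3 single by simp
      also have "(LSUM z. p z * \<phi> z) \<ge> (LSUM z. p z * (- m))"
      proof (rule integral_mono)
        show "p z * (- m) \<le> p z * \<phi> z" for z
          using l[of x] l[of "x + z"] xy p_nonneg[of z] by (intro mult_left_mono) (auto simp: \<phi>_def)
      qed (use p_int i3 in auto)
      moreover have "(LSUM z. p z * (- m)) = - (rate p * m)" by (simp add: rate_def)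
      ultimately show ?thesis by linarith
    qed
    have cb: "\<bar>c r u v\<bar> \<le> 1" "\<bar>b r u v\<bar> \<le> 1" for u v using c_range[OF r0, of u v] b_range[OF r0, of u v] by auto
    have h1: "A (\<lambda>z. c r z y) x - (LSUM z. p z * (if x + z = y then 0 else b r (x + z) y - b r x y)) + rate p * (c r x y - b r x y)
        \<ge> - (rate p * m) + p (y - x) * (c r y y - c r x y)"
      by (rule half[of "\<lambda>z. c r z y" "\<lambda>z. b r z y"]) (use cb lo[of "(_, y)"] xy(2) in \<open>auto simp: f_def\<close>)
    have h2: "A (\<lambda>z. c r x z) y - (LSUM z. p z * (if y + z = x then 0 else b r x (y + z) - b r x y)) + rate p * (c r x y - b r x y)
        \<ge> - (rate p * m) + p (x - y) * (c r x x - c r x y)"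
      by (rule half[of "\<lambda>z. c r x z" "\<lambda>z. b r x z"]) (use cb lo[of "(x, _)"] xy(2) in \<open>auto simp: f_def\<close>)
    have pe: "p (x - y) = p (y - x)" using p_even[of "y - x"] by simp
    have "0 \<le> c r y y - c r x y + (c r x x - c r x y)"
    proof -
      have RR: "integrable M (\<lambda>w. R r u w * R r v w)" for u v
        by (rule integrable_bdd[where D=1]) (use R_bnd[OF r0] in \<open>auto simp: abs_mult intro: mult_le_one\<close>)
      have "0 \<le> (\<E> w. (R r x w - R r y w)\<^sup>2)" by simp
      also have "\<dots> = (\<E> w. (R r y w * R r y w - R r x w * R r y w) + (R r x w * R r x w - R r x w * R r y w))"
        by (rule integral_congL) (auto simp: power2_eq_square algebra_simps)
      also have "\<dots> = c r y y - c r x y + (c r x x - c r x y)" unfolding c_def using RR by simp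
      finally show ?thesis .
    qed
    then have "0 \<le> p (y - x) * (c r y y - c r x y + (c r x x - c r x y))" using p_nonneg by simp
    then have "0 \<le> p (y - x) * (c r y y - c r x y) + p (x - y) * (c r x x - c r x y)" unfolding pe distrib_left .
    then show "- (2 * rate p * m + 0) \<le> a r q + 2 * rate p * f r q"
      using h1 h2 unfolding a_def f_def xy(1) prod.case Ac_def Ab_def by (simp add: algebra_simps)
  qed (use t xy rate_nonneg f0 fb in \<open>auto simp: abs_le_iff intro: order_trans[of _ 0]\<close>)
  then show ?thesis by (simp add: f_def)
qed

end

section \<open>Uniform control of the fluctuations\<close>

lemma integrable_square:
  fixes g :: "'a \<Rightarrow> real"
  assumes "integrable N g" "bnd C g"
  shows "integrable N (\<lambda>x. (g x)\<^sup>2)"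
proof (rule integrable_boundL[of _ "\<lambda>x. C * g x"])
  show "AE x in N. norm ((g x)\<^sup>2) \<le> norm (C * g x)"
    using mult_right_mono[OF bndD[OF assms(2)] abs_ge_zero] bnd_nonneg[OF assms(2)]
    by (intro AE_I2) (simp add: power2_eq_square abs_mult del: abs_mult_self_eq)
qed (use assms(1) in auto)

lemma square_diff_le: "(a - b)\<^sup>2 \<le> 2 * a\<^sup>2 + 2 * b\<^sup>2" for a b :: real
  using zero_le_power2[of "a + b"] by (simp add: power2_eq_square algebra_simps)

context particle
begin

lemma dl_dl_bnd: "0 \<le> t \<Longrightarrow> \<bar>dl t x w * dl t y w\<bar> \<le> 1"
  using bndD[OF dl_bnd[of t w], of x] bndD[OF dl_bnd[of t w], of y] by (auto simp: abs_mult intro: mult_le_one)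

text \<open>Expanding the product, the terms with one factor \<open>dl\<close> and one factor
  \<open>R\<close> vanish, since \<open>R\<close> is known at time 0. The rest is \<open>b\<close>
  minus \<open>c\<close>.\<close>

lemma dl_dl_expect:
  assumes t: "0 \<le> t"
  shows "x \<noteq> y \<Longrightarrow> (\<E> w. dl t x w * dl t y w) \<le> 0" and "(\<E> w. dl t x w * dl t y w) \<le> 1" (is ?g1)
proof -
  have i: "integrable M (\<lambda>w. dl t x w * dl t y w)" by (rule integrable_bdd[OF _ dl_dl_bnd[OF t]]) (use t in measurable)
  have "(\<E> w. dl t x w * dl t y w) \<le> (\<E> w. 1)"
    by (rule integral_mono[OF i]) (use dl_dl_bnd[OF t] in \<open>auto simp: abs_le_iff\<close>)
  then show ?g1 by (simp add: prob_space)
  have R1: "\<bar>R t u w\<bar> \<le> 1" for u w using R_bnd[OF t, of u w] by auto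
  have o: "(\<E> w. dl t u w * R t v w) = 0" for u v by (rule one_point[OF R_F0 R1 t])
  have i1: "integrable M (\<lambda>w. dl t u w * R t v w)" for u v
    by (rule integrable_bdd[where D=1]) (use t bndD[OF dl_bnd[OF t]] R1 in \<open>auto simp: abs_mult intro: mult_le_one\<close>)
  have i2: "integrable M (\<lambda>w. occ (\<eta> w t) x * occ (\<eta> w t) y)" by (rule integrable_bdd[where D=1]) (use t in auto)
  have i3: "integrable M (\<lambda>w. R t x w * R t y w)" by (rule integrable_bdd[where D=1]) (use R1 in \<open>auto simp: abs_mult intro: mult_le_one\<close>)
  have "(\<E> w. dl t x w * dl t y w) = (\<E> w. occ (\<eta> w t) x * occ (\<eta> w t) y - R t x w * R t y w - dl t x w * R t y w - dl t y w * R t x w)"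
    by (rule integral_congL) (auto simp: dl_def algebra_simps)
  also have "\<dots> = b t x y - c t x y" using i1 i2 i3 by (simp add: o b_def c_def)
  finally show "x \<noteq> y \<Longrightarrow> (\<E> w. dl t x w * dl t y w) \<le> 0" using two_point[OF t, of x y] by simp
qed

definition X :: "(int^'d \<Rightarrow> real) \<Rightarrow> real \<Rightarrow> 'w \<Rightarrow> real" where
  "X g t w = (LSUM x. g x * dl t x w)"

lemma X_integrable:
  assumes "lsummable g" "0 \<le> t"
  shows "lsummable (\<lambda>x. g x * dl t x w)"
proof (rule integrable_boundL[OF assms(1)])
  show "AE x in count_space UNIV. norm (g x * dl t x w) \<le> norm (g x)"
    using bndD[OF dl_bnd[OF assms(2)]] by (auto simp: abs_mult intro!: mult_left_le AE_I2)
qed simp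

lemma X_bound:
  assumes "lsummable g" "0 \<le> t"
  shows "\<bar>X g t w\<bar> \<le> (LSUM x. \<bar>g x\<bar>)"
proof -
  have "\<bar>X g t w\<bar> \<le> (LSUM x. \<bar>g x * dl t x w\<bar>)" unfolding X_def by (rule integral_abs_bound)
  also have "\<dots> \<le> (LSUM x. \<bar>g x\<bar>)"
    by (rule integral_mono[OF integrable_abs[OF X_integrable[OF assms]] integrable_abs[OF assms(1)]])
      (use bndD[OF dl_bnd[OF assms(2)]] in \<open>auto simp: abs_mult intro: mult_left_le\<close>)
  finally show ?thesis .
qed

lemma X_M:
  assumes "lsummable g" "0 \<le> t"
  shows "X g t \<in> borel_measurable M"
  unfolding X_def[abs_def]
  by (rule borel_measurable_integrable, rule expect_conv(2)[OF assms(1), of "dl t" 1])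
    (rule dl_M[OF assms(2)], rule bndD[OF dl_bnd[OF assms(2)]])

lemma X_sq_integrable:
  assumes "lsummable g" "0 \<le> t"
  shows "integrable M (\<lambda>w. (X g t w)\<^sup>2)"
proof (rule integrable_bdd)
  show "\<bar>(X g t w)\<^sup>2\<bar> \<le> (LSUM x. \<bar>g x\<bar>)\<^sup>2" for w
    using X_bound[OF assms, of w] by (simp add: abs_le_square_iff[symmetric] abs_of_nonneg)
qed (use X_M[OF assms] in measurable)

text \<open>For weights of one sign the off-diagonal covariances contribute nothing positive, and
  each diagonal one is at most 1.\<close>

lemma variance_nonneg:
  assumes g: "lsummable g" and gb: "bnd C g" and g0: "\<And>x. 0 \<le> g x" and t: "0 \<le> t"
  shows "(\<E> w. (X g t w)\<^sup>2) \<le> (LSUM x. (g x)\<^sup>2)"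
proof -
  define I where "I = (LSUM x. \<bar>g x\<bar>)"
  have [measurable]: "X g t \<in> borel_measurable M" by (rule X_M[OF g t])
  have Xb: "\<bar>X g t w\<bar> \<le> I" for w unfolding I_def by (rule X_bound[OF g t])
  have d1: "\<bar>dl t x w\<bar> \<le> 1" for x w using bndD[OF dl_bnd[OF t]] .
  have I0: "0 \<le> I" using Xb[of undefined] by linarith
  have fb: "\<bar>dl t x w * X g t w\<bar> \<le> I" for x w
    using mult_mono[OF d1 Xb] by (simp add: abs_mult)
  have fm: "(\<lambda>w. dl t x w * X g t w) \<in> borel_measurable M" for x using t by measurable
  have sq: "(X g t w)\<^sup>2 = (LSUM x. g x * (dl t x w * X g t w))" for w
  proof -
    have "(LSUM x. g x * dl t x w * X g t w) = X g t w * X g t w"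
      by (subst integral_mult_left_zero) (simp add: X_def)
    then show ?thesis by (simp add: power2_eq_square mult.assoc)
  qed
  have inner: "(\<E> w. dl t x w * X g t w) \<le> g x" for x
  proof -
    have e: "dl t x w * X g t w = (LSUM y. g y * (dl t x w * dl t y w))" for w
    proof -
      have "(LSUM y. dl t x w * (g y * dl t y w)) = dl t x w * X g t w" by (simp add: X_def)
      then show ?thesis by (simp add: mult.left_commute)
    qed
    have dm: "(\<lambda>w. dl t x w * dl t y w) \<in> borel_measurable M" for y using t by measurable
    have "(\<E> w. dl t x w * X g t w) = (LSUM y. g y * (\<E> w. dl t x w * dl t y w))"
      unfolding e by (rule expect_conv(1)[OF g, of "\<lambda>y w. dl t x w * dl t y w", OF dm dl_dl_bnd[OF t]])
    also have "\<dots> \<le> (LSUM y. (if y = x then g y else 0))"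
    proof (rule integral_mono)
      have db: "\<bar>\<E> w. dl t x w * dl t y w\<bar> \<le> 1" for y by (rule abs_expectation_le[OF dm dl_dl_bnd[OF t]])
      show "lsummable (\<lambda>y. g y * (\<E> w. dl t x w * dl t y w))"
      proof (rule integrable_boundL[OF g])
        show "AE y in count_space UNIV. norm (g y * (\<E> w. dl t x w * dl t y w)) \<le> norm (g y)"
          using db by (auto simp: abs_mult intro!: mult_left_le AE_I2)
      qed simp
      show "g y * (\<E> w. dl t x w * dl t y w) \<le> (if y = x then g y else 0)" for y
        using dl_dl_expect(1)[OF t, of x y] dl_dl_expect(2)[OF t, of x y] g0[of y]
        by (auto intro: mult_left_le simp: mult_nonneg_nonpos)
    qed (rule count_single(2))
    finally show ?thesis by (simp add: count_single(1))
  qed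
  have "(\<E> w. (X g t w)\<^sup>2) = (LSUM x. g x * (\<E> w. dl t x w * X g t w))"
    unfolding sq by (rule expect_conv(1)[OF g, of "\<lambda>x w. dl t x w * X g t w", OF fm fb])
  also have "\<dots> \<le> (LSUM x. (g x)\<^sup>2)"
  proof (rule integral_mono)
    have eb: "\<bar>\<E> w. dl t x w * X g t w\<bar> \<le> I" for x by (rule abs_expectation_le[OF fm fb])
    show "lsummable (\<lambda>x. g x * (\<E> w. dl t x w * X g t w))"
    proof (rule integrable_boundL[of _ "\<lambda>x. I * g x"])
      show "AE x in count_space UNIV. norm (g x * (\<E> w. dl t x w * X g t w)) \<le> norm (I * g x)"
        using eb I0 by (auto simp: abs_mult mult.commute[of I] intro!: mult_left_mono AE_I2)
    qed (use g in auto)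
    show "g x * (\<E> w. dl t x w * X g t w) \<le> (g x)\<^sup>2" for x
      using mult_left_mono[OF inner g0] by (simp add: power2_eq_square)
  qed (rule integrable_square[OF g gb])
  finally show ?thesis .
qed

text \<open>Negative correlations help only for weights of one sign. Splitting g into positive and
  negative part costs the factor 2, while the squares of the two parts add up to the square of
  g.\<close>

lemma variance:
  assumes g: "lsummable g" and gb: "bnd C g" and t: "0 \<le> t"
  shows "(\<E> w. (X g t w)\<^sup>2) \<le> 2 * (LSUM x. (g x)\<^sup>2)"
proof -
  define gp where "gp x = max 0 (g x)" for x
  define gm where "gm x = max 0 (- g x)" for x
  have ip: "lsummable gp" and im: "lsummable gm"
    unfolding gp_def[abs_def] gm_def[abs_def] using g by auto
  have bp: "bnd C gp" and bm: "bnd C gm" using gb unfolding bnd_def gp_def gm_def by (auto simp: abs_le_iff max_def) 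
  have e: "X g t w = X gp t w - X gm t w" for w
  proof -
    have "X g t w = (LSUM x. gp x * dl t x w - gm x * dl t x w)"
      unfolding X_def by (rule integral_congL) (auto simp: gp_def gm_def max_def)
    then show ?thesis unfolding X_def using X_integrable[OF ip t] X_integrable[OF im t] by simp
  qed
  have "(\<E> w. (X g t w)\<^sup>2) \<le> (\<E> w. 2 * (X gp t w)\<^sup>2 + 2 * (X gm t w)\<^sup>2)"
    by (rule integral_mono) (use X_sq_integrable[OF g t] X_sq_integrable[OF ip t] X_sq_integrable[OF im t] square_diff_le in \<open>auto simp: e\<close>)
  also have "\<dots> = 2 * (\<E> w. (X gp t w)\<^sup>2) + 2 * (\<E> w. (X gm t w)\<^sup>2)"
    using X_sq_integrable[OF ip t] X_sq_integrable[OF im t] by simp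
  also have "\<dots> \<le> 2 * (LSUM x. (gp x)\<^sup>2) + 2 * (LSUM x. (gm x)\<^sup>2)"
    using variance_nonneg[OF ip bp _ t] variance_nonneg[OF im bm _ t] by (simp add: gp_def gm_def)
  also have "\<dots> = 2 * (LSUM x. (gp x)\<^sup>2 + (gm x)\<^sup>2)"
    using integrable_square[OF ip bp] integrable_square[OF im bm] by simp
  also have "(\<lambda>x. (gp x)\<^sup>2 + (gm x)\<^sup>2) = (\<lambda>x. (g x)\<^sup>2)" by (auto simp: gp_def gm_def max_def fun_eq_iff)
  finally show ?thesis .
qed

lemma gen_dual_count:
  assumes g: "lsummable g" and gb: "bnd C g" and f: "bnd C' f"
  shows "(LSUM x. g x * A f x) = (LSUM x. A g x * f x)" (is ?g1) and "lsummable (A g)"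
proof -
  interpret t: transl_inv "count_space (UNIV :: (int^'d) set)" by (rule transl_inv_count)
  have od: "odd_shift (\<lambda>y :: int^'d. y)" by (simp add: odd_shift_def)
  note cd = t.conv_dual[OF walk_axioms od g gb _ f]
  have ig: "lsummable (conv p (\<lambda>y. y) g)" using cd(2) by simp
  show "lsummable (A g)" unfolding gen_def[abs_def] using ig g by auto
  have m: "lsummable (\<lambda>x. k x * w x)" if "lsummable k" "bnd B w" for k w :: "int^'d \<Rightarrow> real" and B
  proof (rule integrable_boundL[of _ "\<lambda>x. B * k x"])
    show "AE x in count_space UNIV. norm (k x * w x) \<le> norm (B * k x)"
      using bndD[OF that(2)] bnd_nonneg[OF that(2)] by (auto simp: abs_mult mult.commute[of B] intro!: mult_left_mono AE_I2)
  qed (use that in auto)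
  have "(LSUM x. g x * A f x) = (LSUM x. g x * conv p (\<lambda>y. y) f x - rate p * (g x * f x))"
    by (simp add: gen_def algebra_simps)
  also have "\<dots> = (LSUM x. conv p (\<lambda>y. y) g x * f x) - rate p * (LSUM x. g x * f x)"
    using m[OF g conv_bnd[OF f]] m[OF g f] cd(1) by simp
  also have "\<dots> = (LSUM x. conv p (\<lambda>y. y) g x * f x - rate p * (g x * f x))"
    using m[OF ig f] m[OF g f] by simp
  finally show ?g1
    by (simp add: gen_def algebra_simps)
qed

text \<open>\<open>X g\<close> is not a martingale, but a finite combination Y of one-site Dynkin
  martingales differs from it by a time integral of Q. Doob controls Y at all times by its final
  value; the integral is controlled at all times by the integral Z of |Q|. The variance bound enters
  three times: for X at time S, and for Q in the second moment of Z both here and in that of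
  Y.\<close>

lemma fluctuation_uniform:
  fixes g :: "int^'d \<Rightarrow> real"
  assumes fin: "finite {x. g x \<noteq> 0}" and S: "0 < S" and \<epsilon>: "0 < \<epsilon>"
    and N: "N = (LSUM x. (g x)\<^sup>2) + S\<^sup>2 * (LSUM x. (A g x)\<^sup>2)"
  shows "\<exists>V\<in>sets M. (\<forall>w\<in>V. \<forall>t\<in>{0..S}. \<bar>X g t w\<bar> \<le> 2 * \<epsilon>) \<and> 1 - 6 * N / \<epsilon>\<^sup>2 \<le> measure M V"
proof -
  define P where "P = {x. g x \<noteq> 0}"
  have P: "finite P" unfolding P_def by (rule fin)
  have cs: "(LSUM x. g x * k x) = (\<Sum>x\<in>P. g x * k x)" for k
    by (subst lebesgue_integral_count_space_finite_support)
      (auto simp: P_def intro!: sum.mono_neutral_cong_left finite_subset[OF _ fin])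
  have g: "lsummable g"
  proof -
    have "lsummable (\<lambda>x. \<Sum>y\<in>P. if x = y then g x else 0)"
      by (intro Bochner_Integration.integrable_sum count_single(2))
    also have "(\<lambda>x. \<Sum>y\<in>P. if x = y then g x else 0) = g" using P by (auto simp: fun_eq_iff P_def)
    finally show ?thesis .
  qed
  have gb: "bnd (\<Sum>x\<in>P. \<bar>g x\<bar>) g"
    unfolding bnd_def
  proof
    fix x show "\<bar>g x\<bar> \<le> (\<Sum>x\<in>P. \<bar>g x\<bar>)"
      using member_le_sum[of x P "\<lambda>x. \<bar>g x\<bar>"] P by (cases "x \<in> P") (auto simp: P_def intro: sum_nonneg)
  qed
  have S0: "0 \<le> S" using S by simp
  define Q where "Q r w = (\<Sum>x\<in>P. g x * A (\<lambda>z. dl r z w) x)" for r w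
  \<comment> \<open>Summation by parts puts the generator on g. For a smooth profile seen at scale n
    this is of order n^(-\<alpha>), whereas the generator of the fluctuating field has no such
    smallness.\<close>
  have QX: "Q r w = X (A g) r w" if "0 \<le> r" for r w
    unfolding Q_def X_def cs[symmetric] by (rule gen_dual_count(1)[OF g gb dl_bnd[OF that]])
  have Ag: "lsummable (A g)" by (rule gen_dual_count(2)[OF g gb occ_bnd])
  have Agb: "bnd (2 * rate p * (\<Sum>x\<in>P. \<bar>g x\<bar>)) (A g)" by (rule gen_bnd[OF gb])
  define K where "K = (LSUM x. \<bar>A g x\<bar>)"
  have Qb: "\<bar>Q r w\<bar> \<le> K" if "r \<in> {0..S}" for r w using X_bound[OF Ag, of r w] QX that by (simp add: K_def)
  have Qm[measurable]: "(\<lambda>q. indicator {0..S} (fst q) * Q (fst q) (snd q)) \<in> borel_measurable (lborel \<Otimes>\<^sub>M M)"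
  proof -
    have [measurable]: "(\<lambda>q. A (\<lambda>z. dlS S (fst q) z (snd q)) x) \<in> borel_measurable (lborel \<Otimes>\<^sub>M M)" for x
      by (rule pair_id(1)[OF gen_dlS_joint[OF S0]])
    have "(\<lambda>q. indicator {0..S} (fst q) * Q (fst q) (snd q)) = (\<lambda>q. \<Sum>x\<in>P. g x * A (\<lambda>z. dlS S (fst q) z (snd q)) x)"
      by (simp add: Q_def sum_distrib_left gen_dlS mult.left_commute)
    then show ?thesis by simp
  qed
  have i2: "(\<lambda>q. indicator {0..S} (fst q) * \<bar>Q (fst q) (snd q)\<bar>) \<in> borel_measurable (lborel \<Otimes>\<^sub>M M)"
  proof -
    have "(\<lambda>q. \<bar>indicator {0..S} (fst q) * Q (fst q) (snd q)\<bar>) \<in> borel_measurable (lborel \<Otimes>\<^sub>M M)" using Qm by measurable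
    then show ?thesis by (simp add: abs_mult)
  qed
  have i3: "(\<lambda>q. indicator {0..S} (fst q) * (Q (fst q) (snd q))\<^sup>2) \<in> borel_measurable (lborel \<Otimes>\<^sub>M M)"
  proof -
    have "(\<lambda>q. (indicator {0..S} (fst q) * Q (fst q) (snd q)) * (indicator {0..S} (fst q) * Q (fst q) (snd q))) \<in> borel_measurable (lborel \<Otimes>\<^sub>M M)" using Qm by measurable
    moreover have "(indicator {0..S} r * Q r w) * (indicator {0..S} r * Q r w) = indicator {0..S} r * (Q r w)\<^sup>2" for r w
      by (auto simp: power2_eq_square split: split_indicator)
    ultimately show ?thesis by simp
  qed
  have Q2b: "\<bar>(Q r w)\<^sup>2\<bar> \<le> K\<^sup>2" if "r \<in> {0..S}" for r w using abs_le_square_iff[of "Q r w" K] Qb[OF that, of w] by auto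
  have Qi: "set_integrable lborel {0..S} (\<lambda>r. Q r w)" and Qai: "set_integrable lborel {0..S} (\<lambda>r. \<bar>Q r w\<bar>)" and Q2i: "set_integrable lborel {0..S} (\<lambda>r. (Q r w)\<^sup>2)"
    if w: "w \<in> space M" for w
  proof -
    show "set_integrable lborel {0..S} (\<lambda>r. Q r w)"
      by (rule time_integrable[OF _ Qb]) (use measurable_compose[OF measurable_Pair2'[OF w] Qm] in auto)
    show "set_integrable lborel {0..S} (\<lambda>r. \<bar>Q r w\<bar>)"
      by (rule time_integrable[where C=K]) (use Qb measurable_compose[OF measurable_Pair2'[OF w] i2] in auto)
    show "set_integrable lborel {0..S} (\<lambda>r. (Q r w)\<^sup>2)"
      by (rule time_integrable[where C="K\<^sup>2"]) (use Q2b measurable_compose[OF measurable_Pair2'[OF w] i3] in auto)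
  qed
  define Z where "Z w = (LBINT r:{0..S}. \<bar>Q r w\<bar>)" for w
  have Zm: "Z \<in> borel_measurable M"
    unfolding Z_def[abs_def] by (rule borel_measurable_integrable, rule time_fubini(3)[OF S0 i2, where C=K]) (use Qb in simp)
  note TF = time_fubini[OF S0 i3 Q2b]
  have Z0: "0 \<le> Z w" for w unfolding Z_def set_lebesgue_integral_def by (rule integral_nonnegL) simp
  have one: "(LBINT r:{0..S}. (k::real)) = k * S" "set_integrable lborel {0..S} (\<lambda>r. k)" for k :: real
    using S by (simp_all add: set_lebesgue_integral_def set_integrable_def)
  \<comment> \<open>Cauchy-Schwarz in time, obtained by expanding the integral of (|Q| - k)^2 with k
    the time average of |Q|.\<close>
  have CS: "(Z w)\<^sup>2 \<le> S * (LBINT r:{0..S}. (Q r w)\<^sup>2)" if w: "w \<in> space M" for w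
  proof -
    define k where "k = Z w / S"
    have "0 \<le> (LBINT r:{0..S}. (\<bar>Q r w\<bar> - k)\<^sup>2)" unfolding set_lebesgue_integral_def by (rule integral_nonnegL) simp
    also have "\<dots> = (LBINT r:{0..S}. (Q r w)\<^sup>2 - (2 * k) * \<bar>Q r w\<bar> + k\<^sup>2)"
      by (rule set_lebesgue_integral_cong) (auto simp: power2_diff)
    also have "\<dots> = (LBINT r:{0..S}. (Q r w)\<^sup>2) - (2 * k) * Z w + k\<^sup>2 * S"
      unfolding Z_def by (subst set_integral_add(2), use Q2i[OF w] Qai[OF w] one in simp, use one in simp,
          subst set_integral_diff(2), use Q2i[OF w] Qai[OF w] in simp_all) (simp add: one)
    also have "(2 * k) * Z w = 2 * ((Z w)\<^sup>2 / S)" by (simp add: k_def power2_eq_square)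
    also have "k\<^sup>2 * S = (Z w)\<^sup>2 / S" using S by (simp add: k_def power2_eq_square)
    finally have "(Z w)\<^sup>2 / S \<le> (LBINT r:{0..S}. (Q r w)\<^sup>2)" by linarith
    then show ?thesis using S by (simp add: divide_le_eq mult.commute)
  qed
  have Zb: "\<bar>(Z w)\<^sup>2\<bar> \<le> (K * S)\<^sup>2" if w: "w \<in> space M" for w
  proof -
    have "Z w \<le> (LBINT r:{0..S}. K)" unfolding Z_def by (rule set_integral_mono[OF Qai[OF w] one(2)]) (use Qb in auto)
    then show ?thesis using Z0[of w] by (auto simp: one power_mono)
  qed
  have Zi: "integrable M (\<lambda>w. (Z w)\<^sup>2)" by (rule integrable_bdd[OF _ Zb]) (use Zm in measurable)
  define G where "G = (LSUM x. (g x)\<^sup>2)"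
  define H where "H = (LSUM x. (A g x)\<^sup>2)"
  have GH: "0 \<le> G" "0 \<le> H" "N = G + S\<^sup>2 * H" by (simp_all add: G_def H_def N)
  have EZ: "(\<E> w. (Z w)\<^sup>2) \<le> 2 * (S\<^sup>2 * H)"
  proof -
    have "(\<E> w. (Z w)\<^sup>2) \<le> (\<E> w. S * (LBINT r:{0..S}. (Q r w)\<^sup>2))"
      by (rule integral_mono[OF Zi]) (use TF(3) CS in auto)
    also have "\<dots> = S * (LBINT r:{0..S}. \<E> w. (Q r w)\<^sup>2)" using TF(1) by simp
    also have "(LBINT r:{0..S}. \<E> w. (Q r w)\<^sup>2) \<le> (LBINT r:{0..S}. 2 * H)"
      by (rule set_integral_mono[OF TF(2) one(2)]) (use variance[OF Ag Agb] QX in \<open>auto simp: H_def\<close>)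
    finally show ?thesis using S by (simp add: one power2_eq_square mult_ac)
  qed
  define Y where "Y t w = (\<Sum>x\<in>P. g x * D x t w)" for t w
  have YX: "Y t w = X g t w - (LBINT r:{0..t}. Q r w)" if t: "0 \<le> t" and w: "w \<in> space M" for t w
  proof -
    have i: "set_integrable lborel {0..t} (\<lambda>r. g x * A (\<lambda>z. dl r z w) x)" for x
      using gen_path_integrable(2)[OF t w, of x] by simp
    have "(LBINT r:{0..t}. Q r w) = (\<Sum>x\<in>P. (LBINT r:{0..t}. g x * A (\<lambda>z. dl r z w) x))"
      unfolding Q_def set_lebesgue_integral_def scaleR_sum_right
      by (rule Bochner_Integration.integral_sum) (use i in \<open>simp add: set_integrable_def\<close>)
    also have "\<dots> = (\<Sum>x\<in>P. g x * (LBINT r:{0..t}. A (\<lambda>z. dl r z w) x))" by simp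
    finally show ?thesis unfolding Y_def X_def cs by (simp add: D_dl[OF t w] right_diff_distrib sum_subtractf)
  qed
  have QZ: "\<bar>LBINT r:{0..t}. Q r w\<bar> \<le> Z w" if t: "t \<in> {0..S}" and w: "w \<in> space M" for t w
  proof -
    have "\<bar>LBINT r:{0..t}. Q r w\<bar> \<le> (LBINT r. \<bar>indicator {0..t} r *\<^sub>R Q r w\<bar>)"
      unfolding set_lebesgue_integral_def by (rule integral_abs_bound)
    also have "\<dots> \<le> Z w"
      unfolding Z_def set_lebesgue_integral_def
    proof (rule integral_mono)
      have "set_integrable lborel {0..t} (\<lambda>r. Q r w)" by (rule set_integrable_subset[OF Qi[OF w]]) (use t in auto)
      then show "integrable lborel (\<lambda>r. \<bar>indicator {0..t} r *\<^sub>R Q r w\<bar>)" unfolding set_integrable_def by (rule integrable_abs)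
    qed (use Qai[OF w] t in \<open>auto simp: set_integrable_def split: split_indicator\<close>)
    finally show ?thesis .
  qed
  have XM2: "integrable M (\<lambda>w. (X g S w)\<^sup>2)" by (rule X_sq_integrable[OF g S0])
  have sSS: "S \<in> {0..S}" using S by simp
  define B where "B = (\<Sum>x\<in>P. \<bar>g x\<bar> * (1 + 2 * rate p * S))"
  have Yb: "\<bar>Y s w\<bar> \<le> B" if "s \<in> {0..S}" "w \<in> space M" for s w
  proof -
    have "\<bar>g x * D x s w\<bar> \<le> \<bar>g x\<bar> * (1 + 2 * rate p * S)" for x
    proof -
      have "\<bar>D x s w\<bar> \<le> 1 + 2 * rate p * s" using D_bound that by simp
      also have "\<dots> \<le> 1 + 2 * rate p * S" using that rate_nonneg by (simp add: mult_left_mono)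
      finally show ?thesis by (simp add: abs_mult mult_left_mono)
    qed
    then show ?thesis unfolding Y_def B_def by (rule order_trans[OF sum_abs sum_mono])
  qed
  have YF: "Y s \<in> borel_measurable (F s)" if "s \<in> {0..S}" for s
    unfolding Y_def[abs_def] by (intro borel_measurable_sum borel_measurable_times borel_measurable_const D_F) (use that in simp)
  have YM: "Y s \<in> borel_measurable M" if "s \<in> {0..S}" for s using measurable_compose[OF F_sub YF[OF that]] by simp
  have EY: "(\<E> w. (Y S w)\<^sup>2) \<le> 4 * N"
  proof -
    have "(\<E> w. (Y S w)\<^sup>2) \<le> (\<E> w. 2 * (X g S w)\<^sup>2 + 2 * (Z w)\<^sup>2)"
    proof (rule integral_mono)
      have "(Y S w)\<^sup>2 \<le> B\<^sup>2" if "w \<in> space M" for w using abs_le_square_iff[of "Y S w" B] Yb[OF sSS that] by auto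
      then show "integrable M (\<lambda>w. (Y S w)\<^sup>2)" by (intro integrable_bdd[where D="B\<^sup>2"]) (use YM[OF sSS] in auto)
      fix w assume w: "w \<in> space M"
      have "(LBINT r:{0..S}. Q r w)\<^sup>2 \<le> (Z w)\<^sup>2" using abs_le_square_iff[of "LBINT r:{0..S}. Q r w" "Z w"] QZ[OF sSS w] Z0[of w] by simp
      then show "(Y S w)\<^sup>2 \<le> 2 * (X g S w)\<^sup>2 + 2 * (Z w)\<^sup>2"
        unfolding YX[OF S0 w] using square_diff_le[of "X g S w" "LBINT r:{0..S}. Q r w"] by linarith
    qed (use XM2 Zi in auto)
    also have "\<dots> = 2 * (\<E> w. (X g S w)\<^sup>2) + 2 * (\<E> w. (Z w)\<^sup>2)" using XM2 Zi by simp
    also have "\<dots> \<le> 4 * N" using EZ variance[OF g gb S0] GH unfolding G_def[symmetric] by linarith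
    finally show ?thesis .
  qed
  have "\<exists>V\<in>sets M. (\<forall>w\<in>V. \<forall>t\<in>{0..S}. \<bar>Y t w\<bar> \<le> \<epsilon>) \<and> 1 - (\<E> w. (Y S w)\<^sup>2) / \<epsilon>\<^sup>2 \<le> measure M V"
  proof (rule maximal_inequality[where F=F and B=B, OF S F_sub F_mono space_F YF Yb _ _ \<epsilon>])
    fix s and W :: "'w \<Rightarrow> real" assume s: "s \<in> {0..S}" and W: "W \<in> borel_measurable (F s)" "bounded (W ` space M)"
    have [measurable]: "W \<in> borel_measurable M" using measurable_compose[OF F_sub W(1)] by simp
    obtain B' where w: "\<And>w. w \<in> space M \<Longrightarrow> \<bar>W w\<bar> \<le> B'" using W(2) unfolding bounded_iff by auto
    have i: "integrable M (\<lambda>w. (D x S w - D x s w) * W w)" for x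
    proof (rule integrable_bdd)
      have [measurable]: "(\<lambda>w. D x r w) \<in> borel_measurable M" if "0 \<le> r" for r using measurable_compose[OF F_sub D_F[OF that]] by simp
      show "(\<lambda>w. (D x S w - D x s w) * W w) \<in> borel_measurable M" using s S0 by simp
      fix w assume o: "w \<in> space M"
      have "\<bar>D x S w - D x s w\<bar> \<le> (1 + 2 * rate p * S) + (1 + 2 * rate p * s)" using D_bound[of S w x] D_bound[of s w x] s S0 o by (simp add: abs_le_iff)
      then show "\<bar>(D x S w - D x s w) * W w\<bar> \<le> ((1 + 2 * rate p * S) + (1 + 2 * rate p * s)) * B'"
        unfolding abs_mult by (rule mult_mono[OF _ w[OF o]]) (use s S0 rate_nonneg in auto)
    qed
    have "(Y S w - Y s w) * W w = (\<Sum>x\<in>P. g x * ((D x S w - D x s w) * W w))" for w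
      unfolding Y_def by (simp add: sum_subtractf[symmetric] sum_distrib_right left_diff_distrib right_diff_distrib mult.assoc)
    then have "(\<E> w. (Y S w - Y s w) * W w) = (\<Sum>x\<in>P. g x * (\<E> w. (D x S w - D x s w) * W w))" using i by simp
    also have "\<dots> = 0" using D_mart[OF _ _ W] s by simp
    finally show "(\<E> w. (Y S w - Y s w) * W w) = 0" .
  next
    fix w t e assume w: "w \<in> space M" and t: "t \<in> {0..<S}" and e: "0 < (e::real)"
    define e' where "e' = e / ((\<Sum>x\<in>P. \<bar>g x\<bar>) + 1)"
    have G1: "0 < (\<Sum>x\<in>P. \<bar>g x\<bar>) + 1" by (intro add_nonneg_pos sum_nonneg) auto
    have "0 < e'" using e G1 by (simp add: e'_def)
    then have "\<forall>x. \<exists>\<delta>>0. \<forall>s. t \<le> s \<and> s < t + \<delta> \<longrightarrow> \<bar>D x s w - D x t w\<bar> < e'" using D_right_cont[OF _ w] t by simp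
    then obtain \<delta> where \<delta>: "\<And>x. 0 < \<delta> x" "\<And>x s. t \<le> s \<Longrightarrow> s < t + \<delta> x \<Longrightarrow> \<bar>D x s w - D x t w\<bar> < e'" by metis
    define d where "d = Min (insert 1 (\<delta> ` P))"
    have d: "0 < d" "\<And>x. x \<in> P \<Longrightarrow> d \<le> \<delta> x" using P \<delta>(1) by (auto simp: d_def)
    have "\<bar>Y s w - Y t w\<bar> < e" if s: "t \<le> s" "s < t + d" for s
    proof -
      have "\<bar>Y s w - Y t w\<bar> = \<bar>\<Sum>x\<in>P. g x * (D x s w - D x t w)\<bar>" unfolding Y_def by (simp add: sum_subtractf right_diff_distrib)
      also have "\<dots> \<le> (\<Sum>x\<in>P. \<bar>g x\<bar> * e')"
      proof (rule order_trans[OF sum_abs sum_mono])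
        fix x assume "x \<in> P"
        then have "\<bar>D x s w - D x t w\<bar> < e'" using \<delta>(2)[of s x] d(2)[of x] s by simp
        then show "\<bar>g x * (D x s w - D x t w)\<bar> \<le> \<bar>g x\<bar> * e'" by (simp add: abs_mult mult_left_mono)
      qed
      also have "\<dots> = (\<Sum>x\<in>P. \<bar>g x\<bar>) * e'" by (simp add: sum_distrib_right)
      also have "\<dots> < ((\<Sum>x\<in>P. \<bar>g x\<bar>) + 1) * e'" using \<open>0 < e'\<close> by simp
      also have "\<dots> = e" using G1 by (simp add: e'_def)
      finally show ?thesis .
    qed
    then show "\<exists>\<delta>>0. \<forall>s. t \<le> s \<and> s < t + \<delta> \<and> s \<le> S \<longrightarrow> \<bar>Y s w - Y t w\<bar> < e" using d(1) by blast
  qed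
  then obtain V where V: "V \<in> sets M" "\<And>w t. w \<in> V \<Longrightarrow> t \<in> {0..S} \<Longrightarrow> \<bar>Y t w\<bar> \<le> \<epsilon>" "1 - (\<E> w. (Y S w)\<^sup>2) / \<epsilon>\<^sup>2 \<le> measure M V" by blast
  \<comment> \<open>The exceptional set for the time integral. Markov costs 2 N over \<epsilon>
    squared here and Doob costs 4 N for Y; together they give the constant 6.\<close>
  define U where "U = {w \<in> space M. \<epsilon>\<^sup>2 \<le> (Z w)\<^sup>2}"
  have U: "U \<in> sets M" unfolding U_def using Zm by measurable
  have e2: "0 < \<epsilon>\<^sup>2" using \<epsilon> by simp
  have "measure M U \<le> (\<E> w. (Z w)\<^sup>2) / \<epsilon>\<^sup>2"
    unfolding U_def by (rule integral_Markov_inequality_measure[OF Zi sets.empty_sets _ e2]) auto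
  also have "\<dots> \<le> 2 * N / \<epsilon>\<^sup>2" using EZ GH by (intro divide_right_mono) auto
  finally have mU: "measure M U \<le> 2 * N / \<epsilon>\<^sup>2" .
  have "(\<E> w. (Y S w)\<^sup>2) / \<epsilon>\<^sup>2 \<le> 4 * N / \<epsilon>\<^sup>2" using EY by (intro divide_right_mono) auto
  then have mV: "1 - 4 * N / \<epsilon>\<^sup>2 \<le> measure M V" using V(3) by linarith
  have "measure M V \<le> measure M (V - U) + measure M U"
    by (rule order_trans[OF finite_measure_mono measure_Un_le]) (use V(1) U in auto)
  moreover have "6 * N / \<epsilon>\<^sup>2 = 4 * N / \<epsilon>\<^sup>2 + 2 * N / \<epsilon>\<^sup>2" by (simp add: add_divide_distrib[symmetric])
  ultimately have "1 - 6 * N / \<epsilon>\<^sup>2 \<le> measure M (V - U)" using mU mV by linarith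
  moreover have "\<bar>X g t w\<bar> \<le> 2 * \<epsilon>" if w: "w \<in> V - U" and t: "t \<in> {0..S}" for w t
  proof -
    have ws: "w \<in> space M" using w V(1) sets.sets_into_space by auto
    have "Z w < \<epsilon>" using w ws Z0[of w] \<epsilon> by (auto simp: U_def not_le intro: power2_less_imp_less)
    then show ?thesis using V(2)[of w t] QZ[OF t ws] YX[of t w] w t ws by simp
  qed
  ultimately show ?thesis using V(1) U by (intro bexI[of _ "V - U"]) auto
qed

end

section \<open>The hydrodynamic limit\<close>

lemma integral_diff_le:
  fixes f g k :: "'a \<Rightarrow> real"
  assumes "integrable N f" "integrable N g" "integrable N k" "\<And>x. \<bar>f x - g x\<bar> \<le> k x"
  shows "\<bar>(\<integral>x. f x \<partial>N) - (\<integral>x. g x \<partial>N)\<bar> \<le> (\<integral>x. k x \<partial>N)"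
  using integral_abs_bound[of N "\<lambda>x. f x - g x"] integral_mono[of N "\<lambda>x. \<bar>f x - g x\<bar>" k] assms
  by (simp del: integral_abs_bound)

text \<open>Inner probability tending to one: events with uncountably many times need not be
  measurable, so measurable subsets witness them.\<close>

definition whp :: "(nat \<Rightarrow> 'w measure) \<Rightarrow> (nat \<Rightarrow> 'w \<Rightarrow> bool) \<Rightarrow> bool" where
  "whp M P \<longleftrightarrow> (\<exists>A. (\<forall>n. A n \<in> sets (M n) \<and> (\<forall>w\<in>A n. P n w)) \<and> (\<lambda>n. measure (M n) (A n)) \<longlonglongrightarrow> 1)"

text \<open>Finitely many indices do not affect the limit; the witnessing sets are emptied before
  N.\<close>

lemma whp_mono:
  assumes "whp M P" "\<And>n w. N \<le> n \<Longrightarrow> w \<in> space (M n) \<Longrightarrow> P n w \<Longrightarrow> Q n w"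
  shows "whp M Q"
proof -
  obtain A where A: "\<And>n. A n \<in> sets (M n)" "\<And>n w. w \<in> A n \<Longrightarrow> P n w" "(\<lambda>n. measure (M n) (A n)) \<longlonglongrightarrow> 1"
    using assms(1) unfolding whp_def by blast
  define B where "B n = (if N \<le> n then A n else {})" for n
  have "(\<lambda>n. measure (M n) (B n)) \<longlonglongrightarrow> 1"
    by (rule Lim_transform_eventually[OF A(3)]) (auto simp: B_def intro: eventually_sequentiallyI[of N])
  moreover have "B n \<in> sets (M n) \<and> (\<forall>w\<in>B n. Q n w)" for n
    using A(1)[of n] A(2) assms(2) sets.sets_into_space[OF A(1)[of n]] by (auto simp: B_def)
  ultimately show ?thesis unfolding whp_def by blast
qed

lemma whp_conj:
  assumes M: "\<And>n. prob_space (M n)" and P: "whp M P" and Q: "whp M Q"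
  shows "whp M (\<lambda>n w. P n w \<and> Q n w)"
proof -
  obtain A where A: "\<And>n. A n \<in> sets (M n)" "\<And>n w. w \<in> A n \<Longrightarrow> P n w" "(\<lambda>n. measure (M n) (A n)) \<longlonglongrightarrow> 1"
    using P unfolding whp_def by blast
  obtain B where B: "\<And>n. B n \<in> sets (M n)" "\<And>n w. w \<in> B n \<Longrightarrow> Q n w" "(\<lambda>n. measure (M n) (B n)) \<longlonglongrightarrow> 1"
    using Q unfolding whp_def by blast
  have "(\<lambda>n. measure (M n) (A n \<inter> B n)) \<longlonglongrightarrow> 1"
  proof (rule tendsto_sandwich[of "\<lambda>n. measure (M n) (A n) + measure (M n) (B n) - 1" _ _ "\<lambda>n. 1"])
    show "\<forall>\<^sub>F n in sequentially. measure (M n) (A n) + measure (M n) (B n) - 1 \<le> measure (M n) (A n \<inter> B n)"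
    proof (intro always_eventually allI)
      fix n
      interpret prob_space "M n" by (rule M)
      have "prob (A n \<union> B n) = prob (A n) + prob (B n - A n)"
        using finite_measure_Union[of "A n" "B n - A n"] A(1) B(1) by (auto simp: Un_Diff_cancel)
      moreover have "prob (B n - A n) = prob (B n) - prob (A n \<inter> B n)"
        using finite_measure_Diff'[OF B(1)[of n] A(1)[of n]] by (simp add: Int_commute)
      ultimately show "prob (A n) + prob (B n) - 1 \<le> prob (A n \<inter> B n)" using prob_le_1[of "A n \<union> B n"] by linarith
    qed
    show "\<forall>\<^sub>F n in sequentially. measure (M n) (A n \<inter> B n) \<le> 1" by (intro always_eventually allI prob_space.prob_le_1[OF M])
    show "(\<lambda>n. measure (M n) (A n) + measure (M n) (B n) - 1) \<longlonglongrightarrow> 1"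
      using tendsto_diff[OF tendsto_add[OF A(3) B(3)] tendsto_const[of 1]] by simp
  qed simp
  then show ?thesis unfolding whp_def using A B by (intro exI[of _ "\<lambda>n. A n \<inter> B n"]) auto
qed

lemma whp_finite_ball:
  assumes M: "\<And>n. prob_space (M n)" and "finite I" "\<And>i. i \<in> I \<Longrightarrow> whp M (P i)"
  shows "whp M (\<lambda>n w. \<forall>i\<in>I. P i n w)"
  using assms(2,3)
proof (induction I rule: finite_induct)
  case empty
  show ?case unfolding whp_def by (rule exI[of _ "\<lambda>n. space (M n)"]) (simp add: prob_space.prob_space[OF M])
next
  case (insert i I)
  then have "whp M (\<lambda>n w. P i n w \<and> (\<forall>i\<in>I. P i n w))" by (intro whp_conj[OF M]) auto
  then show ?case by simp
qed

section \<open>Empirical pairings, cutoffs and fluctuations of the rescaled process\<close>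

context stable
begin

definition cst :: "real \<Rightarrow> real" where "cst r = (1 + r) powr (real CARD('d) + \<alpha>) * Cw"

lemma Cw_nonneg: "0 \<le> Cw"
  unfolding Cw_def using wt_pos by (intro mult_nonneg_nonneg integral_nonnegL) (auto intro: less_imp_le)

lemma cst_nonneg: "0 \<le> cst r" unfolding cst_def using Cw_nonneg by simp

lemma supp_lattice:
  fixes F :: "real^'d \<Rightarrow> real"
  assumes F: "bnd C F" "\<And>x. r < norm x \<Longrightarrow> F x = 0" "0 \<le> r" and n: "0 < n"
  shows "lsummable (\<lambda>z. F (shiftn n z))" (is ?g1)
    and "(LSUM z. \<bar>F (shiftn n z)\<bar>) \<le> real n ^ CARD('d) * (C * cst r)" (is ?g2)
proof -
  define K where "K = C * (1 + r) powr (real CARD('d) + \<alpha>)"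
  have K: "\<bar>F x\<bar> \<le> K * wt x" for x unfolding K_def by (rule compact_le_wt[OF F])
  have K0: "0 \<le> K" unfolding K_def using bnd_nonneg[OF F(1)] by simp
  show i: ?g1
  proof (rule integrable_boundL)
    show "lsummable (\<lambda>z. K * wt (shiftn n z))" using wt_lattice(1)[OF n] by simp
    show "AE z in count_space UNIV. norm (F (shiftn n z)) \<le> norm (K * wt (shiftn n z))"
      using K K0 less_imp_le[OF wt_pos] by (intro AE_I2) (simp add: abs_mult)
  qed simp
  have "(LSUM z. \<bar>F (shiftn n z)\<bar>) \<le> (LSUM z. K * wt (shiftn n z))"
    by (rule integral_mono[OF integrable_abs[OF i]]) (use wt_lattice(1)[OF n] K in auto)
  also have "\<dots> = K * (LSUM z. wt (shiftn n z))" by simp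
  also have "\<dots> \<le> K * (real n ^ CARD('d) * Cw)" by (rule mult_left_mono[OF wt_lattice(2)[OF n] K0])
  finally show ?g2
    by (simp add: K_def cst_def mult_ac)
qed

lemma emp_integral:
  fixes f :: "real^'d \<Rightarrow> real"
  assumes f: "lsummable (\<lambda>z. f (shiftn n z))"
  shows "lsummable (\<lambda>z. occ \<xi> z * f (shiftn n z))" (is ?g1)
    and "emp n \<xi> f = (LSUM z. occ \<xi> z * f (shiftn n z)) / real n ^ CARD('d)" (is ?g2)
proof -
  show i: ?g1
    by (rule integrable_boundL[OF f]) (auto intro!: AE_I2)
  show ?g2
    using infsumI[OF has_sum_count_space[OF i]] by (simp add: emp_def shiftn_def)
qed

lemma emp_diff_le:
  fixes f g :: "real^'d \<Rightarrow> real"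
  assumes f: "lsummable (\<lambda>z. f (shiftn n z))" and g: "lsummable (\<lambda>z. g (shiftn n z))"
    and n: "0 < n" and le: "(LSUM z. \<bar>f (shiftn n z) - g (shiftn n z)\<bar>) \<le> real n ^ CARD('d) * B"
  shows "\<bar>emp n \<xi> f - emp n \<xi> g\<bar> \<le> B"
proof -
  have n0: "0 < real n ^ CARD('d)" using n by simp
  have i: "lsummable (\<lambda>z. occ \<xi> z * (f (shiftn n z) - g (shiftn n z)))"
    using emp_integral(1)[OF f, of \<xi>] emp_integral(1)[OF g, of \<xi>] by (simp add: right_diff_distrib)
  have "emp n \<xi> f - emp n \<xi> g = (LSUM z. occ \<xi> z * (f (shiftn n z) - g (shiftn n z))) / real n ^ CARD('d)"
    unfolding emp_integral(2)[OF f] emp_integral(2)[OF g] right_diff_distrib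
    by (subst integral_diffL[OF emp_integral(1)[OF f] emp_integral(1)[OF g]]) (simp add: diff_divide_distrib)
  moreover have "\<bar>LSUM z. occ \<xi> z * (f (shiftn n z) - g (shiftn n z))\<bar> \<le> real n ^ CARD('d) * B"
  proof -
    have "\<bar>LSUM z. occ \<xi> z * (f (shiftn n z) - g (shiftn n z))\<bar> \<le> (LSUM z. \<bar>occ \<xi> z * (f (shiftn n z) - g (shiftn n z))\<bar>)"
      by (rule integral_abs_bound)
    also have "\<dots> \<le> (LSUM z. \<bar>f (shiftn n z) - g (shiftn n z)\<bar>)"
      by (rule integral_mono[OF integrable_abs[OF i]]) (use f g in auto)
    finally show ?thesis using le by linarith
  qed
  ultimately show ?thesis using n0 by (simp add: divide_le_eq mult.commute)
qed

text \<open>Continuous, 1 up to radius R and 0 beyond 2 R. It makes evolved test functions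
  admissible in \<open>associated\<close>, and what it removes is at most twice
  \<open>psi R\<close>.\<close>

definition chi :: "real \<Rightarrow> real^'d \<Rightarrow> real" where "chi R x = max 0 (min 1 (2 - norm x / R))"

lemma chi_range: "0 \<le> chi R x" "chi R x \<le> 1" by (auto simp: chi_def)

lemma chi_supp: "0 < R \<Longrightarrow> 2 * R < norm x \<Longrightarrow> chi R x = 0"
  by (simp add: chi_def field_simps max_def min_def)

lemma chi_cont: "continuous_on UNIV (chi R)"
  unfolding chi_def[abs_def] divide_inverse by (intro continuous_intros)

lemma chi_psi: "0 < R \<Longrightarrow> \<bar>1 - chi R x\<bar> \<le> 2 * psi R x"
proof (cases "norm x \<le> R")
  case True
  assume "0 < R"
  then have "chi R x = 1" using True by (simp add: chi_def field_simps)
  then show ?thesis using psi_range(1)[of R x] by simp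
next
  case False
  assume "0 < R"
  then have "1 / 2 \<le> psi R x" using False by (intro psi_ge) auto
  then show ?thesis using chi_range[of R x] by simp
qed

lemma nice_abs:
  assumes "nice r C F"
  shows "bnd C F" "bnd C (\<lambda>x. \<bar>F x\<bar>)" "\<And>x. r < norm x \<Longrightarrow> F x = 0" "0 \<le> r" "0 \<le> C"
  using assms bnd_nonneg[of C F] by (auto simp: nice_def bnd_def)

text \<open>The evolved test function need not have compact support; occupation numbers are at most
  1, so the tail bound of the walk controls the removed part for every configuration.\<close>

lemma cut_lattice:
  assumes F: "nice r C F" and n: "0 < n" and R: "1 \<le> R" and t: "0 \<le> t" "t \<le> T"
  shows "\<bar>emp n \<xi> (sn n t F) - emp n \<xi> (\<lambda>x. chi R x * sn n t F x)\<bar> \<le> 2 * tl R r T * (C * cst r)" (is ?g1)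
    and "lsummable (\<lambda>z. sn n t F (shiftn n z))" (is ?g2)
    and "lsummable (\<lambda>z. chi R (shiftn n z) * sn n t F (shiftn n z))" (is ?g3)
proof -
  interpret w: walk "pn n" by (rule pn_walk)
  note N = nice_abs[OF F]
  have iF: "lsummable (\<lambda>z. \<bar>F (shiftn n z)\<bar>)" by (rule integrable_abs[OF supp_lattice(1)[OF N(1,3,4) n]])
  note TL = tail_lattice[OF n R t iF N(2), of r]
  have ab: "\<bar>sn n t F x\<bar> \<le> sn n t (\<lambda>x. \<bar>F x\<bar>) x" for x by (rule w.semi_abs[OF N(1) t(1)])
  have i0: "lsummable (\<lambda>z. sn n t (\<lambda>x. \<bar>F x\<bar>) (shiftn n z))" by (rule TL(3)) (use N in auto)
  show i1: ?g2
    by (rule integrable_boundL[OF i0])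
      (simp, rule AE_I2, unfold real_norm_def, rule order_trans[OF ab abs_ge_self])
  show i2: ?g3
    by (rule integrable_boundL[OF i1]) (use chi_range in \<open>auto intro!: AE_I2 mult_left_le_one_le simp: abs_mult\<close>)
  have "\<bar>sn n t F x - chi R x * sn n t F x\<bar> \<le> 2 * (sn n t (\<lambda>x. \<bar>F x\<bar>) x * psi R x)" for x
  proof -
    have "\<bar>sn n t F x - chi R x * sn n t F x\<bar> = \<bar>1 - chi R x\<bar> * \<bar>sn n t F x\<bar>" by (simp add: abs_mult[symmetric] left_diff_distrib)
    also have "\<dots> \<le> (2 * psi R x) * sn n t (\<lambda>x. \<bar>F x\<bar>) x" by (rule mult_mono[OF chi_psi ab]) (use R psi_range(1)[of R x] in auto)
    finally show ?thesis by (simp add: mult_ac)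
  qed
  then have "(LSUM z. \<bar>sn n t F (shiftn n z) - chi R (shiftn n z) * sn n t F (shiftn n z)\<bar>)
      \<le> (LSUM z. 2 * (sn n t (\<lambda>x. \<bar>F x\<bar>) (shiftn n z) * psi R (shiftn n z)))"
    using i1 i2 TL(2) N(3) by (intro integral_mono integrable_abs) auto
  also have "\<dots> = 2 * (LSUM z. sn n t (\<lambda>x. \<bar>F x\<bar>) (shiftn n z) * psi R (shiftn n z))" by simp
  also have "\<dots> \<le> 2 * (tl R r T * (LSUM z. \<bar>F (shiftn n z)\<bar>))" using TL(1) N(3) by simp
  also have "\<dots> \<le> 2 * (tl R r T * (real n ^ CARD('d) * (C * cst r)))"
    using t by (intro mult_left_mono supp_lattice(2)[OF N(1,3,4) n] tl_nonneg) auto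
  finally have "(LSUM z. \<bar>sn n t F (shiftn n z) - chi R (shiftn n z) * sn n t F (shiftn n z)\<bar>) \<le> real n ^ CARD('d) * (2 * tl R r T * (C * cst r))"
    by (simp add: mult_ac)
  then show ?g1
    by (rule emp_diff_le[where f="sn n t F" and g="\<lambda>x. chi R x * sn n t F x", OF i1 i2 n])
qed

text \<open>The semigroup commutes with translations and is a contraction, so it preserves the
  Lipschitz constant of F.\<close>

lemma sn_cont:
  assumes F: "nice r C F" and t: "0 \<le> t"
  shows "continuous_on UNIV (sn n t F)"
proof -
  interpret w: walk "pn n" by (rule pn_walk)
  note N = nice_abs[OF F]
  have "\<bar>sn n t F y - sn n t F x\<bar> \<le> C * norm (y - x)" for x y
  proof -
    define G where "G z = F (z + (y - x))" for z
    have Gb: "bnd C G" using N(1) by (auto simp: G_def bnd_def)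
    have "sn n t G x = sn n t F (x + (y - x))" unfolding G_def by (rule semi_factor) (simp add: algebra_simps)
    moreover have "sn n t (\<lambda>z. G z - F z) x = sn n t G x - sn n t F x" by (rule w.semi_diff[OF Gb N(1)])
    moreover have "bnd (C * norm (y - x)) (\<lambda>z. G z - F z)" unfolding bnd_def
    proof
      fix z have "\<bar>F (z + (y - x)) - F z\<bar> \<le> C * norm ((z + (y - x)) - z)" using F unfolding nice_def by blast
      then show "\<bar>G z - F z\<bar> \<le> C * norm (y - x)" by (simp add: G_def)
    qed
    ultimately show ?thesis using bndD[OF w.semi_bnd[OF _ t], of "C * norm (y - x)" "\<lambda>z. G z - F z" "shiftn n" x] by simp
  qed
  then have "C-lipschitz_on UNIV (sn n t F)" by (intro lipschitz_onI) (auto simp: dist_norm N(5))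
  then show ?thesis by (rule lipschitz_on_continuous_on)
qed

text \<open>Association holds for one function at a time, so the family over all large n and all t
  is covered by finitely many functions, all at a single index m. The freedom to take m beyond
  \<open>m0\<close> lets the same index be close to the macroscopic limit, and the second bound
  allows a return from s to t on the integral side.\<close>

lemma sn_grid:
  assumes F: "nice r C F" and \<delta>: "0 < \<delta>" and T: "0 < T"
  shows "\<exists>m\<ge>m0. 0 < m \<and> (\<exists>Ts N. finite Ts \<and> Ts \<subseteq> {0..T} \<and> 0 < N \<and> (\<forall>n\<ge>N. \<forall>t\<in>{0..T}. \<exists>s\<in>Ts. \<forall>x.
     \<bar>sn n t F x - sn m s F x\<bar> \<le> \<delta> \<and> \<bar>sn m t F x - sn m s F x\<bar> \<le> \<delta>))"
proof -
  note N = nice_abs[OF F]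
  obtain e where e: "e \<longlonglongrightarrow> 0" "\<And>n x. 0 < n \<Longrightarrow> \<bar>gn n F x - frac_gen h F x\<bar> \<le> e n" using gn_tendsto[OF F] by blast
  \<comment> \<open>Two indices contribute \<delta>' each to the difference of generators; over time
    T this is \<delta>/2, which leaves \<delta>/2 for the time grid.\<close>
  define \<delta>' where "\<delta>' = \<delta> / (4 * T)"
  have \<delta>': "0 < \<delta>'" using \<delta> T by (simp add: \<delta>'_def)
  have "\<forall>\<^sub>F n in sequentially. e n < \<delta>'" by (rule order_tendstoD(2)[OF e(1) \<delta>'])
  then obtain N1 where N1: "\<And>n. N1 \<le> n \<Longrightarrow> e n < \<delta>'" by (auto simp: eventually_sequentially)
  define m where "m = max m0 (Suc N1)"
  have m: "m0 \<le> m" "0 < m" "N1 \<le> m" by (auto simp: m_def)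
  interpret w: walk "pn m" by (rule pn_walk)
  define L where "L = 4 * C * C0"
  have L0: "0 \<le> L" using N(5) C0_nonneg by (simp add: L_def)
  obtain K :: nat where K: "L * T / (\<delta> / 2) < real K" using reals_Archimedean2 by blast
  define K' where "K' = Suc K"
  have K': "L * (T / real K') \<le> \<delta> / 2"
  proof -
    have "L * T < real K' * (\<delta> / 2)" using K \<delta> by (simp add: K'_def field_simps)
    then show ?thesis using \<delta> by (simp add: K'_def field_simps)
  qed
  have lip: "\<bar>sn m t F x - sn m s F x\<bar> \<le> L * (t - s)" if "0 \<le> s" "s \<le> t" for s t x
    unfolding L_def by (rule w.semi_time_lipschitz[OF N(1) nice_gn_bnd[OF m(2) F] that])
  define Ts where "Ts = (\<lambda>k. real k * T / real K') ` {..K'}"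
  have "\<exists>s\<in>Ts. \<forall>x. \<bar>sn n t F x - sn m s F x\<bar> \<le> \<delta> \<and> \<bar>sn m t F x - sn m s F x\<bar> \<le> \<delta>"
    if n: "Suc N1 \<le> n" and t: "t \<in> {0..T}" for n t
  proof -
    define k where "k = nat \<lfloor>t * real K' / T\<rfloor>"
    define s where "s = real k * T / real K'"
    have fl: "real k \<le> t * real K' / T" "t * real K' / T < real k + 1"
      using t T by (auto simp: k_def)
    have kK: "k \<le> K'"
    proof -
      have "real k * T \<le> t * real K'" using fl(1) T by (simp add: le_divide_eq)
      also have "\<dots> \<le> T * real K'" using t by (intro mult_right_mono) auto
      finally show ?thesis using T by (simp add: mult.commute)
    qed
    have Kp: "0 < real K'" by (simp add: K'_def)
    have s: "0 \<le> s" "s \<le> t" "t - s \<le> T / real K'"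
    proof -
      have "t * real K' < (real k + 1) * T" "real k * T \<le> t * real K'" using fl T by (simp_all add: divide_less_eq le_divide_eq)
      then have "t < (real k + 1) * T / real K'" "s \<le> t" using Kp by (simp_all add: s_def less_divide_eq divide_le_eq)
      then show "0 \<le> s" "s \<le> t" "t - s \<le> T / real K'" using T by (auto simp: s_def distrib_right add_divide_distrib)
    qed
    have a: "\<bar>sn m t F x - sn m s F x\<bar> \<le> \<delta> / 2" for x
      using lip[OF s(1,2), of x] mult_left_mono[OF s(3) L0] K' by linarith
    have bb: "bnd (2 * \<delta>') (\<lambda>x. gn n F x - gn m F x)" unfolding bnd_def
    proof
      fix x show "\<bar>gn n F x - gn m F x\<bar> \<le> 2 * \<delta>'"
        using e(2)[of n x] e(2)[of m x] N1[of n] N1[of m] n m by linarith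
    qed
    have a': "\<bar>sn n t F x - sn m t F x\<bar> \<le> \<delta> / 2" for x
    proof -
      have "\<bar>sn n t F x - sn m t F x\<bar> \<le> 2 * \<delta>' * t" using semi_compare[OF pn_walk pn_walk N(1) bb] t by simp
      also have "\<dots> \<le> 2 * \<delta>' * T" using t \<delta>' by (intro mult_left_mono) auto
      also have "\<dots> = \<delta> / 2" using T by (simp add: \<delta>'_def)
      finally show ?thesis .
    qed
    have "\<bar>sn n t F x - sn m s F x\<bar> \<le> \<delta> \<and> \<bar>sn m t F x - sn m s F x\<bar> \<le> \<delta>" for x
      using a[of x] a'[of x] \<delta> by (intro conjI) linarith+
    moreover have "s \<in> Ts" using kK by (auto simp: Ts_def s_def)
    ultimately show ?thesis by blast
  qed
  moreover have "finite Ts" by (simp add: Ts_def)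
  moreover have "Ts \<subseteq> {0..T}" 
  proof -
    have "real k * T / real K' \<le> T" if "k \<le> K'" for k
      using mult_right_mono[of "real k" "real K'" T] that T by (simp add: K'_def divide_le_eq mult.commute del: of_nat_Suc)
    then show ?thesis using T by (auto simp: Ts_def)
  qed
  ultimately show ?thesis using m by (intro exI[of _ m] conjI exI[of _ Ts] exI[of _ "Suc N1"]) auto
qed

lemma wt_square_lattice:
  assumes n: "0 < n" and B: "0 \<le> B" "\<And>x. \<bar>k x\<bar> \<le> B * wt x"
  shows "(LSUM z. (k (shiftn n z))\<^sup>2) \<le> B\<^sup>2 * (real n ^ CARD('d) * Cw)"
proof -
  have le: "(k x)\<^sup>2 \<le> B\<^sup>2 * wt x" for x
  proof -
    have "(k x)\<^sup>2 \<le> (B * wt x)\<^sup>2" using B(2)[of x] by (simp add: abs_le_square_iff[symmetric])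
    also have "\<dots> = B\<^sup>2 * (wt x * wt x)" by (simp add: power2_eq_square mult_ac)
    also have "\<dots> \<le> B\<^sup>2 * wt x" using wt_le1[of x] less_imp_le[OF wt_pos[of x]] by (intro mult_left_mono mult_left_le) auto
    finally show ?thesis .
  qed
  have i: "lsummable (\<lambda>z. B\<^sup>2 * wt (shiftn n z))" using wt_lattice(1)[OF n] by simp
  have "(LSUM z. (k (shiftn n z))\<^sup>2) \<le> (LSUM z. B\<^sup>2 * wt (shiftn n z))"
  proof (rule integral_mono[OF _ i])
    show "lsummable (\<lambda>z. (k (shiftn n z))\<^sup>2)"
      by (rule integrable_boundL[OF i]) (auto intro!: AE_I2 order_trans[OF le])
  qed (rule le)
  also have "\<dots> = B\<^sup>2 * (LSUM z. wt (shiftn n z))" by simp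
  also have "\<dots> \<le> B\<^sup>2 * (real n ^ CARD('d) * Cw)" by (rule mult_left_mono[OF wt_lattice(2)[OF n]]) simp
  finally show ?thesis .
qed

text \<open>The indicator of the support is itself bounded with bounded support, hence summable over
  the lattice.\<close>

lemma lattice_supp_finite:
  fixes F :: "real^'d \<Rightarrow> real"
  assumes "bnd C F" "\<And>x. r < norm x \<Longrightarrow> F x = 0" "0 \<le> r" "0 < n"
  shows "finite {z. F (shiftn n z) \<noteq> 0}"
proof -
  define G :: "real^'d \<Rightarrow> real" where "G = indicator {x. F x \<noteq> 0}"
  have "lsummable (\<lambda>z. G (shiftn n z))"
    by (rule supp_lattice(1)[where r=r and C=1]) (use assms in \<open>auto simp: G_def bnd_def split: split_indicator\<close>)
  also have "(\<lambda>z. G (shiftn n z)) = indicator {z. F (shiftn n z) \<noteq> 0}" by (auto simp: G_def split: split_indicator)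
  finally have "emeasure (count_space UNIV) {z. F (shiftn n z) \<noteq> 0} < \<infinity>" by (simp add: integrable_indicator_iff)
  moreover have "emeasure (count_space UNIV) {z. F (shiftn n z) \<noteq> 0} = \<infinity>" if "infinite {z. F (shiftn n z) \<noteq> 0}"
    by (rule emeasure_count_space_infinite[OF subset_UNIV that])
  ultimately show ?thesis by (metis less_irrefl)
qed

text \<open>The second moments are of order n^d while the threshold is of order n^d, so Chebyshev
  gives a failure probability of order n^(-d), bounded here by a multiple of 1/n.\<close>

lemma fluctuation_whp:
  assumes F: "nice r C F" and T: "0 < T" and \<epsilon>: "0 < \<epsilon>" and P: "\<And>n. particle (M n) h (\<eta> n)"
  shows "whp M (\<lambda>n w. \<forall>t\<in>{0..T}. \<bar>emp n (\<eta> n w (t * real n powr \<alpha>)) F - emp n (\<eta> n w 0) (sn n t F)\<bar> \<le> \<epsilon>)"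
proof -
  note N = nice_abs[OF F]
  obtain A where A: "0 \<le> A" "\<And>n x. 0 < n \<Longrightarrow> \<bar>gn n F x\<bar> \<le> A * wt x"
    using gn_decay[OF N(4,5)] F by (elim exE conjE) simp_all
  define B where "B = C * (1 + r) powr (real CARD('d) + \<alpha>)"
  have B: "\<bar>F x\<bar> \<le> B * wt x" for x unfolding B_def by (rule compact_le_wt[OF N(1,3,4)])
  have B0: "0 \<le> B" using N(5) by (simp add: B_def)
  \<comment> \<open>The 6 of \<open>fluctuation_uniform\<close> times the 4 from the squared
    threshold, which is \<epsilon> n^d / 2.\<close>
  define K where "K = 24 * (B\<^sup>2 + T\<^sup>2 * A\<^sup>2) * Cw / \<epsilon>\<^sup>2"
  have K0: "0 \<le> K" using Cw_nonneg by (simp add: K_def)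
  have "\<exists>V\<in>sets (M n). (\<forall>w\<in>V. \<forall>t\<in>{0..T}. \<bar>emp n (\<eta> n w (t * real n powr \<alpha>)) F - emp n (\<eta> n w 0) (sn n t F)\<bar> \<le> \<epsilon>)
     \<and> 1 - K * (1 / real n) \<le> measure (M n) V" if n: "0 < n" for n
  proof -
    interpret q: particle "M n" h "\<eta> n" by (rule P)
    interpret ti: transl_inv "count_space (UNIV :: (int^'d) set)" by (rule transl_inv_count)
    define d where "d = real n ^ CARD('d)"
    have d: "0 < d" "real n \<le> d" using n self_le_power[of "real n" "CARD('d)"] by (auto simp: d_def)
    define g where "g z = F (shiftn n z)" for z
    define a where "a = real n powr \<alpha>"
    have a: "0 < a" using n by (simp add: a_def)
    have pn: "pn n = (\<lambda>y. a * jump_rate h y)" by (simp add: pn_def[abs_def] a_def)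
    have ig: "lsummable g" unfolding g_def by (rule supp_lattice(1)[OF N(1,3,4) n])
    have gb: "bnd C g" using N(1) by (auto simp: bnd_def g_def)
    have Ag: "gen (jump_rate h) (\<lambda>y. y) g z = gn n F (shiftn n z) / a" for z
    proof -
      have "gn n F (shiftn n z) = gen (pn n) (\<lambda>y. y) g z" by (simp add: gen_def conv_def g_def shiftn_add)
      also have "\<dots> = a * gen (jump_rate h) (\<lambda>y. y) g z" unfolding pn by (rule gen_scale)
      finally show ?thesis using a by simp
    qed
    define Nn where "Nn = (LSUM x. (g x)\<^sup>2) + (T * a)\<^sup>2 * (LSUM x. (gen (jump_rate h) (\<lambda>y. y) g x)\<^sup>2)"
    \<comment> \<open>The horizon T n^\<alpha> enters squared and the microscopic generator is
      \<open>gn n F\<close> divided by n^\<alpha>, so the acceleration cancels exactly.\<close>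
    have "(T * a)\<^sup>2 * (LSUM x. (gen (jump_rate h) (\<lambda>y. y) g x)\<^sup>2) = T\<^sup>2 * (LSUM z. (gn n F (shiftn n z))\<^sup>2)"
      unfolding Ag power_divide using a by (simp add: power_mult_distrib)
    also have "\<dots> \<le> T\<^sup>2 * (A\<^sup>2 * (d * Cw))"
      unfolding d_def by (rule mult_left_mono[OF wt_square_lattice[OF n A(1) A(2)[OF n]]]) simp
    finally have "Nn \<le> B\<^sup>2 * (d * Cw) + T\<^sup>2 * (A\<^sup>2 * (d * Cw))"
      unfolding Nn_def using wt_square_lattice[OF n B0 B] by (simp add: g_def d_def)
    also have "\<dots> = (B\<^sup>2 + T\<^sup>2 * A\<^sup>2) * Cw * d" by (simp add: algebra_simps)
    finally have Nn: "Nn \<le> (B\<^sup>2 + T\<^sup>2 * A\<^sup>2) * Cw * d" .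
    define e where "e = \<epsilon> * d / 2"
    have e: "0 < e" using \<epsilon> d by (simp add: e_def)
    have Ta: "0 < T * a" using T a by simp
    have fin: "finite {x. g x \<noteq> 0}" unfolding g_def by (rule lattice_supp_finite[OF N(1,3,4) n])
    obtain V where V: "V \<in> sets (M n)" "\<And>w t. w \<in> V \<Longrightarrow> t \<in> {0..T * a} \<Longrightarrow> \<bar>q.X g t w\<bar> \<le> 2 * e" "1 - 6 * Nn / e\<^sup>2 \<le> measure (M n) V"
      using q.fluctuation_uniform[OF fin Ta e Nn_def] by blast
    have "6 * Nn / e\<^sup>2 \<le> 6 * ((B\<^sup>2 + T\<^sup>2 * A\<^sup>2) * Cw * d) / e\<^sup>2" using Nn by (intro divide_right_mono mult_left_mono) auto
    also have "\<dots> = K * (1 / d)" using d \<epsilon> by (simp add: K_def e_def power2_eq_square field_simps)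
    also have "\<dots> \<le> K * (1 / real n)" using n d K0 by (intro mult_left_mono divide_left_mono) auto
    finally have mV: "1 - K * (1 / real n) \<le> measure (M n) V" using V(3) by linarith
    have "\<bar>emp n (\<eta> n w (t * a)) F - emp n (\<eta> n w 0) (sn n t F)\<bar> \<le> \<epsilon>" if w: "w \<in> V" and t: "t \<in> {0..T}" for w t
    proof -
      have ta: "t * a \<in> {0..T * a}" using t a by (auto intro: mult_right_mono)
      have od: "odd_shift (\<lambda>y :: int^'d. y)" by (simp add: odd_shift_def)
      have sg: "semi (jump_rate h) (\<lambda>y. y) (t * a) g z = sn n t F (shiftn n z)" for z
      proof -
        have "sn n t F (shiftn n z) = semi (pn n) (\<lambda>y. y) t g z" unfolding g_def by (rule semi_factor[symmetric]) (rule shiftn_add)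
        then show ?thesis unfolding pn semi_scale by (simp add: mult.commute)
      qed
      note SD = ti.semi_dual[OF walk_jump od ig gb, of "occ (\<eta> n w 0)" 1 "t * a"]
      have iS: "lsummable (\<lambda>z. sn n t F (shiftn n z))" by (rule cut_lattice(2)[OF F n order_refl]) (use t in auto)
      have R: "(LSUM z. g z * q.R (t * a) z w) = d * emp n (\<eta> n w 0) (sn n t F)"
        using SD(1) d unfolding q.R_def emp_integral(2)[OF iS] sg by (simp add: q.occ_bnd mult.commute[of "occ _ _"] d_def)
      have io: "lsummable (\<lambda>z. g z * occ (\<eta> n w (t * a)) z)"
        using emp_integral(1)[OF ig[unfolded g_def], of "\<eta> n w (t * a)"] unfolding g_def by (subst mult.commute)
      have O: "(LSUM z. g z * occ (\<eta> n w (t * a)) z) = d * emp n (\<eta> n w (t * a)) F"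
        using d unfolding emp_integral(2)[OF ig[unfolded g_def]] by (simp add: g_def mult.commute[of "F _"] d_def)
      have iR: "lsummable (\<lambda>z. g z * q.R (t * a) z w)"
        using integrable_mult_bnd[OF ig, of "\<lambda>z. q.R (t * a) z w" 1] q.R_bnd[of "t * a" _ w] ta by (simp add: mult.commute)
      have "q.X g (t * a) w = (LSUM z. g z * occ (\<eta> n w (t * a)) z - g z * q.R (t * a) z w)"
        unfolding q.X_def q.dl_def by (simp add: right_diff_distrib)
      also have "\<dots> = d * (emp n (\<eta> n w (t * a)) F - emp n (\<eta> n w 0) (sn n t F))"
        by (subst integral_diffL[OF io iR]) (simp add: O R right_diff_distrib)
      finally have "d * \<bar>emp n (\<eta> n w (t * a)) F - emp n (\<eta> n w 0) (sn n t F)\<bar> \<le> d * \<epsilon>"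
        using V(2)[OF w ta] d by (simp add: abs_mult e_def mult.commute)
      then show ?thesis using d by simp
    qed
    then show ?thesis using V(1) mV unfolding a_def by blast
  qed
  then obtain V where V: "\<And>n. 0 < n \<Longrightarrow> V n \<in> sets (M n)"
    "\<And>n w t. 0 < n \<Longrightarrow> w \<in> V n \<Longrightarrow> t \<in> {0..T} \<Longrightarrow> \<bar>emp n (\<eta> n w (t * real n powr \<alpha>)) F - emp n (\<eta> n w 0) (sn n t F)\<bar> \<le> \<epsilon>"
    "\<And>n. 0 < n \<Longrightarrow> 1 - K * (1 / real n) \<le> measure (M n) (V n)" by metis
  \<comment> \<open>At n = 0 the scaling is degenerate and the empty set serves as witness.\<close>
  define V' where "V' n = (if n = 0 then {} else V n)" for n
  have "(\<lambda>n. measure (M n) (V' n)) \<longlonglongrightarrow> 1"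
  proof (rule tendsto_sandwich[of "\<lambda>n. 1 - K * (1 / real n)" _ _ "\<lambda>n. 1"])
    show "\<forall>\<^sub>F n in sequentially. 1 - K * (1 / real n) \<le> measure (M n) (V' n)"
      using V(3) by (intro eventually_sequentiallyI[of 1]) (auto simp: V'_def)
    show "\<forall>\<^sub>F n in sequentially. measure (M n) (V' n) \<le> 1"
      using P unfolding particle_def by (intro always_eventually allI prob_space.prob_le_1) blast
    show "(\<lambda>n. 1 - K * (1 / real n)) \<longlonglongrightarrow> 1" using tendsto_diff[OF tendsto_const[of 1] tendsto_mult[OF tendsto_const[of K] lim_1_over_n]] by simp
  qed simp
  then show ?thesis unfolding whp_def using V by (intro exI[of _ V']) (auto simp: V'_def)
qed

end

section \<open>From the initial measure to the profile at later times\<close>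

context stable_init
begin

lemma cut_lborel:
  assumes F: "nice r C F" and n: "0 < n" and R: "1 \<le> R" and t: "t \<in> {0..T}"
  shows "\<bar>(LBINT x. u0 x * (chi R x * sn n t F x)) - (LBINT x. un n t x * F x)\<bar> \<le> 2 * tl R r T * (LBINT x. \<bar>F x\<bar>)" (is ?g1)
    and "integrable lborel (\<lambda>x. u0 x * (chi R x * sn n t F x))" (is ?g2)
proof -
  interpret w: walk "pn n" by (rule pn_walk)
  interpret tl: transl_inv "lborel :: (real^'d) measure" by (rule transl_inv_lborel)
  note N = nice_abs[OF F]
  have t': "0 \<le> t" "t \<le> T" using t by auto
  have iF: "integrable lborel F" by (rule nice_integrable[OF F])
  note TL = tail_lborel[OF n R t' integrable_abs[OF iF] N(2), of r]
  have ab: "\<bar>sn n t F x\<bar> \<le> sn n t (\<lambda>x. \<bar>F x\<bar>) x" for x by (rule w.semi_abs[OF N(1) t'(1)])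
  have [measurable]: "sn n t F \<in> borel_measurable borel" by (rule sn_meas(1)[OF nice_meas[OF F]])
  have [measurable]: "chi R \<in> borel_measurable borel" by (rule borel_measurable_continuous_onI[OF chi_cont])
  have i1: "integrable lborel (sn n t F)" by (rule tl.semi_integrable_N[OF pn_walk shiftn_odd iF N(1)])
  have i2: "integrable lborel (\<lambda>x. u0 x * sn n t F x)" by (rule integrable_mult_bnd[OF i1, where D=1]) (use u0_range in auto)
  have "integrable lborel (\<lambda>x. (u0 x * chi R x) * sn n t F x)"
    by (rule integrable_mult_bnd[OF i1, where D=1]) (use u0_range chi_range in \<open>auto simp: abs_mult intro!: mult_le_one\<close>)
  then show i3: ?g2 by (simp add: mult.assoc)
  have "(LBINT x. F x * un n t x) = (LBINT x. sn n t F x * u0 x)"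
    by (rule tl.semi_dual(1)[OF pn_walk shiftn_odd iF N(1) _ u0_bnd]) simp
  then have du: "(LBINT x. un n t x * F x) = (LBINT x. u0 x * sn n t F x)" by (simp add: mult.commute)
  have le: "\<bar>u0 x * (chi R x * sn n t F x) - u0 x * sn n t F x\<bar> \<le> 2 * (sn n t (\<lambda>x. \<bar>F x\<bar>) x * psi R x)" for x
  proof -
    have "\<bar>u0 x * (chi R x * sn n t F x) - u0 x * sn n t F x\<bar> = \<bar>u0 x\<bar> * \<bar>1 - chi R x\<bar> * \<bar>sn n t F x\<bar>"
      by (simp add: abs_mult[symmetric] algebra_simps abs_minus_commute)
    also have "\<dots> \<le> (1 * (2 * psi R x)) * sn n t (\<lambda>x. \<bar>F x\<bar>) x"
      using u0_range psi_range(1)[of R x] R chi_psi[of R x] by (intro mult_mono ab) auto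
    finally show ?thesis by (simp add: mult_ac)
  qed
  have "\<bar>(LBINT x. u0 x * (chi R x * sn n t F x)) - (LBINT x. un n t x * F x)\<bar> \<le> (LBINT x. 2 * (sn n t (\<lambda>x. \<bar>F x\<bar>) x * psi R x))"
    unfolding du by (rule integral_diff_le[OF i3 i2 _ le]) (use TL(2) N(3) in auto)
  also have "\<dots> = 2 * (LBINT x. sn n t (\<lambda>x. \<bar>F x\<bar>) x * psi R x)" by simp
  also have "\<dots> \<le> 2 * (tl R r T * (LBINT x. \<bar>F x\<bar>))" using TL(1) N(3) by simp
  finally show ?g1 by simp
qed

lemma initial_determines_profile:
  assumes F: "nice r C F" and \<epsilon>: "0 < \<epsilon>"
    and lim: "\<exists>N>0. \<forall>n\<ge>N. \<forall>t\<in>{0..T}. \<bar>(LBINT x. un n t x * F x) - v t\<bar> \<le> \<epsilon> / 4"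
  shows "\<exists>Gs N. finite Gs \<and> Gs \<subseteq> Cc \<and> 0 < N \<and> (\<forall>n\<ge>N. \<forall>\<xi>. (\<forall>G\<in>Gs. \<bar>emp n \<xi> G - (LBINT x. u0 x * G x)\<bar> \<le> \<epsilon> / 4) \<longrightarrow>
    (\<forall>t\<in>{0..T}. \<bar>emp n \<xi> (sn n t F) - v t\<bar> \<le> \<epsilon>))"
proof -
  note N = nice_abs[OF F]
  have T0: "0 \<le> T" using T by simp
  define I1 where "I1 = (LBINT x. \<bar>F x\<bar>)"
  define B1 where "B1 = C * cst r + I1"
  have I1: "0 \<le> I1" unfolding I1_def by simp
  have B1: "0 \<le> B1" using I1 N(5) cst_nonneg[of r] by (simp add: B1_def)
  have "\<forall>\<^sub>F R in at_top. tl R r T < \<epsilon> / (8 * (B1 + 1)) \<and> 1 \<le> R"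
    using order_tendstoD(2)[OF tl_tendsto, of "\<epsilon> / (8 * (B1 + 1))" r T] B1 \<epsilon> eventually_ge_at_top[of "1::real"] by (auto intro: eventually_conj)
  then obtain R where R: "tl R r T < \<epsilon> / (8 * (B1 + 1))" "1 \<le> R" using eventually_happens by fastforce
  have small1: "2 * tl R r T * (C * cst r) + 2 * tl R r T * I1 \<le> \<epsilon> / 4"
  proof -
    have "2 * tl R r T * (C * cst r) + 2 * tl R r T * I1 = (2 * tl R r T) * B1" by (simp add: B1_def algebra_simps)
    also have "\<dots> \<le> (2 * (\<epsilon> / (8 * (B1 + 1)))) * (B1 + 1)"
      using R(1) tl_nonneg[OF T0, of R r] B1 by (intro mult_mono) auto
    also have "\<dots> = \<epsilon> / 4" using B1 by (simp add: field_simps)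
    finally show ?thesis .
  qed
  have R0: "0 < R" using R by simp
  define I2 :: real where "I2 = (\<integral>x. indicator (cball 0 (2 * R)) x \<partial>(lborel :: (real^'d) measure))"
  have I2: "0 \<le> I2" unfolding I2_def by simp
  define B2 where "B2 = cst (2 * R) + I2"
  have B2: "0 \<le> B2" using I2 cst_nonneg[of "2 * R"] by (simp add: B2_def)
  define \<delta> where "\<delta> = \<epsilon> / (4 * (B2 + 1))"
  have \<delta>: "0 < \<delta>" using B2 \<epsilon> by (simp add: \<delta>_def)
  have small2: "\<delta> * cst (2 * R) + \<delta> * I2 \<le> \<epsilon> / 4"
  proof -
    have "\<delta> * cst (2 * R) + \<delta> * I2 \<le> \<delta> * (B2 + 1)" using \<delta> by (simp add: B2_def distrib_left[symmetric])
    also have "\<dots> = \<epsilon> / 4" using B2 by (simp add: \<delta>_def field_simps)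
    finally show ?thesis .
  qed
  obtain m0 where m0: "\<And>n t. m0 \<le> n \<Longrightarrow> t \<in> {0..T} \<Longrightarrow> \<bar>(LBINT x. un n t x * F x) - v t\<bar> \<le> \<epsilon> / 4" using lim by blast
  obtain m Ts N0 where m: "m0 \<le> m" "0 < m" and Ts: "finite Ts" "Ts \<subseteq> {0..T}" and N0: "0 < N0"
    and grid: "\<forall>n\<ge>N0. \<forall>t\<in>{0..T}. \<exists>s\<in>Ts. \<forall>x. \<bar>sn n t F x - sn m s F x\<bar> \<le> \<delta> \<and> \<bar>sn m t F x - sn m s F x\<bar> \<le> \<delta>"
    using sn_grid[OF F \<delta> T, of m0] by blast
  define G where "G n s x = chi R x * sn n s F x" for n s x
  define Gs where "Gs = G m ` Ts"
  have Gcc: "G n s \<in> Cc" if "0 \<le> s" for n s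
    unfolding Cc_def G_def
  proof (intro CollectI conjI exI[of _ "cball 0 (2 * R)"])
    show "continuous_on UNIV (\<lambda>x. chi R x * sn n s F x)" by (intro continuous_on_mult chi_cont sn_cont[OF F that])
  qed (auto simp: chi_supp[OF R0])
  have Gb: "bnd C (G n s)" if "0 \<le> s" for n s
  proof -
    interpret w: walk "pn n" by (rule pn_walk)
    have "\<bar>chi R x\<bar> * \<bar>sn n s F x\<bar> \<le> 1 * C" for x
      using chi_range[of R x] bndD[OF w.semi_bnd[OF N(1) that], of "shiftn n" x] by (intro mult_mono) auto
    then show ?thesis by (simp add: bnd_def G_def abs_mult)
  qed
  have Gsupp: "2 * R < norm x \<Longrightarrow> G n s x = 0" for n s x by (simp add: G_def chi_supp[OF R0])
  have Gdiff: "\<bar>G n t x - G m s x\<bar> \<le> \<delta>" if "\<And>x. \<bar>sn n t F x - sn m s F x\<bar> \<le> \<delta>" for n t s x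
  proof -
    have "\<bar>chi R x\<bar> * \<bar>sn n t F x - sn m s F x\<bar> \<le> 1 * \<delta>" using chi_range[of R x] that[of x] by (intro mult_mono) auto
    then show ?thesis by (simp add: G_def abs_mult[symmetric] right_diff_distrib)
  qed
  have "\<bar>emp n \<xi> (sn n t F) - v t\<bar> \<le> \<epsilon>"
    if n: "N0 \<le> n" and a: "\<forall>G\<in>Gs. \<bar>emp n \<xi> G - (LBINT x. u0 x * G x)\<bar> \<le> \<epsilon> / 4" and t: "t \<in> {0..T}" for n \<xi> t
  proof -
    have n0: "0 < n" using n N0 by simp
    have t': "0 \<le> t" "t \<le> T" using t by auto
    obtain s where s: "s \<in> Ts" "\<And>x. \<bar>sn n t F x - sn m s F x\<bar> \<le> \<delta>" "\<And>x. \<bar>sn m t F x - sn m s F x\<bar> \<le> \<delta>" using grid n t by blast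
    have s0: "s \<in> {0..T}" using s Ts by auto
    have s0': "0 \<le> s" using s0 by simp
    have R2: "0 \<le> 2 * R" using R0 by simp
    have e1: "\<bar>emp n \<xi> (sn n t F) - emp n \<xi> (G n t)\<bar> \<le> 2 * tl R r T * (C * cst r)"
      using cut_lattice(1)[OF F n0 R(2) t'] by (simp add: G_def[abs_def])
    have e2: "\<bar>emp n \<xi> (G n t) - emp n \<xi> (G m s)\<bar> \<le> \<delta> * cst (2 * R)"
    proof (rule emp_diff_le[OF supp_lattice(1)[OF Gb[OF t'(1)] Gsupp R2 n0] supp_lattice(1)[OF Gb[OF s0'] Gsupp R2 n0] n0])
      show "(LSUM z. \<bar>G n t (shiftn n z) - G m s (shiftn n z)\<bar>) \<le> real n ^ CARD('d) * (\<delta> * cst (2 * R))"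
        by (rule supp_lattice(2)[where F="\<lambda>x. G n t x - G m s x", OF _ _ R2 n0]) (use Gdiff[OF s(2)] Gsupp in \<open>auto simp: bnd_def\<close>)
    qed
    have e3: "\<bar>emp n \<xi> (G m s) - (LBINT x. u0 x * G m s x)\<bar> \<le> \<epsilon> / 4" using a s(1) by (auto simp: Gs_def)
    have iG: "integrable lborel (\<lambda>x. u0 x * G m q x)" if "q \<in> {0..T}" for q
      using cut_lborel(2)[OF F m(2) R(2) that] by (simp add: G_def)
    have e4: "\<bar>(LBINT x. u0 x * G m s x) - (LBINT x. u0 x * G m t x)\<bar> \<le> \<delta> * I2"
    proof -
      have le: "\<bar>u0 x * G m s x - u0 x * G m t x\<bar> \<le> \<delta> * indicator (cball 0 (2 * R)) x" for x
      proof (cases "2 * R < norm x")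
        case False
        have "\<bar>u0 x\<bar> * \<bar>G m t x - G m s x\<bar> \<le> 1 * \<delta>" using u0_range Gdiff[OF s(3)] by (intro mult_mono) auto
        then show ?thesis using False by (simp add: abs_mult[symmetric] right_diff_distrib abs_minus_commute)
      qed (simp add: Gsupp)
      have "\<bar>(LBINT x. u0 x * G m s x) - (LBINT x. u0 x * G m t x)\<bar> \<le> (\<integral>x. \<delta> * indicator (cball 0 (2 * R)) x \<partial>(lborel :: (real^'d) measure))"
        by (rule integral_diff_le[OF iG[OF s0] iG[OF t] integrable_indicator_cball le])
      also have "\<dots> = \<delta> * I2" unfolding I2_def by (rule integral_mult_right_zero)
      finally show ?thesis .
    qed
    have e5: "\<bar>(LBINT x. u0 x * G m t x) - (LBINT x. un m t x * F x)\<bar> \<le> 2 * tl R r T * I1"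
      using cut_lborel(1)[OF F m(2) R(2) t] by (simp add: G_def I1_def)
    \<comment> \<open>Four quarters of \<epsilon>: the cutoff on both sides (e1, e5), the grid on
      both sides (e2, e4), association (e3), and the distance of index m from the limit.\<close>
    show ?thesis using e1 e2 e3 e4 e5 m0[OF m(1) t] small1 small2 by linarith
  qed
  moreover have "finite Gs" "Gs \<subseteq> Cc" using Ts Gcc by (auto simp: Gs_def)
  ultimately show ?thesis using N0 by blast
qed

text \<open>\<open>associated\<close> makes the bad sets small; passing to complements needs them
  measurable, which the summability of G over the scaled lattice provides for n > 0. At n = 0 the
  witness is empty.\<close>

lemma associated_whp:
  assumes as: "associated M (\<lambda>n w. \<eta> n w 0) u0" and P: "\<And>n. particle (M n) h (\<eta> n)" and G: "G \<in> Cc" and \<epsilon>: "0 < \<epsilon>"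
  shows "whp M (\<lambda>n w. \<bar>emp n (\<eta> n w 0) G - (LBINT x. u0 x * G x)\<bar> \<le> \<epsilon>)"
proof -
  define B where "B n = {w \<in> space (M n). \<bar>emp n (\<eta> n w 0) G - (LBINT x. u0 x * G x)\<bar> > \<epsilon>}" for n
  have lim: "(\<lambda>n. measure (M n) (B n)) \<longlonglongrightarrow> 0" using as G \<epsilon> unfolding associated_def B_def by blast
  obtain K where K: "continuous_on UNIV G" "compact K" "\<And>x. x \<notin> K \<Longrightarrow> G x = 0" using G unfolding Cc_def by blast
  obtain r where r: "0 \<le> r" "\<And>x. x \<in> K \<Longrightarrow> norm x \<le> r" using compact_radius[OF K(2)] by blast
  have "bounded (G ` K)" by (rule compact_imp_bounded[OF compact_continuous_image[OF continuous_on_subset[OF K(1)] K(2)]]) simp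
  then obtain C where C: "\<And>x. x \<in> K \<Longrightarrow> \<bar>G x\<bar> \<le> C" unfolding bounded_iff by auto
  have Gb: "bnd (max 0 C) G" unfolding bnd_def using C K(3) by (metis abs_zero max.cobounded1 max.coboundedI2)
  have Gs: "r < norm x \<Longrightarrow> G x = 0" for x using K(3) r(2) by fastforce
  have Bm: "B n \<in> sets (M n)" if n: "0 < n" for n
  proof -
    interpret q: particle "M n" h "\<eta> n" by (rule P)
    have i: "lsummable (\<lambda>z. G (shiftn n z))" by (rule supp_lattice(1)[OF Gb Gs r(1) n])
    have "integrable (M n) (\<lambda>w. LSUM z. G (shiftn n z) * occ (\<eta> n w 0) z)"
      by (rule q.expect_conv(2)[OF i, where C=1]) auto
    then have "integrable (M n) (\<lambda>w. LSUM z. occ (\<eta> n w 0) z * G (shiftn n z))" by (simp add: mult.commute)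
    then have [measurable]: "(\<lambda>w. emp n (\<eta> n w 0) G) \<in> borel_measurable (M n)" unfolding emp_integral(2)[OF i] by measurable
    show ?thesis unfolding B_def by measurable
  qed
  define A where "A n = (if n = 0 then {} else space (M n) - B n)" for n
  have "(\<lambda>n. measure (M n) (A n)) \<longlonglongrightarrow> 1"
  proof (rule Lim_transform_eventually)
    show "(\<lambda>n. 1 - measure (M n) (B n)) \<longlonglongrightarrow> 1" using tendsto_diff[OF tendsto_const[of 1] lim] by simp
    show "\<forall>\<^sub>F n in sequentially. 1 - measure (M n) (B n) = measure (M n) (A n)"
    proof (rule eventually_sequentiallyI[of 1])
      fix n :: nat assume n: "1 \<le> n"
      interpret q: particle "M n" h "\<eta> n" by (rule P)
      show "1 - measure (M n) (B n) = measure (M n) (A n)" using n q.prob_compl[OF Bm[of n]] by (simp add: A_def)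
    qed
  qed
  moreover have "A n \<in> sets (M n) \<and> (\<forall>w\<in>A n. \<bar>emp n (\<eta> n w 0) G - (LBINT x. u0 x * G x)\<bar> \<le> \<epsilon>)" for n
    using Bm[of n] by (auto simp: A_def B_def not_less)
  ultimately show ?thesis unfolding whp_def by blast
qed

text \<open>On the intersection of two likely events the fluctuation is at most \<epsilon> and the
  evolved initial profile is within \<epsilon> of its limit.\<close>

lemma nice_empirical_whp:
  assumes as: "associated M (\<lambda>n w. \<eta> n w 0) u0" and P: "\<And>n. particle (M n) h (\<eta> n)"
    and F: "nice r C F" and \<epsilon>: "0 < \<epsilon>"
    and lim: "\<exists>N>0. \<forall>n\<ge>N. \<forall>t\<in>{0..T}. \<bar>(LBINT x. un n t x * F x) - v t\<bar> \<le> \<epsilon> / 4"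
  shows "whp M (\<lambda>n w. \<forall>t\<in>{0..T}. \<bar>emp n (\<eta> n w (t * real n powr \<alpha>)) F - v t\<bar> \<le> 2 * \<epsilon>)"
proof -
  have pr: "prob_space (M n)" for n using P[of n] by (simp add: particle_def)
  obtain Gs N where Gs: "finite Gs" "Gs \<subseteq> Cc"
    and prof: "\<forall>n\<ge>N. \<forall>\<xi>. (\<forall>G\<in>Gs. \<bar>emp n \<xi> G - (LBINT x. u0 x * G x)\<bar> \<le> \<epsilon> / 4) \<longrightarrow> (\<forall>t\<in>{0..T}. \<bar>emp n \<xi> (sn n t F) - v t\<bar> \<le> \<epsilon>)"
    using initial_determines_profile[OF F \<epsilon> lim] by (elim exE conjE) 
  have "whp M (\<lambda>n w. \<forall>G\<in>Gs. \<bar>emp n (\<eta> n w 0) G - (LBINT x. u0 x * G x)\<bar> \<le> \<epsilon> / 4)"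
    by (rule whp_finite_ball[OF pr Gs(1)], rule associated_whp[OF as P]) (use Gs(2) \<epsilon> in auto)
  from whp_conj[OF pr this fluctuation_whp[OF F T \<epsilon> P]] show ?thesis
  proof (rule whp_mono[where N=N])
    fix n w assume n: "N \<le> n"
      and a: "(\<forall>G\<in>Gs. \<bar>emp n (\<eta> n w 0) G - (LBINT x. u0 x * G x)\<bar> \<le> \<epsilon> / 4) \<and>
        (\<forall>t\<in>{0..T}. \<bar>emp n (\<eta> n w (t * real n powr \<alpha>)) F - emp n (\<eta> n w 0) (sn n t F)\<bar> \<le> \<epsilon>)"
    show "\<forall>t\<in>{0..T}. \<bar>emp n (\<eta> n w (t * real n powr \<alpha>)) F - v t\<bar> \<le> 2 * \<epsilon>"
    proof
      fix t assume t: "t \<in> {0..T}"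
      have "\<bar>emp n (\<eta> n w 0) (sn n t F) - v t\<bar> \<le> \<epsilon>" by (rule prof[rule_format, OF n _ t]) (use conjunct1[OF a] in simp)
      moreover have "\<bar>emp n (\<eta> n w (t * real n powr \<alpha>)) F - emp n (\<eta> n w 0) (sn n t F)\<bar> \<le> \<epsilon>" using a t by blast
      ultimately show "\<bar>emp n (\<eta> n w (t * real n powr \<alpha>)) F - v t\<bar> \<le> 2 * \<epsilon>" by linarith
    qed
  qed
qed

text \<open>F is uniformly approximated by a smooth H with support in a common ball. Particle and
  macroscopic densities are both bounded, so exchanging F for H costs at most \<epsilon>/4 for every
  configuration and every time.\<close>

lemma empirical_whp:
  assumes as: "associated M (\<lambda>n w. \<eta> n w 0) u0" and P: "\<And>n. particle (M n) h (\<eta> n)"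
    and um: "(\<lambda>(t, x). u t x) \<in> borel_measurable (lborel \<Otimes>\<^sub>M lborel)" and ur: "\<And>t x. 0 \<le> u t x \<and> u t x \<le> 1"
    and lim: "\<And>F r C \<epsilon>. nice r C F \<Longrightarrow> 0 < \<epsilon> \<Longrightarrow> \<exists>N>0. \<forall>n\<ge>N. \<forall>t\<in>{0..T}. \<bar>(LBINT x. un n t x * F x) - (LBINT x. u t x * F x)\<bar> \<le> \<epsilon>"
    and F: "F \<in> Cc" and \<epsilon>: "0 < \<epsilon>"
  shows "whp M (\<lambda>n w. \<forall>t\<in>{0..T}. \<bar>emp n (\<eta> n w (t * real n powr \<alpha>)) F - (LBINT x. u t x * F x)\<bar> < \<epsilon>)"
proof -
  obtain K where K: "continuous_on UNIV F" "compact K" "\<And>x. x \<notin> K \<Longrightarrow> F x = 0" using F unfolding Cc_def by blast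
  obtain r where r: "0 \<le> r" "\<And>x. x \<in> K \<Longrightarrow> norm x \<le> r" using compact_radius[OF K(2)] by blast
  have Fs: "r < norm x \<Longrightarrow> F x = 0" for x using K(3) r(2) by fastforce
  define \<rho> where "\<rho> = r + 1"
  have \<rho>: "0 \<le> \<rho>" using r by (simp add: \<rho>_def)
  define I :: real where "I = (\<integral>x. indicator (cball 0 \<rho>) x \<partial>(lborel :: (real^'d) measure))"
  have I: "0 \<le> I" unfolding I_def by simp
  define B where "B = cst \<rho> + I"
  have B: "0 \<le> B" using I cst_nonneg[of \<rho>] by (simp add: B_def)
  define \<delta> where "\<delta> = \<epsilon> / (4 * (B + 1))"
  have \<delta>: "0 < \<delta>" using B \<epsilon> by (simp add: \<delta>_def)
  have small: "\<delta> * cst \<rho> + \<delta> * I \<le> \<epsilon> / 4"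
  proof -
    have "\<delta> * cst \<rho> + \<delta> * I \<le> \<delta> * (B + 1)" using \<delta> by (simp add: B_def distrib_left[symmetric])
    also have "\<dots> = \<epsilon> / 4" using B by (simp add: \<delta>_def field_simps)
    finally show ?thesis .
  qed
  obtain p where p: "real_polynomial_function p" "\<And>x. \<bar>F x - bump (r + 1) p x\<bar> \<le> \<delta>" using bump_dense[OF K(1) Fs r(1) \<delta>] by blast
  define H where "H = bump (r + 1) p"
  obtain C where H: "nice \<rho> C H" using bump_nice[OF p(1), of \<rho>] \<rho> by (auto simp: H_def \<rho>_def)
  note N = nice_abs[OF H]
  have Fb: "bnd (C + \<delta>) F" unfolding bnd_def
  proof
    fix x show "\<bar>F x\<bar> \<le> C + \<delta>" using p(2)[of x] bndD[OF N(1), of x] unfolding H_def by linarith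
  qed
  have Fs': "\<rho> < norm x \<Longrightarrow> F x = 0" for x using Fs by (simp add: \<rho>_def)
  have d: "\<bar>F x - H x\<bar> \<le> \<delta> * indicator (cball 0 \<rho>) x" for x
    using p(2)[of x] Fs'[of x] N(3)[of x] by (auto simp: H_def[symmetric] not_le split: split_indicator)
  have db: "bnd \<delta> (\<lambda>x. F x - H x)" using p(2) by (auto simp: bnd_def H_def)
  have near: "\<bar>emp n \<xi> F - emp n \<xi> H\<bar> \<le> \<delta> * cst \<rho>" if n: "0 < n" for n \<xi>
  proof (rule emp_diff_le[where f=F and g=H])
    show "(LSUM z. \<bar>F (shiftn n z) - H (shiftn n z)\<bar>) \<le> real n ^ CARD('d) * (\<delta> * cst \<rho>)"
      by (rule supp_lattice(2)[where F="\<lambda>x. F x - H x", OF db _ \<rho> n]) (use Fs' N(3) in auto)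
    show "lsummable (\<lambda>z. F (shiftn n z))" by (rule supp_lattice(1)[OF Fb Fs' \<rho> n])
    show "lsummable (\<lambda>z. H (shiftn n z))" by (rule supp_lattice(1)[OF N(1) N(3) \<rho> n])
  qed (rule n)
  have um'[measurable]: "(\<lambda>x. u t x) \<in> borel_measurable borel" for t using measurable_Pair2[OF um, of t] by simp
  have iH: "integrable lborel H" by (rule nice_integrable[OF H])
  have iF: "integrable lborel F"
  proof -
    have [measurable]: "F \<in> borel_measurable borel" by (rule borel_measurable_continuous_onI[OF K(1)])
    show ?thesis
    proof (rule integrable_boundL[OF integrable_indicator_cball[of "C + \<delta>" \<rho>]])
      have "\<bar>F x\<bar> \<le> \<bar>(C + \<delta>) * indicator (cball 0 \<rho>) x\<bar>" for x
        using bndD[OF Fb, of x] Fs'[of x] by (auto simp: not_le split: split_indicator)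
      then show "AE x in lborel. norm (F x) \<le> norm ((C + \<delta>) * indicator (cball 0 \<rho>) x)" by simp
    qed simp
  qed
  have iu: "integrable lborel (\<lambda>x. u t x * k x)" if "integrable lborel k" for t k
    by (rule integrable_mult_bnd[OF that, where D=1]) (use ur in auto)
  have nearu: "\<bar>(LBINT x. u t x * F x) - (LBINT x. u t x * H x)\<bar> \<le> \<delta> * I" for t
  proof -
    have le: "\<bar>u t x * F x - u t x * H x\<bar> \<le> \<delta> * indicator (cball 0 \<rho>) x" for x
    proof -
      have "\<bar>u t x\<bar> * \<bar>F x - H x\<bar> \<le> 1 * (\<delta> * indicator (cball 0 \<rho>) x)" using ur[of t x] d[of x] by (intro mult_mono) auto
      then show ?thesis by (simp add: abs_mult[symmetric] right_diff_distrib)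
    qed
    have "\<bar>(LBINT x. u t x * F x) - (LBINT x. u t x * H x)\<bar> \<le> (\<integral>x. \<delta> * indicator (cball 0 \<rho>) x \<partial>(lborel :: (real^'d) measure))"
      by (rule integral_diff_le[OF iu[OF iF] iu[OF iH] integrable_indicator_cball le])
    also have "\<dots> = \<delta> * I" unfolding I_def by (rule integral_mult_right_zero)
    finally show ?thesis .
  qed
  have e4: "0 < \<epsilon> / 4" "0 < \<epsilon> / 4 / 4" using \<epsilon> by auto
  have "whp M (\<lambda>n w. \<forall>t\<in>{0..T}. \<bar>emp n (\<eta> n w (t * real n powr \<alpha>)) H - (LBINT x. u t x * H x)\<bar> \<le> 2 * (\<epsilon> / 4))"
    by (rule nice_empirical_whp[OF as P H e4(1) lim[OF H e4(2)]])
  then show ?thesis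
  proof (rule whp_mono[where N=1])
    fix n :: nat and w assume n: "1 \<le> n" and a: "\<forall>t\<in>{0..T}. \<bar>emp n (\<eta> n w (t * real n powr \<alpha>)) H - (LBINT x. u t x * H x)\<bar> \<le> 2 * (\<epsilon> / 4)"
    show "\<forall>t\<in>{0..T}. \<bar>emp n (\<eta> n w (t * real n powr \<alpha>)) F - (LBINT x. u t x * F x)\<bar> < \<epsilon>"
    proof
      fix t assume t: "t \<in> {0..T}"
      show "\<bar>emp n (\<eta> n w (t * real n powr \<alpha>)) F - (LBINT x. u t x * F x)\<bar> < \<epsilon>"
        using a[rule_format, OF t] near[of n "\<eta> n w (t * real n powr \<alpha>)"] nearu[of t] small n \<epsilon> by linarith
    qed
  qed
qed

end

theorem theorem3:
  fixes h :: "real^'d \<Rightarrow> real" and \<alpha> :: real and u0 :: "real^'d \<Rightarrow> real"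
    and M :: "nat \<Rightarrow> 'w measure" and \<eta> :: "nat \<Rightarrow> 'w \<Rightarrow> real \<Rightarrow> 'd config" and T :: real
  assumes alpha: "0 < \<alpha>" "\<alpha> < 2"
    and h_cont: "continuous_on (- {0}) h"
    and h_pos: "\<forall>x. x \<noteq> 0 \<longrightarrow> h x > 0"
    and h_even: "\<forall>x. h (- x) = h x"
    and h_hom: "\<forall>c x. c > 0 \<and> x \<noteq> 0 \<longrightarrow> h (c *\<^sub>R x) = c powr (- (real CARD('d) + \<alpha>)) * h x"
    and u0_meas: "u0 \<in> borel_measurable lborel"
    and u0_range: "\<forall>x. 0 \<le> u0 x \<and> u0 x \<le> 1"
    and prob: "\<forall>n. prob_space (M n)"
    and meas: "\<forall>n t z. t \<ge> 0 \<longrightarrow> {\<omega> \<in> space (M n). \<eta> n \<omega> t z} \<in> sets (M n)"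
    and cadlag: "\<forall>n. \<forall>\<omega>\<in>space (M n). cadlag_coords (\<eta> n \<omega>)"
    and gen: "\<forall>n. martingale_problem (M n) h (\<eta> n)"
    and assoc: "associated M (\<lambda>n \<omega>. \<eta> n \<omega> 0) u0"
    and T: "T > 0"
  shows "\<exists>u. weak_sol T h u0 u
           \<and> (\<forall>v. weak_sol T h u0 v \<longrightarrow> (\<forall>t\<in>{0..T}. AE x in lborel. v t x = u t x))
           \<and> conv_dist_D T M (\<lambda>n \<omega> t F. emp n (\<eta> n \<omega> (t * real n powr \<alpha>)) F)
                            (\<lambda>t F. \<integral>x. u t x * F x \<partial>lborel)"
proof -
  interpret stable_init h \<alpha> u0 T
    using alpha h_cont h_pos h_even h_hom u0_meas u0_range T by unfold_locales auto
  have P: "particle (M n) h (\<eta> n)" for n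
  proof -
    interpret prob_space "M n" using prob by simp
    interpret walk "jump_rate h" by (rule walk_jump)
    show ?thesis using meas cadlag gen by unfold_locales auto
  qed
  obtain u k where um: "(\<lambda>(t, x). u t x) \<in> borel_measurable (lborel \<Otimes>\<^sub>M lborel)" and ur: "\<And>t x. 0 \<le> u t x \<and> u t x \<le> 1"
    and k: "\<And>j. 0 < k j" "filterlim k at_top sequentially" and lim: "\<And>t. t \<in> {0..T} \<Longrightarrow> AE x in lborel. (\<lambda>j. un (k j) t x) \<longlonglongrightarrow> u t x"
    using macroscopic_limit by blast
  have ws: "weak_sol T h u0 u" by (rule weak_sol_limit[OF um ur k lim])
  have "conv_dist_D T M (\<lambda>n w t F. emp n (\<eta> n w (t * real n powr \<alpha>)) F) (\<lambda>t F. LBINT x. u t x * F x)"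
    unfolding conv_dist_D_def
  proof (intro allI impI)
    fix Fs :: "(real^'d \<Rightarrow> real) set" and \<epsilon> :: real assume a: "finite Fs \<and> Fs \<subseteq> Cc \<and> 0 < \<epsilon>"
    \<comment> \<open>Closeness is uniform in time, so the identity is an admissible time change for
      the Skorohod neighbourhood.\<close>
    have id: "time_change T (\<lambda>t. t)" by (simp add: time_change_def strict_mono_on_def)
    have "whp M (\<lambda>n w. \<forall>F\<in>Fs. \<forall>t\<in>{0..T}. \<bar>emp n (\<eta> n w (t * real n powr \<alpha>)) F - (LBINT x. u t x * F x)\<bar> < \<epsilon>)"
      by (rule whp_finite_ball, use prob in simp, use a in simp,
          rule empirical_whp[OF assoc P um ur un_pairing_uniform[OF um ur k lim]]) (use a in auto)
    then obtain A where A: "\<And>n. A n \<in> sets (M n)" "(\<lambda>n. measure (M n) (A n)) \<longlonglongrightarrow> 1"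
      "\<And>n w. w \<in> A n \<Longrightarrow> \<forall>F\<in>Fs. \<forall>t\<in>{0..T}. \<bar>emp n (\<eta> n w (t * real n powr \<alpha>)) F - (LBINT x. u t x * F x)\<bar> < \<epsilon>"
      unfolding whp_def by blast
    have "(\<lambda>t F. emp n (\<eta> n w (t * real n powr \<alpha>)) F) \<in> sk_nbhd T Fs \<epsilon> (\<lambda>t F. LBINT x. u t x * F x)" if "w \<in> A n" for n w
      unfolding sk_nbhd_def using A(3)[OF that] a id by (intro CollectI exI[of _ "\<lambda>t. t"]) simp
    then show "\<exists>A. (\<forall>n. A n \<in> sets (M n) \<and> A n \<subseteq> {w \<in> space (M n). (\<lambda>t F. emp n (\<eta> n w (t * real n powr \<alpha>)) F) \<in> sk_nbhd T Fs \<epsilon> (\<lambda>t F. LBINT x. u t x * F x)})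
        \<and> (\<lambda>n. measure (M n) (A n)) \<longlonglongrightarrow> 1"
      using A(1,2) sets.sets_into_space by (intro exI[of _ A]) blast
  qed
  then show ?thesis using ws weak_sol_unique[OF _ ws] by blast
qed

end
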